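(* Let $A$ be an artin algebra. Then $A$ is of representation bound three if and only if $A$ is a wedged-string algebra with radical cubed zero, but not a Nakayama algebra with radical squared zero.
   Context: $A$ is an artin $R$-algebra, where $R$ is a commutative artinian ring; $J$ is the Jacobson radical of $A$; $\mathrm{mod}\,A$ is the category of finitely generated left $A$-modules; $A^\circ$ is the opposite algebra, and $\mathrm{mod}\,A^\circ$ is identified with the category of finitely generated right $A$-modules. "Radical cubed (squared) zero" means $J^3=0$ ($J^2=0$). The representation bound of $A$ is the supremum of the composition lengths of the indecomposable left $A$-modules of finite length. $I_M$ denotes an injective envelope of $M$ (in the category $\mathrm{mod}\,A$ or $\mathrm{mod}\,A^\circ$ in which $M$ lies). A module is local if its top is simple, and colocal if its socle is simple. A module is uniserial if any two of its submodules are comparable under inclusion. $A$ is a Nakayama algebra if all indecomposable projective and injective modules in $\mathrm{mod}\,A$ are uniserial. An indecomposable module $M$ is biserial if it has two non-comparable uniserial submodules $M_1,M_2$ such that (i) $M_1+M_2$ is $M$ or the largest proper submodule of $M$, and (ii) $M_1\cap M_2$ is zero or the smallest nonzero submodule of $M$. A biserial module is astride biserial if it is local and not colocal. An artin algebra $A$ is wedged-string if every indecomposable projective module $P$ in $\mathrm{mod}\,A$ or $\mathrm{mod}\,A^\circ$ is uniserial, or astride biserial with $\mathrm{rad}\,P=S_1\oplus S_2$, where $S_1,S_2$ are simple such that $I_{S_1}$ and $I_{S_2}$ are uniserial. *)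

theory Defs
  imports "HOL-Algebra.Module" "HOL-Algebra.Ideal_Product" "HOL-Library.Extended_Nat"
begin

section \<open>Left modules over a possibly noncommutative ring\<close>

text \<open>The library locale \<^locale>\<open>Module.module\<close> requires a commutative ring of scalars.  Modules are again
  represented by the record type \<open>module\<close>, whose fields \<open>mult\<close> and \<open>one\<close> carry no information;
  submodules are those of the library locale \<^locale>\<open>submodule\<close>, which does not need commutativity.\<close>

locale left_module = A?: ring A + M?: abelian_group M
  for A :: "('a, 'z) ring_scheme" (structure) and M :: "('a, 'm, 'x) module_scheme" (structure) +
  assumes smult_closed:
      "\<lbrakk>a \<in> carrier A; x \<in> carrier M\<rbrakk> \<Longrightarrow> a \<odot>\<^bsub>M\<^esub> x \<in> carrier M"
    and smult_l_distr:
      "\<lbrakk>a \<in> carrier A; b \<in> carrier A; x \<in> carrier M\<rbrakk> \<Longrightarrow>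
      (a \<oplus> b) \<odot>\<^bsub>M\<^esub> x = a \<odot>\<^bsub>M\<^esub> x \<oplus>\<^bsub>M\<^esub> b \<odot>\<^bsub>M\<^esub> x"
    and smult_r_distr:
      "\<lbrakk>a \<in> carrier A; x \<in> carrier M; y \<in> carrier M\<rbrakk> \<Longrightarrow>
      a \<odot>\<^bsub>M\<^esub> (x \<oplus>\<^bsub>M\<^esub> y) = a \<odot>\<^bsub>M\<^esub> x \<oplus>\<^bsub>M\<^esub> a \<odot>\<^bsub>M\<^esub> y"
    and smult_assoc:
      "\<lbrakk>a \<in> carrier A; b \<in> carrier A; x \<in> carrier M\<rbrakk> \<Longrightarrow>
      (a \<otimes> b) \<odot>\<^bsub>M\<^esub> x = a \<odot>\<^bsub>M\<^esub> (b \<odot>\<^bsub>M\<^esub> x)"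
    and smult_one:
      "x \<in> carrier M \<Longrightarrow> \<one> \<odot>\<^bsub>M\<^esub> x = x"

definition module_homs :: "('a, 'z) ring_scheme \<Rightarrow> ('a, 'm, 'x) module_scheme \<Rightarrow>
    ('a, 'n, 'y) module_scheme \<Rightarrow> ('m \<Rightarrow> 'n) set" where
  "module_homs A M N = {f \<in> carrier M \<rightarrow> carrier N.
     (\<forall>x\<in>carrier M. \<forall>y\<in>carrier M. f (x \<oplus>\<^bsub>M\<^esub> y) = f x \<oplus>\<^bsub>N\<^esub> f y) \<and>
     (\<forall>a\<in>carrier A. \<forall>x\<in>carrier M. f (a \<odot>\<^bsub>M\<^esub> x) = a \<odot>\<^bsub>N\<^esub> f x)}"

definition sub_module :: "('a, 'm, 'x) module_scheme \<Rightarrow> 'm set \<Rightarrow> ('a, 'm, 'x) module_scheme" where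
  "sub_module M N = M\<lparr>carrier := N\<rparr>"

definition quotient_module :: "('a, 'm, 'x) module_scheme \<Rightarrow> 'm set \<Rightarrow> ('a, 'm set) module" where
  "quotient_module M N =
    \<lparr>carrier = a_rcosets\<^bsub>M\<^esub> N, mult = undefined, one = undefined, zero = N, add = set_add M,
     smult = (\<lambda>a X. \<Union>x\<in>X. N +>\<^bsub>M\<^esub> (a \<odot>\<^bsub>M\<^esub> x))\<rparr>"

definition finitely_generated :: "('a, 'z) ring_scheme \<Rightarrow> ('a, 'm, 'x) module_scheme \<Rightarrow> bool" where
  "finitely_generated A M \<longleftrightarrow> (\<exists>X. finite X \<and> X \<subseteq> carrier M \<and>
     (\<forall>N. submodule N A M \<and> X \<subseteq> N \<longrightarrow> N = carrier M))"

definition simple_module :: "('a, 'z) ring_scheme \<Rightarrow> ('a, 'm, 'x) module_scheme \<Rightarrow> bool" where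
  "simple_module A M \<longleftrightarrow> carrier M \<noteq> {\<zero>\<^bsub>M\<^esub>} \<and>
     (\<forall>N. submodule N A M \<longrightarrow> N = {\<zero>\<^bsub>M\<^esub>} \<or> N = carrier M)"

definition simple_submodule ::
    "('a, 'z) ring_scheme \<Rightarrow> ('a, 'm, 'x) module_scheme \<Rightarrow> 'm set \<Rightarrow> bool" where
  "simple_submodule A M S \<longleftrightarrow> submodule S A M \<and> simple_module A (sub_module M S)"

definition maximal_submodule ::
    "('a, 'z) ring_scheme \<Rightarrow> ('a, 'm, 'x) module_scheme \<Rightarrow> 'm set \<Rightarrow> bool" where
  "maximal_submodule A M N \<longleftrightarrow> submodule N A M \<and> N \<noteq> carrier M \<and>
     (\<forall>L. submodule L A M \<and> N \<subseteq> L \<longrightarrow> L = N \<or> L = carrier M)"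

definition module_rad :: "('a, 'z) ring_scheme \<Rightarrow> ('a, 'm, 'x) module_scheme \<Rightarrow> 'm set" where
  "module_rad A M = carrier M \<inter> \<Inter> {N. maximal_submodule A M N}"

definition module_top :: "('a, 'z) ring_scheme \<Rightarrow> ('a, 'm, 'x) module_scheme \<Rightarrow> ('a, 'm set) module" where
  "module_top A M = quotient_module M (module_rad A M)"

text \<open>The socle is the sum of all simple submodules, that is, the smallest submodule
  containing all of them.\<close>

definition module_socle :: "('a, 'z) ring_scheme \<Rightarrow> ('a, 'm, 'x) module_scheme \<Rightarrow> 'm set" where
  "module_socle A M =
     \<Inter> {N. submodule N A M \<and> (\<forall>S. simple_submodule A M S \<longrightarrow> S \<subseteq> N)}"

text \<open>\<open>N\<close> is the internal direct sum of the submodules \<open>N\<^sub>1\<close> and \<open>N\<^sub>2\<close> of \<open>M\<close>.\<close>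

definition is_direct_sum :: "('a, 'm, 'x) module_scheme \<Rightarrow> 'm set \<Rightarrow> 'm set \<Rightarrow> 'm set \<Rightarrow> bool" where
  "is_direct_sum M N N\<^sub>1 N\<^sub>2 \<longleftrightarrow> N\<^sub>1 <+>\<^bsub>M\<^esub> N\<^sub>2 = N \<and> N\<^sub>1 \<inter> N\<^sub>2 = {\<zero>\<^bsub>M\<^esub>}"

definition indecomposable :: "('a, 'z) ring_scheme \<Rightarrow> ('a, 'm, 'x) module_scheme \<Rightarrow> bool" where
  "indecomposable A M \<longleftrightarrow> carrier M \<noteq> {\<zero>\<^bsub>M\<^esub>} \<and>
     (\<forall>N\<^sub>1 N\<^sub>2. submodule N\<^sub>1 A M \<and> submodule N\<^sub>2 A M \<and> is_direct_sum M (carrier M) N\<^sub>1 N\<^sub>2 \<longrightarrow>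
        N\<^sub>1 = {\<zero>\<^bsub>M\<^esub>} \<or> N\<^sub>2 = {\<zero>\<^bsub>M\<^esub>})"

subsection \<open>Composition length\<close>

definition composition_series ::
    "('a, 'z) ring_scheme \<Rightarrow> ('a, 'm, 'x) module_scheme \<Rightarrow> 'm set list \<Rightarrow> bool" where
  "composition_series A M Ns \<longleftrightarrow> Ns \<noteq> [] \<and> hd Ns = {\<zero>\<^bsub>M\<^esub>} \<and> last Ns = carrier M \<and>
     (\<forall>N\<in>set Ns. submodule N A M) \<and>
     (\<forall>i. Suc i < length Ns \<longrightarrow> Ns ! i \<subseteq> Ns ! Suc i \<and>
        simple_module A (quotient_module (sub_module M (Ns ! Suc i)) (Ns ! i)))"

definition finite_length :: "('a, 'z) ring_scheme \<Rightarrow> ('a, 'm, 'x) module_scheme \<Rightarrow> bool" where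
  "finite_length A M \<longleftrightarrow> (\<exists>Ns. composition_series A M Ns)"

text \<open>All composition series have the same length by the Jordan--Hoelder theorem; the minimum
  merely makes the definition independent of that theorem.  A series
  \<open>{0} = N\<^sub>0 \<subset> \<dots> \<subset> N\<^sub>n\<close>, a list of \<open>n + 1\<close> submodules, has length \<open>n\<close>.\<close>

definition composition_length :: "('a, 'z) ring_scheme \<Rightarrow> ('a, 'm, 'x) module_scheme \<Rightarrow> nat" where
  "composition_length A M = (LEAST n. \<exists>Ns. composition_series A M Ns \<and> length Ns = Suc n)"

section \<open>Finitely generated modules\<close>

text \<open>Quantification over all finitely generated modules has to be restricted to a fixed type of
  module elements.  The type \<open>nat \<Rightarrow> 'a\<close> is large enough for every finitely generated module
  over a ring with elements of type \<open>'a\<close>: see \<open>finitely_generated_representable\<close> below.  In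
  particular it is large enough for all modules of finite length.\<close>

type_synonym 'a fg_module = "('a, nat \<Rightarrow> 'a) module"

definition in_mod :: "('a, 'z) ring_scheme \<Rightarrow> ('a, 'm, 'x) module_scheme \<Rightarrow> bool" where
  "in_mod A M \<longleftrightarrow> left_module A M \<and> finitely_generated A M"

definition projective_in_mod :: "('a, 'z) ring_scheme \<Rightarrow> ('a, 'm, 'x) module_scheme \<Rightarrow> bool" where
  "projective_in_mod A P \<longleftrightarrow> in_mod A P \<and>
     (\<forall>(X :: 'a fg_module) (Y :: 'a fg_module). in_mod A X \<and> in_mod A Y \<longrightarrow>
       (\<forall>e\<in>module_homs A X Y. \<forall>g\<in>module_homs A P Y. e ` carrier X = carrier Y \<longrightarrow>
         (\<exists>h\<in>module_homs A P X. \<forall>x\<in>carrier P. e (h x) = g x)))"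

definition injective_in_mod :: "('a, 'z) ring_scheme \<Rightarrow> ('a, 'm, 'x) module_scheme \<Rightarrow> bool" where
  "injective_in_mod A I \<longleftrightarrow> in_mod A I \<and>
     (\<forall>(X :: 'a fg_module) (Y :: 'a fg_module). in_mod A X \<and> in_mod A Y \<longrightarrow>
       (\<forall>j\<in>module_homs A X Y. \<forall>g\<in>module_homs A X I. inj_on j (carrier X) \<longrightarrow>
         (\<exists>h\<in>module_homs A Y I. \<forall>x\<in>carrier X. h (j x) = g x)))"

definition essential_submodule ::
    "('a, 'z) ring_scheme \<Rightarrow> ('a, 'm, 'x) module_scheme \<Rightarrow> 'm set \<Rightarrow> bool" where
  "essential_submodule A M N \<longleftrightarrow> submodule N A M \<and>
     (\<forall>L. submodule L A M \<and> L \<inter> N = {\<zero>\<^bsub>M\<^esub>} \<longrightarrow> L = {\<zero>\<^bsub>M\<^esub>})"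

definition injective_envelope ::
    "('a, 'z) ring_scheme \<Rightarrow> ('a, 'm, 'x) module_scheme \<Rightarrow> ('a, 'n, 'y) module_scheme \<Rightarrow> bool" where
  "injective_envelope A M I \<longleftrightarrow> injective_in_mod A I \<and>
     (\<exists>f\<in>module_homs A M I. inj_on f (carrier M) \<and> essential_submodule A I (f ` carrier M))"

definition representation_bound :: "('a, 'z) ring_scheme \<Rightarrow> enat" where
  "representation_bound A =
     (SUP M \<in> {M :: 'a fg_module. left_module A M \<and> indecomposable A M \<and> finite_length A M}.
        enat (composition_length A M))"

section \<open>Uniserial and biserial modules\<close>

definition uniserial :: "('a, 'z) ring_scheme \<Rightarrow> ('a, 'm, 'x) module_scheme \<Rightarrow> bool" where
  "uniserial A M \<longleftrightarrow> (\<forall>N L. submodule N A M \<and> submodule L A M \<longrightarrow> N \<subseteq> L \<or> L \<subseteq> N)"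

definition local_module :: "('a, 'z) ring_scheme \<Rightarrow> ('a, 'm, 'x) module_scheme \<Rightarrow> bool" where
  "local_module A M \<longleftrightarrow> simple_module A (module_top A M)"

definition colocal_module :: "('a, 'z) ring_scheme \<Rightarrow> ('a, 'm, 'x) module_scheme \<Rightarrow> bool" where
  "colocal_module A M \<longleftrightarrow> simple_module A (sub_module M (module_socle A M))"

definition largest_proper_submodule ::
    "('a, 'z) ring_scheme \<Rightarrow> ('a, 'm, 'x) module_scheme \<Rightarrow> 'm set \<Rightarrow> bool" where
  "largest_proper_submodule A M N \<longleftrightarrow> submodule N A M \<and> N \<noteq> carrier M \<and>
     (\<forall>L. submodule L A M \<and> L \<noteq> carrier M \<longrightarrow> L \<subseteq> N)"

definition smallest_nonzero_submodule ::
    "('a, 'z) ring_scheme \<Rightarrow> ('a, 'm, 'x) module_scheme \<Rightarrow> 'm set \<Rightarrow> bool" where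
  "smallest_nonzero_submodule A M N \<longleftrightarrow> submodule N A M \<and> N \<noteq> {\<zero>\<^bsub>M\<^esub>} \<and>
     (\<forall>L. submodule L A M \<and> L \<noteq> {\<zero>\<^bsub>M\<^esub>} \<longrightarrow> N \<subseteq> L)"

definition biserial :: "('a, 'z) ring_scheme \<Rightarrow> ('a, 'm, 'x) module_scheme \<Rightarrow> bool" where
  "biserial A M \<longleftrightarrow> indecomposable A M \<and>
     (\<exists>M\<^sub>1 M\<^sub>2. submodule M\<^sub>1 A M \<and> submodule M\<^sub>2 A M \<and>
        uniserial A (sub_module M M\<^sub>1) \<and> uniserial A (sub_module M M\<^sub>2) \<and>
        \<not> M\<^sub>1 \<subseteq> M\<^sub>2 \<and> \<not> M\<^sub>2 \<subseteq> M\<^sub>1 \<and>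
        (M\<^sub>1 <+>\<^bsub>M\<^esub> M\<^sub>2 = carrier M \<or> largest_proper_submodule A M (M\<^sub>1 <+>\<^bsub>M\<^esub> M\<^sub>2)) \<and>
        (M\<^sub>1 \<inter> M\<^sub>2 = {\<zero>\<^bsub>M\<^esub>} \<or> smallest_nonzero_submodule A M (M\<^sub>1 \<inter> M\<^sub>2)))"

definition astride_biserial :: "('a, 'z) ring_scheme \<Rightarrow> ('a, 'm, 'x) module_scheme \<Rightarrow> bool" where
  "astride_biserial A M \<longleftrightarrow> biserial A M \<and> local_module A M \<and> \<not> colocal_module A M"

section \<open>Artin algebras\<close>

definition artinian_ring :: "('r, 'z) ring_scheme \<Rightarrow> bool" where
  "artinian_ring R \<longleftrightarrow> (\<forall>I. (\<forall>n::nat. ideal (I n) R \<and> I (Suc n) \<subseteq> I n) \<longrightarrow>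
     (\<exists>k. \<forall>n\<ge>k. I n = I k))"

text \<open>The library locale \<^locale>\<open>algebra\<close> is restricted to commutative algebras.\<close>

locale artin_algebra = Module.module R A + ring A
  for R :: "('r, 'z) ring_scheme" (structure) and A :: "('r, 'a, 'x) module_scheme" (structure) +
  assumes smult_mult_left: "\<lbrakk>r \<in> carrier R; x \<in> carrier A; y \<in> carrier A\<rbrakk> \<Longrightarrow>
      (r \<odot>\<^bsub>A\<^esub> x) \<otimes>\<^bsub>A\<^esub> y = r \<odot>\<^bsub>A\<^esub> (x \<otimes>\<^bsub>A\<^esub> y)"
    and smult_mult_right: "\<lbrakk>r \<in> carrier R; x \<in> carrier A; y \<in> carrier A\<rbrakk> \<Longrightarrow>
      x \<otimes>\<^bsub>A\<^esub> (r \<odot>\<^bsub>A\<^esub> y) = r \<odot>\<^bsub>A\<^esub> (x \<otimes>\<^bsub>A\<^esub> y)"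
    and artinian_base: "artinian_ring R"
    and finitely_generated_algebra: "finitely_generated R A"

text \<open>Right \<open>A\<close>-modules are left modules over the opposite ring.\<close>

definition opposite :: "('a, 'z) ring_scheme \<Rightarrow> ('a, 'z) ring_scheme" where
  "opposite A = A\<lparr>mult := (\<lambda>x y. y \<otimes>\<^bsub>A\<^esub> x)\<rparr>"

definition regular_module :: "('a, 'z) ring_scheme \<Rightarrow> ('a, 'a) module" where
  "regular_module A = \<lparr>carrier = carrier A, mult = mult A, one = one A, zero = zero A, add = add A,
     smult = mult A\<rparr>"

text \<open>The submodules of the left regular module are the left ideals of \<open>A\<close>, so this is the
  intersection of the maximal left ideals.\<close>

definition jacobson_radical :: "('a, 'z) ring_scheme \<Rightarrow> 'a set" where
  "jacobson_radical A = module_rad A (regular_module A)"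

definition radical_squared_zero :: "('a, 'z) ring_scheme \<Rightarrow> bool" where
  "radical_squared_zero A \<longleftrightarrow>
     ideal_prod A (jacobson_radical A) (jacobson_radical A) = {\<zero>\<^bsub>A\<^esub>}"

definition radical_cubed_zero :: "('a, 'z) ring_scheme \<Rightarrow> bool" where
  "radical_cubed_zero A \<longleftrightarrow>
     ideal_prod A (ideal_prod A (jacobson_radical A) (jacobson_radical A)) (jacobson_radical A)
       = {\<zero>\<^bsub>A\<^esub>}"

definition nakayama :: "('a, 'z) ring_scheme \<Rightarrow> bool" where
  "nakayama A \<longleftrightarrow> (\<forall>M :: 'a fg_module. indecomposable A M \<and>
     (projective_in_mod A M \<or> injective_in_mod A M) \<longrightarrow> uniserial A M)"

text \<open>Injective envelopes are unique up to isomorphism, so it does not matter which one is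
  tested for being uniserial.\<close>

definition has_uniserial_envelope :: "('a, 'z) ring_scheme \<Rightarrow> ('a, 'm, 'x) module_scheme \<Rightarrow> bool" where
  "has_uniserial_envelope A S \<longleftrightarrow>
     (\<exists>I :: 'a fg_module. injective_envelope A S I \<and> uniserial A I)"

definition wedged_string_left :: "('a, 'z) ring_scheme \<Rightarrow> bool" where
  "wedged_string_left A \<longleftrightarrow> (\<forall>P :: 'a fg_module. projective_in_mod A P \<and> indecomposable A P \<longrightarrow>
     uniserial A P \<or>
     (astride_biserial A P \<and>
      (\<exists>S\<^sub>1 S\<^sub>2. simple_submodule A P S\<^sub>1 \<and> simple_submodule A P S\<^sub>2 \<and>
         is_direct_sum P (module_rad A P) S\<^sub>1 S\<^sub>2 \<and>
         has_uniserial_envelope A (sub_module P S\<^sub>1) \<and>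
         has_uniserial_envelope A (sub_module P S\<^sub>2))))"

definition wedged_string :: "('a, 'z) ring_scheme \<Rightarrow> bool" where
  "wedged_string A \<longleftrightarrow> wedged_string_left A \<and> wedged_string_left (opposite A)"

section \<open>Every finitely generated module is isomorphic to one with elements in \<open>nat \<Rightarrow> 'a\<close>\<close>

lemma (in left_module) smult_l_null: "x \<in> carrier M \<Longrightarrow> \<zero> \<odot>\<^bsub>M\<^esub> x = \<zero>\<^bsub>M\<^esub>"
  by (metis A.l_zero A.zero_closed M.add.r_cancel_one' smult_closed smult_l_distr)

lemma (in left_module) smult_r_null: "a \<in> carrier A \<Longrightarrow> a \<odot>\<^bsub>M\<^esub> \<zero>\<^bsub>M\<^esub> = \<zero>\<^bsub>M\<^esub>"
  by (metis M.l_zero M.zero_closed M.add.r_cancel_one' smult_closed smult_r_distr)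

lemma (in left_module) smult_minus_one:
  assumes "x \<in> carrier M"
  shows "(\<ominus> \<one>) \<odot>\<^bsub>M\<^esub> x = \<ominus>\<^bsub>M\<^esub> x"
proof -
  have "(\<ominus> \<one>) \<odot>\<^bsub>M\<^esub> x \<oplus>\<^bsub>M\<^esub> x = (\<ominus> \<one> \<oplus> \<one>) \<odot>\<^bsub>M\<^esub> x"
    using assms by (simp add: smult_l_distr smult_one)
  also have "\<dots> = \<zero>\<^bsub>M\<^esub>"
    using assms by (simp add: A.l_neg smult_l_null)
  finally show ?thesis
    using assms by (metis A.a_inv_closed A.one_closed M.minus_equality smult_closed)
qed

lemma (in left_module) smult_finsum:
  assumes "finite F" "a \<in> carrier A" "f \<in> F \<rightarrow> carrier M"
  shows "a \<odot>\<^bsub>M\<^esub> (\<Oplus>\<^bsub>M\<^esub> i \<in> F. f i) = (\<Oplus>\<^bsub>M\<^esub> i \<in> F. a \<odot>\<^bsub>M\<^esub> f i)"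
  using assms
proof (induct set: finite)
  case empty
  then show ?case by (simp add: smult_r_null)
next
  case (insert x F)
  then show ?case by (simp add: Pi_def smult_r_distr smult_closed)
qed

lemma (in left_module) left_module_transport:
  fixes f :: "'m \<Rightarrow> 'n"
  assumes "inj_on f (carrier M)"
  obtains N :: "('a, 'n) module" where "left_module A N" "f \<in> module_homs A M N" "bij_betw f (carrier M) (carrier N)"
proof -
  define g where "g = inv_into (carrier M) f"
  define N :: "('a, 'n) module" where "N = \<lparr>carrier = f ` carrier M, mult = undefined, one = undefined, zero = f \<zero>\<^bsub>M\<^esub>,
    add = (\<lambda>x y. f (g x \<oplus>\<^bsub>M\<^esub> g y)), smult = (\<lambda>a x. f (a \<odot>\<^bsub>M\<^esub> g x))\<rparr>"
  have gf: "g (f x) = x" if "x \<in> carrier M" for x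
    using assms that by (simp add: g_def)
  have "abelian_group N"
  proof (rule abelian_groupI)
    fix x assume "x \<in> carrier N"
    then obtain x' where x: "x' \<in> carrier M" "x = f x'" by (auto simp: N_def)
    show "\<exists>y\<in>carrier N. y \<oplus>\<^bsub>N\<^esub> x = \<zero>\<^bsub>N\<^esub>"
      by (rule bexI[of _ "f (\<ominus>\<^bsub>M\<^esub> x')"]) (use x in \<open>auto simp: N_def gf M.l_neg\<close>)
  qed (auto simp: N_def gf M.a_ac)
  then have "left_module A N"
    by (intro left_module.intro A.ring_axioms left_module_axioms.intro)
      (auto simp: N_def gf smult_closed smult_l_distr smult_r_distr smult_assoc smult_one)
  moreover have "f \<in> module_homs A M N"
    by (auto simp: module_homs_def N_def gf)
  moreover have "bij_betw f (carrier M) (carrier N)"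
    using assms by (simp add: bij_betw_def N_def)
  ultimately show thesis by (rule that)
qed

lemma (in left_module) finitely_generated_representable:
  assumes "finitely_generated A M"
  obtains N :: "('a, nat \<Rightarrow> 'a) module" and f
  where "left_module A N" "f \<in> module_homs A M N" "bij_betw f (carrier M) (carrier N)"
proof -
  obtain X where X: "finite X" "X \<subseteq> carrier M"
    and gen: "\<And>N. submodule N A M \<Longrightarrow> X \<subseteq> N \<Longrightarrow> N = carrier M"
    using assms by (auto simp: finitely_generated_def)
  obtain n x where x: "X = x ` {i::nat. i < n}"
    using X(1) by (auto simp: finite_conv_nat_seg_image)
  have xM: "x i \<in> carrier M" if "i < n" for i
    using X(2) x that by auto
  define s where "s c = (\<Oplus>\<^bsub>M\<^esub> i \<in> {..<n}. c i \<odot>\<^bsub>M\<^esub> x i)" for c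
  define K where "K = s ` (UNIV \<rightarrow> carrier A)"
  have sM: "s c \<in> carrier M" if "c \<in> UNIV \<rightarrow> carrier A" for c
    unfolding s_def using that xM by (intro M.finsum_closed) (auto intro!: smult_closed)
  have smultK: "a \<odot>\<^bsub>M\<^esub> y \<in> K" if a: "a \<in> carrier A" and y: "y \<in> K" for a y
  proof -
    obtain c where c: "c \<in> UNIV \<rightarrow> carrier A" "y = s c" using y by (auto simp: K_def)
    have "a \<odot>\<^bsub>M\<^esub> s c = (\<Oplus>\<^bsub>M\<^esub> i \<in> {..<n}. a \<odot>\<^bsub>M\<^esub> (c i \<odot>\<^bsub>M\<^esub> x i))"
      unfolding s_def using a c xM by (intro smult_finsum) (auto intro!: smult_closed)
    also have "\<dots> = s (\<lambda>i. a \<otimes> c i)"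
      unfolding s_def using a c xM
      by (intro M.finsum_cong') (auto intro!: smult_closed smult_assoc[symmetric] simp: Pi_iff)
    finally show ?thesis
      unfolding K_def using a c by (intro image_eqI[of _ _ "\<lambda>i. a \<otimes> c i"]) auto
  qed
  have addK: "y \<oplus>\<^bsub>M\<^esub> z \<in> K" if yz: "y \<in> K" "z \<in> K" for y z
  proof -
    obtain c d where c: "c \<in> UNIV \<rightarrow> carrier A" "y = s c" and d: "d \<in> UNIV \<rightarrow> carrier A" "z = s d"
      using yz by (auto simp: K_def)
    have "s (\<lambda>i. c i \<oplus> d i) = (\<Oplus>\<^bsub>M\<^esub> i \<in> {..<n}. c i \<odot>\<^bsub>M\<^esub> x i \<oplus>\<^bsub>M\<^esub> d i \<odot>\<^bsub>M\<^esub> x i)"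
      unfolding s_def using c d xM
      by (intro M.finsum_cong') (auto intro!: smult_closed smult_l_distr simp: Pi_iff)
    also have "\<dots> = s c \<oplus>\<^bsub>M\<^esub> s d"
      unfolding s_def using c d xM by (intro M.finsum_addf) (auto intro!: smult_closed)
    finally show ?thesis
      unfolding K_def using c d by (intro image_eqI[of _ _ "\<lambda>i. c i \<oplus> d i"]) auto
  qed
  have xK: "x k \<in> K" if "k < n" for k
  proof -
    have "s (\<lambda>i. if i = k then \<one> else \<zero>) = (\<Oplus>\<^bsub>M\<^esub> i \<in> {..<n}. if k = i then x i else \<zero>\<^bsub>M\<^esub>)"
      unfolding s_def using xM
      by (intro M.finsum_cong') (auto simp: smult_one smult_l_null)
    also have "\<dots> = x k"
      using that xM by (intro M.finsum_singleton) auto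
    finally show ?thesis
      unfolding K_def by (intro image_eqI[of _ _ "\<lambda>i. if i = k then \<one> else \<zero>"]) auto
  qed
  have zeroK: "\<zero>\<^bsub>M\<^esub> \<in> K"
    unfolding K_def
    by (rule image_eqI[of _ _ "\<lambda>i. \<zero>"])
      (use xM in \<open>auto simp: s_def smult_l_null intro!: M.add.finprod_one_eqI[symmetric]\<close>)
  have KM: "K \<subseteq> carrier M" using sM by (auto simp: K_def)
  have "submodule K A M"
  proof (intro submodule.intro subgroup.intro submodule_axioms.intro)
    fix y assume y: "y \<in> K"
    then have "\<ominus>\<^bsub>M\<^esub> y \<in> K"
      using smultK[of "\<ominus> \<one>" y] KM smult_minus_one by auto
    then show "inv\<^bsub>add_monoid M\<^esub> y \<in> K" by (simp add: a_inv_def)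
  qed (use KM zeroK addK smultK in auto)
  then have K: "K = carrier M"
    using gen xK x by blast
  define f where "f = inv_into (UNIV \<rightarrow> carrier A) s"
  have "inj_on f (carrier M)"
    unfolding f_def K[symmetric] K_def by (rule inj_on_inv_into) simp
  then obtain N :: "('a, nat \<Rightarrow> 'a) module" where "left_module A N" "f \<in> module_homs A M N"
      "bij_betw f (carrier M) (carrier N)"
    by (rule left_module_transport)
  then show thesis by (rule that)
qed

end

(*
Write J for the radical.  Everything is phrased through the primitive idempotents e, f, ... of A: the
modules A e are the indecomposable projectives, and the duals of the right modules f A, taken with values
in an injective cogenerator of R, are the indecomposable injectives.

Wedged-string with cubed radical zero bounds the lengths.  Let M be indecomposable of finite length.  If a
submodule L of M with simple socle reaches the Loewy length of M and the injective envelope of that socle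
is uniserial, then the envelope map splits M, so M = L.  This settles all cases in which the projective
covering a suitable element x = e x of M and the injective belonging to a simple f J x are both uniserial.
If A e is not uniserial, then J^2 e = 0 and the right modules f A with f J e nonzero are uniserial, so f J g
is generated by any nonzero element of f J e, for every g.  Given a complement C of A x modulo J M that is
minimal with A x + C = M, a simple submodule of the intersection lies in J C, and this allows to change x
by an element of C until A x becomes a direct summand.  The remaining case is dual.

Conversely, let all indecomposables have length at most three.  A non-uniserial indecomposable projective
A e has length three, so its radical is a direct sum of two simple modules.  If for one of these the
injective envelope, the dual of f A, were not uniserial, then f J would be a direct sum of two simple right
modules, and there would be v in f J e and w in f J e' neither of which generates the other.  The quotient
of A e + A e' (direct sum) by the diagonal copy A (v, w) would then be indecomposable of length at least four.

Finally, the bound two corresponds to Nakayama algebras with squared radical zero: a non-uniserial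
indecomposable module has length at least three, and so does A e when J^2 e is nonzero.
*)

theory Submission
  imports Defs
begin

text \<open>The conditions on injective envelopes of simple left modules are conditions on right
  modules in disguise: the envelope belonging to f is dual to f A, so it is uniserial exactly when f
  A is. This turns the hypothesis into statements about products f J e inside A. The duality needs
  an injective cogenerator of R, obtained as a module of greatest length among those with
  multiplicity-free socle. Pairing with such a module cannot increase lengths; this bounds the
  lengths in question by that of R and also yields double annihilators. Extremal choices of
  submodules by length replace projective covers and decomposition theorems. In the converse, the
  amalgam of A e and A e' must also kill the square of the radical, because J^2 e' is not known to
  vanish. The equation f J^2 = 0 keeps this from affecting the elements of the kernel fixed by f, on
  which indecomposability depends. Modulo J^2 the two factors contribute at least 3 + 2, and the
  diagonal costs at most 1, whence the length 4.\<close>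

abbreviation jac :: "('a, 'z) ring_scheme \<Rightarrow> 'a set" where "jac \<equiv> jacobson_radical"

abbreviation zero_in ("\<zero>[_]") where "\<zero>[M] \<equiv> \<zero>\<^bsub>M\<^esub>"
abbreviation one_in ("\<one>[_]") where "\<one>[M] \<equiv> \<one>\<^bsub>M\<^esub>"
abbreviation add_in ("(_ \<oplus>[_]/ _)" [65, 0, 66] 65) where "x \<oplus>[M] y \<equiv> x \<oplus>\<^bsub>M\<^esub> y"
abbreviation minus_in ("(_ \<ominus>[_]/ _)" [65, 0, 66] 65) where "x \<ominus>[M] y \<equiv> x \<ominus>\<^bsub>M\<^esub> y"
abbreviation uminus_in ("\<ominus>[_] _" [0, 81] 80) where "\<ominus>[M] x \<equiv> \<ominus>\<^bsub>M\<^esub> x"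
abbreviation mult_in ("(_ \<otimes>[_]/ _)" [70, 0, 71] 70) where "x \<otimes>[M] y \<equiv> x \<otimes>\<^bsub>M\<^esub> y"
abbreviation smult_in ("(_ \<odot>[_]/ _)" [70, 0, 71] 70) where "a \<odot>[M] x \<equiv> a \<odot>\<^bsub>M\<^esub> x"
abbreviation sum_in ("(_ <+>[_]/ _)" [60, 0, 61] 60) where "X <+>[M] Y \<equiv> X <+>\<^bsub>M\<^esub> Y"
abbreviation coset_in ("(_ +>[_]/ _)" [60, 0, 61] 60) where "N +>[M] x \<equiv> N +>\<^bsub>M\<^esub> x"

section \<open>Lengths of intervals of submodules\<close>

text \<open>Chains are weakly increasing, and only their strict steps are counted below. So the
  image of a chain under a monotone map is again a chain, without deleting repetitions.\<close>

definition chains :: "'m set set \<Rightarrow> ((nat \<Rightarrow> 'm set) \<times> nat) set" where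
  "chains S = {(c, n). (\<forall>i\<le>n. c i \<in> S) \<and> (\<forall>i<n. c i \<subseteq> c (Suc i))}"

definition jumps :: "(nat \<Rightarrow> 'm set) \<Rightarrow> nat \<Rightarrow> nat" where
  "jumps c n = card {i. i < n \<and> c i \<noteq> c (Suc i)}"

definition height :: "'m set set \<Rightarrow> enat" where
  "height S = (SUP (c, n) \<in> chains S. enat (jumps c n))"

lemma height_upper: "(c, n) \<in> chains S \<Longrightarrow> enat (jumps c n) \<le> height S"
  unfolding height_def by (rule SUP_upper2[where i = "(c, n)"]) auto

lemma height_le: "(\<And>c n. (c, n) \<in> chains S \<Longrightarrow> enat (jumps c n) \<le> h) \<Longrightarrow> height S \<le> h"
  unfolding height_def by (rule SUP_least) auto

text \<open>The case k = 0 is excluded because S may be empty; then there is no chain at all, while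
  the height is still 0.\<close>

lemma height_attained:
  assumes "enat k \<le> height S" "k > 0"
  obtains c n where "(c, n) \<in> chains S" "k \<le> jumps c n"
proof (rule ccontr)
  assume "\<not> thesis"
  then have *: "\<And>c n. (c, n) \<in> chains S \<Longrightarrow> jumps c n < k" using that by (meson not_le)
  have "height S \<le> enat (k - 1)"
    by (rule height_le) (use * assms(2) in fastforce)
  then have "enat k \<le> enat (k - 1)" using assms(1) by (rule order_trans[rotated])
  then show False using assms(2) by simp
qed

lemma the_enat_less:
  fixes a b c :: enat
  assumes "a + 1 \<le> b" "b \<le> c" "c < \<infinity>"
  shows "the_enat a < the_enat b"
proof -
  obtain l where l: "c = enat l" using assms(3) by (cases c) auto
  then obtain k where k: "b = enat k" using assms(2) by (cases b) auto
  then obtain i where "a = enat i" using assms(1) by (cases a) auto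
  then show ?thesis using assms(1) k by (simp add: one_enat_def)
qed

lemma enat_unbounded: "(\<And>l. enat l \<le> c) \<Longrightarrow> c = \<infinity>"
proof (cases c)
  case (enat k)
  assume "\<And>l. enat l \<le> c"
  then have "enat (Suc k) \<le> enat k" using enat by metis
  then show ?thesis by simp
qed

text \<open>If a or b is infinite, take 0 on the other side and let the finite bound on the infinite
  side grow; this makes c infinite too.\<close>

lemma enat_add_le:
  fixes a b c :: enat
  assumes "\<And>k l. enat k \<le> a \<Longrightarrow> enat l \<le> b \<Longrightarrow> enat (k + l) \<le> c"
  shows "a + b \<le> c"
proof (cases a)
  case [simp]: (enat k)
  show ?thesis
  proof (cases b)
    case (enat l)
    then show ?thesis using assms[of k l] by simp
  next
    case infinity
    have "enat l \<le> c" for l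
      using assms[of 0 l] infinity by (simp add: zero_enat_def[symmetric])
    then have "c = \<infinity>" by (rule enat_unbounded)
    then show ?thesis by simp
  qed
next
  case infinity
  have "enat l \<le> c" for l
    using assms[of l 0] infinity by (simp add: zero_enat_def[symmetric])
  then have "c = \<infinity>" by (rule enat_unbounded)
  then show ?thesis by simp
qed

lemma jumps_mono_map:
  assumes "(c, n) \<in> chains S" "\<And>X Y. X \<in> S \<Longrightarrow> Y \<in> S \<Longrightarrow> X \<noteq> Y \<Longrightarrow> f X \<noteq> f Y"
  shows "jumps c n \<le> jumps (\<lambda>i. f (c i)) n"
  unfolding jumps_def
proof (rule card_mono, simp, rule subsetI)
  fix i assume i: "i \<in> {i. i < n \<and> c i \<noteq> c (Suc i)}"
  then have "c i \<in> S" "c (Suc i) \<in> S" using assms(1) by (auto simp: chains_def)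
  then show "i \<in> {i. i < n \<and> f (c i) \<noteq> f (c (Suc i))}" using i assms(2) by blast
qed

lemma height_mono_map:
  assumes "\<And>X. X \<in> S \<Longrightarrow> f X \<in> T"
    and "\<And>X Y. X \<in> S \<Longrightarrow> Y \<in> S \<Longrightarrow> X \<subseteq> Y \<Longrightarrow> f X \<subseteq> f Y"
    and "inj_on f S"
  shows "height S \<le> height T"
proof (rule height_le)
  fix c n assume c: "(c, n) \<in> chains S"
  then have "(\<lambda>i. f (c i), n) \<in> chains T"
    using assms(1,2) by (auto simp: chains_def)
  then have "enat (jumps (\<lambda>i. f (c i)) n) \<le> height T" by (rule height_upper)
  moreover have "jumps c n \<le> jumps (\<lambda>i. f (c i)) n"
    using jumps_mono_map[OF c, of f] assms(3) by (auto simp: inj_on_def)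
  ultimately show "enat (jumps c n) \<le> height T"
    by (meson enat_ord_simps(1) order_trans)
qed

text \<open>The image chain is read backwards, so the step starting at i becomes the step starting
  at \<open>n - Suc i\<close>.\<close>

lemma height_anti_map:
  assumes "\<And>X. X \<in> S \<Longrightarrow> f X \<in> T"
    and "\<And>X Y. X \<in> S \<Longrightarrow> Y \<in> S \<Longrightarrow> X \<subseteq> Y \<Longrightarrow> f Y \<subseteq> f X"
    and "inj_on f S"
  shows "height S \<le> height T"
proof (rule height_le)
  fix c n assume c: "(c, n) \<in> chains S"
  define d where "d i = f (c (n - i))" for i
  have "(d, n) \<in> chains T"
  proof -
    have "d i \<subseteq> d (Suc i)" if "i < n" for i
    proof -
      have "Suc (n - Suc i) = n - i" "n - Suc i < n" using that by auto
      moreover have "c (n - Suc i) \<subseteq> c (Suc (n - Suc i))" using c \<open>n - Suc i < n\<close> unfolding chains_def by blast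
      moreover have "c (n - Suc i) \<in> S" "c (n - i) \<in> S" using c by (simp_all add: chains_def)
      ultimately show ?thesis unfolding d_def by (metis assms(2))
    qed
    then show ?thesis using c assms(1) by (auto simp: chains_def d_def)
  qed
  then have "enat (jumps d n) \<le> height T" by (rule height_upper)
  moreover have "jumps c n \<le> jumps d n"
    unfolding jumps_def
  proof (rule card_inj_on_le[where f = "\<lambda>i. n - Suc i"])
    show "inj_on (\<lambda>i. n - Suc i) {i. i < n \<and> c i \<noteq> c (Suc i)}" by (auto simp: inj_on_def)
    show "(\<lambda>i. n - Suc i) ` {i. i < n \<and> c i \<noteq> c (Suc i)} \<subseteq> {i. i < n \<and> d i \<noteq> d (Suc i)}"
    proof clarify
      fix i assume i: "i < n" "c i \<noteq> c (Suc i)"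
      have "n - (n - Suc i) = Suc i" "n - Suc (n - Suc i) = i" using i by auto
      moreover have "f (c i) \<noteq> f (c (Suc i))"
      proof -
        have "c i \<in> S" "c (Suc i) \<in> S" using c i by (simp_all add: chains_def)
        then show ?thesis using assms(3) i(2) by (metis inj_onD)
      qed
      ultimately show "n - Suc i < n \<and> d (n - Suc i) \<noteq> d (Suc (n - Suc i))"
        using i by (auto simp: d_def)
    qed
  qed simp
  ultimately show "enat (jumps c n) \<le> height T"
    by (meson enat_ord_simps(1) order_trans)
qed

text \<open>By the last hypothesis a strict step of a chain stays strict under f or under g, so its
  jumps are covered by the jumps of the two image chains. For submodules that hypothesis will be the
  modular law.\<close>

lemma height_split:
  assumes "\<And>X. X \<in> S \<Longrightarrow> f X \<in> T" "\<And>X. X \<in> S \<Longrightarrow> g X \<in> U"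
    and "\<And>X Y. X \<in> S \<Longrightarrow> Y \<in> S \<Longrightarrow> X \<subseteq> Y \<Longrightarrow> f X \<subseteq> f Y"
    and "\<And>X Y. X \<in> S \<Longrightarrow> Y \<in> S \<Longrightarrow> X \<subseteq> Y \<Longrightarrow> g X \<subseteq> g Y"
    and "\<And>X Y. X \<in> S \<Longrightarrow> Y \<in> S \<Longrightarrow> X \<subseteq> Y \<Longrightarrow> f X = f Y \<Longrightarrow> g X = g Y \<Longrightarrow> X = Y"
  shows "height S \<le> height T + height U"
proof (rule height_le)
  fix c n assume c: "(c, n) \<in> chains S"
  have "(\<lambda>i. f (c i), n) \<in> chains T" "(\<lambda>i. g (c i), n) \<in> chains U"
    using c assms(1-4) by (auto simp: chains_def)
  then have h: "enat (jumps (\<lambda>i. f (c i)) n) \<le> height T" "enat (jumps (\<lambda>i. g (c i)) n) \<le> height U"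
    by (auto intro: height_upper)
  have "{i. i < n \<and> c i \<noteq> c (Suc i)} \<subseteq>
      {i. i < n \<and> f (c i) \<noteq> f (c (Suc i))} \<union> {i. i < n \<and> g (c i) \<noteq> g (c (Suc i))}"
  proof
    fix i assume i: "i \<in> {i. i < n \<and> c i \<noteq> c (Suc i)}"
    then have "c i \<in> S" "c (Suc i) \<in> S" "c i \<subseteq> c (Suc i)" using c by (auto simp: chains_def)
    then show "i \<in> {i. i < n \<and> f (c i) \<noteq> f (c (Suc i))} \<union> {i. i < n \<and> g (c i) \<noteq> g (c (Suc i))}"
      using i assms(5) by blast
  qed
  then have "jumps c n \<le> card ({i. i < n \<and> f (c i) \<noteq> f (c (Suc i))} \<union> {i. i < n \<and> g (c i) \<noteq> g (c (Suc i))})"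
    unfolding jumps_def by (rule card_mono[rotated]) auto
  also have "\<dots> \<le> jumps (\<lambda>i. f (c i)) n + jumps (\<lambda>i. g (c i)) n"
    unfolding jumps_def by (rule card_Un_le)
  finally have "enat (jumps c n) \<le> enat (jumps (\<lambda>i. f (c i)) n) + enat (jumps (\<lambda>i. g (c i)) n)"
    by simp
  also have "\<dots> \<le> height T + height U" using h by (rule add_mono)
  finally show "enat (jumps c n) \<le> height T + height U" .
qed

lemma height_mono: "S \<subseteq> T \<Longrightarrow> height S \<le> height T"
  by (rule height_mono_map[where f = id]) auto

lemma height_concat:
  assumes "T \<subseteq> S" "U \<subseteq> S" "\<And>X Y. X \<in> T \<Longrightarrow> Y \<in> U \<Longrightarrow> X \<subseteq> Y"
  shows "height T + height U \<le> height S"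
proof (rule enat_add_le)
  fix k l assume k: "enat k \<le> height T" and l: "enat l \<le> height U"
  show "enat (k + l) \<le> height S"
  proof (cases "k = 0 \<or> l = 0")
    case True
    then show ?thesis using k l height_mono[OF assms(1)] height_mono[OF assms(2)]
      by (metis add.right_neutral add_0 order_trans)
  next
    case False
    obtain c n where c: "(c, n) \<in> chains T" "k \<le> jumps c n"
      using height_attained[OF k] False by auto
    obtain d m where d: "(d, m) \<in> chains U" "l \<le> jumps d m"
      using height_attained[OF l] False by auto
    \<comment> \<open>The chain of U starts at position n + 1. The linking step from
      \<open>c n\<close> to \<open>d 0\<close> may be strict but is not counted.\<close>
    define b where "b i = (if i \<le> n then c i else d (i - Suc n))" for i
    have "(b, Suc n + m) \<in> chains S"
    proof -
      have "b i \<in> S" if "i \<le> Suc n + m" for i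
        using that c(1) d(1) assms(1,2) unfolding b_def chains_def by auto
      moreover have "b i \<subseteq> b (Suc i)" if i: "i < Suc n + m" for i
      proof (cases "i < n")
        case True
        then show ?thesis using c by (auto simp: b_def chains_def)
      next
        case False
        show ?thesis
        proof (cases "i = n")
          case True
          then show ?thesis using c(1) d(1) assms(3)[of "c n" "d 0"] by (auto simp: b_def chains_def)
        next
          case F: False
          then have "Suc (i - Suc n) = i - n" "i - Suc n < m" using False i by auto
          then show ?thesis using d(1) False F by (auto simp: b_def chains_def) (metis subsetD)
        qed
      qed
      ultimately show ?thesis by (auto simp: chains_def)
    qed
    then have "enat (jumps b (Suc n + m)) \<le> height S" by (rule height_upper)
    moreover have "jumps c n + jumps d m \<le> jumps b (Suc n + m)"
    proof -
      let ?C = "{i. i < n \<and> c i \<noteq> c (Suc i)}" and ?D = "{i. i < m \<and> d i \<noteq> d (Suc i)}"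
      have "?C \<union> (\<lambda>i. i + Suc n) ` ?D \<subseteq> {i. i < Suc n + m \<and> b i \<noteq> b (Suc i)}"
        by (auto simp: b_def Suc_diff_le)
      then have "card (?C \<union> (\<lambda>i. i + Suc n) ` ?D) \<le> jumps b (Suc n + m)"
        unfolding jumps_def by (rule card_mono[rotated]) auto
      moreover have "card (?C \<union> (\<lambda>i. i + Suc n) ` ?D) = card ?C + card ((\<lambda>i. i + Suc n) ` ?D)"
        by (rule card_Un_disjoint) auto
      moreover have "card ((\<lambda>i. i + Suc n) ` ?D) = card ?D"
        by (rule card_image) (auto simp: inj_on_def)
      ultimately show ?thesis by (simp add: jumps_def)
    qed
    ultimately show ?thesis using c(2) d(2)
      by (meson add_le_mono enat_ord_simps(1) order_trans)
  qed
qed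

text \<open>Two jumps i < j of one chain would give c i < c (i + 1) and c (i + 1) contained in c j <
  c (j + 1), against the hypothesis.\<close>

lemma height_le_one:
  assumes "\<And>X Y Z. X \<in> S \<Longrightarrow> Y \<in> S \<Longrightarrow> Z \<in> S \<Longrightarrow> X \<subset> Y \<Longrightarrow> Y \<subseteq> Z \<Longrightarrow> Y = Z"
  shows "height S \<le> 1"
proof (rule height_le)
  fix c n assume c: "(c, n) \<in> chains S"
  have mono: "c i \<subseteq> c j" if "i \<le> j" "j \<le> n" for i j
    using that
  proof (induction j rule: dec_induct)
    case (step j)
    then have "c j \<subseteq> c (Suc j)" using c by (auto simp: chains_def)
    then show ?case using step by auto
  qed simp
  define K where "K = {i. i < n \<and> c i \<noteq> c (Suc i)}"
  have le: "i = j" if ij: "i \<in> K" "j \<in> K" "i \<le> j" for i j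
  proof (rule ccontr)
    assume "i \<noteq> j"
    with ij have "Suc i \<le> j" by simp
    have that: "i < n" "j < n" "c i \<noteq> c (Suc i)" "c j \<noteq> c (Suc j)" using ij by (auto simp: K_def)
    have "c i \<subset> c (Suc i)" using that mono[of i "Suc i"] by auto
    moreover have "c (Suc i) \<subseteq> c j" "c j \<subset> c (Suc j)" "c (Suc i) \<subseteq> c (Suc j)"
      using mono that \<open>Suc i \<le> j\<close> by (auto simp: psubset_eq)
    moreover have "c i \<in> S" "c (Suc i) \<in> S" "c (Suc j) \<in> S" "c j \<in> S" using c that by (auto simp: chains_def)
    ultimately show False using assms by blast
  qed
  have "i = j" if "i \<in> K" "j \<in> K" for i j
    using le[of i j] le[of j i] that by (cases "i \<le> j") auto
  moreover have "finite K" unfolding K_def by simp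
  ultimately have "card K \<le> Suc 0" using card_le_Suc0_iff_eq by blast
  then have "jumps c n \<le> 1" by (simp add: jumps_def K_def)
  then show "enat (jumps c n) \<le> 1" by (simp add: one_enat_def)
qed

section \<open>Intervals in the lattice of submodules and their lengths\<close>

definition subs :: "('a, 'z) ring_scheme \<Rightarrow> ('a, 'm, 'x) module_scheme \<Rightarrow> 'm set \<Rightarrow> 'm set \<Rightarrow> 'm set set" where
  "subs A M U V = {N. submodule N A M \<and> U \<subseteq> N \<and> N \<subseteq> V}"

text \<open>For submodules U contained in V this is the length of V/U, read off from the interval
  between them, so that lengths of subquotients need no quotient modules.\<close>

definition il :: "('a, 'z) ring_scheme \<Rightarrow> ('a, 'm, 'x) module_scheme \<Rightarrow> 'm set \<Rightarrow> 'm set \<Rightarrow> enat" where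
  "il A M U V = height (subs A M U V)"

abbreviation mlen :: "('a, 'z) ring_scheme \<Rightarrow> ('a, 'm, 'x) module_scheme \<Rightarrow> enat" where
  "mlen A M \<equiv> il A M {\<zero>[M]} (carrier M)"

text \<open>Covering in the lattice of submodules; by \<open>simple_subquotient_iff\<close> this is
  simplicity of V/U.\<close>

definition covers :: "('a, 'z) ring_scheme \<Rightarrow> ('a, 'm, 'x) module_scheme \<Rightarrow> 'm set \<Rightarrow> 'm set \<Rightarrow> bool" where
  "covers A M U V \<longleftrightarrow> submodule U A M \<and> submodule V A M \<and> U \<subset> V \<and>
     (\<forall>N. submodule N A M \<longrightarrow> U \<subseteq> N \<longrightarrow> N \<subseteq> V \<longrightarrow> N = U \<or> N = V)"

context left_module begin

text \<open>Closure under negatives comes from the scalar -1, which leaves only sums and scalar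
  multiples to check.\<close>

lemma sub_iff: "submodule N A M \<longleftrightarrow> N \<subseteq> carrier M \<and> \<zero>[M] \<in> N \<and>
   (\<forall>x\<in>N. \<forall>y\<in>N. x \<oplus>[M] y \<in> N) \<and> (\<forall>a\<in>carrier A. \<forall>x\<in>N. a \<odot>[M] x \<in> N)"
proof
  assume "submodule N A M"
  then interpret N: submodule N A M .
  show "N \<subseteq> carrier M \<and> \<zero>[M] \<in> N \<and>
   (\<forall>x\<in>N. \<forall>y\<in>N. x \<oplus>[M] y \<in> N) \<and> (\<forall>a\<in>carrier A. \<forall>x\<in>N. a \<odot>[M] x \<in> N)"
    using N.subset N.one_closed N.m_closed by auto
next
  assume *: "N \<subseteq> carrier M \<and> \<zero>[M] \<in> N \<and>
   (\<forall>x\<in>N. \<forall>y\<in>N. x \<oplus>[M] y \<in> N) \<and> (\<forall>a\<in>carrier A. \<forall>x\<in>N. a \<odot>[M] x \<in> N)"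
  show "submodule N A M"
  proof (intro submodule.intro subgroup.intro submodule_axioms.intro)
    fix y assume y: "y \<in> N"
    then have "(\<ominus> \<one>) \<odot>[M] y \<in> N" using * by simp
    then have "\<ominus>[M] y \<in> N" using y * smult_minus_one[of y] by (metis subsetD)
    then show "inv\<^bsub>add_monoid M\<^esub> y \<in> N" by (simp add: a_inv_def)
  qed (use * in auto)
qed

lemma sub_subset: "submodule N A M \<Longrightarrow> N \<subseteq> carrier M"
  and sub_mem: "submodule N A M \<Longrightarrow> x \<in> N \<Longrightarrow> x \<in> carrier M"
  and sub_zero: "submodule N A M \<Longrightarrow> \<zero>[M] \<in> N"
  and sub_add: "submodule N A M \<Longrightarrow> x \<in> N \<Longrightarrow> y \<in> N \<Longrightarrow> x \<oplus>[M] y \<in> N"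
  and sub_smult: "submodule N A M \<Longrightarrow> a \<in> carrier A \<Longrightarrow> x \<in> N \<Longrightarrow> a \<odot>[M] x \<in> N"
  by (auto simp: sub_iff)

lemma sub_neg: "submodule N A M \<Longrightarrow> x \<in> N \<Longrightarrow> \<ominus>[M] x \<in> N"
  by (metis A.a_inv_closed A.one_closed smult_minus_one sub_mem sub_smult)

lemma sub_minus: "submodule N A M \<Longrightarrow> x \<in> N \<Longrightarrow> y \<in> N \<Longrightarrow> x \<ominus>[M] y \<in> N"
  by (simp add: a_minus_def sub_add sub_neg)

lemma sub_add_cancel:
  assumes "submodule N A M" "y \<in> N" "x \<in> carrier M"
  shows "x \<oplus>[M] y \<in> N \<longleftrightarrow> x \<in> N" "y \<oplus>[M] x \<in> N \<longleftrightarrow> x \<in> N"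
proof -
  have y: "y \<in> carrier M" using assms sub_mem by auto
  have "x = (x \<oplus>[M] y) \<ominus>[M] y"
    using assms y by (simp add: a_minus_def M.a_assoc M.r_neg)
  then show 1: "x \<oplus>[M] y \<in> N \<longleftrightarrow> x \<in> N"
    using sub_minus[OF assms(1) _ assms(2)] sub_add[OF assms(1) _ assms(2)] by metis
  then show "y \<oplus>[M] x \<in> N \<longleftrightarrow> x \<in> N"
    using y assms(3) by (simp add: M.a_comm)
qed

lemma sub_0: "submodule {\<zero>[M]} A M"
  by (auto simp: sub_iff smult_r_null)

lemma sub_carrier: "submodule (carrier M) A M"
  by (auto simp: sub_iff smult_closed)

lemma sub_Int: "submodule N A M \<Longrightarrow> submodule L A M \<Longrightarrow> submodule (N \<inter> L) A M"
  by (auto simp: sub_iff)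

lemma sub_Inter: "(\<And>N. N \<in> F \<Longrightarrow> submodule N A M) \<Longrightarrow> F \<noteq> {} \<Longrightarrow> submodule (\<Inter> F) A M"
  unfolding sub_iff by blast

lemma mem_set_add: "z \<in> N <+>[M] L \<longleftrightarrow> (\<exists>x\<in>N. \<exists>y\<in>L. z = x \<oplus>[M] y)"
  by (auto simp: set_add_def')

lemma sub_sum:
  assumes "submodule N A M" "submodule L A M"
  shows "submodule (N <+>[M] L) A M"
  unfolding sub_iff
proof (intro conjI ballI subsetI)
  show "\<zero>[M] \<in> N <+>[M] L"
    unfolding mem_set_add using assms sub_zero by (metis M.r_zero M.zero_closed)
  show "x \<in> carrier M" if "x \<in> N <+>[M] L" for x
    using that assms sub_mem by (auto simp: mem_set_add)
  show "a \<odot>[M] x \<in> N <+>[M] L" if "a \<in> carrier A" "x \<in> N <+>[M] L" for a x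
    using that assms unfolding mem_set_add by (metis smult_r_distr sub_mem sub_smult)
  fix x y assume "x \<in> N <+>[M] L" "y \<in> N <+>[M] L"
  then obtain a b c d where *: "a \<in> N" "b \<in> L" "c \<in> N" "d \<in> L" "x = a \<oplus>[M] b" "y = c \<oplus>[M] d"
    by (auto simp: mem_set_add)
  then have "x \<oplus>[M] y = (a \<oplus>[M] c) \<oplus>[M] (b \<oplus>[M] d)"
    using assms sub_mem by (simp add: M.a_ac)
  then show "x \<oplus>[M] y \<in> N <+>[M] L"
    using * assms unfolding mem_set_add by (metis sub_add)
qed

lemma sum_upper:
  assumes "submodule N A M" "submodule L A M"
  shows "N \<subseteq> N <+>[M] L" "L \<subseteq> N <+>[M] L"
  unfolding mem_set_add subset_iff
  using assms sub_zero sub_mem by (metis M.r_zero M.l_zero)+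

lemma sum_least:
  assumes "submodule K A M" "N \<subseteq> K" "L \<subseteq> K"
  shows "N <+>[M] L \<subseteq> K"
  using assms sub_add unfolding subset_iff mem_set_add by metis

lemma sum_comm: "submodule N A M \<Longrightarrow> submodule L A M \<Longrightarrow> N <+>[M] L = L <+>[M] N"
  by (meson sum_least sum_upper sub_sum subset_antisym)

lemma sum_mono: "N \<subseteq> N' \<Longrightarrow> L \<subseteq> L' \<Longrightarrow> N <+>[M] L \<subseteq> N' <+>[M] L'"
  unfolding subset_iff mem_set_add by metis

text \<open>An element y of Y is x + v, and v = y - x lies in Y and in V, hence in X. This is the
  separation hypothesis of \<open>height_split\<close> needed for \<open>il_add\<close>.\<close>

lemma modular_eq:
  assumes "submodule X A M" "submodule Y A M" "submodule V A M"
    and "X \<subseteq> Y" "X \<inter> V = Y \<inter> V" "Y \<subseteq> X <+>[M] V"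
  shows "X = Y"
proof
  show "Y \<subseteq> X"
  proof
    fix y assume y: "y \<in> Y"
    then obtain x v where xv: "x \<in> X" "v \<in> V" "y = x \<oplus>[M] v" using assms(6) unfolding subset_iff mem_set_add by metis
    then have "v \<in> Y" using y assms sub_add_cancel(2)[OF assms(2), of x v] sub_mem by auto
    then show "y \<in> X" using assms xv by (metis IntD1 IntI sub_add)
  qed
qed fact

lemma subs_mem: "N \<in> subs A M U V \<longleftrightarrow> submodule N A M \<and> U \<subseteq> N \<and> N \<subseteq> V"
  by (simp add: subs_def)

text \<open>Sending X to its intersection with V and to its sum with V splits a chain into two,
  which bounds the left side. Concatenating a chain below V with one above V gives the other
  inequality.\<close>

lemma il_add:
  assumes "submodule U A M" "submodule V A M" "submodule W A M" "U \<subseteq> V" "V \<subseteq> W"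
  shows "il A M U W = il A M U V + il A M V W"
proof (rule antisym)
  show "il A M U W \<le> il A M U V + il A M V W"
    unfolding il_def
  proof (rule height_split[where f = "\<lambda>X. X \<inter> V" and g = "\<lambda>X. X <+>[M] V"])
    fix X Y assume X: "X \<in> subs A M U W"
    then show "X \<inter> V \<in> subs A M U V" "X <+>[M] V \<in> subs A M V W"
      using assms sum_upper[of X V] by (auto simp: subs_mem sub_Int sub_sum) (meson sum_least subsetD)
    assume Y: "Y \<in> subs A M U W" "X \<subseteq> Y"
    then show "X \<inter> V \<subseteq> Y \<inter> V" "X <+>[M] V \<subseteq> Y <+>[M] V" by (auto intro: sum_mono[THEN subsetD])
    assume "X \<inter> V = Y \<inter> V" "X <+>[M] V = Y <+>[M] V"
    then show "X = Y" using modular_eq[of X Y V] X Y assms sum_upper by (simp add: subs_mem)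
  qed
  show "il A M U V + il A M V W \<le> il A M U W"
    unfolding il_def by (rule height_concat) (use assms in \<open>unfold subs_mem subset_iff, blast+\<close>)
qed

lemma il_pos:
  assumes "submodule U A M" "submodule V A M" "U \<subset> V"
  shows "1 \<le> il A M U V"
proof -
  define c where "c i = (if i = (0::nat) then U else V)" for i
  have "(c, 1) \<in> chains (subs A M U V)" using assms by (auto simp: chains_def subs_mem c_def)
  then have "enat (jumps c 1) \<le> il A M U V" unfolding il_def by (rule height_upper)
  moreover have "{i. i < 1 \<and> c i \<noteq> c (Suc i)} = {0}" using assms by (auto simp: c_def)
  then have "jumps c 1 = 1" unfolding jumps_def by simp
  ultimately show ?thesis by (simp add: one_enat_def)
qed

lemma il_refl: "il A M U U = 0"
proof -
  have "il A M U U \<le> 0"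
    unfolding il_def
  proof (rule height_le)
    fix c n assume "(c, n) \<in> chains (subs A M U U)"
    then have "c i = U" if "i \<le> n" for i using that by (auto simp: chains_def subs_mem)
    then have "{i. i < n \<and> c i \<noteq> c (Suc i)} = {}" by auto
    then show "enat (jumps c n) \<le> 0" unfolding jumps_def by (simp add: zero_enat_def)
  qed
  then show ?thesis by simp
qed

lemma il_eq_0: "submodule U A M \<Longrightarrow> submodule V A M \<Longrightarrow> U \<subseteq> V \<Longrightarrow> il A M U V = 0 \<Longrightarrow> U = V"
  using il_pos[of U V] by (auto simp: psubset_eq)

lemma il_mono: "U' \<subseteq> U \<Longrightarrow> V \<subseteq> V' \<Longrightarrow> il A M U V \<le> il A M U' V'"
  unfolding il_def by (rule height_mono) (unfold subset_iff subs_mem, blast)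

lemma il_strict:
  assumes "submodule U A M" "submodule V A M" "submodule W A M" "U \<subseteq> V" "V \<subset> W"
  shows "il A M U V + 1 \<le> il A M U W"
  using il_add[of U V W] il_pos[of V W] assms by (simp add: psubset_eq add_left_mono)

text \<open>The second isomorphism theorem for lengths: adding Y and intersecting with X are
  mutually inverse order isomorphisms of the two intervals.\<close>

lemma il_diamond:
  assumes "submodule X A M" "submodule Y A M"
  shows "il A M (X \<inter> Y) X = il A M Y (X <+>[M] Y)"
proof (rule antisym)
  show "il A M (X \<inter> Y) X \<le> il A M Y (X <+>[M] Y)"
    unfolding il_def
  proof (rule height_mono_map[where f = "\<lambda>Z. Z <+>[M] Y"])
    fix Z assume "Z \<in> subs A M (X \<inter> Y) X"
    then show "Z <+>[M] Y \<in> subs A M Y (X <+>[M] Y)"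
      using assms sum_upper[of Z Y] by (auto simp: subs_mem sub_sum) (meson sum_mono subset_refl subsetD)
  next
    show "inj_on (\<lambda>Z. Z <+>[M] Y) (subs A M (X \<inter> Y) X)"
    proof (rule inj_onI)
      fix Z Z' assume Z: "Z \<in> subs A M (X \<inter> Y) X" "Z' \<in> subs A M (X \<inter> Y) X" "Z <+>[M] Y = Z' <+>[M] Y"
      have "W = (W <+>[M] Y) \<inter> X" if W: "W \<in> subs A M (X \<inter> Y) X" for W
      proof
        show "W \<subseteq> (W <+>[M] Y) \<inter> X" using W assms sum_upper[of W Y] by (auto simp: subs_mem)
        show "(W <+>[M] Y) \<inter> X \<subseteq> W"
        proof
          fix x assume x: "x \<in> (W <+>[M] Y) \<inter> X"
          then obtain w y where wy: "w \<in> W" "y \<in> Y" "x = w \<oplus>[M] y" by (auto simp: mem_set_add)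
          then have "y \<in> X" using x W sub_add_cancel(2)[OF assms(1), of w y] assms sub_mem
            by (auto simp: subs_mem)
          then show "x \<in> W" using wy W sub_add by (auto simp: subs_mem)
        qed
      qed
      then show "Z = Z'" using Z by metis
    qed
  qed (use sum_mono in blast)
  show "il A M Y (X <+>[M] Y) \<le> il A M (X \<inter> Y) X"
    unfolding il_def
  proof (rule height_mono_map[where f = "\<lambda>Z. Z \<inter> X"])
    show "inj_on (\<lambda>Z. Z \<inter> X) (subs A M Y (X <+>[M] Y))"
    proof (rule inj_onI)
      fix Z Z' assume Z: "Z \<in> subs A M Y (X <+>[M] Y)" "Z' \<in> subs A M Y (X <+>[M] Y)" "Z \<inter> X = Z' \<inter> X"
      have "W = (W \<inter> X) <+>[M] Y" if W: "W \<in> subs A M Y (X <+>[M] Y)" for W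
      proof
        show "(W \<inter> X) <+>[M] Y \<subseteq> W" using W sum_least by (auto simp: subs_mem)
        show "W \<subseteq> (W \<inter> X) <+>[M] Y"
        proof
          fix z assume z: "z \<in> W"
          then obtain x y where xy: "x \<in> X" "y \<in> Y" "z = x \<oplus>[M] y" using W unfolding subs_mem subset_iff mem_set_add by metis
          then have "x \<in> W" using z W sub_add_cancel(1)[of W y x] assms sub_mem by (auto simp: subs_mem)
          then show "z \<in> (W \<inter> X) <+>[M] Y" using xy by (auto simp: mem_set_add)
        qed
      qed
      then show "Z = Z'" using Z by metis
    qed
  qed (auto simp: subs_mem assms sub_Int)
qed

lemma il_covers:
  assumes "covers A M U V"
  shows "il A M U V = 1"
proof (rule antisym)
  have *: "X = U \<or> X = V" if "X \<in> subs A M U V" for X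
    using that assms by (auto simp: covers_def subs_mem)
  have "X = U" "Y = V" if "X \<in> subs A M U V" "Y \<in> subs A M U V" "X \<subset> Y" for X Y
    using *[OF that(1)] *[OF that(2)] that(3) assms by (auto simp: covers_def)
  then show "il A M U V \<le> 1"
    unfolding il_def by (intro height_le_one) (use * in \<open>metis psubset_eq\<close>)
qed (use assms in \<open>simp add: covers_def il_pos\<close>)

text \<open>A submodule of least length above U will do, since anything strictly between would be
  shorter. Finiteness of the length makes \<open>the_enat\<close> faithful in this
  comparison.\<close>

lemma exists_cover:
  assumes "submodule U A M" "submodule V A M" "U \<subset> V" "il A M U V < \<infinity>"
  obtains W where "covers A M U W" "W \<subseteq> V"
proof -
  define P where "P W \<longleftrightarrow> submodule W A M \<and> U \<subset> W \<and> W \<subseteq> V" for W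
  have "P V" using assms by (simp add: P_def)
  define W where "W = (ARG_MIN (\<lambda>W. the_enat (il A M U W)) W. P W)"
  have W: "P W" "\<And>Y. P Y \<Longrightarrow> the_enat (il A M U W) \<le> the_enat (il A M U Y)"
    unfolding W_def using arg_min_nat_lemma[of P V "\<lambda>W. the_enat (il A M U W)"] \<open>P V\<close> by blast+
  have "covers A M U W"
    unfolding covers_def
  proof (intro conjI allI impI)
    fix N assume N: "submodule N A M" "U \<subseteq> N" "N \<subseteq> W"
    show "N = U \<or> N = W"
    proof (rule ccontr)
      assume F: "\<not> (N = U \<or> N = W)"
      then have "P N" using N W by (auto simp: P_def)
      have "il A M U N + 1 \<le> il A M U W" using il_strict[of U N W] N W F assms by (auto simp: P_def)
      moreover have "il A M U W \<le> il A M U V" using W by (auto simp: P_def intro: il_mono)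
      ultimately have "the_enat (il A M U N) < the_enat (il A M U W)"
        using assms(4) by (rule the_enat_less)
      then show False using W(2)[OF \<open>P N\<close>] by simp
    qed
  qed (use W(1) assms(1) in \<open>simp_all add: P_def\<close>)
  then show thesis using W(1) that by (simp add: P_def)
qed

text \<open>Finite colength takes the place of Zorn's lemma: a submodule of least colength among
  those with property P is maximal among them.\<close>

lemma exists_max_submodule:
  assumes "P U" "submodule U A M" "il A M U (carrier M) < \<infinity>"
  shows "\<exists>C. submodule C A M \<and> U \<subseteq> C \<and> P C \<and> (\<forall>D. submodule D A M \<longrightarrow> C \<subseteq> D \<longrightarrow> P D \<longrightarrow> D = C)"
proof -
  define Q where "Q C \<longleftrightarrow> submodule C A M \<and> U \<subseteq> C \<and> P C" for C
  have "Q U" using assms by (simp add: Q_def)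
  define C where "C = (ARG_MIN (\<lambda>W. the_enat (il A M W (carrier M))) W. Q W)"
  have C: "Q C" "\<And>Y. Q Y \<Longrightarrow> the_enat (il A M C (carrier M)) \<le> the_enat (il A M Y (carrier M))"
    unfolding C_def using arg_min_nat_lemma[of Q U "\<lambda>W. the_enat (il A M W (carrier M))"] \<open>Q U\<close> by blast+
  show ?thesis
  proof (intro exI[of _ C] conjI allI impI)
    fix D assume D: "submodule D A M" "C \<subseteq> D" "P D"
    then have "Q D" using C by (auto simp: Q_def)
    show "D = C"
    proof (rule ccontr)
      assume "D \<noteq> C"
      then have "il A M C (carrier M) = il A M C D + il A M D (carrier M)" "1 \<le> il A M C D"
        using il_add[of C D "carrier M"] il_pos[of C D] C D by (auto simp: Q_def sub_carrier sub_subset)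
      moreover have "il A M C (carrier M) \<le> il A M U (carrier M)"
        using C by (intro il_mono) (auto simp: Q_def)
      ultimately have "the_enat (il A M D (carrier M)) < the_enat (il A M C (carrier M))"
        using assms(3) by (intro the_enat_less[of _ _ "il A M U (carrier M)"]) (auto simp: add.commute add_right_mono)
      then show False using C(2)[OF \<open>Q D\<close>] by simp
    qed
  qed (use C(1) in \<open>simp_all add: Q_def\<close>)
qed

lemma exists_min_submodule:
  assumes "P U" "submodule U A M" "il A M {\<zero>[M]} U < \<infinity>"
  shows "\<exists>C. submodule C A M \<and> C \<subseteq> U \<and> P C \<and> (\<forall>D. submodule D A M \<longrightarrow> D \<subseteq> C \<longrightarrow> P D \<longrightarrow> D = C)"
proof -
  define Q where "Q C \<longleftrightarrow> submodule C A M \<and> C \<subseteq> U \<and> P C" for C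
  have "Q U" using assms by (simp add: Q_def)
  define C where "C = (ARG_MIN (\<lambda>W. the_enat (il A M {\<zero>[M]} W)) W. Q W)"
  have C: "Q C" "\<And>Y. Q Y \<Longrightarrow> the_enat (il A M {\<zero>[M]} C) \<le> the_enat (il A M {\<zero>[M]} Y)"
    unfolding C_def using arg_min_nat_lemma[of Q U "\<lambda>W. the_enat (il A M {\<zero>[M]} W)"] \<open>Q U\<close> by blast+
  show ?thesis
  proof (intro exI[of _ C] conjI allI impI)
    fix D assume D: "submodule D A M" "D \<subseteq> C" "P D"
    then have "Q D" using C by (auto simp: Q_def)
    show "D = C"
    proof (rule ccontr)
      assume "D \<noteq> C"
      then have "il A M {\<zero>[M]} D + 1 \<le> il A M {\<zero>[M]} C"
        using il_strict[of "{\<zero>[M]}" D C] C D by (auto simp: Q_def sub_0 sub_zero)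
      moreover have "il A M {\<zero>[M]} C \<le> il A M {\<zero>[M]} U"
        using C by (intro il_mono) (auto simp: Q_def)
      ultimately have "the_enat (il A M {\<zero>[M]} D) < the_enat (il A M {\<zero>[M]} C)"
        using assms(3) by (rule the_enat_less)
      then show False using C(2)[OF \<open>Q D\<close>] by simp
    qed
  qed (use C(1) in \<open>simp_all add: Q_def\<close>)
qed

end

section \<open>Homomorphisms, quotients, products\<close>

text \<open>The module axioms pass along any surjection of carriers that respects the operations.
  Quotients receive their module structure this way.\<close>

lemma left_module_surj_image:
  assumes "left_module A M" and car: "carrier Q = p ` carrier M" and z: "\<zero>[Q] = p \<zero>[M]"
    and add: "\<And>x y. x \<in> carrier M \<Longrightarrow> y \<in> carrier M \<Longrightarrow> p x \<oplus>[Q] p y = p (x \<oplus>[M] y)"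
    and smult: "\<And>a x. a \<in> carrier A \<Longrightarrow> x \<in> carrier M \<Longrightarrow> a \<odot>[Q] p x = p (a \<odot>[M] x)"
  shows "left_module A Q" "p \<in> module_homs A M Q"
proof -
  interpret left_module A M by fact
  have "abelian_group Q"
  proof (rule abelian_groupI)
    fix x assume "x \<in> carrier Q"
    then obtain x' where x: "x' \<in> carrier M" "x = p x'" by (auto simp: car)
    show "\<exists>y\<in>carrier Q. y \<oplus>[Q] x = \<zero>[Q]"
      by (rule bexI[of _ "p (\<ominus>[M] x')"]) (use x in \<open>auto simp: car z add M.l_neg\<close>)
  qed (auto simp: car z add M.a_ac)
  then show "left_module A Q"
    by (intro left_module.intro A.ring_axioms left_module_axioms.intro)
      (auto simp: car add smult smult_closed smult_l_distr smult_r_distr smult_assoc smult_one)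
  show "p \<in> module_homs A M Q"
    by (auto simp: module_homs_def car add smult)
qed

lemma (in left_module) minus_eq_0:
  assumes "x \<in> carrier M" "y \<in> carrier M"
  shows "x \<ominus>[M] y = \<zero>[M] \<longleftrightarrow> x = y"
proof
  assume "x \<ominus>[M] y = \<zero>[M]"
  then have "(x \<ominus>[M] y) \<oplus>[M] y = y" using assms by simp
  then show "x = y" using assms by (simp add: a_minus_def M.a_assoc M.l_neg)
qed (use assms in \<open>simp add: a_minus_def M.r_neg\<close>)

lemma (in left_module) minus_add_cancel:
  assumes "x \<in> carrier M" "y \<in> carrier M"
  shows "(x \<ominus>[M] y) \<oplus>[M] y = x" "y \<oplus>[M] (x \<ominus>[M] y) = x" "(x \<oplus>[M] y) \<ominus>[M] y = x"
    "(y \<oplus>[M] x) \<ominus>[M] y = x"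
proof -
  show 1: "(x \<ominus>[M] y) \<oplus>[M] y = x" and 2: "(x \<oplus>[M] y) \<ominus>[M] y = x"
    using assms by (simp_all add: a_minus_def M.a_assoc M.l_neg M.r_neg)
  show "y \<oplus>[M] (x \<ominus>[M] y) = x" "(y \<oplus>[M] x) \<ominus>[M] y = x"
    using 1 2 assms by (simp_all add: M.a_comm)
qed

locale lhom = dom: left_module A M + cod: left_module A N
  for A :: "('a, 'z) ring_scheme" and M :: "('a, 'm, 'x) module_scheme" and N :: "('a, 'n, 'y) module_scheme" +
  fixes f assumes hom: "f \<in> module_homs A M N"
begin

lemma closed: "x \<in> carrier M \<Longrightarrow> f x \<in> carrier N"
  and add: "x \<in> carrier M \<Longrightarrow> y \<in> carrier M \<Longrightarrow> f (x \<oplus>[M] y) = f x \<oplus>[N] f y"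
  and smult: "a \<in> carrier A \<Longrightarrow> x \<in> carrier M \<Longrightarrow> f (a \<odot>[M] x) = a \<odot>[N] f x"
  using hom by (auto simp: module_homs_def)

lemma zero: "f \<zero>[M] = \<zero>[N]"
  using add[of "\<zero>[M]" "\<zero>[M]"] closed by (metis cod.add.l_cancel_one' dom.M.zero_closed dom.r_zero)

lemma neg: "x \<in> carrier M \<Longrightarrow> f (\<ominus>[M] x) = \<ominus>[N] f x"
  by (metis closed cod.smult_minus_one dom.A.a_inv_closed dom.A.one_closed dom.smult_minus_one smult)

lemma minus: "x \<in> carrier M \<Longrightarrow> y \<in> carrier M \<Longrightarrow> f (x \<ominus>[M] y) = f x \<ominus>[N] f y"
  by (simp add: a_minus_def add neg)

definition ker where "ker = {x \<in> carrier M. f x = \<zero>[N]}"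

lemma ker_iff: "x \<in> ker \<longleftrightarrow> x \<in> carrier M \<and> f x = \<zero>[N]" by (simp add: ker_def)

lemma sub_ker: "submodule ker A M"
  unfolding dom.sub_iff
  by (auto simp: ker_iff add smult zero dom.smult_closed cod.smult_r_null)

lemma sub_image: "submodule X A M \<Longrightarrow> submodule (f ` X) A N"
  unfolding cod.sub_iff
proof (intro conjI ballI)
  assume X: "submodule X A M"
  have XM: "x \<in> carrier M" if "x \<in> X" for x using that X dom.sub_mem by auto
  show "f ` X \<subseteq> carrier N" using closed XM by auto
  show "\<zero>[N] \<in> f ` X" using X zero dom.sub_zero by (metis imageI)
  show "x \<oplus>[N] y \<in> f ` X" if "x \<in> f ` X" "y \<in> f ` X" for x y
    using that XM X by (auto simp: add[symmetric] dom.sub_add)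
  show "a \<odot>[N] x \<in> f ` X" if "a \<in> carrier A" "x \<in> f ` X" for a x
    using that XM X by (auto simp: smult[symmetric] dom.sub_smult)
qed

definition pre where "pre Y = {x \<in> carrier M. f x \<in> Y}"

lemma pre_iff: "x \<in> pre Y \<longleftrightarrow> x \<in> carrier M \<and> f x \<in> Y" by (simp add: pre_def)

lemma sub_pre: "submodule Y A N \<Longrightarrow> submodule (pre Y) A M"
  unfolding dom.sub_iff
  by (auto simp: pre_iff add smult zero dom.smult_closed cod.sub_zero cod.sub_add cod.sub_smult)

lemma image_pre: "Y \<subseteq> f ` carrier M \<Longrightarrow> f ` pre Y = Y"
  by (auto simp: pre_def)

lemma pre_image: "submodule X A M \<Longrightarrow> ker \<subseteq> X \<Longrightarrow> pre (f ` X) = X"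
proof
  assume X: "submodule X A M" "ker \<subseteq> X"
  show "pre (f ` X) \<subseteq> X"
  proof
    fix y assume "y \<in> pre (f ` X)"
    then obtain x where x: "x \<in> X" "f y = f x" "y \<in> carrier M" by (auto simp: pre_def)
    then have xM: "x \<in> carrier M" using X dom.sub_mem by auto
    then have "f (y \<ominus>[M] x) = \<zero>[N]" using x by (simp add: minus closed cod.minus_eq_0)
    then have "y \<ominus>[M] x \<in> X" using x xM X by (auto simp: ker_iff)
    then show "y \<in> X" using x xM X dom.sub_add_cancel(1)[of X "\<ominus>[M] x" y]
      by (auto simp: a_minus_def dom.sub_neg)
  qed
  show "X \<subseteq> pre (f ` X)" using X dom.sub_mem by (auto simp: pre_def)
qed

lemma inj_iff: "inj_on f (carrier M) \<longleftrightarrow> ker = {\<zero>[M]}"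
proof
  assume "inj_on f (carrier M)"
  then have "x = \<zero>[M]" if "x \<in> ker" for x
    using that inj_onD[of f "carrier M" x "\<zero>[M]"] by (simp add: ker_def zero)
  then show "ker = {\<zero>[M]}" by (auto simp: ker_def zero)
next
  assume k: "ker = {\<zero>[M]}"
  show "inj_on f (carrier M)"
  proof (rule inj_onI)
    fix x y assume xy: "x \<in> carrier M" "y \<in> carrier M" "f x = f y"
    then have "f (x \<ominus>[M] y) = \<zero>[N]" by (simp add: minus closed cod.minus_eq_0)
    then have "x \<ominus>[M] y = \<zero>[M]" using xy k ker_iff[of "x \<ominus>[M] y"] by auto
    then show "x = y" using xy dom.minus_eq_0 by auto
  qed
qed

text \<open>The correspondence theorem: on the interval from Y to X, taking images is inverted by
  taking the preimage and intersecting with X, because Y contains the part of the kernel lying in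
  X.\<close>

lemma il_image:
  assumes X: "submodule X A M" and Y: "submodule Y A M" and YX: "Y \<subseteq> X" "ker \<inter> X \<subseteq> Y"
  shows "il A M Y X = il A N (f ` Y) (f ` X)"
proof (rule antisym)
  have bk: "pre (f ` Z) \<inter> X = Z" if Z: "submodule Z A M" "Y \<subseteq> Z" "Z \<subseteq> X" for Z
  proof
    show "pre (f ` Z) \<inter> X \<subseteq> Z"
    proof
      fix y assume "y \<in> pre (f ` Z) \<inter> X"
      then obtain x where x: "x \<in> Z" "f y = f x" "y \<in> carrier M" "y \<in> X" by (auto simp: pre_def)
      then have xM: "x \<in> carrier M" using Z dom.sub_mem by auto
      then have "f (y \<ominus>[M] x) = \<zero>[N]" using x by (simp add: minus closed cod.minus_eq_0)
      moreover have "y \<ominus>[M] x \<in> X" using x Z X by (auto intro: dom.sub_minus)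
      ultimately have "y \<ominus>[M] x \<in> ker \<inter> X" using x xM by (simp add: ker_iff)
      then have "y \<ominus>[M] x \<in> Z" using Z YX by blast
      then show "y \<in> Z" using x xM Z dom.sub_add_cancel(1)[of Z "\<ominus>[M] x" y]
        by (auto simp: a_minus_def dom.sub_neg)
    qed
    show "Z \<subseteq> pre (f ` Z) \<inter> X" using Z dom.sub_mem by (auto simp: pre_def)
  qed
  show "il A M Y X \<le> il A N (f ` Y) (f ` X)"
    unfolding il_def
  proof (rule height_mono_map[where f = "\<lambda>Z. f ` Z"])
    show "inj_on ((`) f) (subs A M Y X)"
      by (rule inj_onI) (metis bk dom.subs_mem)
  qed (auto simp: subs_def sub_image)
  show "il A N (f ` Y) (f ` X) \<le> il A M Y X"
    unfolding il_def
  proof (rule height_mono_map[where f = "\<lambda>Z. pre Z \<inter> X"])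
    have img: "f ` (pre Z \<inter> X) = Z" if "Z \<in> subs A N (f ` Y) (f ` X)" for Z
      using that X dom.sub_mem by (auto simp: cod.subs_mem pre_def)
    show "inj_on (\<lambda>Z. pre Z \<inter> X) (subs A N (f ` Y) (f ` X))"
      by (rule inj_onI) (metis img)
    fix Z assume Z: "Z \<in> subs A N (f ` Y) (f ` X)"
    have "Y \<subseteq> pre Z \<inter> X"
      using Z YX dom.sub_mem[OF Y] by (auto simp: cod.subs_mem pre_def)
    then show "pre Z \<inter> X \<in> subs A M Y X"
      using Z X by (auto simp: cod.subs_mem dom.subs_mem sub_pre dom.sub_Int)
  qed (auto simp: pre_def)
qed

lemma image_0: "f ` {\<zero>[M]} = {\<zero>[N]}" by (simp add: zero)

text \<open>Rank-nullity: modulo its intersection with the kernel, X has the same submodules as its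
  image, and \<open>il_add\<close> does the rest.\<close>

lemma il_ker_image:
  assumes "submodule X A M"
  shows "il A M {\<zero>[M]} X = il A M {\<zero>[M]} (ker \<inter> X) + il A N {\<zero>[N]} (f ` X)"
proof -
  have "il A M (ker \<inter> X) X = il A N (f ` (ker \<inter> X)) (f ` X)"
    using assms by (intro il_image) (auto simp: dom.sub_Int sub_ker)
  moreover have "f ` (ker \<inter> X) = {\<zero>[N]}"
  proof -
    have "\<zero>[M] \<in> ker \<inter> X" using assms sub_ker dom.sub_zero by blast
    then show ?thesis using zero by (auto simp: ker_def image_iff)
  qed
  ultimately show ?thesis
    using dom.il_add[of "{\<zero>[M]}" "ker \<inter> X" X] assms dom.sub_Int sub_ker dom.sub_0 dom.sub_zero
    by auto
qed

lemma il_image_le: "submodule X A M \<Longrightarrow> il A N {\<zero>[N]} (f ` X) \<le> il A M {\<zero>[M]} X"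
  by (simp add: il_ker_image)

lemma il_inj:
  assumes "submodule X A M" "inj_on f (carrier M)"
  shows "il A N {\<zero>[N]} (f ` X) = il A M {\<zero>[M]} X"
proof -
  have "ker \<inter> X = {\<zero>[M]}" using assms inj_iff dom.sub_zero by blast
  then show ?thesis using il_ker_image[OF assms(1)] by (simp add: dom.il_refl)
qed

end

subsection \<open>Submodules as modules\<close>

lemma sub_module_simps [simp]: "carrier (sub_module M N) = N" "\<zero>[sub_module M N] = \<zero>[M]"
  "x \<oplus>[sub_module M N] y = x \<oplus>[M] y" "a \<odot>[sub_module M N] x = a \<odot>[M] x"
  by (simp_all add: sub_module_def)

context left_module begin

lemma left_module_sub:
  assumes "submodule N A M" shows "left_module A (sub_module M N)"
proof -
  have mem: "\<And>x. x \<in> N \<Longrightarrow> x \<in> carrier M" using assms sub_mem by auto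
  have "abelian_group (sub_module M N)"
  proof (rule abelian_groupI)
    fix x assume "x \<in> carrier (sub_module M N)"
    then show "\<exists>y\<in>carrier (sub_module M N). y \<oplus>[sub_module M N] x = \<zero>[sub_module M N]"
      using assms by (intro bexI[of _ "\<ominus>[M] x"]) (auto simp: mem M.l_neg sub_neg)
  qed (use assms in \<open>auto simp: mem M.a_ac sub_add sub_zero\<close>)
  then show ?thesis
    by (intro left_module.intro A.ring_axioms left_module_axioms.intro)
      (use assms in \<open>auto simp: mem sub_smult smult_l_distr smult_r_distr smult_assoc smult_one\<close>)
qed

lemma sub_sub_iff:
  assumes "submodule N A M"
  shows "submodule L A (sub_module M N) \<longleftrightarrow> submodule L A M \<and> L \<subseteq> N"
proof -
  interpret N: left_module A "sub_module M N" by (rule left_module_sub[OF assms])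
  show ?thesis unfolding N.sub_iff sub_iff using sub_subset[OF assms] by auto
qed

lemma il_sub:
  assumes "submodule N A M" "V \<subseteq> N" shows "il A (sub_module M N) U V = il A M U V"
proof -
  have "subs A (sub_module M N) U V = subs A M U V"
    using assms by (auto simp: subs_def sub_sub_iff)
  then show ?thesis by (simp add: il_def)
qed

lemma covers_sub:
  assumes "submodule N A M" "V \<subseteq> N" shows "covers A (sub_module M N) U V \<longleftrightarrow> covers A M U V"
  using assms unfolding covers_def sub_sub_iff[OF assms(1)] by blast

lemma lhom_incl: "submodule N A M \<Longrightarrow> lhom A (sub_module M N) M (\<lambda>x. x)"
  by (intro lhom.intro left_module_sub lhom_axioms.intro left_module_axioms)
    (auto simp: module_homs_def sub_mem)

lemma simple_module_iff: "simple_module A M \<longleftrightarrow> covers A M {\<zero>[M]} (carrier M)"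
  unfolding simple_module_def covers_def
  using sub_0 sub_carrier sub_zero sub_subset by blast

lemma simple_submodule_iff: "simple_submodule A M S \<longleftrightarrow> covers A M {\<zero>[M]} S"
proof (cases "submodule S A M")
  case True
  then interpret S: left_module A "sub_module M S" by (rule left_module_sub)
  show ?thesis unfolding simple_submodule_def using True S.simple_module_iff covers_sub[OF True, of S] by simp
qed (auto simp: simple_submodule_def covers_def)

lemma sub_module_carrier: "sub_module M (carrier M) = M"
  by (simp add: sub_module_def)

subsection \<open>Quotients\<close>

lemma coset_iff: "z \<in> N +>[M] x \<longleftrightarrow> (\<exists>n\<in>N. z = n \<oplus>[M] x)"
  by (auto simp: a_r_coset_def')

lemma coset_eq:
  assumes N: "submodule N A M" and x: "x \<in> carrier M" "y \<in> carrier M"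
  shows "N +>[M] x = N +>[M] y \<longleftrightarrow> x \<ominus>[M] y \<in> N"
proof
  assume *: "N +>[M] x = N +>[M] y"
  have "x \<in> N +>[M] x" using N x sub_zero by (auto simp: coset_iff intro!: bexI[of _ "\<zero>[M]"])
  then obtain n where n: "n \<in> N" "x = n \<oplus>[M] y" using * by (auto simp: coset_iff)
  then have "x \<ominus>[M] y = n" using x sub_mem[OF N] by (simp add: a_minus_def M.a_assoc M.r_neg)
  then show "x \<ominus>[M] y \<in> N" using n by simp
next
  assume *: "x \<ominus>[M] y \<in> N"
  have sub: "N +>[M] u \<subseteq> N +>[M] v" if "u \<ominus>[M] v \<in> N" "u \<in> carrier M" "v \<in> carrier M" for u v
  proof
    fix z assume "z \<in> N +>[M] u"
    then obtain n where n: "n \<in> N" "z = n \<oplus>[M] u" by (auto simp: coset_iff)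
    then have "z = (n \<oplus>[M] (u \<ominus>[M] v)) \<oplus>[M] v"
      using that sub_mem[OF N] by (simp add: a_minus_def M.a_assoc M.l_neg)
    then show "z \<in> N +>[M] v" using n that N by (auto simp: coset_iff sub_add)
  qed
  have "y \<ominus>[M] x = \<ominus>[M] (x \<ominus>[M] y)"
    using x by (simp add: a_minus_def M.minus_add M.a_comm)
  then have "y \<ominus>[M] x \<in> N" using * N sub_neg by simp
  then show "N +>[M] x = N +>[M] y" using sub * x by blast
qed

lemma quotient:
  assumes N: "submodule N A M"
  shows "left_module A (quotient_module M N)" (is ?L)
    and "(\<lambda>x. N +>[M] x) \<in> module_homs A M (quotient_module M N)" (is ?H)
    and "carrier (quotient_module M N) = (\<lambda>x. N +>[M] x) ` carrier M" (is ?C)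
    and "\<zero>[quotient_module M N] = N"
proof -
  have Nm: "\<And>x. x \<in> N \<Longrightarrow> x \<in> carrier M" using N sub_mem by auto
  have self: "x \<in> N +>[M] x" if "x \<in> carrier M" for x
    using N that sub_zero by (auto simp: coset_iff intro!: bexI[of _ "\<zero>[M]"])
  show ?C
    by (auto simp: quotient_module_def A_RCOSETS_def')
  have add: "(N +>[M] x) <+>[M] (N +>[M] y) = N +>[M] (x \<oplus>[M] y)"
    if "x \<in> carrier M" "y \<in> carrier M" for x y
  proof (rule equalityI; rule subsetI)
    fix z assume "z \<in> (N +>[M] x) <+>[M] (N +>[M] y)"
    then obtain n m where "n \<in> N" "m \<in> N" "z = (n \<oplus>[M] x) \<oplus>[M] (m \<oplus>[M] y)" by (auto simp: mem_set_add coset_iff)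
    then have "z = (n \<oplus>[M] m) \<oplus>[M] (x \<oplus>[M] y)" "n \<oplus>[M] m \<in> N"
      using that Nm N by (auto simp: M.a_ac sub_add)
    then show "z \<in> N +>[M] (x \<oplus>[M] y)" by (auto simp: coset_iff)
  next
    fix z assume "z \<in> N +>[M] (x \<oplus>[M] y)"
    then obtain n where n: "n \<in> N" "z = n \<oplus>[M] (x \<oplus>[M] y)" by (auto simp: coset_iff)
    then have "z = (n \<oplus>[M] x) \<oplus>[M] y" using that Nm by (simp add: M.a_assoc)
    then show "z \<in> (N +>[M] x) <+>[M] (N +>[M] y)" unfolding mem_set_add using n self[OF that(2)] coset_iff by blast
  qed
  \<comment> \<open>All members of a coset give the same coset after scaling, so the union in the
    definition of \<open>quotient_module\<close> runs over a single value.\<close>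
  have smult: "(\<Union>z\<in>N +>[M] x. N +>[M] (a \<odot>[M] z)) = N +>[M] (a \<odot>[M] x)"
    if "a \<in> carrier A" "x \<in> carrier M" for a x
  proof -
    have "N +>[M] (a \<odot>[M] z) = N +>[M] (a \<odot>[M] x)" if z: "z \<in> N +>[M] x" for z
    proof -
      obtain n where n: "n \<in> N" "z = n \<oplus>[M] x" using z by (auto simp: coset_iff)
      have "a \<odot>[M] z = a \<odot>[M] n \<oplus>[M] a \<odot>[M] x"
        using n \<open>a \<in> carrier A\<close> \<open>x \<in> carrier M\<close> Nm by (simp add: smult_r_distr)
      then have "a \<odot>[M] z \<ominus>[M] a \<odot>[M] x = a \<odot>[M] n"
        using n \<open>a \<in> carrier A\<close> \<open>x \<in> carrier M\<close> Nm by (simp add: a_minus_def M.a_assoc M.r_neg smult_closed)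
      moreover have "a \<odot>[M] n \<in> N" using n \<open>a \<in> carrier A\<close> N by (simp add: sub_smult)
      moreover have "z \<in> carrier M" using n Nm \<open>x \<in> carrier M\<close> by simp
      ultimately show ?thesis using coset_eq[OF N] \<open>a \<in> carrier A\<close> \<open>x \<in> carrier M\<close> by (simp add: smult_closed)
    qed
    then show ?thesis using self[OF that(2)] by (intro SUP_eq_const) blast+
  qed
  have "z \<in> N \<longleftrightarrow> z \<in> N +>[M] \<zero>[M]" for z unfolding coset_iff using Nm M.r_zero by metis
  then have zero: "N = N +>[M] \<zero>[M]" by blast
  show ?L ?H
    by (rule left_module_surj_image[OF left_module_axioms \<open>?C\<close>];
        simp add: quotient_module_def add smult zero[symmetric])+
  show "\<zero>[quotient_module M N] = N" by (simp add: quotient_module_def)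
qed

lemma lhom_quotient: "submodule N A M \<Longrightarrow> lhom A M (quotient_module M N) (\<lambda>x. N +>[M] x)"
  by (intro lhom.intro lhom_axioms.intro left_module_axioms quotient)

lemma ker_quotient:
  assumes N: "submodule N A M"
  shows "lhom.ker M (quotient_module M N) (\<lambda>x. N +>[M] x) = N"
proof -
  interpret p: lhom A M "quotient_module M N" "\<lambda>x. N +>[M] x" by (rule lhom_quotient[OF N])
  have "N +>[M] x = N \<longleftrightarrow> x \<in> N" if "x \<in> carrier M" for x
  proof -
    have "N = N +>[M] \<zero>[M]" using p.zero quotient(4)[OF N] by simp
    then show ?thesis using coset_eq[OF N that M.zero_closed] that minus_add_cancel(1)[OF that M.zero_closed] by simp
  qed
  then show ?thesis using sub_mem[OF N] by (auto simp: p.ker_iff quotient(4)[OF N])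
qed

lemma simple_quotient_iff:
  assumes N: "submodule N A M"
  shows "simple_module A (quotient_module M N) \<longleftrightarrow> covers A M N (carrier M)"
proof -
  interpret p: lhom A M "quotient_module M N" "\<lambda>x. N +>[M] x" by (rule lhom_quotient[OF N])
  let ?Q = "quotient_module M N" and ?f = "\<lambda>x. N +>[M] x"
  have k: "p.ker = N" by (rule ker_quotient[OF N])
  have fN: "?f ` N = {\<zero>[?Q]}"
  proof -
    have "?f x = \<zero>[?Q]" if "x \<in> N" for x using that k p.ker_iff by blast
    then show ?thesis using sub_zero[OF N] by blast
  qed
  show ?thesis
  proof
    assume s: "simple_module A ?Q"
    show "covers A M N (carrier M)"
      unfolding covers_def
    proof (intro conjI allI impI)
      show "submodule N A M" "submodule (carrier M) A M" by (rule N, rule sub_carrier)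
      show "N \<subset> carrier M"
      proof
        show "N \<subseteq> carrier M" by (rule sub_subset[OF N])
        show "N \<noteq> carrier M"
          using s fN quotient(3)[OF N] unfolding simple_module_def by metis
      qed
      fix L assume L: "submodule L A M" "N \<subseteq> L" "L \<subseteq> carrier M"
      have 0: "?f ` L = {\<zero>[?Q]} \<or> ?f ` L = carrier ?Q"
        using s p.sub_image[OF L(1)] unfolding simple_module_def by blast
      have 1: "p.pre (?f ` L) = L" using p.pre_image L k by simp
      have 2: "p.pre {\<zero>[?Q]} = N" using k unfolding p.pre_def p.ker_def by simp
      have 3: "p.pre (carrier ?Q) = carrier M" using p.closed unfolding p.pre_def by blast
      from 0 show "L = N \<or> L = carrier M"
      proof
        assume "?f ` L = {\<zero>[?Q]}"
        then show ?thesis using 1 2 by argo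
      next
        assume "?f ` L = carrier ?Q"
        then show ?thesis using 1 3 by argo
      qed
    qed
  next
    assume c: "covers A M N (carrier M)"
    show "simple_module A ?Q"
      unfolding simple_module_def
    proof (intro conjI allI impI)
      show "carrier ?Q \<noteq> {\<zero>[?Q]}"
      proof
        assume Q0: "carrier ?Q = {\<zero>[?Q]}"
        obtain x where x: "x \<in> carrier M" "x \<notin> N" using c by (auto simp: covers_def)
        have "?f x \<in> carrier ?Q" by (rule p.closed[OF x(1)])
        then have "x \<in> p.ker" using x Q0 p.ker_iff by blast
        then show False using x k by simp
      qed
      fix L assume L: "submodule L A ?Q"
      have "N \<subseteq> p.pre L"
      proof
        fix x assume "x \<in> N"
        then show "x \<in> p.pre L" using k p.ker_iff[of x] p.pre_iff[of x L] p.cod.sub_zero[OF L] by simp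
      qed
      then have "p.pre L = N \<or> p.pre L = carrier M"
        using c p.sub_pre[OF L] sub_subset[of "p.pre L"] unfolding covers_def by blast
      moreover have "?f ` p.pre L = L" using p.image_pre[of L] p.cod.sub_subset[OF L] quotient(3)[OF N] by simp
      ultimately show "L = {\<zero>[?Q]} \<or> L = carrier ?Q"
      proof (elim disjE)
        assume "p.pre L = N" "?f ` p.pre L = L"
        then show ?thesis using fN by simp
      next
        assume "p.pre L = carrier M" "?f ` p.pre L = L"
        then show ?thesis using quotient(3)[OF N] by simp
      qed
    qed
  qed
qed

lemma simple_subquotient_iff:
  assumes "submodule N A M" "submodule V A M" "N \<subseteq> V"
  shows "simple_module A (quotient_module (sub_module M V) N) \<longleftrightarrow> covers A M N V"
proof -
  interpret V: left_module A "sub_module M V" by (rule left_module_sub) fact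
  show ?thesis using V.simple_quotient_iff[of N] assms covers_sub[of V V N] by (simp add: sub_sub_iff)
qed

subsection \<open>Composition series\<close>

text \<open>Every factor is a cover and contributes 1, so additivity telescopes. The left side does
  not depend on the series, which gives the equality of lengths in the Jordan-Hoelder
  theorem.\<close>

lemma composition_series_length:
  assumes "composition_series A M Ns"
  shows "mlen A M = enat (length Ns - 1)"
proof -
  have sub: "submodule (Ns ! i) A M" if "i < length Ns" for i
    using assms that by (auto simp: composition_series_def)
  have cov: "covers A M (Ns ! i) (Ns ! Suc i)" if "Suc i < length Ns" for i
    using assms that simple_subquotient_iff[OF sub sub] by (auto simp: composition_series_def)
  have ne: "Ns \<noteq> []" "Ns ! 0 = {\<zero>[M]}" "Ns ! (length Ns - 1) = carrier M"
    using assms by (auto simp: composition_series_def hd_conv_nth last_conv_nth)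
  have "il A M {\<zero>[M]} (Ns ! i) = enat i" if "i < length Ns" for i
    using that
  proof (induction i)
    case 0
    then show ?case by (simp add: ne il_refl zero_enat_def)
  next
    case (Suc i)
    have "il A M {\<zero>[M]} (Ns ! Suc i) = il A M {\<zero>[M]} (Ns ! i) + il A M (Ns ! i) (Ns ! Suc i)"
      using sub[of i] cov[OF Suc.prems] Suc.prems sub_zero
      by (intro il_add) (auto simp: covers_def sub_0)
    then show ?case using Suc il_covers[OF cov[OF Suc.prems]] by (simp add: one_enat_def)
  qed
  from this[of "length Ns - 1"] show ?thesis using ne by simp
qed

lemma exists_composition_series:
  assumes "submodule U A M" "il A M U (carrier M) < \<infinity>"
  shows "\<exists>Ns. Ns \<noteq> [] \<and> hd Ns = U \<and> last Ns = carrier M \<and> (\<forall>N\<in>set Ns. submodule N A M) \<and>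
     (\<forall>i. Suc i < length Ns \<longrightarrow> covers A M (Ns ! i) (Ns ! Suc i))"
  using assms
proof (induction "the_enat (il A M U (carrier M))" arbitrary: U rule: less_induct)
  case less
  show ?case
  proof (cases "U = carrier M")
    case True
    then show ?thesis by (intro exI[of _ "[carrier M]"]) (auto simp: sub_carrier)
  next
    case False
    then have "U \<subset> carrier M" using sub_subset less.prems by auto
    then obtain W where W: "covers A M U W" using exists_cover[OF less.prems(1) sub_carrier] less.prems by blast
    then have sW: "submodule W A M" "U \<subseteq> W" by (auto simp: covers_def)
    have eq: "il A M U (carrier M) = 1 + il A M W (carrier M)"
      using il_add[of U W "carrier M"] il_covers[OF W] sW less.prems sub_carrier sub_subset by simp
    have "the_enat (il A M W (carrier M)) < the_enat (il A M U (carrier M))" "il A M W (carrier M) < \<infinity>"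
      using eq less.prems(2) by (cases "il A M W (carrier M)"; simp add: one_enat_def)+
    then obtain Ns where Ns: "Ns \<noteq> []" "hd Ns = W" "last Ns = carrier M" "\<forall>N\<in>set Ns. submodule N A M"
      "\<forall>i. Suc i < length Ns \<longrightarrow> covers A M (Ns ! i) (Ns ! Suc i)"
      using less.hyps[of W] sW by blast
    show ?thesis
    proof (intro exI[of _ "U # Ns"] conjI allI impI)
      fix i assume "Suc i < length (U # Ns)"
      then show "covers A M ((U # Ns) ! i) ((U # Ns) ! Suc i)"
        using Ns W by (cases i) (auto simp: hd_conv_nth)
    qed (use Ns less.prems in auto)
  qed
qed

lemma finite_length_iff: "finite_length A M \<longleftrightarrow> mlen A M < \<infinity>"
proof
  assume "finite_length A M"
  then show "mlen A M < \<infinity>" using composition_series_length by (auto simp: finite_length_def)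
next
  assume "mlen A M < \<infinity>"
  then obtain Ns where Ns: "Ns \<noteq> []" "hd Ns = {\<zero>[M]}" "last Ns = carrier M" "\<forall>N\<in>set Ns. submodule N A M"
    "\<forall>i. Suc i < length Ns \<longrightarrow> covers A M (Ns ! i) (Ns ! Suc i)"
    using exists_composition_series[OF sub_0] by blast
  have "composition_series A M Ns"
    unfolding composition_series_def
  proof (intro conjI allI impI Ns)
    fix i assume i: "Suc i < length Ns"
    then have c: "covers A M (Ns ! i) (Ns ! Suc i)" using Ns by simp
    then show "Ns ! i \<subseteq> Ns ! Suc i" by (auto simp: covers_def)
    show "simple_module A (quotient_module (sub_module M (Ns ! Suc i)) (Ns ! i))"
      using c simple_subquotient_iff[of "Ns ! i" "Ns ! Suc i"] by (auto simp: covers_def)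
  qed
  then show "finite_length A M" by (auto simp: finite_length_def)
qed

text \<open>The least length in the definition is attained by some series, and every series has
  length \<open>mlen A M\<close>.\<close>

lemma composition_length_eq:
  assumes "finite_length A M" shows "enat (composition_length A M) = mlen A M"
proof -
  obtain Ns where Ns: "composition_series A M Ns" using assms by (auto simp: finite_length_def)
  have "\<exists>Ns'. composition_series A M Ns' \<and> length Ns' = Suc (length Ns - 1)"
    using Ns by (intro exI[of _ Ns]) (auto simp: composition_series_def)
  then obtain Ns' where "composition_series A M Ns'" "length Ns' = Suc (composition_length A M)"
    unfolding composition_length_def using LeastI_ex[of "\<lambda>n. \<exists>Ns. composition_series A M Ns \<and> length Ns = Suc n"] by blast
  then show ?thesis using composition_series_length by fastforce
qed

end

section \<open>The regular module and cyclic submodules\<close>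

lemma regular_module_simps [simp]: "carrier (regular_module A) = carrier A"
  "\<zero>[regular_module A] = \<zero>[A]" "x \<oplus>[regular_module A] y = x \<oplus>[A] y"
  "a \<odot>[regular_module A] x = a \<otimes>[A] x"
  by (simp_all add: regular_module_def)

lemma (in ring) left_module_regular: "left_module R (regular_module R)"
proof -
  have "abelian_group (regular_module R)"
  proof (rule abelian_groupI)
    fix x assume "x \<in> carrier (regular_module R)"
    then show "\<exists>y\<in>carrier (regular_module R). y \<oplus>[regular_module R] x = \<zero>[regular_module R]"
      by (intro bexI[of _ "\<ominus> x"]) (auto simp: l_neg)
  qed (auto simp: a_ac)
  then show ?thesis
    by (intro left_module.intro ring_axioms left_module_axioms.intro) (auto simp: l_distr r_distr m_assoc)
qed

definition cyc :: "('a, 'z) ring_scheme \<Rightarrow> ('a, 'm, 'x) module_scheme \<Rightarrow> 'm \<Rightarrow> 'm set" where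
  "cyc A M x = (\<lambda>a. a \<odot>[M] x) ` carrier A"

context left_module begin

lemma reg: "left_module A (regular_module A)" by (rule A.left_module_regular)

lemma lhom_cyc: "x \<in> carrier M \<Longrightarrow> lhom A (regular_module A) M (\<lambda>a. a \<odot>[M] x)"
  by (intro lhom.intro reg lhom_axioms.intro left_module_axioms)
    (auto simp: module_homs_def smult_closed smult_l_distr smult_assoc)

lemma sub_cyc: "x \<in> carrier M \<Longrightarrow> submodule (cyc A M x) A M"
  using lhom.sub_image[OF lhom_cyc, of x "carrier A"] left_module.sub_carrier[OF reg]
  by (simp add: cyc_def)

lemma cyc_mem: "a \<in> carrier A \<Longrightarrow> a \<odot>[M] x \<in> cyc A M x" by (simp add: cyc_def)

lemma cyc_self: "x \<in> carrier M \<Longrightarrow> x \<in> cyc A M x"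
  using cyc_mem[OF A.one_closed, of x] by (simp add: smult_one)

lemma cyc_least: "submodule N A M \<Longrightarrow> x \<in> N \<Longrightarrow> cyc A M x \<subseteq> N"
  using sub_smult by (auto simp: cyc_def)

lemma il_cyc_le: "x \<in> carrier M \<Longrightarrow> il A M {\<zero>[M]} (cyc A M x) \<le> mlen A (regular_module A)"
  using lhom.il_image_le[OF lhom_cyc, of x "carrier A"] left_module.sub_carrier[OF reg]
  by (simp add: cyc_def)

lemma mem_sum_cyc: "z \<in> N <+>[M] cyc A M x \<longleftrightarrow> (\<exists>n\<in>N. \<exists>a\<in>carrier A. z = n \<oplus>[M] a \<odot>[M] x)"
  unfolding mem_set_add cyc_def by blast

lemma smult_minus_l:
  assumes "a \<in> carrier A" "b \<in> carrier A" "x \<in> carrier M"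
  shows "(a \<ominus> b) \<odot>[M] x = a \<odot>[M] x \<ominus>[M] b \<odot>[M] x"
proof -
  have "((a \<ominus> b) \<oplus> b) \<odot>[M] x = (a \<ominus> b) \<odot>[M] x \<oplus>[M] b \<odot>[M] x" using assms by (simp add: smult_l_distr)
  moreover have "(a \<ominus> b) \<oplus> b = a" using assms by (simp add: a_minus_def A.a_assoc A.l_neg)
  ultimately show ?thesis using assms minus_add_cancel(3)[of "(a \<ominus> b) \<odot>[M] x" "b \<odot>[M] x"] by (simp add: smult_closed)
qed

lemma smult_minus_r:
  assumes "a \<in> carrier A" "y \<in> carrier M" "x \<in> carrier M"
  shows "a \<odot>[M] (x \<ominus>[M] y) = a \<odot>[M] x \<ominus>[M] a \<odot>[M] y"
proof -
  have "a \<odot>[M] ((x \<ominus>[M] y) \<oplus>[M] y) = a \<odot>[M] (x \<ominus>[M] y) \<oplus>[M] a \<odot>[M] y" using assms by (simp add: smult_r_distr)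
  then show ?thesis using assms minus_add_cancel(1)[of x y] minus_add_cancel(3)[of "a \<odot>[M] (x \<ominus>[M] y)" "a \<odot>[M] y"]
    by (simp add: smult_closed)
qed

subsection \<open>Finite generation and finite length\<close>

text \<open>Among the submodules generated up to containment by finitely many elements, take a
  maximal C. Adding one more element x to the finite set cannot enlarge C, so C contains every
  x.\<close>

lemma finite_length_imp_fg:
  assumes "mlen A M < \<infinity>" shows "finitely_generated A M"
proof -
  define P where "P C \<longleftrightarrow> (\<exists>X. finite X \<and> X \<subseteq> carrier M \<and> (\<forall>N. submodule N A M \<and> X \<subseteq> N \<longrightarrow> C \<subseteq> N))" for C
  have "P {\<zero>[M]}" unfolding P_def using sub_zero by (intro exI[of _ "{}"]) simp
  from exists_max_submodule[of P, OF this sub_0 assms]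
  obtain C where C': "submodule C A M \<and> {\<zero>[M]} \<subseteq> C \<and> P C \<and> (\<forall>D. submodule D A M \<longrightarrow> C \<subseteq> D \<longrightarrow> P D \<longrightarrow> D = C)" ..
  note C = C'[THEN conjunct1] C'[THEN conjunct2, THEN conjunct2, THEN conjunct1] C'[THEN conjunct2, THEN conjunct2, THEN conjunct2]
  obtain X where X': "finite X \<and> X \<subseteq> carrier M \<and> (\<forall>N. submodule N A M \<and> X \<subseteq> N \<longrightarrow> C \<subseteq> N)"
    using C(2) unfolding P_def ..
  then have X: "finite X" "X \<subseteq> carrier M" "\<And>N. submodule N A M \<Longrightarrow> X \<subseteq> N \<Longrightarrow> C \<subseteq> N" by simp_all
  have "x \<in> C" if x: "x \<in> carrier M" for x
  proof -
    let ?D = "C <+>[M] cyc A M x"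
    have "P ?D" unfolding P_def
    proof (intro exI[of _ "insert x X"] conjI allI impI)
      fix N assume N: "submodule N A M \<and> insert x X \<subseteq> N"
      then have "C \<subseteq> N" "cyc A M x \<subseteq> N" using X(3)[of N] cyc_least[of N x] by simp_all
      then show "?D \<subseteq> N" using N sum_least by simp
    qed (use X x in auto)
    then have "?D = C" using C(3) sub_sum[OF C(1) sub_cyc[OF x]] sum_upper(1)[OF C(1) sub_cyc[OF x]] by simp
    moreover have "x \<in> ?D" using sum_upper(2)[OF C(1) sub_cyc[OF x]] cyc_self[OF x] by blast
    ultimately show "x \<in> C" by simp
  qed
  then have "carrier M \<subseteq> C" by blast
  show ?thesis unfolding finitely_generated_def
  proof (intro exI[of _ X] conjI allI impI)
    fix N assume "submodule N A M \<and> X \<subseteq> N"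
    then show "N = carrier M" using X(3)[of N] \<open>carrier M \<subseteq> C\<close> sub_subset[of N] by blast
  qed (use X in auto)
qed

lemma il_sum_le:
  assumes "submodule C A M" "submodule D A M"
  shows "il A M {\<zero>[M]} (C <+>[M] D) \<le> il A M {\<zero>[M]} C + il A M {\<zero>[M]} D"
proof -
  have "il A M {\<zero>[M]} (C <+>[M] D) = il A M {\<zero>[M]} C + il A M C (C <+>[M] D)"
    using assms by (intro il_add) (auto simp: sub_0 sub_sum sub_zero sum_upper)
  also have "il A M C (C <+>[M] D) = il A M (D \<inter> C) D" using il_diamond[OF assms(2,1)] sum_comm[OF assms] by simp
  also have "\<dots> \<le> il A M {\<zero>[M]} D" using assms sub_zero by (intro il_mono) auto
  finally show ?thesis by (simp add: add_left_mono)
qed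

text \<open>Each cyclic submodule is an image of the regular module and lengths are subadditive, so
  the generators can be added one at a time.\<close>

lemma fg_imp_finite_length:
  assumes "finitely_generated A M" "mlen A (regular_module A) < \<infinity>" shows "mlen A M < \<infinity>"
proof -
  obtain X where X: "finite X" "X \<subseteq> carrier M" "\<And>N. submodule N A M \<Longrightarrow> X \<subseteq> N \<Longrightarrow> N = carrier M"
    using assms(1) by (auto simp: finitely_generated_def)
  have "\<exists>C. submodule C A M \<and> X \<subseteq> C \<and> il A M {\<zero>[M]} C < \<infinity>"
    using X(1,2)
  proof (induction X)
    case empty
    show ?case using sub_0 il_refl by (intro exI[of _ "{\<zero>[M]}"]) (simp add: zero_enat_def)
  next
    case (insert x X)
    then obtain C where C: "submodule C A M" "X \<subseteq> C" "il A M {\<zero>[M]} C < \<infinity>" by auto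
    have x: "x \<in> carrier M" using insert by simp
    have "il A M {\<zero>[M]} (cyc A M x) < \<infinity>" using il_cyc_le[OF x] assms(2) by (rule le_less_trans)
    then have "il A M {\<zero>[M]} C + il A M {\<zero>[M]} (cyc A M x) < \<infinity>" using C(3)
      by (simp add: enat_ord_code(4) plus_eq_infty_iff_enat less_le)
    then have "il A M {\<zero>[M]} (C <+>[M] cyc A M x) < \<infinity>"
      using il_sum_le[OF C(1) sub_cyc[OF x]] by (rule le_less_trans[rotated])
    moreover have "insert x X \<subseteq> C <+>[M] cyc A M x"
      using sum_upper[OF C(1) sub_cyc[OF x]] cyc_self[OF x] C(2) by blast
    ultimately show ?case using sub_sum[OF C(1) sub_cyc[OF x]] by blast
  qed
  then obtain C where C: "submodule C A M" "X \<subseteq> C" "il A M {\<zero>[M]} C < \<infinity>" by blast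
  then have "C = carrier M" using X(3) by simp
  then show ?thesis using C(3) by simp
qed

lemma exists_cocover:
  assumes "submodule X A M" "submodule N A M" "X \<subset> N" "mlen A M < \<infinity>"
  obtains C where "X \<subseteq> C" "covers A M C N"
proof -
  have "il A M X (carrier M) < \<infinity>"
  proof (rule le_less_trans[OF _ assms(4)])
    show "il A M X (carrier M) \<le> mlen A M" using sub_zero[OF assms(1)] by (intro il_mono) auto
  qed
  from exists_max_submodule[where P = "\<lambda>C. C \<subset> N", OF assms(3,1) this]
  obtain C where C': "submodule C A M \<and> X \<subseteq> C \<and> C \<subset> N \<and> (\<forall>D. submodule D A M \<longrightarrow> C \<subseteq> D \<longrightarrow> D \<subset> N \<longrightarrow> D = C)" ..
  note C = C'[THEN conjunct1] C'[THEN conjunct2, THEN conjunct1] C'[THEN conjunct2, THEN conjunct2, THEN conjunct1]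
    C'[THEN conjunct2, THEN conjunct2, THEN conjunct2]
  have "L = C \<or> L = N" if "submodule L A M" "C \<subseteq> L" "L \<subseteq> N" for L
    using C(4) that by blast
  then have "covers A M C N" using assms(2) C(1,3) unfolding covers_def by simp
  then show thesis using that C(2) by blast
qed

end

section \<open>The Jacobson radical\<close>

lemma (in left_module) covers_gen:
  assumes "covers A M X Y" "y \<in> Y" "y \<notin> X" "z \<in> Y"
  obtains x a where "x \<in> X" "a \<in> carrier A" "z = x \<oplus>[M] a \<odot>[M] y"
proof -
  have X: "submodule X A M" "submodule Y A M" "X \<subseteq> Y" using assms(1) by (auto simp: covers_def)
  have y: "y \<in> carrier M" using X assms sub_mem by blast
  let ?D = "X <+>[M] cyc A M y"
  have "X \<subseteq> ?D" "?D \<subseteq> Y" "submodule ?D A M" "y \<in> ?D"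
    using X sum_upper[OF X(1) sub_cyc[OF y]] sum_least[OF X(2)] cyc_least[OF X(2) assms(2)] cyc_self[OF y]
      sub_sum[OF X(1) sub_cyc[OF y]] by blast+
  then have "?D = Y" using assms(1,3) unfolding covers_def by blast
  then show thesis using assms(4) that mem_sum_cyc by blast
qed

lemma (in left_module) maximal_iff_covers: "maximal_submodule A M N \<longleftrightarrow> covers A M N (carrier M)"
proof (cases "submodule N A M")
  case True
  have "N \<subset> carrier M \<longleftrightarrow> N \<noteq> carrier M" using sub_subset[OF True] by (simp add: psubset_eq)
  moreover have "(submodule L A M \<and> N \<subseteq> L \<longrightarrow> Q) \<longleftrightarrow> (submodule L A M \<longrightarrow> N \<subseteq> L \<longrightarrow> L \<subseteq> carrier M \<longrightarrow> Q)" for L Q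
    using sub_subset[of L] by argo
  ultimately show ?thesis unfolding maximal_submodule_def covers_def using True sub_carrier by simp
qed (simp add: maximal_submodule_def covers_def)

lemma J_iff: "j \<in> jac A \<longleftrightarrow>
    j \<in> carrier A \<and> (\<forall>m. maximal_submodule A (regular_module A) m \<longrightarrow> j \<in> m)"
  by (auto simp: jacobson_radical_def module_rad_def)

lemma J_carrier: "j \<in> jac A \<Longrightarrow> j \<in> carrier A" by (simp add: J_iff)

context left_module begin

text \<open>This left ideal is the annihilator of y modulo X; the quotient of A by it is isomorphic
  to the simple module Y/X.\<close>

lemma covers_maximal:
  assumes c: "covers A M X Y" and y: "y \<in> Y" "y \<notin> X"
  shows "maximal_submodule A (regular_module A) {a \<in> carrier A. a \<odot>[M] y \<in> X}"
proof -
  interpret R: left_module A "regular_module A" by (rule reg)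
  have X: "submodule X A M" "submodule Y A M" using c by (auto simp: covers_def)
  have yM: "y \<in> carrier M" using X(2) y(1) by (rule sub_mem)
  define m where "m = {a \<in> carrier A. a \<odot>[M] y \<in> X}"
  have m: "submodule m A (regular_module A)"
    unfolding R.sub_iff m_def using X yM
    by (auto simp: smult_l_distr sub_add smult_assoc sub_smult smult_l_null sub_zero)
  have "maximal_submodule A (regular_module A) m"
    unfolding maximal_submodule_def
  proof (intro conjI allI impI m)
    have "\<one> \<notin> m" using y(2) yM by (simp add: m_def smult_one)
    then show "m \<noteq> carrier (regular_module A)" by auto
    fix L assume L: "submodule L A (regular_module A) \<and> m \<subseteq> L"
    show "L = m \<or> L = carrier (regular_module A)"
    proof (rule disjCI)
      assume "L \<noteq> carrier (regular_module A)"
      then have nc: "\<one> \<notin> L" using L R.sub_smult[of L _ \<one>] R.sub_subset[of L] by auto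
      have "a \<in> m" if a: "a \<in> L" for a
      proof (rule ccontr)
        assume "a \<notin> m"
        have aA: "a \<in> carrier A" using a L R.sub_mem by auto
        then have "a \<odot>[M] y \<in> Y" "a \<odot>[M] y \<notin> X" using X y \<open>a \<notin> m\<close> by (auto simp: m_def sub_smult)
        then obtain x b where b: "x \<in> X" "b \<in> carrier A" "y = x \<oplus>[M] b \<odot>[M] (a \<odot>[M] y)"
          using covers_gen[OF c _ _ y(1)] by blast
        \<comment> \<open>From y = x + b a y with x in X it follows that 1 - b a annihilates y
          modulo X, so it lies in m and hence in L. As b a is in L too, so is 1.\<close>
        have "(\<one> \<ominus> b \<otimes> a) \<odot>[M] y = y \<ominus>[M] b \<odot>[M] (a \<odot>[M] y)"
          using aA b yM by (simp add: smult_minus_l smult_one smult_assoc)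
        also have "\<dots> = x" using b(3) minus_add_cancel(3)[of x "b \<odot>[M] (a \<odot>[M] y)"] b aA yM X sub_mem
          by (simp add: smult_closed)
        finally have "\<one> \<ominus> b \<otimes> a \<in> L" using b(1) aA b(2) L by (auto simp: m_def)
        moreover have "b \<otimes> a \<in> L" using a b L R.sub_smult by auto
        ultimately have "(\<one> \<ominus> b \<otimes> a) \<oplus> b \<otimes> a \<in> L" using L R.sub_add by auto
        moreover have "(\<one> \<ominus> b \<otimes> a) \<oplus> b \<otimes> a = \<one>" using aA b(2) by (simp add: a_minus_def A.a_assoc A.l_neg)
        ultimately show False using nc by simp
      qed
      then show "L = m" using L by blast
    qed
  qed
  then show ?thesis by (simp add: m_def)
qed

text \<open>For y outside X the annihilator of y modulo X is a maximal left ideal, and it contains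
  J. Thus J annihilates every simple subquotient.\<close>

lemma J_covers:
  assumes c: "covers A M X Y" and y: "y \<in> Y" and j: "j \<in> jac A"
  shows "j \<odot>[M] y \<in> X"
proof (cases "y \<in> X")
  case True
  then show ?thesis using c j sub_smult by (auto simp: covers_def J_carrier)
next
  case False
  then have "j \<in> {a \<in> carrier A. a \<odot>[M] y \<in> X}" using covers_maximal[OF c y False] j unfolding J_iff by blast
  then show ?thesis by simp
qed

lemma sub_J: "submodule (jac A) A (regular_module A)"
proof -
  interpret R: left_module A "regular_module A" by (rule reg)
  show ?thesis unfolding R.sub_iff using R.sub_add R.sub_smult R.sub_zero
    by (auto simp: J_iff maximal_submodule_def)
qed

lemma J_zero: "\<zero> \<in> jac A"
  and J_add: "i \<in> jac A \<Longrightarrow> j \<in> jac A \<Longrightarrow> i \<oplus> j \<in> jac A"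
  and J_mult_l: "a \<in> carrier A \<Longrightarrow> j \<in> jac A \<Longrightarrow> a \<otimes> j \<in> jac A"
  using left_module.sub_zero[OF reg sub_J] left_module.sub_add[OF reg sub_J]
    left_module.sub_smult[OF reg sub_J] by simp_all

text \<open>This makes J two-sided: for a maximal left ideal m the simple module A/m is annihilated
  by J, so j a lies in m.\<close>

lemma J_mult_r: "j \<in> jac A \<Longrightarrow> a \<in> carrier A \<Longrightarrow> j \<otimes> a \<in> jac A"
proof -
  assume j: "j \<in> jac A" and a: "a \<in> carrier A"
  interpret R: left_module A "regular_module A" by (rule reg)
  show ?thesis
    using R.J_covers[of _ "carrier A" a j] j a R.maximal_iff_covers by (simp add: J_iff[of "j \<otimes> a"] J_carrier)
qed

end

text \<open>The submodule J N. Only sums of products are generated; closure under A follows since J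
  is a left ideal (\<open>sub_jmul\<close>).\<close>

inductive_set jmul :: "('a, 'z) ring_scheme \<Rightarrow> ('a, 'm, 'x) module_scheme \<Rightarrow> 'm set \<Rightarrow> 'm set"
  for A M N where
  zero: "\<zero>[M] \<in> jmul A M N"
| elem: "j \<in> jac A \<Longrightarrow> x \<in> N \<Longrightarrow> j \<odot>[M] x \<in> jmul A M N"
| add: "x \<in> jmul A M N \<Longrightarrow> y \<in> jmul A M N \<Longrightarrow> x \<oplus>[M] y \<in> jmul A M N"

definition jpow :: "('a, 'z) ring_scheme \<Rightarrow> ('a, 'm, 'x) module_scheme \<Rightarrow> nat \<Rightarrow> 'm set \<Rightarrow> 'm set" where
  "jpow A M k = (jmul A M ^^ k)"

context left_module begin

lemma jmul_least:
  assumes "submodule L A M" "\<And>j x. j \<in> jac A \<Longrightarrow> x \<in> N \<Longrightarrow> j \<odot>[M] x \<in> L"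
  shows "jmul A M N \<subseteq> L"
proof
  fix x assume "x \<in> jmul A M N"
  then show "x \<in> L" by induction (use assms in \<open>simp_all add: sub_zero sub_add\<close>)
qed

lemma sub_jmul:
  assumes "N \<subseteq> carrier M" shows "submodule (jmul A M N) A M"
proof -
  have c: "jmul A M N \<subseteq> carrier M"
    by (rule jmul_least[OF sub_carrier]) (use assms in \<open>auto intro: smult_closed J_carrier\<close>)
  have sm: "a \<odot>[M] x \<in> jmul A M N" if a: "a \<in> carrier A" and x: "x \<in> jmul A M N" for a x
    using x
  proof induction
    case zero
    then show ?case using a by (simp add: smult_r_null jmul.zero)
  next
    case (elem j x)
    then have "a \<odot>[M] (j \<odot>[M] x) = (a \<otimes> j) \<odot>[M] x" using a assms by (simp add: smult_assoc J_carrier subset_iff)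
    then show ?case using elem a J_mult_l jmul.elem by metis
  next
    case (add x y)
    then have "a \<odot>[M] (x \<oplus>[M] y) = a \<odot>[M] x \<oplus>[M] a \<odot>[M] y" using a c by (simp add: smult_r_distr subset_iff)
    then show ?case using add jmul.add by metis
  qed
  show ?thesis by (simp add: sub_iff c jmul.zero jmul.add sm)
qed

lemma jmul_subset: "submodule N A M \<Longrightarrow> jmul A M N \<subseteq> N"
  by (rule jmul_least) (auto intro: sub_smult J_carrier)

lemma jmul_mono: "N \<subseteq> L \<Longrightarrow> L \<subseteq> carrier M \<Longrightarrow> jmul A M N \<subseteq> jmul A M L"
  by (rule jmul_least[OF sub_jmul]) (blast intro: jmul.elem)+

lemma sub_jmul': "submodule N A M \<Longrightarrow> submodule (jmul A M N) A M"
  using sub_jmul sub_subset by blast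

lemma jmul_covers: "covers A M C N \<Longrightarrow> jmul A M N \<subseteq> C"
  by (rule jmul_least) (auto simp: covers_def intro: J_covers)

text \<open>A proper X lies in some C that is covered by N, and J N lies in C because N/C is simple.
  So X + J N stays inside C.\<close>

lemma nakayama_lemma:
  assumes "submodule X A M" "submodule N A M" "mlen A M < \<infinity>" "X \<subseteq> N" "N \<subseteq> X <+>[M] jmul A M N"
  shows "X = N"
proof (rule ccontr)
  assume "X \<noteq> N"
  then obtain C where C: "X \<subseteq> C" "covers A M C N" using exists_cocover[OF assms(1,2)] assms by blast
  then have "X <+>[M] jmul A M N \<subseteq> C" using jmul_covers sum_least[of C] by (auto simp: covers_def)
  then show False using assms C by (auto simp: covers_def)
qed

lemma jmul_proper:
  assumes "submodule N A M" "mlen A M < \<infinity>" "N \<noteq> {\<zero>[M]}"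
  shows "jmul A M N \<subset> N"
proof -
  have "jmul A M N \<noteq> N"
  proof
    assume eq: "jmul A M N = N"
    have "N \<subseteq> {\<zero>[M]} <+>[M] jmul A M N" using sum_upper(2)[OF sub_0 sub_jmul'[OF assms(1)]] eq by simp
    then show False using nakayama_lemma[OF sub_0 assms(1,2)] assms(1,3) sub_zero by auto
  qed
  then show ?thesis using jmul_subset[OF assms(1)] by blast
qed

lemma jpow_0: "jpow A M 0 N = N" and jpow_Suc: "jpow A M (Suc k) N = jmul A M (jpow A M k N)"
  and jpow_Suc': "jpow A M (Suc k) N = jpow A M k (jmul A M N)"
  by (simp_all add: jpow_def funpow_swap1)

lemma jmul_0: "jmul A M {\<zero>[M]} = {\<zero>[M]}"
  using jmul_subset[OF sub_0] jmul.zero by blast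

text \<open>By \<open>jmul_proper\<close>, multiplication by J lowers the length of a nonzero
  submodule by at least 1.\<close>

lemma jpow_zero_of_length:
  assumes "mlen A M < \<infinity>" "submodule N A M" "il A M {\<zero>[M]} N \<le> enat k"
  shows "jpow A M k N = {\<zero>[M]}"
  using assms(2,3)
proof (induction k arbitrary: N)
  case 0
  then show ?case using il_eq_0[OF sub_0, of N] sub_zero[of N] by (simp add: jpow_0 zero_enat_def[symmetric])
next
  case (Suc k)
  have s: "submodule (jmul A M N) A M" using sub_jmul' Suc.prems by blast
  show ?case
  proof (cases "N = {\<zero>[M]}")
    case True
    have "jpow A M i {\<zero>[M]} = {\<zero>[M]}" for i by (induction i) (simp_all add: jpow_0 jpow_Suc jmul_0)
    then show ?thesis using True by simp
  next
    case False
    have "il A M {\<zero>[M]} (jmul A M N) + 1 \<le> il A M {\<zero>[M]} N"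
      using jmul_proper[OF Suc.prems(1) assms(1) False] s Suc.prems sub_zero
      by (intro il_strict) (auto simp: sub_0)
    then have "il A M {\<zero>[M]} (jmul A M N) + 1 \<le> enat (Suc k)" using Suc.prems(2) by (rule order_trans)
    then have "il A M {\<zero>[M]} (jmul A M N) \<le> enat k"
      by (cases "il A M {\<zero>[M]} (jmul A M N)") (simp_all add: one_enat_def)
    then show ?thesis using Suc.IH[OF s] by (simp add: jpow_Suc')
  qed
qed

text \<open>Since J A lies in J, a sum of elements of J A x collapses to a single multiple j
  x.\<close>

lemma jmul_cyc:
  assumes x: "x \<in> carrier M" shows "jmul A M (cyc A M x) = (\<lambda>j. j \<odot>[M] x) ` jac A"
proof
  interpret c: lhom A "regular_module A" M "\<lambda>a. a \<odot>[M] x" by (rule lhom_cyc[OF x])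
  show "jmul A M (cyc A M x) \<subseteq> (\<lambda>j. j \<odot>[M] x) ` jac A"
  proof (rule jmul_least[OF c.sub_image[OF sub_J]])
    fix j y assume j: "j \<in> jac A" "y \<in> cyc A M x"
    then obtain a where a: "a \<in> carrier A" "y = a \<odot>[M] x" by (auto simp: cyc_def)
    then have "j \<odot>[M] y = (j \<otimes> a) \<odot>[M] x" using j x by (simp add: smult_assoc J_carrier)
    then show "j \<odot>[M] y \<in> (\<lambda>j. j \<odot>[M] x) ` jac A" using J_mult_r[OF j(1) a(1)] by blast
  qed
  show "(\<lambda>j. j \<odot>[M] x) ` jac A \<subseteq> jmul A M (cyc A M x)"
    by (intro image_subsetI jmul.elem cyc_self x)
qed

end

section \<open>Fitting's lemma\<close>

lemma indecomposable_alt: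
  "indecomposable A M \<longleftrightarrow> carrier M \<noteq> {\<zero>[M]} \<and>
    (\<forall>X Y. submodule X A M \<longrightarrow> submodule Y A M \<longrightarrow> X <+>[M] Y = carrier M \<longrightarrow> X \<inter> Y = {\<zero>[M]} \<longrightarrow>
        X = {\<zero>[M]} \<or> Y = {\<zero>[M]})"
  unfolding indecomposable_def is_direct_sum_def by (simp add: imp_conjL)

lemma indecomposableD:
  assumes "indecomposable A M" "submodule X A M" "submodule Y A M" "X <+>[M] Y = carrier M" "X \<inter> Y = {\<zero>[M]}"
  shows "X = {\<zero>[M]} \<or> Y = {\<zero>[M]}"
  using assms unfolding indecomposable_alt by simp

lemma comp_hom:
  assumes "f \<in> module_homs A M N" "g \<in> module_homs A N L"
  shows "(\<lambda>x. g (f x)) \<in> module_homs A M L"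
  using assms unfolding module_homs_def by (simp add: Pi_iff)

context left_module begin

lemma id_hom: "(\<lambda>x. x) \<in> module_homs A M M" by (simp add: module_homs_def)

lemma funpow_hom: "f \<in> module_homs A M M \<Longrightarrow> f ^^ n \<in> module_homs A M M"
proof (induction n)
  case 0
  then show ?case using id_hom by (simp add: id_def)
next
  case (Suc n)
  then show ?case using comp_hom[of "f ^^ n" A M M f M] by (simp add: comp_def)
qed

lemma hom_lhom: "left_module A N \<Longrightarrow> f \<in> module_homs A M N \<Longrightarrow> lhom A M N f"
  by (intro lhom.intro lhom_axioms.intro left_module_axioms)

lemma inj_endo_surj:
  assumes "f \<in> module_homs A M M" "mlen A M < \<infinity>" "inj_on f (carrier M)"
  shows "f ` carrier M = carrier M"
proof (rule ccontr)
  interpret f: lhom A M M f using assms by (intro hom_lhom left_module_axioms)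
  assume "f ` carrier M \<noteq> carrier M"
  then have "f ` carrier M \<subset> carrier M" using f.closed by blast
  then have "il A M {\<zero>[M]} (f ` carrier M) + 1 \<le> mlen A M"
    using f.sub_image[OF sub_carrier] sub_zero by (intro il_strict) (auto simp: sub_0 sub_carrier)
  then show False using f.il_inj[OF sub_carrier assms(3)] assms(2) by (cases "mlen A M") (simp_all add: one_enat_def)
qed

text \<open>For a suitable n the image X of f^n satisfies f^n X = X. Then M is the direct sum of X
  and the kernel of f^n, and indecomposability makes one of them zero.\<close>

lemma fitting:
  assumes "f \<in> module_homs A M M" "mlen A M < \<infinity>" "indecomposable A M"
  obtains n where "\<And>x. x \<in> carrier M \<Longrightarrow> (f ^^ n) x = \<zero>[M]"
  | "inj_on f (carrier M)" "f ` carrier M = carrier M"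
proof -
  interpret f: lhom A M M f using assms by (intro hom_lhom left_module_axioms)
  have h: "lhom A M M (f ^^ n)" for n using hom_lhom[OF left_module_axioms funpow_hom[OF assms(1)]] .
  define l where "l n = the_enat (il A M {\<zero>[M]} ((f ^^ n) ` carrier M))" for n
  have fin: "il A M {\<zero>[M]} Z < \<infinity>" if "Z \<subseteq> carrier M" for Z
    using il_mono[OF subset_refl that, of "{\<zero>[M]}"] assms(2) by (rule le_less_trans)
  have finI: "il A M {\<zero>[M]} ((f ^^ k) ` carrier M) < \<infinity>" for k
    by (rule fin) (simp add: image_subset_iff lhom.closed[OF h])
  define m where "m = (ARG_MIN l n. True)"
  have minm: "l m \<le> l k" for k unfolding m_def by (rule arg_min_nat_le) simp
  \<comment> \<open>The successor keeps the minimal length. A positive exponent makes the kernel of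
    f part of the kernel of f^n, also when the minimum is attained at 0.\<close>
  define n where "n = Suc m"
  have "l n \<le> l m"
  proof -
    interpret h: lhom A M M "f ^^ m" by (rule h)
    have "(f ^^ n) ` carrier M = f ` (f ^^ m) ` carrier M" by (simp add: n_def image_comp)
    then have "il A M {\<zero>[M]} ((f ^^ n) ` carrier M) \<le> il A M {\<zero>[M]} ((f ^^ m) ` carrier M)"
      using f.il_image_le[OF h.sub_image[OF sub_carrier]] by simp
    then show ?thesis using finI[of m] unfolding l_def
      by (cases "il A M {\<zero>[M]} ((f ^^ m) ` carrier M)"; cases "il A M {\<zero>[M]} ((f ^^ n) ` carrier M)") simp_all
  qed
  then have min: "l n \<le> l k" for k using minm[of k] by simp
  interpret g: lhom A M M "f ^^ n" by (rule h)
  interpret g2: lhom A M M "f ^^ (n + n)" by (rule h)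
  let ?X = "(f ^^ n) ` carrier M"
  have X: "submodule ?X A M" by (rule g.sub_image[OF sub_carrier])
  have gX: "(f ^^ n) ` ?X = (f ^^ (n + n)) ` carrier M" by (simp add: funpow_add image_comp)
  have eq: "il A M {\<zero>[M]} ((f ^^ (n + n)) ` carrier M) = il A M {\<zero>[M]} ?X"
  proof (rule antisym)
    have s: "(f ^^ (n + n)) ` carrier M \<subseteq> ?X" using gX g.closed by blast
    show "il A M {\<zero>[M]} ((f ^^ (n + n)) ` carrier M) \<le> il A M {\<zero>[M]} ?X" by (rule il_mono[OF subset_refl s])
    have "il A M {\<zero>[M]} ((f ^^ (n + n)) ` carrier M) < \<infinity>" "il A M {\<zero>[M]} ?X < \<infinity>"
      by (rule finI)+
    then show "il A M {\<zero>[M]} ?X \<le> il A M {\<zero>[M]} ((f ^^ (n + n)) ` carrier M)"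
      using min[of "n + n"] unfolding l_def
      by (cases "il A M {\<zero>[M]} ?X"; cases "il A M {\<zero>[M]} ((f ^^ (n + n)) ` carrier M)") simp_all
  qed
  have sub: "(f ^^ n) ` ?X \<subseteq> ?X" using gX g.closed by blast
  have fX: "(f ^^ n) ` ?X = ?X"
  proof (rule ccontr)
    assume "(f ^^ n) ` ?X \<noteq> ?X"
    then have "il A M {\<zero>[M]} ((f ^^ n) ` ?X) + 1 \<le> il A M {\<zero>[M]} ?X"
      using sub g.sub_image[OF X] X sub_zero by (intro il_strict) (auto simp: sub_0)
    moreover have "il A M {\<zero>[M]} ?X < \<infinity>" by (rule finI)
    ultimately show False using eq gX by (cases "il A M {\<zero>[M]} ?X") (simp_all add: one_enat_def)
  qed
  have K: "submodule g.ker A M" by (rule g.sub_ker)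
  have sum: "?X <+>[M] g.ker = carrier M"
  proof
    show "?X <+>[M] g.ker \<subseteq> carrier M" using X K by (intro sum_least[OF sub_carrier] sub_subset)
    show "carrier M \<subseteq> ?X <+>[M] g.ker"
    proof
      fix y assume y: "y \<in> carrier M"
      then have "(f ^^ n) y \<in> (f ^^ n) ` ?X" using fX by simp
      then obtain z where z: "z \<in> ?X" "(f ^^ n) y = (f ^^ n) z" by auto
      have zM: "z \<in> carrier M" using z(1) X sub_mem by blast
      have "(f ^^ n) (y \<ominus>[M] z) = \<zero>[M]" using y zM z(2) by (simp add: g.minus g.closed minus_eq_0)
      then have "y \<ominus>[M] z \<in> g.ker" using y zM by (simp add: g.ker_iff)
      moreover have "y = z \<oplus>[M] (y \<ominus>[M] z)" using y zM by (simp add: minus_add_cancel)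
      ultimately show "y \<in> ?X <+>[M] g.ker" unfolding mem_set_add using z(1) by blast
    qed
  qed
  have int: "?X \<inter> g.ker = {\<zero>[M]}"
  proof -
    have "il A M {\<zero>[M]} ?X = il A M {\<zero>[M]} (g.ker \<inter> ?X) + il A M {\<zero>[M]} ?X"
      using g.il_ker_image[OF X] fX by simp
    moreover have "il A M {\<zero>[M]} ?X < \<infinity>" by (rule finI)
    ultimately have "il A M {\<zero>[M]} (g.ker \<inter> ?X) = 0"
      by (cases "il A M {\<zero>[M]} ?X"; cases "il A M {\<zero>[M]} (g.ker \<inter> ?X)") (simp_all add: zero_enat_def)
    moreover have "{\<zero>[M]} \<subseteq> g.ker \<inter> ?X" using sub_zero[OF sub_Int[OF K X]] by simp
    ultimately show ?thesis using il_eq_0[OF sub_0 sub_Int[OF K X]] by (simp add: Int_commute)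
  qed
  have "?X = {\<zero>[M]} \<or> g.ker = {\<zero>[M]}" using indecomposableD[OF assms(3) X K sum int] .
  then show thesis
  proof
    assume "?X = {\<zero>[M]}"
    then show thesis using that(1)[of n] by blast
  next
    assume k: "g.ker = {\<zero>[M]}"
      have "f.ker = {\<zero>[M]}"
      proof -
        have "x = \<zero>[M]" if "x \<in> f.ker" for x
        proof -
          have x: "x \<in> carrier M" "f x = \<zero>[M]" using that by (simp_all add: f.ker_iff)
          have "(f ^^ n) x = (f ^^ m) (f x)" by (simp add: n_def funpow_swap1)
          also have "\<dots> = \<zero>[M]" using x(2) lhom.zero[OF h] by simp
          finally have "x \<in> g.ker" using x(1) by (simp add: g.ker_iff)
          then show ?thesis using k by simp
        qed
        then show ?thesis using sub_zero[OF f.sub_ker] by blast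
      qed
      then have "inj_on f (carrier M)" by (simp add: f.inj_iff)
      then show thesis using that(2) inj_endo_surj[OF assms(1,2)] by blast
  qed
qed

end

section \<open>Primitive idempotents\<close>

definition prim :: "('a, 'z) ring_scheme \<Rightarrow> 'a \<Rightarrow> bool" where
  "prim A e \<longleftrightarrow> e \<in> carrier A \<and> e \<noteq> \<zero>[A] \<and> e \<otimes>[A] e = e \<and>
     (\<forall>g\<in>carrier A. g \<otimes>[A] g = g \<longrightarrow> e \<otimes>[A] g = g \<longrightarrow> g \<otimes>[A] e = g \<longrightarrow> g = \<zero>[A] \<or> g = e)"

lemma primD: "prim A e \<Longrightarrow> e \<in> carrier A" "prim A e \<Longrightarrow> e \<noteq> \<zero>[A]" "prim A e \<Longrightarrow> e \<otimes>[A] e = e"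
  by (simp_all add: prim_def)

abbreviation pim :: "('a, 'z) ring_scheme \<Rightarrow> 'a \<Rightarrow> ('a, 'a) module" where
  "pim A e \<equiv> sub_module (regular_module A) (cyc A (regular_module A) e)"

lemma cyc_regular: "cyc A (regular_module A) e = (\<lambda>a. a \<otimes>[A] e) ` carrier A"
  by (simp add: cyc_def)

context ring begin

lemma cyc_idem:
  assumes "e \<in> carrier R" "e \<otimes> e = e"
  shows "x \<in> cyc R (regular_module R) e \<longleftrightarrow> x \<in> carrier R \<and> x \<otimes> e = x"
proof
  assume "x \<in> cyc R (regular_module R) e"
  then obtain a where "a \<in> carrier R" "x = a \<otimes> e" by (auto simp: cyc_regular)
  then show "x \<in> carrier R \<and> x \<otimes> e = x" using assms by (simp add: m_assoc)
next
  assume x: "x \<in> carrier R \<and> x \<otimes> e = x"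
  then have "x \<in> (\<lambda>a. a \<otimes> e) ` carrier R" by (intro image_eqI[of _ _ x]) simp_all
  then show "x \<in> cyc R (regular_module R) e" by (simp add: cyc_regular)
qed

lemma sub_cyc_reg: "e \<in> carrier R \<Longrightarrow> submodule (cyc R (regular_module R) e) R (regular_module R)"
  using left_module.sub_cyc[OF left_module_regular] by simp

lemma left_module_pim: "e \<in> carrier R \<Longrightarrow> left_module R (pim R e)"
  by (rule left_module.left_module_sub[OF left_module_regular sub_cyc_reg])

lemma mlen_pim_le: "e \<in> carrier R \<Longrightarrow> mlen R (pim R e) \<le> mlen R (regular_module R)"
proof -
  assume e: "e \<in> carrier R"
  interpret R: left_module R "regular_module R" by (rule left_module_regular)
  have "cyc R (regular_module R) e \<subseteq> carrier (regular_module R)" using R.sub_subset[OF sub_cyc_reg[OF e]] .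
  then show ?thesis using R.il_sub[OF sub_cyc_reg[OF e] subset_refl] R.il_mono[of "{\<zero>}" "{\<zero>}"] by simp
qed

lemma idem_minus:
  assumes "e \<in> carrier R" "e \<otimes> e = e" "g \<in> carrier R" "g \<otimes> g = g" "e \<otimes> g = g" "g \<otimes> e = g"
  shows "(e \<ominus> g) \<otimes> (e \<ominus> g) = e \<ominus> g" "e \<otimes> (e \<ominus> g) = e \<ominus> g" "(e \<ominus> g) \<otimes> e = e \<ominus> g" "g \<oplus> (e \<ominus> g) = e"
  "(e \<ominus> g) \<otimes> g = \<zero>" "g \<otimes> (e \<ominus> g) = \<zero>"
proof -
  show 1: "e \<otimes> (e \<ominus> g) = e \<ominus> g" "(e \<ominus> g) \<otimes> e = e \<ominus> g" "(e \<ominus> g) \<otimes> g = \<zero>" "g \<otimes> (e \<ominus> g) = \<zero>"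
    using assms by (simp_all add: a_minus_def l_distr r_distr l_minus r_minus r_neg)
  show "(e \<ominus> g) \<otimes> (e \<ominus> g) = e \<ominus> g" using 1 assms
    by (simp add: a_minus_def l_distr l_minus)
  show "g \<oplus> (e \<ominus> g) = e" using assms by (simp add: a_minus_def a_ac r_neg)
qed

text \<open>An induction form of the decomposition of 1 into primitive idempotents. An idempotent
  that is neither 0 nor primitive splits as g + (e - g), and both A g and A (e - g) are shorter than
  A e.\<close>

lemma prim_induct:
  assumes fin: "mlen R (regular_module R) < \<infinity>" and "\<zero> \<in> H" "\<And>e. prim R e \<Longrightarrow> e \<in> H"
    and add: "\<And>a b. a \<in> H \<Longrightarrow> b \<in> H \<Longrightarrow> a \<oplus> b \<in> H"
  shows "\<one> \<in> H"
proof -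
  interpret R: left_module R "regular_module R" by (rule left_module_regular)
  let ?l = "\<lambda>e. il R (regular_module R) {\<zero>} (cyc R (regular_module R) e)"
  have fin': "?l e < \<infinity>" if "e \<in> carrier R" for e
    using le_less_trans[OF R.il_cyc_le[of e] fin] that by simp
  have lt: "the_enat (?l g) < the_enat (?l e)"
    if "e \<in> carrier R" "e \<otimes> e = e" "g \<in> carrier R" "g \<otimes> g = g" "e \<otimes> g = g" "g \<otimes> e = g" "g \<noteq> e" for e g
  proof -
    have "cyc R (regular_module R) g \<subseteq> cyc R (regular_module R) e"
      using R.cyc_least[of "cyc R (regular_module R) e" g] that sub_cyc_reg cyc_idem by simp
    moreover have "e \<notin> cyc R (regular_module R) g" using that by (simp add: cyc_idem)
    moreover have "e \<in> cyc R (regular_module R) e" using that by (simp add: cyc_idem)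
    ultimately have "cyc R (regular_module R) g \<subset> cyc R (regular_module R) e" by blast
    then have "?l g + 1 \<le> ?l e"
      using R.il_strict[of "{\<zero>}"] R.sub_0 sub_cyc_reg that R.sub_zero[OF sub_cyc_reg[of g]] by simp
    then show ?thesis using fin'[OF that(1)] by (intro the_enat_less[of _ _ "?l e"]) auto
  qed
  have "e \<in> H" if "e \<in> carrier R" "e \<otimes> e = e" for e
    using that
  proof (induction "the_enat (?l e)" arbitrary: e rule: less_induct)
    case less
    show ?case
    proof (cases "e = \<zero> \<or> prim R e")
      case True
      then show ?thesis using assms by blast
    next
      case False
      then obtain g where g: "g \<in> carrier R" "g \<otimes> g = g" "e \<otimes> g = g" "g \<otimes> e = g" "g \<noteq> \<zero>" "g \<noteq> e"
        using less.prems unfolding prim_def by blast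
      note i = idem_minus[OF less.prems g(1-4)]
      have "e \<ominus> g \<noteq> e"
      proof
        assume "e \<ominus> g = e"
        then have "g \<otimes> e = \<zero>" using i(6) by simp
        then show False using g by simp
      qed
      then have "g \<in> H" "e \<ominus> g \<in> H" using less.hyps[OF lt[of e g]] less.hyps[OF lt[of e "e \<ominus> g"]] less.prems g i by simp_all
      then show ?thesis using add i(4) by metis
    qed
  qed
  then show ?thesis by simp
qed

text \<open>The components x and y of e in a decomposition of A e are orthogonal idempotents of e A
  e. So x is 0 or e, and the summand that contains e is everything.\<close>

lemma prim_indecomposable:
  assumes e: "prim R e"
  shows "indecomposable R (pim R e)"
proof -
  interpret R: left_module R "regular_module R" by (rule left_module_regular)
  have e': "e \<in> carrier R" "e \<otimes> e = e" "e \<noteq> \<zero>" using e by (simp_all add: primD)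
  let ?P = "cyc R (regular_module R) e"
  have P: "submodule ?P R (regular_module R)" by (rule sub_cyc_reg[OF e'(1)])
  have eP: "e \<in> ?P" using e' by (simp add: cyc_idem)
  interpret P: left_module R "pim R e" by (rule left_module_pim[OF e'(1)])
  show ?thesis
    unfolding indecomposable_alt
  proof (intro conjI allI impI)
    show "carrier (pim R e) \<noteq> {\<zero>[pim R e]}" using eP e' by auto
    fix X Y assume X: "submodule X R (pim R e)" and Y: "submodule Y R (pim R e)"
      and s: "X <+>[pim R e] Y = carrier (pim R e)" and i: "X \<inter> Y = {\<zero>[pim R e]}"
    have X': "submodule X R (regular_module R)" "X \<subseteq> ?P" and Y': "submodule Y R (regular_module R)" "Y \<subseteq> ?P"
      using X Y R.sub_sub_iff[OF P] by blast+
    have "e \<in> X <+>[pim R e] Y" using s eP by simp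
    then obtain x y where xy: "x \<in> X" "y \<in> Y" "e = x \<oplus> y" unfolding P.mem_set_add by auto
    have c: "x \<in> carrier R" "y \<in> carrier R" "x \<otimes> e = x" "y \<otimes> e = y"
      using xy X' Y' cyc_idem[OF e'(1,2)] by blast+
    have mX: "a \<otimes> z \<in> X" if "a \<in> carrier R" "z \<in> X" for a z using R.sub_smult[OF X'(1)] that by simp
    have mY: "a \<otimes> z \<in> Y" if "a \<in> carrier R" "z \<in> Y" for a z using R.sub_smult[OF Y'(1)] that by simp
    \<comment> \<open>Here a = a a + a b, so a b is a difference of elements of Z, while it also
      lies in W.\<close>
    have key: "a \<otimes> b = \<zero> \<and> a \<otimes> a = a" if "a \<in> carrier R" "b \<in> carrier R" "e = a \<oplus> b" "a \<otimes> e = a" "a \<in> Z" "b \<in> W"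
      "Z \<inter> W = {\<zero>}" "submodule Z R (regular_module R)" "submodule W R (regular_module R)" for a b Z W
    proof -
      have 1: "a = a \<otimes> a \<oplus> a \<otimes> b" using that(1-4) r_distr by metis
      have Z: "a \<otimes> a \<in> Z" and W: "a \<otimes> b \<in> W" using R.sub_smult[OF that(8), of a a] R.sub_smult[OF that(9), of a b] that by simp_all
      have "a \<otimes> a \<oplus> a \<otimes> b \<in> Z" using 1 that(5) by simp
      then have "a \<otimes> b \<in> Z" using R.sub_add_cancel(2)[OF that(8) Z, of "a \<otimes> b"] that by simp
      then have "a \<otimes> b = \<zero>" using W that(7) by blast
      then show ?thesis using 1 that by simp
    qed
    have i': "X \<inter> Y = {\<zero>}" "Y \<inter> X = {\<zero>}" using i by auto
    have kx: "x \<otimes> y = \<zero>" "x \<otimes> x = x" using key[OF c(1,2) xy(3) c(3) xy(1,2) i'(1) X'(1) Y'(1)] by simp_all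
    have "e = y \<oplus> x" using xy(3) c by (simp add: a_comm)
    then have ky: "y \<otimes> x = \<zero>" "y \<otimes> y = y" using key[OF c(2,1) _ c(4) xy(2,1) i'(2) Y'(1) X'(1)] by simp_all
    have "e \<otimes> x = x" using xy(3) c kx ky by (simp add: l_distr)
    then have "x = \<zero> \<or> x = e" using e c kx by (simp add: prim_def)
    then show "X = {\<zero>[pim R e]} \<or> Y = {\<zero>[pim R e]}"
    proof
      assume "x = \<zero>"
      then have "e \<in> Y" using xy c by simp
      then have "?P \<subseteq> Y" using R.cyc_least[OF Y'(1)] by simp
      then show ?thesis using X'(2) i' by auto
    next
      assume "x = e"
      then have "?P \<subseteq> X" using R.cyc_least[OF X'(1)] xy by simp
      then show ?thesis using Y'(2) i' by auto
    qed
  qed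
qed

lemma rmult_hom:
  assumes "e \<in> carrier R" "e \<otimes> e = e" "a \<in> carrier R" "a \<otimes> e = a"
  shows "(\<lambda>x. x \<otimes> a) \<in> module_homs R (pim R e) (pim R e)"
proof -
  have "x \<in> carrier R" if "x \<in> cyc R (regular_module R) e" for x using that assms by (simp add: cyc_idem)
  then show ?thesis using assms unfolding module_homs_def
    by (auto simp: cyc_idem m_assoc l_distr)
qed

text \<open>Choose a maximal left ideal m without a and write e = c + b a with c in m. Cut down by
  e, the two summands become endomorphisms \<gamma> and \<alpha> of A e with sum the identity. By
  Fitting's lemma \<alpha> is bijective, which gives a left multiple of a equal to e, or nilpotent.
  In the latter case \<gamma> is injective, hence bijective, which puts e and then a = a e into
  m.\<close>

lemma prim_local:
  assumes fin: "mlen R (regular_module R) < \<infinity>" and e: "prim R e"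
    and a: "a \<in> carrier R" "a \<otimes> e = a" "a \<notin> jac R"
  obtains b where "b \<in> carrier R" "b \<otimes> a = e"
proof -
  interpret R: left_module R "regular_module R" by (rule left_module_regular)
  have e': "e \<in> carrier R" "e \<otimes> e = e" "e \<noteq> \<zero>" using e by (simp_all add: primD)
  interpret P: left_module R "pim R e" by (rule left_module_pim[OF e'(1)])
  have finP: "mlen R (pim R e) < \<infinity>" using mlen_pim_le[OF e'(1)] fin by (rule le_less_trans)
  have eP: "e \<in> carrier (pim R e)" using e' by (simp add: cyc_idem)
  obtain m where m: "maximal_submodule R (regular_module R) m" "a \<notin> m" using a by (auto simp: J_iff)
  have sm: "submodule m R (regular_module R)" using m by (simp add: maximal_submodule_def)
  have cov: "covers R (regular_module R) m (carrier R)" using m R.maximal_iff_covers by simp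
  obtain c b where cb: "c \<in> m" "b \<in> carrier R" "e = c \<oplus> b \<otimes> a"
    using R.covers_gen[OF cov a(1) m(2) e'(1)] by auto
  have c: "c \<in> carrier R" using R.sub_mem[OF sm cb(1)] by simp
  define \<alpha> where "\<alpha> = e \<otimes> (b \<otimes> a)"
  define \<gamma> where "\<gamma> = e \<otimes> c"
  have "e \<otimes> \<alpha> = (e \<otimes> e) \<otimes> (b \<otimes> a)" using e'(1) cb(2) a(1) unfolding \<alpha>_def by (simp only: m_assoc m_closed)
  then have \<alpha>: "\<alpha> \<in> carrier R" "\<alpha> \<otimes> e = \<alpha>" "e \<otimes> \<alpha> = \<alpha>" using e'(1,2) cb(2) a(1,2) by (simp_all add: \<alpha>_def m_assoc)
  have sum: "e = \<gamma> \<oplus> \<alpha>"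
  proof -
    have "e = e \<otimes> (c \<oplus> b \<otimes> a)" using e' cb(3) by simp
    then show ?thesis using e' c cb a by (simp add: r_distr \<alpha>_def \<gamma>_def)
  qed
  have gm: "\<gamma> \<in> m" using R.sub_smult[OF sm e'(1) cb(1)] by (simp add: \<gamma>_def)
  have g: "\<gamma> \<in> carrier R" using e' c by (simp add: \<gamma>_def)
  have ge: "\<gamma> = e \<ominus> \<alpha>" using sum g \<alpha> by (simp add: a_minus_def a_assoc r_neg)
  have g2: "\<gamma> \<otimes> e = \<gamma>" using ge \<alpha> e' by (simp add: a_minus_def l_distr l_minus)
  have P: "x \<in> carrier R" "x \<otimes> e = x" if "x \<in> carrier (pim R e)" for x using that e' cyc_idem by simp_all
  show thesis
  proof (rule P.fitting[OF rmult_hom[OF e'(1,2) \<alpha>(1,2)] finP prim_indecomposable[OF e]])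
    assume "(\<lambda>x. x \<otimes> \<alpha>) ` carrier (pim R e) = carrier (pim R e)"
    then obtain x where x: "x \<in> carrier (pim R e)" "e = x \<otimes> \<alpha>" using eP by blast
    have "(x \<otimes> e \<otimes> b) \<otimes> a = x \<otimes> \<alpha>" using P(1)[OF x(1)] e'(1) cb(2) a(1) by (simp add: \<alpha>_def m_assoc)
    then have "(x \<otimes> e \<otimes> b) \<otimes> a = e" using x(2) by simp
    then show thesis using that[of "x \<otimes> e \<otimes> b"] P(1)[OF x(1)] e'(1) cb(2) by simp
  next
    fix n assume n: "\<And>x. x \<in> carrier (pim R e) \<Longrightarrow> ((\<lambda>x. x \<otimes> \<alpha>) ^^ n) x = \<zero>[pim R e]"
    interpret \<gamma>: lhom R "pim R e" "pim R e" "\<lambda>x. x \<otimes> \<gamma>"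
      by (rule P.hom_lhom[OF P.left_module_axioms rmult_hom[OF e'(1,2) g g2]])
    have "\<gamma>.ker = {\<zero>[pim R e]}"
    proof -
      have "x = \<zero>" if x: "x \<in> \<gamma>.ker" for x
      proof -
        have x': "x \<in> carrier (pim R e)" "x \<otimes> \<gamma> = \<zero>" using x by (simp_all add: \<gamma>.ker_iff)
        have "x \<otimes> e = x \<otimes> \<gamma> \<oplus> x \<otimes> \<alpha>" using sum P[OF x'(1)] g \<alpha> r_distr by metis
        then have xx: "x = x \<otimes> \<alpha>" using P[OF x'(1)] x' \<alpha> by simp
        have "((\<lambda>x. x \<otimes> \<alpha>) ^^ k) x = x" for k by (induction k) (simp_all add: xx[symmetric])
        then show ?thesis using n[OF x'(1)] by simp
      qed
      moreover have "\<zero> \<in> \<gamma>.ker" using P.sub_zero[OF \<gamma>.sub_ker] by simp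
      ultimately have "\<gamma>.ker = {\<zero>}" by blast
      then show ?thesis by simp
    qed
    then have "(\<lambda>x. x \<otimes> \<gamma>) ` carrier (pim R e) = carrier (pim R e)"
      using P.inj_endo_surj[OF \<gamma>.hom finP] \<gamma>.inj_iff by simp
    then obtain x where x: "x \<in> carrier (pim R e)" "e = x \<otimes> \<gamma>" using eP by blast
    have "x \<otimes> \<gamma> \<in> m" using R.sub_smult[OF sm, of x \<gamma>] gm P(1)[OF x(1)] by simp
    then have "e \<in> m" using x(2) by simp
    then have "a \<in> m" using R.sub_smult[OF sm, of a e] a by simp
    then show thesis using m by simp
  qed
qed

end

section \<open>The opposite ring\<close>

lemma opposite_simps [simp]: "carrier (opposite A) = carrier A" "\<zero>[opposite A] = \<zero>[A]" "\<one>[opposite A] = \<one>[A]"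
  "x \<oplus>[opposite A] y = x \<oplus>[A] y" "x \<otimes>[opposite A] y = y \<otimes>[A] x"
  by (simp_all add: opposite_def)

lemma opposite_opposite [simp]: "opposite (opposite A) = A"
  by (cases A) (simp add: opposite_def)

lemma (in ring) ring_opposite: "ring (opposite R)"
proof (rule ringI)
  show "abelian_group (opposite R)"
  proof (rule abelian_groupI)
    fix x assume "x \<in> carrier (opposite R)"
    then show "\<exists>y\<in>carrier (opposite R). y \<oplus>[opposite R] x = \<zero>[opposite R]"
      by (intro bexI[of _ "\<ominus> x"]) (auto simp: l_neg)
  qed (auto simp: a_ac)
  show "monoid (opposite R)" by (rule monoidI) (auto simp: m_assoc)
qed (auto simp: l_distr r_distr)

lemma prim_opposite [simp]: "prim (opposite A) e \<longleftrightarrow> prim A e"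
  unfolding prim_def by auto

text \<open>If k lies outside a maximal left ideal m, then 1 = n + t with n in m and t = a k. The
  radical of the opposite ring is nilpotent, so right multiplication by t is nilpotent and that by n
  = 1 - t is injective, hence surjective by finite length. Then 1 = x n lies in m.\<close>

lemma (in ring) J_opposite_le:
  assumes fin: "mlen R (regular_module R) < \<infinity>" and fin': "mlen (opposite R) (regular_module (opposite R)) < \<infinity>"
  shows "jac (opposite R) \<subseteq> jac R"
proof
  fix k assume k: "k \<in> jac (opposite R)"
  interpret O: ring "opposite R" by (rule ring_opposite)
  interpret L: left_module R "regular_module R" by (rule left_module_regular)
  interpret P: left_module "opposite R" "regular_module (opposite R)" by (rule O.left_module_regular)
  have kc: "k \<in> carrier R" using k J_carrier by fastforce
  show "k \<in> jac R"
    unfolding J_iff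
  proof (intro conjI allI impI kc)
    fix m assume m: "maximal_submodule R (regular_module R) m"
    have sm: "submodule m R (regular_module R)" using m by (simp add: maximal_submodule_def)
    show "k \<in> m"
    proof (rule ccontr)
      assume "k \<notin> m"
      then obtain n a where na: "n \<in> m" "a \<in> carrier R" "\<one> = n \<oplus> a \<otimes> k"
        using L.covers_gen[of m "carrier R" k \<one>] m kc L.maximal_iff_covers by auto
      have n: "n \<in> carrier R" using L.sub_mem[OF sm na(1)] by simp
      define t where "t = a \<otimes> k"
      have t: "t \<in> jac (opposite R)" using P.J_mult_r[OF k, of a] na(2) by (simp add: t_def)
      have tc: "t \<in> carrier R" using na kc by (simp add: t_def)
      obtain N where N: "mlen (opposite R) (regular_module (opposite R)) = enat N" using fin' by (cases "mlen (opposite R) (regular_module (opposite R))") auto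
      have j0: "jpow (opposite R) (regular_module (opposite R)) N (carrier R) = {\<zero>}"
        using P.jpow_zero_of_length[OF fin' P.sub_carrier, of N] N by simp
      have "((\<lambda>x. x \<otimes> t) ^^ i) x \<in> jpow (opposite R) (regular_module (opposite R)) i (carrier R)" if "x \<in> carrier R" for x i
      proof (induction i)
        case 0
        then show ?case using that by (simp add: jpow_def)
      next
        case (Suc i)
        then show ?case using jmul.elem[where M = "regular_module (opposite R)", OF t Suc] by (simp add: jpow_def)
      qed
      then have nil: "((\<lambda>x. x \<otimes> t) ^^ N) x = \<zero>" if "x \<in> carrier R" for x using that j0 by blast
      have "(\<lambda>x. x \<otimes> n) \<in> module_homs R (regular_module R) (regular_module R)"
        using n by (simp add: module_homs_def l_distr m_assoc)
      then interpret g: lhom R "regular_module R" "regular_module R" "\<lambda>x. x \<otimes> n"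
        by (rule L.hom_lhom[OF left_module_regular])
      have "x = \<zero>" if x: "x \<in> g.ker" for x
      proof -
        have x': "x \<in> carrier R" "x \<otimes> n = \<zero>" using x by (simp_all add: g.ker_iff)
        have "x \<otimes> \<one> = x \<otimes> n \<oplus> x \<otimes> t" using na(3) x'(1) n tc by (simp add: t_def[symmetric] r_distr)
        then have xx: "x \<otimes> t = x" using x' tc by simp
        have "((\<lambda>x. x \<otimes> t) ^^ i) x = x" for i by (induction i) (simp_all add: xx)
        then show ?thesis using nil[OF x'(1)] by simp
      qed
      moreover have "\<zero> \<in> g.ker" using L.sub_zero[OF g.sub_ker] by simp
      ultimately have "g.ker = {\<zero>}" by blast
      then have "(\<lambda>x. x \<otimes> n) ` carrier R = carrier R"
        using L.inj_endo_surj[OF g.hom] fin g.inj_iff by simp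
      then have "\<one> \<in> (\<lambda>x. x \<otimes> n) ` carrier R" by simp
      then obtain x where x: "x \<in> carrier R" "\<one> = x \<otimes> n" by blast
      have "x \<otimes> n \<in> m" using L.sub_smult[OF sm x(1) na(1)] by simp
      then have "\<one> \<in> m" using x(2) by simp
      then have "k \<otimes> \<one> \<in> m" using L.sub_smult[OF sm kc] by simp
      then show False using \<open>k \<notin> m\<close> kc by simp
    qed
  qed
qed

text \<open>Finite length is demanded on both sides, so that everything proved for left modules
  applies to \<open>opposite A\<close> as well.\<close>

locale fl_ring = ring A for A :: "('a, 'z) ring_scheme" (structure) +
  assumes fin_l: "mlen A (regular_module A) < \<infinity>"
    and fin_r: "mlen (opposite A) (regular_module (opposite A)) < \<infinity>"
begin

lemma fl_ring_opposite: "fl_ring (opposite A)"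
  by (intro fl_ring.intro ring_opposite fl_ring_axioms.intro) (simp_all only: opposite_opposite fin_l fin_r)

lemma J_opposite: "jac (opposite A) = jac A"
proof
  show "jac (opposite A) \<subseteq> jac A" by (rule J_opposite_le[OF fin_l fin_r])
  show "jac A \<subseteq> jac (opposite A)"
    using ring.J_opposite_le[OF ring_opposite fin_r] fin_l by simp
qed

text \<open>If e were in J, then e = e e would give A e = J A e, against Nakayama's lemma.\<close>

lemma prim_not_J: "prim A e \<Longrightarrow> e \<notin> jac A"
proof
  assume e: "prim A e" and j: "e \<in> jac A"
  interpret L: left_module A "regular_module A" by (rule left_module_regular)
  have e': "e \<in> carrier A" "e \<noteq> \<zero>" "e \<otimes> e = e" using primD[OF e] by simp_all
  have ec: "e \<in> cyc A (regular_module A) e" using e' by (simp add: cyc_idem)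
  then have "e \<otimes> e \<in> jmul A (regular_module A) (cyc A (regular_module A) e)" using jmul.elem[where M = "regular_module A", OF j ec] by simp
  then have "cyc A (regular_module A) e \<subseteq> jmul A (regular_module A) (cyc A (regular_module A) e)"
    using L.cyc_least[OF L.sub_jmul'[OF sub_cyc_reg]] e' by simp
  moreover have "cyc A (regular_module A) e \<noteq> {\<zero>[regular_module A]}" using ec e' by auto
  ultimately show False using L.jmul_proper[OF sub_cyc_reg fin_l] e' by blast
qed

text \<open>This is locality of e A e. The element a has a left inverse d, which again lies outside
  J and so has a left inverse c; then c = c d a = a, and d is a two-sided inverse.\<close>

lemma prim_unit:
  assumes e: "prim A e" and a: "a \<in> carrier A" "a \<otimes> e = a" "e \<otimes> a = a" "a \<notin> jac A"
  obtains d where "d \<in> carrier A" "d \<otimes> a = e" "a \<otimes> d = e" "e \<otimes> d = d" "d \<otimes> e = d"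
proof -
  interpret L: left_module A "regular_module A" by (rule left_module_regular)
  have e': "e \<in> carrier A" "e \<otimes> e = e" using primD[OF e] by simp_all
  have ex: "\<exists>d\<in>carrier A. d \<otimes> a = e \<and> e \<otimes> d = d \<and> d \<otimes> e = d \<and> d \<notin> jac A"
    if a: "a \<in> carrier A" "a \<otimes> e = a" "e \<otimes> a = a" "a \<notin> jac A" for a
  proof -
    obtain b where b: "b \<in> carrier A" "b \<otimes> a = e" using prim_local[OF fin_l e a(1,2,4)] by blast
    define d where "d = e \<otimes> (b \<otimes> e)"
    have d: "d \<in> carrier A" using e' b by (simp add: d_def)
    have 1: "d \<otimes> a = e \<otimes> (b \<otimes> (e \<otimes> a))" unfolding d_def using e'(1) b(1) a(1) by (simp add: m_assoc)
    then have 1: "d \<otimes> a = e" using a(3) b(2) e'(2) by simp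
    have "e \<otimes> d = (e \<otimes> e) \<otimes> (b \<otimes> e)" unfolding d_def using e'(1) b(1) by (simp only: m_assoc m_closed)
    then have 2: "e \<otimes> d = d" using e'(2) by (simp add: d_def)
    have "d \<otimes> e = e \<otimes> (b \<otimes> (e \<otimes> e))" unfolding d_def using e'(1) b(1) by (simp only: m_assoc m_closed)
    then have 3: "d \<otimes> e = d" using e'(2) by (simp add: d_def)
    have "d \<notin> jac A"
    proof
      assume "d \<in> jac A"
      then have "d \<otimes> a \<in> jac A" using L.J_mult_r a(1) by blast
      then show False using 1 prim_not_J[OF e] by simp
    qed
    then show ?thesis using d 1 2 3 by blast
  qed
  obtain d where d: "d \<in> carrier A" "d \<otimes> a = e" "e \<otimes> d = d" "d \<otimes> e = d" "d \<notin> jac A"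
    using ex[OF a] by blast
  obtain c where c: "c \<in> carrier A" "c \<otimes> d = e" "e \<otimes> c = c" "c \<otimes> e = c" using ex[OF d(1,4,3,5)] by blast
  have "c \<otimes> (d \<otimes> a) = (c \<otimes> d) \<otimes> a" using c(1) d(1) a(1) by (simp only: m_assoc)
  then have "c = a" using c d a by simp
  then show thesis using that[OF d(1,2) _ d(3,4)] c(2) by simp
qed

end

section \<open>Modules of finite length\<close>

locale fl_module = left_module A M + fl_ring A for A :: "('a, 'z) ring_scheme" (structure) and M :: "('a, 'm, 'x) module_scheme" (structure) +
  assumes fin_M: "mlen A M < \<infinity>"
begin

text \<open>x = 1 x, and 1 is a sum of primitive idempotents. N is only asked to be closed under
  addition because the lemma is also applied to kernels of left multiplications, which are not
  submodules in general.\<close>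

lemma exists_prim:
  assumes N: "\<zero>[M] \<in> N" "\<And>y z. y \<in> N \<Longrightarrow> z \<in> N \<Longrightarrow> y \<oplus>[M] z \<in> N" and x: "x \<in> carrier M" "x \<notin> N"
  obtains e where "prim A e" "e \<odot>[M] x \<notin> N"
proof (rule ccontr)
  assume *: "\<not> thesis"
  have "\<one> \<in> {a \<in> carrier A. a \<odot>[M] x \<in> N}"
  proof (rule prim_induct[OF fin_l])
    show "\<zero> \<in> {a \<in> carrier A. a \<odot>[M] x \<in> N}" using N x by (simp add: smult_l_null)
    fix e assume "prim A e"
    then show "e \<in> {a \<in> carrier A. a \<odot>[M] x \<in> N}" using * that[of e] primD(1)[of A e] by blast
  next
    fix a b assume "a \<in> {a \<in> carrier A. a \<odot>[M] x \<in> N}" "b \<in> {a \<in> carrier A. a \<odot>[M] x \<in> N}"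
    then show "a \<oplus> b \<in> {a \<in> carrier A. a \<odot>[M] x \<in> N}" using N x by (simp add: smult_l_distr)
  qed
  then show False using x by (simp add: smult_one)
qed

lemma exists_prim_sub:
  assumes N: "submodule N A M" and x: "x \<in> carrier M" "x \<notin> N"
  obtains e where "prim A e" "e \<odot>[M] x \<notin> N"
  using exists_prim[of N x] sub_zero[OF N] sub_add[OF N] x by blast

text \<open>Since x = e x, one has y = (a e) x. The element a e is outside J, so
  \<open>prim_local\<close> multiplies it back to e.\<close>

lemma local_cyc:
  assumes e: "prim A e" and x: "x \<in> carrier M" "e \<odot>[M] x = x" and y: "y \<in> cyc A M x" "y \<notin> jmul A M (cyc A M x)"
  obtains b where "b \<in> carrier A" "b \<odot>[M] y = x"
proof -
  have e': "e \<in> carrier A" "e \<otimes> e = e" using primD[OF e] by simp_all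
  obtain a where a: "a \<in> carrier A" "y = a \<odot>[M] x" using y by (auto simp: cyc_def)
  have y': "y = (a \<otimes> e) \<odot>[M] x" using a x e' by (simp add: smult_assoc)
  have "a \<otimes> e \<notin> jac A" using jmul.elem[where M = M, OF _ cyc_self[OF x(1)], of "a \<otimes> e" A] y(2) y' by auto
  moreover have "(a \<otimes> e) \<otimes> e = a \<otimes> e" using a e' by (simp add: m_assoc)
  ultimately obtain b where b: "b \<in> carrier A" "b \<otimes> (a \<otimes> e) = e"
    using prim_local[OF fin_l e, of "a \<otimes> e"] a e' by auto
  then have "b \<odot>[M] y = x" using y' a e' x smult_assoc[of b "a \<otimes> e" x] by simp
  then show thesis using that b by blast
qed

lemma sub_local:
  assumes e: "prim A e" and x: "x \<in> carrier M" "e \<odot>[M] x = x" and L: "submodule L A M" "L \<subseteq> cyc A M x"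
  shows "L = cyc A M x \<or> L \<subseteq> jmul A M (cyc A M x)"
proof (rule disjCI)
  assume "\<not> L \<subseteq> jmul A M (cyc A M x)"
  then obtain y where y: "y \<in> L" "y \<notin> jmul A M (cyc A M x)" by blast
  then obtain b where "b \<in> carrier A" "b \<odot>[M] y = x" using local_cyc[OF e x, of y] L by blast
  then have "x \<in> L" using sub_smult[OF L(1)] y(1) by blast
  then show "L = cyc A M x" using cyc_least[OF L(1)] L(2) by blast
qed

lemma covers_local:
  assumes e: "prim A e" and x: "x \<in> carrier M" "e \<odot>[M] x = x" "x \<noteq> \<zero>[M]"
  shows "covers A M (jmul A M (cyc A M x)) (cyc A M x)"
proof -
  have s: "submodule (cyc A M x) A M" by (rule sub_cyc[OF x(1)])
  have "cyc A M x \<noteq> {\<zero>[M]}" using cyc_self[OF x(1)] x(3) by auto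
  then have "jmul A M (cyc A M x) \<subset> cyc A M x" by (rule jmul_proper[OF s fin_M])
  moreover have "N = jmul A M (cyc A M x) \<or> N = cyc A M x"
    if "submodule N A M" "jmul A M (cyc A M x) \<subseteq> N" "N \<subseteq> cyc A M x" for N
    using sub_local[OF e x(1,2) that(1,3)] that(2) by blast
  ultimately show ?thesis unfolding covers_def using s sub_jmul'[OF s] by simp
qed

text \<open>In effect this is semisimplicity of M/JM. Take C maximal among the submodules that
  contain JM but not z. If g y lies outside C + A z, then C + A g y still avoids z: in an equation z
  = c + a g y, either a g is in J and z is in C, or a g can be inverted and g y is in C + A z. This
  contradicts maximality of C.\<close>

lemma exists_complement:
  assumes z: "z \<in> carrier M" "z \<notin> jmul A M (carrier M)"
  obtains C where "submodule C A M" "jmul A M (carrier M) \<subseteq> C" "z \<notin> C" "C <+>[M] cyc A M z = carrier M"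
proof -
  let ?J = "jmul A M (carrier M)"
  have J: "submodule ?J A M" by (rule sub_jmul[OF subset_refl])
  have "il A M ?J (carrier M) \<le> mlen A M" using sub_zero[OF J] by (intro il_mono) auto
  then have "il A M ?J (carrier M) < \<infinity>" using fin_M by (rule le_less_trans)
  from exists_max_submodule[of "\<lambda>C. z \<notin> C", OF z(2) J this] obtain C where
    C': "submodule C A M \<and> ?J \<subseteq> C \<and> z \<notin> C \<and> (\<forall>D. submodule D A M \<longrightarrow> C \<subseteq> D \<longrightarrow> z \<notin> D \<longrightarrow> D = C)" ..
  then have C: "submodule C A M" "?J \<subseteq> C" "z \<notin> C" by simp_all
  let ?S = "C <+>[M] cyc A M z"
  have S: "submodule ?S A M" by (rule sub_sum[OF C(1) sub_cyc[OF z(1)]])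
  have CS: "C \<subseteq> ?S" and zS: "z \<in> ?S" using sum_upper[OF C(1) sub_cyc[OF z(1)]] cyc_self[OF z(1)] by blast+
  have "?S = carrier M"
  proof (rule ccontr)
    assume "?S \<noteq> carrier M"
    then obtain y where y: "y \<in> carrier M" "y \<notin> ?S" using sub_subset[OF S] by blast
    obtain g where g: "prim A g" "g \<odot>[M] y \<notin> ?S" using exists_prim_sub[OF S y] by blast
    have gc: "g \<in> carrier A" "g \<otimes> g = g" using primD[OF g(1)] by simp_all
    have gy: "g \<odot>[M] y \<in> carrier M" using gc y by (simp add: smult_closed)
    let ?D = "C <+>[M] cyc A M (g \<odot>[M] y)"
    have "z \<notin> ?D"
    proof
      assume "z \<in> ?D"
      then obtain c a where ca: "c \<in> C" "a \<in> carrier A" "z = c \<oplus>[M] a \<odot>[M] (g \<odot>[M] y)"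
        using mem_sum_cyc by blast
      have cM: "c \<in> carrier M" using sub_mem[OF C(1) ca(1)] .
      have ag: "a \<otimes> g \<in> carrier A" "(a \<otimes> g) \<otimes> g = a \<otimes> g" using ca(2) gc by (simp_all add: m_assoc)
      have z': "z = c \<oplus>[M] (a \<otimes> g) \<odot>[M] y" using ca gc y by (simp add: smult_assoc)
      show False
      proof (cases "a \<otimes> g \<in> jac A")
        case True
        then have "(a \<otimes> g) \<odot>[M] y \<in> C" using jmul.elem[where M = M, OF True y(1)] C(2) by blast
        then have "z \<in> C" using z' sub_add[OF C(1) ca(1)] by simp
        then show False using C(3) by simp
      next
        case False
        then obtain b where b: "b \<in> carrier A" "b \<otimes> (a \<otimes> g) = g" using prim_local[OF fin_l g(1) ag] by blast
        have "(a \<otimes> g) \<odot>[M] y = z \<ominus>[M] c" using z' cM ag y minus_add_cancel(4)[of "(a \<otimes> g) \<odot>[M] y" c] by (simp add: smult_closed)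
        moreover have "z \<ominus>[M] c \<in> ?S" using sub_minus[OF S zS] CS ca(1) by blast
        ultimately have "b \<odot>[M] ((a \<otimes> g) \<odot>[M] y) \<in> ?S" using sub_smult[OF S b(1)] by simp
        then show False using smult_assoc[OF b(1) ag(1) y(1)] b(2) g(2) by simp
      qed
    qed
    moreover have "submodule ?D A M" "C \<subseteq> ?D" using sub_sum sum_upper(1) C(1) sub_cyc[OF gy] by blast+
    ultimately have "?D = C" using C' by blast
    moreover have "g \<odot>[M] y \<in> ?D" using sum_upper(2)[OF C(1) sub_cyc[OF gy]] cyc_self[OF gy] by blast
    ultimately show False using g(2) CS by blast
  qed
  then show thesis using that C by blast
qed

text \<open>A complement of A z modulo JM, for z in Z outside JM, avoids z and therefore meets the
  simple module Z in 0.\<close>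

lemma simple_summand:
  assumes Z: "covers A M {\<zero>[M]} Z" "\<not> Z \<subseteq> jmul A M (carrier M)"
  obtains C where "submodule C A M" "C \<inter> Z = {\<zero>[M]}" "C <+>[M] Z = carrier M"
proof -
  have sZ: "submodule Z A M" using Z(1) by (simp add: covers_def)
  obtain z where z: "z \<in> Z" "z \<notin> jmul A M (carrier M)" using Z(2) by blast
  have zM: "z \<in> carrier M" using sub_mem[OF sZ z(1)] .
  obtain C where C: "submodule C A M" "jmul A M (carrier M) \<subseteq> C" "z \<notin> C" "C <+>[M] cyc A M z = carrier M"
    by (rule exists_complement[OF zM z(2)])
  have "C \<inter> Z = {\<zero>[M]} \<or> C \<inter> Z = Z"
    using Z(1) sub_Int[OF C(1) sZ] sub_zero[OF sub_Int[OF C(1) sZ]] unfolding covers_def by simp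
  then have "C \<inter> Z = {\<zero>[M]}" using z(1) C(3) by blast
  moreover have "carrier M \<subseteq> C <+>[M] Z" using C(4) sum_mono[OF subset_refl cyc_least[OF sZ z(1)], of C] by simp
  then have "C <+>[M] Z = carrier M" using sub_subset[OF sub_sum[OF C(1) sZ]] by blast
  ultimately show thesis using that C by blast
qed

lemma simple_in_rad:
  assumes "indecomposable A M" "covers A M {\<zero>[M]} Z"
  shows "Z = carrier M \<or> Z \<subseteq> jmul A M (carrier M)"
proof (rule disjCI)
  assume "\<not> Z \<subseteq> jmul A M (carrier M)"
  then obtain C where C: "submodule C A M" "C \<inter> Z = {\<zero>[M]}" "C <+>[M] Z = carrier M" using simple_summand[OF assms(2)] by blast
  have sZ: "submodule Z A M" "Z \<noteq> {\<zero>[M]}" using assms(2) by (auto simp: covers_def)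
  then have "C = {\<zero>[M]}" using indecomposableD[OF assms(1) C(1) sZ(1) C(3,2)] by blast
  then have "C <+>[M] Z \<subseteq> Z" using sum_least[OF sZ(1), of C Z] sub_zero[OF sZ(1)] by simp
  then show "Z = carrier M" using C(3) sub_subset[OF sZ(1)] by blast
qed

lemma exists_simple:
  assumes "submodule N A M" "N \<noteq> {\<zero>[M]}"
  obtains Z where "covers A M {\<zero>[M]} Z" "Z \<subseteq> N"
proof -
  have "{\<zero>[M]} \<subset> N" using sub_zero[OF assms(1)] assms(2) by blast
  moreover have "il A M {\<zero>[M]} N < \<infinity>"
    using il_mono[OF subset_refl sub_subset[OF assms(1)]] fin_M by (rule le_less_trans)
  ultimately show thesis using exists_cover[OF sub_0 assms(1)] that by blast
qed

subsection \<open>Uniserial modules\<close>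

text \<open>Suppose Z lies strictly between JY and Y. For z in Z outside JY and g y in Y outside Z,
  uniseriality puts z into A g y. There z is a generator by \<open>local_cyc\<close>, so g y would
  lie in Z.\<close>

lemma uniserial_covers:
  assumes u: "uniserial A M" and Y: "submodule Y A M"
  shows "il A M (jmul A M Y) Y \<le> 1"
proof (cases "Y = {\<zero>[M]}")
  case True
  then show ?thesis by (simp add: jmul_0 il_refl)
next
  case False
  let ?J = "jmul A M Y"
  have J: "submodule ?J A M" "?J \<subset> Y" using sub_jmul'[OF Y] jmul_proper[OF Y fin_M False] by blast+
  have max: "Z = ?J" if Z: "submodule Z A M" "?J \<subseteq> Z" "Z \<subset> Y" for Z
  proof (rule ccontr)
    assume "Z \<noteq> ?J"
    then obtain z where z: "z \<in> Z" "z \<notin> ?J" using Z by blast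
    obtain y where y: "y \<in> Y" "y \<notin> Z" using Z by blast
    have zM: "z \<in> carrier M" and yM: "y \<in> carrier M" using sub_mem z(1) y(1) Z(1) Y by blast+
    obtain g where g: "prim A g" "g \<odot>[M] y \<notin> Z" using exists_prim_sub[OF Z(1) yM y(2)] by blast
    have gc: "g \<in> carrier A" "g \<otimes> g = g" using primD[OF g(1)] by simp_all
    let ?y = "g \<odot>[M] y"
    have y': "?y \<in> carrier M" "g \<odot>[M] ?y = ?y" "?y \<in> Y"
      using gc yM sub_smult[OF Y gc(1) y(1)] by (simp_all add: smult_closed smult_assoc[symmetric])
    have "cyc A M ?y \<subseteq> cyc A M z \<or> cyc A M z \<subseteq> cyc A M ?y"
      using u sub_cyc[OF y'(1)] sub_cyc[OF zM] by (simp add: uniserial_def)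
    moreover have "\<not> cyc A M ?y \<subseteq> cyc A M z"
      using cyc_least[OF Z(1) z(1)] cyc_self[OF y'(1)] g(2) by blast
    ultimately have zy: "z \<in> cyc A M ?y" using cyc_self[OF zM] by blast
    have "jmul A M (cyc A M ?y) \<subseteq> ?J" by (rule jmul_mono[OF cyc_least[OF Y y'(3)] sub_subset[OF Y]])
    then have "z \<notin> jmul A M (cyc A M ?y)" using z(2) by blast
    then obtain b where "b \<in> carrier A" "b \<odot>[M] z = ?y" using local_cyc[OF g(1) y'(1,2) zy] by blast
    then have "?y \<in> Z" using sub_smult[OF Z(1) _ z(1)] by metis
    then show False using g(2) by simp
  qed
  have "Z = ?J \<or> Z = Y" if "submodule Z A M" "?J \<subseteq> Z" "Z \<subseteq> Y" for Z
    using max[OF that(1,2)] that(3) by blast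
  then have "covers A M ?J Y" unfolding covers_def using J Y by simp
  then show ?thesis by (simp add: il_covers)
qed

text \<open>Each radical layer has length at most 1, so the length is bounded by the Loewy
  length.\<close>

lemma uniserial_length:
  assumes u: "uniserial A M" and "submodule Y A M" "jpow A M k Y = {\<zero>[M]}"
  shows "il A M {\<zero>[M]} Y \<le> enat k"
  using assms(2,3)
proof (induction k arbitrary: Y)
  case 0
  then show ?case by (simp add: jpow_0 il_refl)
next
  case (Suc k)
  have s: "submodule (jmul A M Y) A M" "jmul A M Y \<subseteq> Y" using sub_jmul' jmul_subset Suc.prems by blast+
  have "il A M {\<zero>[M]} (jmul A M Y) \<le> enat k" using Suc.IH[OF s(1)] Suc.prems(2) by (simp add: jpow_Suc')
  moreover have "il A M {\<zero>[M]} Y = il A M {\<zero>[M]} (jmul A M Y) + il A M (jmul A M Y) Y"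
    using sub_zero[OF s(1)] by (intro il_add sub_0 s Suc.prems) auto
  ultimately have "il A M {\<zero>[M]} Y \<le> enat k + 1" using uniserial_covers[OF u Suc.prems(1)] by (simp add: add_mono)
  then show ?case by (simp add: one_enat_def)
qed

end

lemma (in lhom) image_jmul: "X \<subseteq> carrier M \<Longrightarrow> f ` jmul A M X = jmul A N (f ` X)"
proof
  assume X: "X \<subseteq> carrier M"
  have s: "submodule (jmul A M X) A M" by (rule dom.sub_jmul[OF X])
  have fX: "f ` X \<subseteq> carrier N" using X closed by blast
  have "f x \<in> jmul A N (f ` X)" if "x \<in> jmul A M X" for x
    using that
  proof induction
    case zero
    then show ?case using jmul.zero[of N A "f ` X"] lhom.zero[OF lhom_axioms] by simp
  next
    case (elem j x)
    then show ?case using jmul.elem[where M = N, of j A "f x" "f ` X"] smult[OF J_carrier[OF elem(1)], of x] X by (simp add: subset_iff)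
  next
    case (add x y)
    have "x \<in> carrier M" "y \<in> carrier M" using add.hyps dom.sub_mem[OF s] by simp_all
    then show ?case using jmul.add[OF add.IH] add by (simp add: lhom.add[OF lhom_axioms])
  qed
  then show "f ` jmul A M X \<subseteq> jmul A N (f ` X)" by blast
  show "jmul A N (f ` X) \<subseteq> f ` jmul A M X"
  proof (rule cod.jmul_least[OF sub_image[OF s]])
    fix j y assume j: "j \<in> jac A" "y \<in> f ` X"
    then obtain x where x: "x \<in> X" "y = f x" by blast
    have "j \<odot>[N] y = f (j \<odot>[M] x)" using x X smult[OF J_carrier[OF j(1)], of x] by (simp add: subset_iff)
    then show "j \<odot>[N] y \<in> f ` jmul A M X" using jmul.elem[where M = M, OF j(1) x(1)] by blast
  qed
qed

lemma (in lhom) image_jpow: "submodule X A M \<Longrightarrow> f ` jpow A M k X = jpow A N k (f ` X)"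
proof (induction k arbitrary: X)
  case 0
  then show ?case by (simp add: jpow_def)
next
  case (Suc k)
  show ?case using Suc.IH[OF dom.sub_jmul'[OF Suc.prems]] image_jmul[OF dom.sub_subset[OF Suc.prems]]
    by (simp add: dom.jpow_Suc' cod.jpow_Suc')
qed

lemma (in lhom) uniserial_image:
  assumes "uniserial A M" shows "uniserial A (sub_module N (f ` carrier M))"
  unfolding uniserial_def
proof (intro allI impI)
  fix X Y assume XY: "submodule X A (sub_module N (f ` carrier M)) \<and> submodule Y A (sub_module N (f ` carrier M))"
  have c: "submodule (f ` carrier M) A N" by (rule sub_image[OF dom.sub_carrier])
  have X: "submodule X A N" "X \<subseteq> f ` carrier M" and Y: "submodule Y A N" "Y \<subseteq> f ` carrier M"
    using XY cod.sub_sub_iff[OF c] by blast+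
  have "pre X \<subseteq> pre Y \<or> pre Y \<subseteq> pre X" using assms sub_pre X(1) Y(1) by (simp add: uniserial_def)
  then have "f ` pre X \<subseteq> f ` pre Y \<or> f ` pre Y \<subseteq> f ` pre X" by blast
  then show "X \<subseteq> Y \<or> Y \<subseteq> X" using image_pre X(2) Y(2) by simp
qed

lemma (in left_module) uniserial_sub: "submodule N A M \<Longrightarrow> uniserial A M \<Longrightarrow> uniserial A (sub_module M N)"
  by (simp add: uniserial_def sub_sub_iff)

lemma (in left_module) uniserial_sub_sub:
  "submodule N A M \<Longrightarrow> submodule L A M \<Longrightarrow> L \<subseteq> N \<Longrightarrow> uniserial A (sub_module M N) \<Longrightarrow> uniserial A (sub_module M L)"
  by (simp add: uniserial_def sub_sub_iff) blast

section \<open>Isomorphism invariance\<close>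

lemma (in lhom) pre_sum:
  assumes surj: "f ` carrier M = carrier N" and X: "submodule X A N" and Y: "submodule Y A N" and s: "X <+>[N] Y = carrier N"
  shows "pre X <+>[M] pre Y = carrier M"
proof
  have sX: "submodule (pre X) A M" and sY: "submodule (pre Y) A M" by (rule sub_pre[OF X], rule sub_pre[OF Y])
  have iX: "f ` pre X = X" using image_pre cod.sub_subset[OF X] surj by simp
  show "pre X <+>[M] pre Y \<subseteq> carrier M" by (rule dom.sub_subset[OF dom.sub_sum[OF sX sY]])
  show "carrier M \<subseteq> pre X <+>[M] pre Y"
  proof
    fix m assume m: "m \<in> carrier M"
    then have "f m \<in> X <+>[N] Y" using s closed by simp
    then obtain x y where xy: "x \<in> X" "y \<in> Y" "f m = x \<oplus>[N] y" by (auto simp: cod.mem_set_add)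
    obtain x' where x': "x' \<in> pre X" "x = f x'" using xy(1) iX by blast
    have x'M: "x' \<in> carrier M" using x'(1) by (simp add: pre_iff)
    have yN: "y \<in> carrier N" using cod.sub_mem[OF Y xy(2)] .
    have "f (m \<ominus>[M] x') = y" using m x'M xy(3) x'(2) yN closed by (simp add: minus cod.minus_add_cancel)
    then have "m \<ominus>[M] x' \<in> pre Y" using m x'M xy(2) by (simp add: pre_iff)
    moreover have "m = x' \<oplus>[M] (m \<ominus>[M] x')" using m x'M by (simp add: dom.minus_add_cancel)
    ultimately show "m \<in> pre X <+>[M] pre Y" unfolding dom.mem_set_add using x'(1) by blast
  qed
qed

locale liso = lhom + assumes inj: "inj_on f (carrier M)" and surj: "f ` carrier M = carrier N"
begin

lemma ker_0: "ker = {\<zero>[M]}" using inj inj_iff by simp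

lemma liso_inv: "liso A N M (inv_into (carrier M) f)"
proof -
  have g: "inv_into (carrier M) f y \<in> carrier M" "f (inv_into (carrier M) f y) = y" if "y \<in> carrier N" for y
    using that surj by (auto intro: inv_into_into f_inv_into_f)
  have eq: "inv_into (carrier M) f (f x) = x" if "x \<in> carrier M" for x using that inj by simp
  have "inv_into (carrier M) f (x \<oplus>[N] y) = inv_into (carrier M) f x \<oplus>[M] inv_into (carrier M) f y"
    if "x \<in> carrier N" "y \<in> carrier N" for x y
    using eq[of "inv_into (carrier M) f x \<oplus>[M] inv_into (carrier M) f y"] g that by (simp add: add)
  moreover have "inv_into (carrier M) f (a \<odot>[N] x) = a \<odot>[M] inv_into (carrier M) f x"
    if "a \<in> carrier A" "x \<in> carrier N" for a x
    using eq[of "a \<odot>[M] inv_into (carrier M) f x"] g that by (simp add: smult dom.smult_closed)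
  ultimately have "inv_into (carrier M) f \<in> module_homs A N M" using g by (simp add: module_homs_def)
  moreover have "inv_into (carrier M) f ` carrier N = carrier M"
  proof
    show "carrier M \<subseteq> inv_into (carrier M) f ` carrier N"
      using eq closed by (metis image_eqI subsetI)
  qed (use g in auto)
  moreover have "inj_on (inv_into (carrier M) f) (carrier N)" using g by (metis inj_onI)
  ultimately show ?thesis
    by (intro liso.intro lhom.intro lhom_axioms.intro liso_axioms.intro dom.left_module_axioms cod.left_module_axioms)
qed

lemma mlen_eq: "mlen A N = mlen A M"
  using il_inj[OF dom.sub_carrier inj] surj by simp

lemma uniserial_transfer: "uniserial A M \<Longrightarrow> uniserial A N"
  using uniserial_image surj cod.sub_module_carrier by simp

lemma indecomposable_transfer:
  assumes "indecomposable A M" shows "indecomposable A N"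
  unfolding indecomposable_alt
proof (intro conjI allI impI)
  have ne: "carrier M \<noteq> {\<zero>[M]}" using assms by (simp add: indecomposable_alt)
  show "carrier N \<noteq> {\<zero>[N]}"
  proof
    assume "carrier N = {\<zero>[N]}"
    then have "x \<in> ker" if "x \<in> carrier M" for x using closed[OF that] that by (simp add: ker_iff)
    then have "carrier M \<subseteq> ker" by blast
    then show False using ne ker_0 dom.sub_zero[OF dom.sub_carrier] by blast
  qed
  fix X Y assume X: "submodule X A N" and Y: "submodule Y A N" and s: "X <+>[N] Y = carrier N" and i: "X \<inter> Y = {\<zero>[N]}"
  have sX: "submodule (pre X) A M" and sY: "submodule (pre Y) A M" by (rule sub_pre[OF X], rule sub_pre[OF Y])
  have iX: "f ` pre X = X" "f ` pre Y = Y" using image_pre cod.sub_subset[OF X] cod.sub_subset[OF Y] surj by simp_all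
  have "pre X <+>[M] pre Y = carrier M" by (rule pre_sum[OF surj X Y s])
  moreover have "pre X \<inter> pre Y = {\<zero>[M]}"
  proof
    show "pre X \<inter> pre Y \<subseteq> {\<zero>[M]}"
    proof
      fix x assume "x \<in> pre X \<inter> pre Y"
      then have "x \<in> carrier M" "f x \<in> X \<inter> Y" by (simp_all add: pre_iff)
      then have "x \<in> ker" using i by (simp add: ker_iff)
      then show "x \<in> {\<zero>[M]}" using ker_0 by simp
    qed
  qed (use dom.sub_zero[OF sX] dom.sub_zero[OF sY] in simp)
  ultimately have "pre X = {\<zero>[M]} \<or> pre Y = {\<zero>[M]}" using indecomposableD[OF assms sX sY] by simp
  then show "X = {\<zero>[N]} \<or> Y = {\<zero>[N]}" using iX image_0 by metis
qed

end

text \<open>Lifting and extension properties, envelopes and the representation bound quantify over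
  modules on \<open>nat \<Rightarrow> 'a\<close>. Modules on other types, such as A e, quotients and
  duals, are moved there by this isomorphism.\<close>

lemma (in left_module) fg_copy:
  assumes "mlen A M < \<infinity>"
  obtains N :: "'a fg_module" and f where "liso A M N f"
proof -
  obtain N :: "'a fg_module" and f where N: "left_module A N" "f \<in> module_homs A M N" "bij_betw f (carrier M) (carrier N)"
    using finitely_generated_representable[OF finite_length_imp_fg[OF assms]] by blast
  have "liso A M N f"
    by (intro liso.intro liso_axioms.intro hom_lhom N) (use N(3) in \<open>simp_all add: bij_betw_def\<close>)
  then show thesis using that by blast
qed

lemma (in fl_ring) in_mod_iff: "in_mod A M \<longleftrightarrow> left_module A M \<and> mlen A M < \<infinity>"
proof
  assume "in_mod A M"
  then show "left_module A M \<and> mlen A M < \<infinity>"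
    using left_module.fg_imp_finite_length[of A M] fin_l by (simp add: in_mod_def)
next
  assume "left_module A M \<and> mlen A M < \<infinity>"
  then show "in_mod A M" using left_module.finite_length_imp_fg[of A M] by (simp add: in_mod_def)
qed

lemma (in liso) projective_transfer:
  assumes "fl_ring A" "projective_in_mod A M" shows "projective_in_mod A N"
proof -
  interpret fl_ring A by fact
  interpret g: liso A N M "inv_into (carrier M) f" by (rule liso_inv)
  let ?g = "inv_into (carrier M) f"
  have P: "in_mod A M" "\<And>X Y e h. in_mod A (X :: 'a fg_module) \<Longrightarrow> in_mod A (Y :: 'a fg_module) \<Longrightarrow> e \<in> module_homs A X Y \<Longrightarrow>
     h \<in> module_homs A M Y \<Longrightarrow> e ` carrier X = carrier Y \<Longrightarrow> \<exists>k\<in>module_homs A M X. \<forall>x\<in>carrier M. e (k x) = h x"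
    using assms(2) unfolding projective_in_mod_def by blast+
  show ?thesis
    unfolding projective_in_mod_def
  proof (intro conjI allI ballI impI)
    show "in_mod A N" using P(1) mlen_eq cod.left_module_axioms by (simp add: in_mod_iff)
    fix X Y :: "'a fg_module" and e h assume XY: "in_mod A X \<and> in_mod A Y" and e: "e \<in> module_homs A X Y" "e ` carrier X = carrier Y"
      and h: "h \<in> module_homs A N Y"
    have "(\<lambda>x. h (f x)) \<in> module_homs A M Y" by (rule comp_hom[OF hom h])
    then obtain k where k: "k \<in> module_homs A M X" "\<forall>x\<in>carrier M. e (k x) = h (f x)" using P(2)[of X Y e] XY e by blast
    show "\<exists>h'\<in>module_homs A N X. \<forall>x\<in>carrier N. e (h' x) = h x"
    proof (rule bexI[OF _ comp_hom[OF g.hom k(1)]], rule ballI)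
      fix x assume x: "x \<in> carrier N"
      then have "f (?g x) = x" using surj by (simp add: f_inv_into_f)
      then show "e (k (?g x)) = h x" using k(2) g.closed[OF x] by simp
    qed
  qed
qed

lemma (in liso) injective_transfer:
  assumes "fl_ring A" "injective_in_mod A M" shows "injective_in_mod A N"
proof -
  interpret fl_ring A by fact
  interpret g: liso A N M "inv_into (carrier M) f" by (rule liso_inv)
  let ?g = "inv_into (carrier M) f"
  have P: "in_mod A M" "\<And>X Y j h. in_mod A (X :: 'a fg_module) \<Longrightarrow> in_mod A (Y :: 'a fg_module) \<Longrightarrow> j \<in> module_homs A X Y \<Longrightarrow>
     h \<in> module_homs A X M \<Longrightarrow> inj_on j (carrier X) \<Longrightarrow> \<exists>k\<in>module_homs A Y M. \<forall>x\<in>carrier X. k (j x) = h x"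
    using assms(2) unfolding injective_in_mod_def by blast+
  show ?thesis
    unfolding injective_in_mod_def
  proof (intro conjI allI ballI impI)
    show "in_mod A N" using P(1) mlen_eq cod.left_module_axioms by (simp add: in_mod_iff)
    fix X Y :: "'a fg_module" and j h assume XY: "in_mod A X \<and> in_mod A Y" and j: "j \<in> module_homs A X Y" "inj_on j (carrier X)"
      and h: "h \<in> module_homs A X N"
    have "(\<lambda>x. ?g (h x)) \<in> module_homs A X M" by (rule comp_hom[OF h g.hom])
    then obtain k where k: "k \<in> module_homs A Y M" "\<forall>x\<in>carrier X. k (j x) = ?g (h x)" using P(2)[of X Y j] XY j by blast
    show "\<exists>h'\<in>module_homs A Y N. \<forall>x\<in>carrier X. h' (j x) = h x"
    proof (rule bexI[OF _ comp_hom[OF k(1) hom]], rule ballI)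
      fix x assume x: "x \<in> carrier X"
      then have "h x \<in> carrier N" using h by (auto simp: module_homs_def)
      then have "f (?g (h x)) = h x" using surj by (simp add: f_inv_into_f)
      then show "f (k (j x)) = h x" using k(2) x by simp
    qed
  qed
qed

section \<open>Bimodules attached to uniserial projectives\<close>

context fl_ring begin

text \<open>If the right module \<open>f A\<close> is uniserial, then \<open>f J g\<close> is generated, for every primitive \<open>g\<close>, by
  any single nonzero element of \<open>f J e\<close>.\<close>

lemma uniserial_generates:
  assumes e: "prim A e" and g: "prim A g" and f: "f \<in> carrier A" "f \<otimes> f = f"
    and u: "uniserial (opposite A) (pim (opposite A) f)"
    and v: "v \<in> jac A" "f \<otimes> v = v" "v \<otimes> e = v" "v \<noteq> \<zero>"
    and w: "w \<in> jac A" "f \<otimes> w = w" "w \<otimes> g = w"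
    and J2: "\<And>i j. i \<in> jac A \<Longrightarrow> j \<in> jac A \<Longrightarrow> i \<otimes> (j \<otimes> e) = \<zero>"
  obtains a where "a \<in> carrier A" "e \<otimes> a = a" "w = v \<otimes> a"
proof -
  interpret O: ring "opposite A" by (rule ring_opposite)
  interpret L: left_module "opposite A" "regular_module (opposite A)" by (rule O.left_module_regular)
  note e' = primD[OF e] and g' = primD[OF g]
  have c: "v \<in> carrier A" "w \<in> carrier A" by (rule J_carrier[OF v(1)], rule J_carrier[OF w(1)])
  let ?F = "cyc (opposite A) (regular_module (opposite A)) f"
  have F: "submodule ?F (opposite A) (regular_module (opposite A))" using O.sub_cyc_reg f by simp
  have vF: "v \<in> ?F" and wF: "w \<in> ?F" using O.cyc_idem[of f] f c v w by simp_all
  let ?V = "cyc (opposite A) (regular_module (opposite A)) v" and ?W = "cyc (opposite A) (regular_module (opposite A)) w"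
  have "submodule ?V (opposite A) (pim (opposite A) f)" "submodule ?W (opposite A) (pim (opposite A) f)"
    using L.sub_sub_iff[OF F] O.sub_cyc_reg c L.cyc_least[OF F vF] L.cyc_least[OF F wF] by simp_all
  then have "?V \<subseteq> ?W \<or> ?W \<subseteq> ?V" using u unfolding uniserial_def by blast
  then have vw: "v \<in> ?W \<or> w \<in> ?V" using L.cyc_self[of v] L.cyc_self[of w] c by auto
  show thesis
  proof (cases "w \<in> ?V")
    case True
    then obtain a where a: "a \<in> carrier A" "w = v \<otimes> a" by (auto simp: cyc_def)
    have "v \<otimes> (e \<otimes> a) = v \<otimes> a" using m_assoc[OF c(1) e'(1) a(1)] v(3) by simp
    moreover have "e \<otimes> (e \<otimes> a) = e \<otimes> a" using m_assoc[OF e'(1,1) a(1)] e'(3) by simp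
    ultimately show thesis using that[of "e \<otimes> a"] a e'(1) by simp
  next
    case False
    then have "v \<in> ?W" using vw by simp
    then obtain b0 where b0: "b0 \<in> carrier A" "v = w \<otimes> b0" by (auto simp: cyc_def)
    \<comment> \<open>Now v = w b with b in g A e. If b were in J, then w b would lie in J^2 e = 0.
      So b has a two-sided inverse k in e A g, and w = v k.\<close>
    define b where "b = g \<otimes> (b0 \<otimes> e)"
    have b: "b \<in> carrier A" using b0 e' g' by (simp add: b_def)
    have "w \<otimes> b = ((w \<otimes> g) \<otimes> b0) \<otimes> e" unfolding b_def using c b0(1) e'(1) g'(1) by (simp only: m_assoc m_closed)
    then have wb: "w \<otimes> b = v" using w(3) b0(2) v(3) by simp
    have "b \<otimes> e = g \<otimes> (b0 \<otimes> (e \<otimes> e))" unfolding b_def using b0(1) e'(1) g'(1) by (simp only: m_assoc m_closed)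
    then have be: "b \<otimes> e = b" using e' by (simp add: b_def)
    have "g \<otimes> b = (g \<otimes> g) \<otimes> (b0 \<otimes> e)" unfolding b_def using b0(1) e'(1) g'(1) by (simp only: m_assoc m_closed)
    then have gb: "g \<otimes> b = b" using g' by (simp add: b_def)
    have bJ: "b \<notin> jac A"
    proof
      assume "b \<in> jac A"
      then have "w \<otimes> (b \<otimes> e) = \<zero>" by (rule J2[OF w(1)])
      then show False using be wb v by simp
    qed
    obtain d where d: "d \<in> carrier A" "d \<otimes> b = e" using prim_local[OF fin_l e b be bJ] by blast
    define k where "k = e \<otimes> (d \<otimes> g)"
    have k: "k \<in> carrier A" using d e' g' by (simp add: k_def)
    have "k \<otimes> b = e \<otimes> (d \<otimes> (g \<otimes> b))" unfolding k_def using d(1) e'(1) g'(1) b by (simp only: m_assoc m_closed)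
    then have kb: "k \<otimes> b = e" using gb d e' by simp
    have "k \<otimes> g = e \<otimes> (d \<otimes> (g \<otimes> g))" unfolding k_def using d(1) e'(1) g'(1) by (simp only: m_assoc m_closed)
    then have kg: "k \<otimes> g = k" using g' by (simp add: k_def)
    have "e \<otimes> k = (e \<otimes> e) \<otimes> (d \<otimes> g)" unfolding k_def using d(1) e'(1) g'(1) by (simp only: m_assoc m_closed)
    then have ek: "e \<otimes> k = k" using e' by (simp add: k_def)
    have kJ: "k \<notin> jac A"
      using left_module.J_mult_r[OF left_module_regular _ b, of k] kb prim_not_J[OF e] by auto
    obtain l where l: "l \<in> carrier A" "l \<otimes> k = g" using prim_local[OF fin_l g k kg kJ] by blast
    have "l \<otimes> (k \<otimes> b) = (l \<otimes> k) \<otimes> b" using l(1) k b by (simp only: m_assoc)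
    then have le: "l \<otimes> e = b" using kb l gb by simp
    have "b \<otimes> k = l \<otimes> (e \<otimes> k)" using le[symmetric] l(1) e'(1) k by (simp add: m_assoc)
    then have bk: "b \<otimes> k = g" using ek l by simp
    have "v \<otimes> k = w \<otimes> (b \<otimes> k)" using wb[symmetric] c(2) b k by (simp add: m_assoc)
    then have "w = v \<otimes> k" using bk w(3) by simp
    then show thesis using that[OF k ek] by simp
  qed
qed

end

section \<open>Products\<close>

definition prod_module :: "('a, 'm, 'x) module_scheme \<Rightarrow> ('a, 'n, 'y) module_scheme \<Rightarrow> ('a, 'm \<times> 'n) module" where
  "prod_module M N = \<lparr>carrier = carrier M \<times> carrier N, mult = undefined, one = undefined,
     zero = (\<zero>[M], \<zero>[N]), add = (\<lambda>x y. (fst x \<oplus>[M] fst y, snd x \<oplus>[N] snd y)),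
     smult = (\<lambda>a x. (a \<odot>[M] fst x, a \<odot>[N] snd x))\<rparr>"

lemma prod_module_simps [simp]: "carrier (prod_module M N) = carrier M \<times> carrier N"
  "\<zero>[prod_module M N] = (\<zero>[M], \<zero>[N])"
  "x \<oplus>[prod_module M N] y = (fst x \<oplus>[M] fst y, snd x \<oplus>[N] snd y)"
  "a \<odot>[prod_module M N] x = (a \<odot>[M] fst x, a \<odot>[N] snd x)"
  by (simp_all add: prod_module_def)

lemma left_module_prod:
  assumes "left_module A M" "left_module A N" shows "left_module A (prod_module M N)"
proof -
  interpret M: left_module A M by fact
  interpret N: left_module A N by fact
  have "abelian_group (prod_module M N)"
  proof (rule abelian_groupI)
    fix x assume "x \<in> carrier (prod_module M N)"
    then show "\<exists>y\<in>carrier (prod_module M N). y \<oplus>[prod_module M N] x = \<zero>[prod_module M N]"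
      by (intro bexI[of _ "(\<ominus>[M] fst x, \<ominus>[N] snd x)"]) (auto simp: M.l_neg N.l_neg)
  qed (auto simp: M.a_ac N.a_ac)
  then show ?thesis
    by (intro left_module.intro M.A.ring_axioms left_module_axioms.intro)
      (auto simp: M.smult_closed N.smult_closed M.smult_l_distr N.smult_l_distr M.smult_r_distr N.smult_r_distr
        M.smult_assoc N.smult_assoc M.smult_one N.smult_one)
qed

lemma lhom_fst: "left_module A M \<Longrightarrow> left_module A N \<Longrightarrow> lhom A (prod_module M N) M fst"
  by (intro lhom.intro lhom_axioms.intro left_module_prod) (simp_all add: module_homs_def mem_Times_iff)

lemma lhom_snd: "left_module A M \<Longrightarrow> left_module A N \<Longrightarrow> lhom A (prod_module M N) N snd"
  by (intro lhom.intro lhom_axioms.intro left_module_prod) (simp_all add: module_homs_def mem_Times_iff)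

lemma sub_Times:
  assumes "left_module A M" "left_module A N" "submodule X A M" "submodule Y A N"
  shows "submodule (X \<times> Y) A (prod_module M N)"
proof -
  interpret M: left_module A M by fact
  interpret N: left_module A N by fact
  interpret P: left_module A "prod_module M N" by (rule left_module_prod) fact+
  show ?thesis unfolding P.sub_iff using assms(3,4)
    by (auto simp: M.sub_add N.sub_add M.sub_smult N.sub_smult M.sub_zero N.sub_zero
      M.sub_mem N.sub_mem)
qed

lemma il_Times_fst:
  assumes "left_module A M" "left_module A N" "submodule X A M" "submodule X' A M" "X \<subseteq> X'" "submodule Y A N"
  shows "il A (prod_module M N) (X \<times> Y) (X' \<times> Y) = il A M X X'"
proof -
  interpret N: left_module A N by fact
  interpret M: left_module A M by fact
  interpret f: lhom A "prod_module M N" M fst by (rule lhom_fst) fact+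
  have "f.ker \<inter> X' \<times> Y \<subseteq> X \<times> Y" using M.sub_zero[OF assms(3)] by (auto simp: f.ker_def)
  moreover have "X \<times> Y \<subseteq> X' \<times> Y" using assms(5) by blast
  ultimately have "il A (prod_module M N) (X \<times> Y) (X' \<times> Y) = il A M (fst ` (X \<times> Y)) (fst ` (X' \<times> Y))"
    by (intro f.il_image sub_Times[OF assms(1,2)] assms)
  moreover have "fst ` (X \<times> Y) = X" "fst ` (X' \<times> Y) = X'" using N.sub_zero[OF assms(6)] by force+
  ultimately show ?thesis by (simp only:)
qed

lemma il_Times_snd:
  assumes "left_module A M" "left_module A N" "submodule Y A N" "submodule Y' A N" "Y \<subseteq> Y'" "submodule X A M"
  shows "il A (prod_module M N) (X \<times> Y) (X \<times> Y') = il A N Y Y'"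
proof -
  interpret N: left_module A N by fact
  interpret M: left_module A M by fact
  interpret f: lhom A "prod_module M N" N snd by (rule lhom_snd) fact+
  have "f.ker \<inter> X \<times> Y' \<subseteq> X \<times> Y" using N.sub_zero[OF assms(3)] by (auto simp: f.ker_def)
  moreover have "X \<times> Y \<subseteq> X \<times> Y'" using assms(5) by blast
  ultimately have "il A (prod_module M N) (X \<times> Y) (X \<times> Y') = il A N (snd ` (X \<times> Y)) (snd ` (X \<times> Y'))"
    by (intro f.il_image sub_Times[OF assms(1,2)] assms)
  moreover have "snd ` (X \<times> Y) = Y" "snd ` (X \<times> Y') = Y'" using M.sub_zero[OF assms(6)] by force+
  ultimately show ?thesis by (simp only:)
qed

lemma mlen_prod:
  assumes "left_module A M" "left_module A N"
  shows "mlen A (prod_module M N) = mlen A N + mlen A M"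
proof -
  interpret N: left_module A N by fact
  interpret M: left_module A M by fact
  interpret P: left_module A "prod_module M N" by (rule left_module_prod) fact+
  have z: "{\<zero>[M]} \<subseteq> carrier M" "{\<zero>[N]} \<subseteq> carrier N" by simp_all
  have s: "submodule ({\<zero>[M]} \<times> {\<zero>[N]}) A (prod_module M N)" "submodule ({\<zero>[M]} \<times> carrier N) A (prod_module M N)"
    "submodule (carrier M \<times> carrier N) A (prod_module M N)"
    by (intro sub_Times assms M.sub_0 N.sub_0 M.sub_carrier N.sub_carrier)+
  have "il A (prod_module M N) ({\<zero>[M]} \<times> {\<zero>[N]}) (carrier M \<times> carrier N) =
      il A (prod_module M N) ({\<zero>[M]} \<times> {\<zero>[N]}) ({\<zero>[M]} \<times> carrier N) +
      il A (prod_module M N) ({\<zero>[M]} \<times> carrier N) (carrier M \<times> carrier N)"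
    by (rule P.il_add[OF s]) (use z in blast)+
  moreover have "{\<zero>[prod_module M N]} = {\<zero>[M]} \<times> {\<zero>[N]}" by simp
  ultimately show ?thesis
    using il_Times_fst[OF assms M.sub_0 M.sub_carrier z(1) N.sub_carrier]
      il_Times_snd[OF assms N.sub_0 N.sub_carrier z(2) M.sub_0]
    by (simp only: prod_module_simps)
qed

section \<open>An amalgam of two local modules\<close>

context fl_ring begin

text \<open>J is two-sided, so J A e = J e, and the elements of J e are the x in J with x e =
  x.\<close>

lemma jmul_pim:
  assumes "prim A e"
  shows "covers A (pim A e) (jmul A (pim A e) (carrier (pim A e))) (carrier (pim A e))"
    and "x \<in> jmul A (pim A e) (carrier (pim A e)) \<longleftrightarrow> x \<in> jac A \<and> x \<otimes> e = x"
proof -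
  note e = primD[OF assms]
  interpret L: left_module A "regular_module A" by (rule left_module_regular)
  interpret P: left_module A "pim A e" by (rule left_module_pim[OF e(1)])
  have "mlen A (pim A e) < \<infinity>" using mlen_pim_le[OF e(1)] fin_l by (rule le_less_trans)
  then interpret P: fl_module A "pim A e" by (intro fl_module.intro fl_module_axioms.intro P.left_module_axioms fl_ring_axioms)
  have eP: "e \<in> carrier (pim A e)" using e by (simp add: cyc_idem)
  have c: "cyc A (pim A e) e = carrier (pim A e)" by (simp add: cyc_def)
  show "covers A (pim A e) (jmul A (pim A e) (carrier (pim A e))) (carrier (pim A e))"
    using P.covers_local[OF assms eP] e c by simp
  have "jmul A (pim A e) (carrier (pim A e)) = (\<lambda>j. j \<otimes> e) ` jac A"
    using P.jmul_cyc[OF eP] c by simp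
  then show "x \<in> jmul A (pim A e) (carrier (pim A e)) \<longleftrightarrow> x \<in> jac A \<and> x \<otimes> e = x"
  proof (intro iffI)
    assume "x \<in> jmul A (pim A e) (carrier (pim A e))" "jmul A (pim A e) (carrier (pim A e)) = (\<lambda>j. j \<otimes> e) ` jac A"
    then obtain j where j: "j \<in> jac A" "x = j \<otimes> e" by auto
    then show "x \<in> jac A \<and> x \<otimes> e = x" using L.J_mult_r[OF j(1) e(1)] e J_carrier[OF j(1)] by (simp add: m_assoc)
  next
    assume "x \<in> jac A \<and> x \<otimes> e = x" "jmul A (pim A e) (carrier (pim A e)) = (\<lambda>j. j \<otimes> e) ` jac A"
    then show "x \<in> jmul A (pim A e) (carrier (pim A e))" by (metis image_eqI)
  qed
qed

end

text \<open>Homomorphisms between A e and A e' are right multiplications. So \<open>indep\<close>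
  says that none of them maps v to w or w to v. If one did, a shear of the direct sum would move (v,
  w) into one factor and the other factor would split off.\<close>

locale amalgam = fl_ring +
  fixes e e' f v w
  assumes e: "prim A e" and e': "prim A e'" and f: "prim A f"
    and v: "v \<in> jac A" "f \<otimes> v = v" "v \<otimes> e = v"
    and w: "w \<in> jac A" "f \<otimes> w = w" "w \<otimes> e' = w"
    and indep: "\<And>a. a \<in> carrier A \<Longrightarrow> v \<noteq> w \<otimes> a" "\<And>a. a \<in> carrier A \<Longrightarrow> w \<noteq> v \<otimes> a"
    and fJ2: "\<And>i j. i \<in> jac A \<Longrightarrow> j \<in> jac A \<Longrightarrow> f \<otimes> (i \<otimes> j) = \<zero>"
begin

definition F where "F = prod_module (pim A e) (pim A e')"

lemma carr: "e \<in> carrier A" "e' \<in> carrier A" "f \<in> carrier A" "v \<in> carrier A" "w \<in> carrier A"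
  using primD(1)[OF e] primD(1)[OF e'] primD(1)[OF f] J_carrier[OF v(1)] J_carrier[OF w(1)] by simp_all

lemma idem: "e \<otimes> e = e" "e' \<otimes> e' = e'" "f \<otimes> f = f"
  by (rule primD(3)[OF e], rule primD(3)[OF e'], rule primD(3)[OF f])

lemma lm: "left_module A (pim A e)" "left_module A (pim A e')" "left_module A F" "left_module A (regular_module A)"
  unfolding F_def by (auto intro: left_module_prod left_module_pim carr left_module_regular)

sublocale F: left_module A F by (rule lm(3))
sublocale P: left_module A "pim A e" by (rule lm(1))
sublocale P': left_module A "pim A e'" by (rule lm(2))

lemma F_iff: "x \<in> carrier F \<longleftrightarrow> fst x \<in> carrier A \<and> fst x \<otimes> e = fst x \<and> snd x \<in> carrier A \<and> snd x \<otimes> e' = snd x"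
  by (simp add: F_def mem_Times_iff cyc_idem carr idem)

lemma F_simps [simp]: "\<zero>[F] = (\<zero>, \<zero>)" "x \<oplus>[F] y = (fst x \<oplus> fst y, snd x \<oplus> snd y)"
  "a \<odot>[F] x = (a \<otimes> fst x, a \<otimes> snd x)"
  by (simp_all add: F_def)

lemma fJJ: "i \<in> jac A \<Longrightarrow> f \<otimes> i = i \<Longrightarrow> j \<in> jac A \<Longrightarrow> i \<otimes> j = \<zero>"
  using fJ2[of i j] m_assoc[of f i j] carr J_carrier by metis

lemma ne: "v \<noteq> \<zero>" "w \<noteq> \<zero>"
  using indep[of \<zero>] carr by auto

lemma finP: "mlen A (pim A e) < \<infinity>" "mlen A (pim A e') < \<infinity>"
  by (rule le_less_trans[OF mlen_pim_le[OF carr(1)] fin_l], rule le_less_trans[OF mlen_pim_le[OF carr(2)] fin_l])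

lemma fin_F: "mlen A F < \<infinity>"
  using mlen_prod[OF lm(1,2)] finP unfolding F_def
  by (cases "mlen A (pim A e')"; cases "mlen A (pim A e)") simp_all

sublocale F: fl_module A F by (intro fl_module.intro fl_module_axioms.intro lm fl_ring_axioms fin_F)

lemma JF_comp:
  assumes "x \<in> jmul A F (carrier F)" shows "fst x \<in> jac A" "snd x \<in> jac A"
proof -
  interpret L: left_module A "regular_module A" by (rule lm)
  have "fst x \<in> jac A \<and> snd x \<in> jac A" using assms
  proof induction
    case (elem j x)
    then show ?case using L.J_mult_r[OF elem(1)] F_iff[of x] by simp
  qed (simp_all add: L.J_zero L.J_add)
  then show "fst x \<in> jac A" "snd x \<in> jac A" by simp_all
qed

lemma kill: "x \<in> jmul A F (carrier F) \<Longrightarrow> i \<in> jac A \<Longrightarrow> f \<otimes> i = i \<Longrightarrow> i \<odot>[F] x = (\<zero>, \<zero>)"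
  using JF_comp fJJ by simp

lemma il_top: "il A F (jmul A F (carrier F)) (carrier F) \<le> 2"
proof -
  let ?P = "carrier (pim A e)" and ?P' = "carrier (pim A e')"
  let ?J = "jmul A (pim A e) ?P" and ?J' = "jmul A (pim A e') ?P'"
  have s: "submodule ?J A (pim A e)" "submodule ?J' A (pim A e')" "?J \<subseteq> ?P" "?J' \<subseteq> ?P'"
    using jmul_pim(1)[OF e] jmul_pim(1)[OF e'] unfolding covers_def by blast+
  have sub: "?J \<times> ?J' \<subseteq> jmul A F (carrier F)"
  proof
    fix x assume "x \<in> ?J \<times> ?J'"
    then have x: "fst x \<in> jac A" "fst x \<otimes> e = fst x" "snd x \<in> jac A" "snd x \<otimes> e' = snd x"
      using jmul_pim(2)[OF e] jmul_pim(2)[OF e'] by auto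
    have "(e, \<zero>) \<in> carrier F" "(\<zero>, e') \<in> carrier F" using carr idem by (simp_all add: F_iff)
    then have "fst x \<odot>[F] (e, \<zero>) \<oplus>[F] snd x \<odot>[F] (\<zero>, e') \<in> jmul A F (carrier F)"
      by (intro jmul.add jmul.elem x)
    then show "x \<in> jmul A F (carrier F)" using x J_carrier[OF x(1)] J_carrier[OF x(3)] by simp
  qed
  have "il A F (jmul A F (carrier F)) (carrier F) \<le> il A F (?J \<times> ?J') (?P \<times> ?P')"
    using sub by (intro F.il_mono) (simp_all add: F_def)
  also have "\<dots> = il A F (?J \<times> ?J') (?J \<times> ?P') + il A F (?J \<times> ?P') (?P \<times> ?P')"
    unfolding F_def by (intro left_module.il_add[OF left_module_prod] lm sub_Times s P.sub_carrier P'.sub_carrier Sigma_mono subset_refl)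
  also have "il A F (?J \<times> ?J') (?J \<times> ?P') = 1"
    using il_Times_snd[OF lm(1,2) s(2) P'.sub_carrier s(4) s(1)] P'.il_covers[OF jmul_pim(1)[OF e']] by (simp add: F_def)
  also have "il A F (?J \<times> ?P') (?P \<times> ?P') = 1"
    using il_Times_fst[OF lm(1,2) s(1) P.sub_carrier s(3) P'.sub_carrier] P.il_covers[OF jmul_pim(1)[OF e]] by (simp add: F_def)
  finally show ?thesis by (simp add: one_add_one)
qed

text \<open>Otherwise JF < JF + A x < X + JF < F would be three strict steps above JF, where only
  length 2 is available. The last step is strict by Nakayama's lemma.\<close>

lemma gen_top:
  assumes X: "submodule X A F" "X \<noteq> carrier F" and x: "x \<in> X" "y \<in> X" "x \<notin> jmul A F (carrier F)"
  shows "\<exists>b\<in>carrier A. \<exists>n\<in>jmul A F (carrier F). y = n \<oplus>[F] b \<odot>[F] x"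
proof (rule ccontr)
  assume *: "\<not> ?thesis"
  let ?J = "jmul A F (carrier F)"
  have J: "submodule ?J A F" by (rule F.sub_jmul[OF subset_refl])
  have xF: "x \<in> carrier F" "y \<in> carrier F" using F.sub_mem[OF X(1)] x by blast+
  let ?J1 = "?J <+>[F] cyc A F x" and ?X = "X <+>[F] ?J"
  have J1: "submodule ?J1 A F" by (rule F.sub_sum[OF J F.sub_cyc[OF xF(1)]])
  have sX: "submodule ?X A F" by (rule F.sub_sum[OF X(1) J])
  have yJ1: "y \<notin> ?J1" unfolding F.mem_sum_cyc using * by blast
  have a: "?J \<subset> ?J1" using F.sum_upper[OF J F.sub_cyc[OF xF(1)]] F.cyc_self[OF xF(1)] x(3) by blast
  have "?J1 \<subseteq> ?X" using F.sum_upper[OF X(1) J] F.cyc_least[OF X(1) x(1)] by (intro F.sum_least[OF sX]) auto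
  then have b: "?J1 \<subset> ?X" using yJ1 F.sum_upper(1)[OF X(1) J] x(2) by blast
  have "?X \<noteq> carrier F"
  proof
    assume "?X = carrier F"
    then have "X = carrier F" using F.nakayama_lemma[OF X(1) F.sub_carrier fin_F F.sub_subset[OF X(1)]] by simp
    then show False using X by simp
  qed
  then have c: "?X \<subset> carrier F" using F.sub_subset[OF sX] by blast
  have 1: "il A F ?J ?J \<le> 0" by (simp add: F.il_refl)
  have "il A F ?J ?J + 1 \<le> il A F ?J ?J1" by (rule F.il_strict[OF J J J1 subset_refl a])
  moreover have "il A F ?J ?J1 + 1 \<le> il A F ?J ?X" using a by (intro F.il_strict[OF J J1 sX _ b]) auto
  moreover have "il A F ?J ?X + 1 \<le> il A F ?J (carrier F)" using a b by (intro F.il_strict[OF J sX F.sub_carrier _ c]) auto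
  ultimately have "3 \<le> il A F ?J (carrier F)"
    by (cases "il A F ?J ?J"; cases "il A F ?J ?J1"; cases "il A F ?J ?X"; cases "il A F ?J (carrier F)")
      (auto simp: one_enat_def numeral_eq_enat)
  then show False using il_top by (cases "il A F ?J (carrier F)") (auto simp: numeral_eq_enat)
qed

text \<open>Write x and y as rows (\<alpha>, \<beta>) and (\<gamma>, \<delta>). If x lies in JF,
  then v kills it, so w \<gamma> = c v and w \<delta> = c w; here \<delta> is invertible, and v
  becomes a right multiple of w. Otherwise y = n + b x with n in JF, and r = v + w b satisfies r
  \<alpha> = c v and r \<beta> = c w; here \<alpha> is invertible, and w becomes a right multiple of
  v.\<close>

lemma proper_part:
  assumes X: "submodule X A F" "X \<noteq> carrier F" and x: "x \<in> X" "y \<in> X" "e \<odot>[F] x = x" "e' \<odot>[F] y = y"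
    and c: "c \<in> carrier A" "f \<otimes> c = c" "c \<otimes> f = c" "c \<notin> jac A"
    and eq: "v \<odot>[F] x \<oplus>[F] w \<odot>[F] y = c \<odot>[F] (v, w)"
  shows False
proof -
  interpret L: left_module A "regular_module A" by (rule lm)
  have xF: "x \<in> carrier F" "y \<in> carrier F" using F.sub_mem[OF X(1)] x by blast+
  obtain \<alpha> \<beta> where x': "x = (\<alpha>, \<beta>)" by (cases x)
  obtain \<gamma> \<delta> where y': "y = (\<gamma>, \<delta>)" by (cases y)
  have ab: "\<alpha> \<in> carrier A" "\<alpha> \<otimes> e = \<alpha>" "\<beta> \<in> carrier A" "e \<otimes> \<alpha> = \<alpha>" "e \<otimes> \<beta> = \<beta>"
    using xF(1) x(3) by (simp_all add: F_iff x')
  have cd: "\<gamma> \<in> carrier A" "\<delta> \<in> carrier A" "\<delta> \<otimes> e' = \<delta>" "e' \<otimes> \<gamma> = \<gamma>" "e' \<otimes> \<delta> = \<delta>"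
    using xF(2) x(4) by (simp_all add: F_iff y')
  obtain d where d: "d \<in> carrier A" "d \<otimes> c = f" using prim_unit[OF f c(1,3,2,4)] by metis
  have dcv: "d \<otimes> (c \<otimes> v) = v" "d \<otimes> (c \<otimes> w) = w"
    using d carr c v w by (simp_all add: m_assoc[symmetric])
  have eqs: "v \<otimes> \<alpha> \<oplus> w \<otimes> \<gamma> = c \<otimes> v" "v \<otimes> \<beta> \<oplus> w \<otimes> \<delta> = c \<otimes> w" using eq by (simp_all add: x' y')
  have fJ: "r \<otimes> s = \<zero>" if "r \<in> jac A" "f \<otimes> r = r" "s \<in> jac A" for r s using fJJ that by blast
  show False
  proof (cases "x \<in> jmul A F (carrier F)")
    case True
    then have z: "v \<otimes> \<alpha> = \<zero>" "v \<otimes> \<beta> = \<zero>" using kill[OF True v(1,2)] by (simp_all add: x')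
    then have e1: "w \<otimes> \<gamma> = c \<otimes> v" "w \<otimes> \<delta> = c \<otimes> w" using eqs carr cd by simp_all
    have "\<delta> \<notin> jac A"
    proof
      assume "\<delta> \<in> jac A"
      then have "c \<otimes> w = \<zero>" using fJ[OF w(1,2)] e1 by simp
      then have "w = \<zero>" using dcv(2) d by simp
      then show False using ne by simp
    qed
    then obtain k where k: "k \<in> carrier A" "\<delta> \<otimes> k = e'" using prim_unit[OF e' cd(2,3,5)] by metis
    have 1: "v = (d \<otimes> w) \<otimes> \<gamma>" using dcv(1) e1(1)[symmetric] d(1) carr cd by (simp add: m_assoc)
    have 2: "w = (d \<otimes> w) \<otimes> \<delta>" using dcv(2) e1(2)[symmetric] d(1) carr cd by (simp add: m_assoc)
    have "w \<otimes> (k \<otimes> \<gamma>) = ((d \<otimes> w) \<otimes> \<delta>) \<otimes> (k \<otimes> \<gamma>)" using 2 by simp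
    also have "\<dots> = d \<otimes> (w \<otimes> ((\<delta> \<otimes> k) \<otimes> \<gamma>))" using d(1) carr cd(1,2) k(1) by (simp add: m_assoc)
    also have "\<dots> = v" using k(2) cd(4) 1 d(1) carr cd(1) by (simp add: m_assoc)
    finally show False using indep(1)[of "k \<otimes> \<gamma>"] k(1) cd(1) by simp
  next
    case False
    obtain b n where bn: "b \<in> carrier A" "n \<in> jmul A F (carrier F)" "y = n \<oplus>[F] b \<odot>[F] x"
      using gen_top[OF X x(1,2) False] by blast
    have n: "fst n \<in> carrier A" "snd n \<in> carrier A" "w \<otimes> fst n = \<zero>" "w \<otimes> snd n = \<zero>"
      using F.sub_mem[OF F.sub_jmul[OF subset_refl] bn(2)] kill[OF bn(2) w(1,2)] by (simp_all add: F_iff)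
    have y2: "\<gamma> = fst n \<oplus> b \<otimes> \<alpha>" "\<delta> = snd n \<oplus> b \<otimes> \<beta>" using bn(3) by (simp_all add: x' y')
    define r where "r = v \<oplus> w \<otimes> b"
    have r: "r \<in> carrier A" using carr bn by (simp add: r_def)
    have rJ: "r \<in> jac A" unfolding r_def by (rule L.J_add[OF v(1) L.J_mult_r[OF w(1) bn(1)]])
    have "w \<otimes> \<gamma> = w \<otimes> (b \<otimes> \<alpha>)" "w \<otimes> \<delta> = w \<otimes> (b \<otimes> \<beta>)"
      unfolding y2 using carr n bn(1) ab by (simp_all add: r_distr)
    then have "r \<otimes> \<alpha> = c \<otimes> v" "r \<otimes> \<beta> = c \<otimes> w" using eqs carr bn(1) ab by (simp_all add: r_def l_distr m_assoc)
    then have vr: "v = (d \<otimes> r) \<otimes> \<alpha>" "w = (d \<otimes> r) \<otimes> \<beta>" using dcv d(1) r ab carr by (simp_all add: m_assoc)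
    have "\<alpha> \<notin> jac A"
    proof
      assume aJ: "\<alpha> \<in> jac A"
      have "f \<otimes> ((d \<otimes> r) \<otimes> \<alpha>) = \<zero>" by (rule fJ2[OF L.J_mult_l[OF d(1) rJ] aJ])
      then show False using vr(1) v(2) ne by simp
    qed
    then obtain k where k: "k \<in> carrier A" "\<alpha> \<otimes> k = e" using prim_unit[OF e ab(1,2,4)] by metis
    have "v \<otimes> (k \<otimes> \<beta>) = ((d \<otimes> r) \<otimes> \<alpha>) \<otimes> (k \<otimes> \<beta>)" using vr by simp
    also have "\<dots> = d \<otimes> (r \<otimes> ((\<alpha> \<otimes> k) \<otimes> \<beta>))" using d(1) r ab(1,3) k(1) by (simp add: m_assoc)
    also have "\<dots> = w" using k(2) ab(3,5) vr(2) d(1) r by (simp add: m_assoc)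
    finally show False using indep(2)[of "k \<otimes> \<beta>"] k(1) ab(3) by simp
  qed
qed

text \<open>J^2 F is factored out together with A (v, w) because J^2 e' may be nonzero. By
  \<open>fJ2\<close> it is annihilated by f, so it contributes nothing to the elements of K fixed by
  f.\<close>

definition N2 where "N2 = jmul A F (jmul A F (carrier F))"

definition K where "K = N2 <+>[F] cyc A F (v, w)"

lemma vwF: "(v, w) \<in> carrier F" using v w carr by (simp add: F_iff)

lemma sub_N2: "submodule N2 A F" "N2 \<subseteq> jmul A F (carrier F)"
proof -
  have J: "submodule (jmul A F (carrier F)) A F" by (rule F.sub_jmul[OF subset_refl])
  show "submodule N2 A F" "N2 \<subseteq> jmul A F (carrier F)" unfolding N2_def by (rule F.sub_jmul'[OF J], rule F.jmul_subset[OF J])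
qed

lemma sub_K: "submodule K A F" "N2 \<subseteq> K" "cyc A F (v, w) \<subseteq> K" "(v, w) \<in> K"
  unfolding K_def using F.sub_sum[OF sub_N2(1) F.sub_cyc[OF vwF]] F.sum_upper[OF sub_N2(1) F.sub_cyc[OF vwF]]
    F.cyc_self[OF vwF] by blast+

lemma N2_kill: "x \<in> N2 \<Longrightarrow> f \<odot>[F] x = (\<zero>, \<zero>)"
  unfolding N2_def
proof (induction rule: jmul.induct)
  case (elem j x)
  have "f \<otimes> (j \<otimes> fst x) = \<zero>" "f \<otimes> (j \<otimes> snd x) = \<zero>" using JF_comp[OF elem(2)] fJ2[OF elem(1)] by simp_all
  then show ?case by simp
next
  case (add x y)
  have J: "submodule (jmul A F (jmul A F (carrier F))) A F" using sub_N2 by (simp add: N2_def)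
  have "x \<in> carrier F" "y \<in> carrier F" using add.hyps F.sub_mem[OF J] by simp_all
  then show ?case using add.IH carr by (simp add: F_iff r_distr)
qed (simp add: carr)

text \<open>f annihilates \<open>N2\<close>, and v = f v and w = f w, so only the corner f a f of
  the coefficient a survives.\<close>

lemma K_f:
  assumes "z \<in> K" "f \<odot>[F] z = z"
  obtains c where "c \<in> carrier A" "f \<otimes> c = c" "c \<otimes> f = c" "z = c \<odot>[F] (v, w)"
proof -
  obtain n a where na: "n \<in> N2" "a \<in> carrier A" "z = n \<oplus>[F] a \<odot>[F] (v, w)"
    using assms(1) unfolding K_def F.mem_sum_cyc by blast
  have n: "fst n \<in> carrier A" "snd n \<in> carrier A" "f \<otimes> fst n = \<zero>" "f \<otimes> snd n = \<zero>"
    using F.sub_mem[OF sub_N2(1) na(1)] N2_kill[OF na(1)] by (simp_all add: F_iff)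
  have "z = f \<odot>[F] z" using assms(2) by simp
  also have "\<dots> = (f \<otimes> (a \<otimes> v), f \<otimes> (a \<otimes> w))" using na n carr by (simp add: r_distr)
  also have "\<dots> = (f \<otimes> (a \<otimes> (f \<otimes> v)), f \<otimes> (a \<otimes> (f \<otimes> w)))" using v w by simp
  also have "\<dots> = (f \<otimes> a \<otimes> f) \<odot>[F] (v, w)" using na(2) carr by (simp add: m_assoc)
  finally have z: "z = (f \<otimes> a \<otimes> f) \<odot>[F] (v, w)" .
  have "f \<otimes> (f \<otimes> a \<otimes> f) = f \<otimes> f \<otimes> a \<otimes> f" "f \<otimes> a \<otimes> f \<otimes> f = f \<otimes> a \<otimes> (f \<otimes> f)" using na(2) carr by (simp_all only: m_assoc m_closed)
  then show thesis using that[of "f \<otimes> a \<otimes> f"] z na(2) carr idem by simp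
qed

text \<open>Split (e, 0) and (0, e') along F = X + Y. The corresponding combinations p in X and q in
  Y add up to (v, w), which lies in both X and Y, so p lies in K. Hence p = k (v, w) and q = (f - k)
  (v, w) with k in f A f. As k and f - k cannot both be in J, \<open>proper_part\<close> applies to
  X or to Y.\<close>

lemma K_indec:
  assumes X: "submodule X A F" "X \<noteq> carrier F" and Y: "submodule Y A F" "Y \<noteq> carrier F"
    and XY: "X <+>[F] Y = carrier F" "X \<inter> Y = K"
  shows False
proof -
  have dec: "\<exists>x y. x \<in> X \<and> y \<in> Y \<and> g \<odot>[F] x = x \<and> g \<odot>[F] y = y \<and> z = x \<oplus>[F] y"
    if g: "g \<in> carrier A" "g \<otimes> g = g" and z: "z \<in> carrier F" "g \<odot>[F] z = z" for g z
  proof -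
    have "z \<in> X <+>[F] Y" using XY(1) z by simp
    then obtain x y where xy: "x \<in> X" "y \<in> Y" "z = x \<oplus>[F] y" unfolding F.mem_set_add by blast
    have c: "x \<in> carrier F" "y \<in> carrier F" using xy X Y F.sub_mem by blast+
    have "z = g \<odot>[F] x \<oplus>[F] g \<odot>[F] y" using z(2) xy(3) F.smult_r_distr[OF g(1) c] by simp
    moreover have "g \<odot>[F] (g \<odot>[F] x) = g \<odot>[F] x" "g \<odot>[F] (g \<odot>[F] y) = g \<odot>[F] y"
      using F.smult_assoc[OF g(1,1) c(1)] F.smult_assoc[OF g(1,1) c(2)] g(2) by simp_all
    ultimately show ?thesis using F.sub_smult[OF X(1) g(1) xy(1)] F.sub_smult[OF Y(1) g(1) xy(2)] by blast
  qed
  have "(e, \<zero>) \<in> carrier F" "e \<odot>[F] (e, \<zero>) = (e, \<zero>)" using carr idem by (simp_all add: F_iff)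
  then obtain x1 y1 where 1: "x1 \<in> X" "y1 \<in> Y" "e \<odot>[F] x1 = x1" "e \<odot>[F] y1 = y1" "(e, \<zero>) = x1 \<oplus>[F] y1"
    using dec[OF carr(1) idem(1)] by blast
  have "(\<zero>, e') \<in> carrier F" "e' \<odot>[F] (\<zero>, e') = (\<zero>, e')" using carr idem by (simp_all add: F_iff)
  then obtain x2 y2 where 2: "x2 \<in> X" "y2 \<in> Y" "e' \<odot>[F] x2 = x2" "e' \<odot>[F] y2 = y2" "(\<zero>, e') = x2 \<oplus>[F] y2"
    using dec[OF carr(2) idem(2)] by blast
  have c: "x1 \<in> carrier F" "x2 \<in> carrier F" "y1 \<in> carrier F" "y2 \<in> carrier F"
    using 1 2 X Y F.sub_mem by blast+
  define p where "p = v \<odot>[F] x1 \<oplus>[F] w \<odot>[F] x2"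
  define q where "q = v \<odot>[F] y1 \<oplus>[F] w \<odot>[F] y2"
  have pX: "p \<in> X" unfolding p_def by (intro F.sub_add[OF X(1)] F.sub_smult[OF X(1)] carr 1 2)
  have qY: "q \<in> Y" unfolding q_def by (intro F.sub_add[OF Y(1)] F.sub_smult[OF Y(1)] carr 1 2)
  have pF: "p \<in> carrier F" "q \<in> carrier F" using pX qY X Y F.sub_mem by blast+
  have vw: "v \<odot>[F] (e, \<zero>) \<oplus>[F] w \<odot>[F] (\<zero>, e') = (v, w)" using carr v w by simp
  have pq': "v \<odot>[F] (x1 \<oplus>[F] y1) \<oplus>[F] w \<odot>[F] (x2 \<oplus>[F] y2) = p \<oplus>[F] q"
    unfolding p_def q_def using carr c by (simp only: F.smult_r_distr F.smult_closed F.M.a_ac F.M.a_closed)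
  have pq: "p \<oplus>[F] q = (v, w)" using vw unfolding 1(5) 2(5) pq' .
  have "p = (v, w) \<ominus>[F] q" using F.minus_add_cancel(3)[OF pF] pq by simp
  moreover have vwXY: "(v, w) \<in> X" "(v, w) \<in> Y" using sub_K(4) XY(2) by blast+
  ultimately have "p \<in> Y" using F.sub_minus[OF Y(1) vwXY(2) qY] by simp
  then have pK: "p \<in> K" using pX XY(2) by blast
  have fv: "f \<odot>[F] (a \<odot>[F] z) = a \<odot>[F] z" if "f \<otimes> a = a" "a \<in> carrier A" "z \<in> carrier F" for a z
    using F.smult_assoc[OF carr(3) that(2,3)] that(1) by simp
  have fp: "f \<odot>[F] p = p" unfolding p_def
    using F.smult_r_distr[of f "v \<odot>[F] x1" "w \<odot>[F] x2"] fv[OF v(2) carr(4) c(1)] fv[OF w(2) carr(5) c(2)] F.smult_closed carr c by simp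
  obtain k where k: "k \<in> carrier A" "f \<otimes> k = k" "k \<otimes> f = k" "p = k \<odot>[F] (v, w)" by (rule K_f[OF pK fp])
  show False
  proof (cases "k \<in> jac A")
    case False
    show False by (rule proper_part[OF X 1(1) 2(1) 1(3) 2(3) k(1,2,3) False]) (use k(4) in \<open>simp only: p_def\<close>)
  next
    case True
    interpret L: left_module A "regular_module A" by (rule lm)
    have fk: "f \<ominus> k \<in> carrier A" "f \<otimes> (f \<ominus> k) = f \<ominus> k" "(f \<ominus> k) \<otimes> f = f \<ominus> k"
      using k carr idem by (simp_all add: a_minus_def r_distr l_distr l_minus r_minus)
    have nJ: "f \<ominus> k \<notin> jac A"
    proof
      assume "f \<ominus> k \<in> jac A"
      then have "(f \<ominus> k) \<oplus> k \<in> jac A" using L.J_add True by blast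
      moreover have "(f \<ominus> k) \<oplus> k = f" using k carr by (simp add: a_minus_def a_assoc l_neg)
      ultimately show False using prim_not_J[OF f] by simp
    qed
    have "q = (v, w) \<ominus>[F] p" using F.minus_add_cancel(4)[OF pF(2,1)] pq by simp
    also have "\<dots> = f \<odot>[F] (v, w) \<ominus>[F] k \<odot>[F] (v, w)" using k(4) v w by simp
    also have "\<dots> = (f \<ominus> k) \<odot>[F] (v, w)" using F.smult_minus_l[OF carr(3) k(1) vwF] by simp
    finally have "v \<odot>[F] y1 \<oplus>[F] w \<odot>[F] y2 = (f \<ominus> k) \<odot>[F] (v, w)" unfolding q_def .
    then show False by (rule proper_part[OF Y 1(2) 2(2) 1(4) 2(4) fk nJ])
  qed
qed

end

section \<open>The quotient of the amalgam: indecomposability and length\<close>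

context amalgam begin

abbreviation "Q \<equiv> quotient_module F K"

lemma vw_J: "(v, w) \<in> jmul A F (carrier F)"
proof -
  have "(e, \<zero>) \<in> carrier F" "(\<zero>, e') \<in> carrier F" using carr idem by (simp_all add: F_iff)
  then have "v \<odot>[F] (e, \<zero>) \<oplus>[F] w \<odot>[F] (\<zero>, e') \<in> jmul A F (carrier F)"
    by (intro jmul.add jmul.elem v w)
  then show ?thesis using carr v w by simp
qed

lemma cyc_vw: "cyc A F (v, w) \<subseteq> jmul A F (carrier F)"
  by (rule F.cyc_least[OF F.sub_jmul[OF subset_refl] vw_J])

lemma K_proper: "K \<noteq> carrier F"
proof -
  have "(e, \<zero>) \<in> carrier F" using carr idem by (simp add: F_iff)
  moreover have "e \<noteq> \<zero>" by (rule primD(2)[OF e])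
  ultimately have "carrier F \<noteq> {\<zero>[F]}" by auto
  then have "jmul A F (carrier F) \<subset> carrier F" by (rule F.jmul_proper[OF F.sub_carrier fin_F])
  moreover have "K \<subseteq> jmul A F (carrier F)" unfolding K_def
    by (rule F.sum_least[OF F.sub_jmul[OF subset_refl] sub_N2(2) cyc_vw])
  ultimately show ?thesis by blast
qed

text \<open>A decomposition of the quotient lifts to submodules of F with sum F and intersection K.
  By \<open>K_indec\<close> one of them is F, and then the other one is K.\<close>

lemma Q_indecomposable: "indecomposable A Q"
proof -
  interpret p: lhom A F Q "\<lambda>x. K +>[F] x" by (rule F.lhom_quotient[OF sub_K(1)])
  have k: "p.ker = K" by (rule F.ker_quotient[OF sub_K(1)])
  have surj: "(\<lambda>x. K +>[F] x) ` carrier F = carrier Q" using F.quotient(3)[OF sub_K(1)] by simp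
  have "p.pre {\<zero>[Q]} = p.ker" unfolding p.pre_def p.ker_def by simp
  then have pre0: "p.pre {\<zero>[Q]} = K" using k by (rule trans)
  show ?thesis
    unfolding indecomposable_alt
  proof (intro conjI allI impI)
    show "carrier Q \<noteq> {\<zero>[Q]}"
    proof
      assume Q0: "carrier Q = {\<zero>[Q]}"
      have "x \<in> K" if x: "x \<in> carrier F" for x
      proof -
        have "x \<in> p.pre {\<zero>[Q]}" using p.closed[OF x] x unfolding Q0 p.pre_iff by (rule conjI[rotated])
        then show ?thesis unfolding pre0 .
      qed
      then show False using K_proper F.sub_subset[OF sub_K(1)] by blast
    qed
    fix X Y assume X: "submodule X A Q" and Y: "submodule Y A Q" and s: "X <+>[Q] Y = carrier Q" and i: "X \<inter> Y = {\<zero>[Q]}"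
    have pX: "submodule (p.pre X) A F" and pY: "submodule (p.pre Y) A F" by (rule p.sub_pre[OF X], rule p.sub_pre[OF Y])
    have sum: "p.pre X <+>[F] p.pre Y = carrier F" by (rule p.pre_sum[OF surj X Y s])
    have "p.pre X \<inter> p.pre Y = p.pre (X \<inter> Y)" by (auto simp: p.pre_def)
    then have int: "p.pre X \<inter> p.pre Y = K" using i pre0 by simp
    have img: "(\<lambda>x. K +>[F] x) ` p.pre Z = Z" if "submodule Z A Q" for Z
      using p.image_pre p.cod.sub_subset[OF that] surj by simp
    have zero: "Z = {\<zero>[Q]}" if Z: "submodule Z A Q" "p.pre Z = K" for Z
    proof -
      have "Z = (\<lambda>x. K +>[F] x) ` p.pre {\<zero>[Q]}" using img[OF Z(1)] Z(2) pre0 by simp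
      also have "\<dots> = {\<zero>[Q]}" by (rule img[OF p.cod.sub_0])
      finally show ?thesis .
    qed
    have "p.pre X = carrier F \<or> p.pre Y = carrier F" using K_indec[OF pX _ pY _ sum int] by blast
    then show "X = {\<zero>[Q]} \<or> Y = {\<zero>[Q]}"
    proof
      assume "p.pre X = carrier F"
      then have "p.pre Y = K" using int F.sub_subset[OF pY] by blast
      then show ?thesis using zero[OF Y] by blast
    next
      assume "p.pre Y = carrier F"
      then have "p.pre X = K" using int F.sub_subset[OF pX] by blast
      then show ?thesis using zero[OF X] by blast
    qed
  qed
qed

text \<open>Modulo J^2 the factor A e contributes at least 3, and A e' at least 2 because w is a
  nonzero element of J e'. K exceeds J^2 F by at most 1, since A (v, w) is local and its radical
  lies in J^2 F. This leaves 5 - 1.\<close>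

lemma mlen_Q:
  assumes three: "3 \<le> il A (pim A e) (jmul A (pim A e) (jmul A (pim A e) (carrier (pim A e)))) (carrier (pim A e))"
  shows "4 \<le> mlen A Q" "mlen A Q < \<infinity>" "left_module A Q"
proof -
  interpret p: lhom A F Q "\<lambda>x. K +>[F] x" by (rule F.lhom_quotient[OF sub_K(1)])
  show "left_module A Q" by (rule p.cod.left_module_axioms)
  have k: "p.ker = K" by (rule F.ker_quotient[OF sub_K(1)])
  have surj: "(\<lambda>x. K +>[F] x) ` carrier F = carrier Q" using F.quotient(3)[OF sub_K(1)] by simp
  have "mlen A Q \<le> mlen A F" using p.il_image_le[OF F.sub_carrier] surj by simp
  then show fin: "mlen A Q < \<infinity>" using fin_F by (rule le_less_trans)
  have kF: "il A F {\<zero>[F]} (carrier F) = il A F {\<zero>[F]} K + mlen A Q"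
    using p.il_ker_image[OF F.sub_carrier] surj k F.sub_subset[OF sub_K(1)] by (simp only: Int_absorb2)
  let ?P = "carrier (pim A e)" and ?P' = "carrier (pim A e')"
  let ?B = "jmul A (pim A e) (jmul A (pim A e) ?P)" and ?B' = "jmul A (pim A e') (jmul A (pim A e') ?P')"
  have J: "submodule (jmul A (pim A e) ?P) A (pim A e)" "submodule (jmul A (pim A e') ?P') A (pim A e')"
    by (rule P.sub_jmul[OF subset_refl], rule P'.sub_jmul[OF subset_refl])
  have B: "submodule ?B A (pim A e)" "submodule ?B' A (pim A e')"
    by (rule P.sub_jmul'[OF J(1)], rule P'.sub_jmul'[OF J(2)])
  have BP: "?B \<subseteq> ?P" "?B' \<subseteq> ?P'" by (rule P.sub_subset[OF B(1)], rule P'.sub_subset[OF B(2)])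
  interpret f1: lhom A F "pim A e" fst unfolding F_def by (rule lhom_fst[OF lm(1,2)])
  interpret f2: lhom A F "pim A e'" snd unfolding F_def by (rule lhom_snd[OF lm(1,2)])
  have c0: "(x, \<zero>) \<in> carrier F" if "x \<in> ?P" for x using that carr idem by (simp add: F_iff cyc_idem)
  have c0': "(\<zero>, x) \<in> carrier F" if "x \<in> ?P'" for x using that carr idem by (simp add: F_iff cyc_idem)
  have im1: "fst ` carrier F = ?P"
  proof
    show "?P \<subseteq> fst ` carrier F" using image_eqI[OF _ c0, of _ fst] by (intro subsetI) simp
  qed (use f1.closed in blast)
  have im2: "snd ` carrier F = ?P'"
  proof
    show "?P' \<subseteq> snd ` carrier F" using image_eqI[OF _ c0', of _ snd] by (intro subsetI) simp
  qed (use f2.closed in blast)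
  have J_F: "jmul A F (carrier F) \<subseteq> carrier F" by (rule F.jmul_subset[OF F.sub_carrier])
  have "fst ` N2 = ?B" unfolding N2_def using f1.image_jmul[OF J_F] f1.image_jmul[OF subset_refl] im1 by simp
  moreover have "snd ` N2 = ?B'" unfolding N2_def using f2.image_jmul[OF J_F] f2.image_jmul[OF subset_refl] im2 by simp
  ultimately have N2B: "N2 \<subseteq> ?B \<times> ?B'" by (metis image_eqI mem_Times_iff subsetI)
  have "il A F (?B \<times> ?B') (?P \<times> ?P') = il A F (?B \<times> ?B') (?B \<times> ?P') + il A F (?B \<times> ?P') (?P \<times> ?P')"
    unfolding F_def by (intro left_module.il_add[OF left_module_prod] lm sub_Times B P.sub_carrier P'.sub_carrier Sigma_mono subset_refl BP)
  moreover have "il A F (?B \<times> ?B') (?B \<times> ?P') = il A (pim A e') ?B' ?P'"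
    unfolding F_def by (rule il_Times_snd[OF lm(1,2) B(2) P'.sub_carrier BP(2) B(1)])
  moreover have "il A F (?B \<times> ?P') (?P \<times> ?P') = il A (pim A e) ?B ?P"
    unfolding F_def by (rule il_Times_fst[OF lm(1,2) B(1) P.sub_carrier BP(1) P'.sub_carrier])
  moreover have "2 \<le> il A (pim A e') ?B' ?P'"
  proof -
    have "w \<in> jmul A (pim A e') ?P'" using jmul_pim(2)[OF e', of w] w by simp
    then have "jmul A (pim A e') ?P' \<noteq> {\<zero>[pim A e']}" using ne by auto
    then have s: "?B' \<subset> jmul A (pim A e') ?P'" by (rule P'.jmul_proper[OF J(2) finP(2)])
    have "il A (pim A e') ?B' ?B' + 1 \<le> il A (pim A e') ?B' (jmul A (pim A e') ?P')"
      by (rule P'.il_strict[OF B(2) B(2) J(2) subset_refl s])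
    moreover have "il A (pim A e') ?B' (jmul A (pim A e') ?P') + 1 \<le> il A (pim A e') ?B' ?P'"
      by (rule P'.il_strict[OF B(2) J(2) P'.sub_carrier]) (use s jmul_pim(1)[OF e'] in \<open>auto simp: covers_def\<close>)
    ultimately show ?thesis
      by (cases "il A (pim A e') ?B' ?B'"; cases "il A (pim A e') ?B' (jmul A (pim A e') ?P')"; cases "il A (pim A e') ?B' ?P'")
        (auto simp: one_enat_def numeral_eq_enat)
  qed
  ultimately have five: "5 \<le> il A F (?B \<times> ?B') (?P \<times> ?P')" using three
    by (cases "il A (pim A e') ?B' ?P'"; cases "il A (pim A e) ?B ?P") (auto simp: numeral_eq_enat)
  have "il A F (?B \<times> ?B') (?P \<times> ?P') \<le> il A F N2 (carrier F)"
    using N2B by (intro F.il_mono) (simp_all add: F_def)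
  then have N2F: "5 \<le> il A F N2 (carrier F)" using five by (rule order_trans[rotated])
  have "il A F N2 K \<le> 1"
  proof -
    let ?C = "cyc A F (v, w)"
    have C: "submodule ?C A F" by (rule F.sub_cyc[OF vwF])
    have "K = ?C <+>[F] N2" unfolding K_def by (rule F.sum_comm[OF sub_N2(1) C])
    then have "il A F N2 K = il A F (?C \<inter> N2) ?C" using F.il_diamond[OF C sub_N2(1)] by simp
    moreover have "jmul A F ?C \<subseteq> ?C \<inter> N2" using F.jmul_subset[OF C] F.jmul_mono[OF cyc_vw J_F] unfolding N2_def by blast
    then have "il A F (?C \<inter> N2) ?C \<le> il A F (jmul A F ?C) ?C" by (intro F.il_mono subset_refl)
    moreover have "covers A F (jmul A F ?C) ?C"
      using ne v w by (intro F.covers_local[OF f vwF]) simp_all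
    ultimately show ?thesis using F.il_covers by simp
  qed
  moreover have "il A F {\<zero>[F]} K = il A F {\<zero>[F]} N2 + il A F N2 K"
    by (rule F.il_add[OF F.sub_0 sub_N2(1) sub_K(1) _ sub_K(2)]) (use F.sub_zero[OF sub_N2(1)] in blast)
  moreover have "il A F {\<zero>[F]} (carrier F) = il A F {\<zero>[F]} N2 + il A F N2 (carrier F)"
    by (rule F.il_add[OF F.sub_0 sub_N2(1) F.sub_carrier _ F.sub_subset[OF sub_N2(1)]]) (use F.sub_zero[OF sub_N2(1)] in blast)
  ultimately show "4 \<le> mlen A Q" using kF N2F fin fin_F
    by (cases "il A F {\<zero>[F]} N2"; cases "il A F N2 K"; cases "il A F N2 (carrier F)"; cases "mlen A Q"; cases "mlen A F")
      (auto simp: one_enat_def numeral_eq_enat)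
qed

end

section \<open>Commutative artinian rings have finite length\<close>

lemma (in cring) sub_regular_iff: "submodule I R (regular_module R) \<longleftrightarrow> ideal I R"
proof -
  interpret L: left_module R "regular_module R" by (rule left_module_regular)
  show ?thesis
  proof
    assume I: "submodule I R (regular_module R)"
    have c: "x \<in> carrier R" if "x \<in> I" for x using L.sub_mem[OF I that] by simp
    have s: "a \<otimes> x \<in> I" if "a \<in> carrier R" "x \<in> I" for a x using L.sub_smult[OF I that] by simp
    have n: "\<ominus> x \<in> I" if "x \<in> I" for x using s[of "\<ominus> \<one>" x] c[OF that] that by (simp add: l_minus)
    have z: "\<zero> \<in> I" using L.sub_zero[OF I] by simp
    have a: "x \<oplus> y \<in> I" if "x \<in> I" "y \<in> I" for x y using L.sub_add[OF I that] by simp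
    have s': "x \<otimes> a \<in> I" if "a \<in> carrier R" "x \<in> I" for a x using s[OF that] m_comm[OF c[OF that(2)] that(1)] by simp
    show "ideal I R"
    proof (rule idealI[OF ring_axioms])
      show "subgroup I (add_monoid R)"
        by (rule subgroup.intro) (use c n z a in \<open>auto simp: a_inv_def[symmetric]\<close>)
    qed (use s s' in blast)+
  next
    assume "ideal I R"
    then interpret I: ideal I R .
    show "submodule I R (regular_module R)"
      unfolding L.sub_iff using I.Icarr I.I_l_closed I.zero_closed I.a_closed by auto
  qed
qed

text \<open>Without a minimal ideal, dependent choice would produce a strictly descending sequence
  of ideals with property P.\<close>

lemma (in cring) artinian_minimal:
  assumes art: "artinian_ring R" and P: "P I0" "ideal I0 R"
  shows "\<exists>I. ideal I R \<and> P I \<and> (\<forall>K. ideal K R \<longrightarrow> K \<subset> I \<longrightarrow> \<not> P K)"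
proof (rule ccontr)
  assume *: "\<not> ?thesis"
  define S where "S I \<longleftrightarrow> ideal I R \<and> P I" for I
  have step: "\<exists>K. S K \<and> K \<subset> I" if "S I" for I using * that unfolding S_def by blast
  have "\<exists>c. \<forall>n. S (c n) \<and> c (Suc n) \<subset> c n"
  proof (rule dependent_nat_choice[where P = "\<lambda>_. S" and Q = "\<lambda>_ I K. K \<subset> I"])
    show "\<exists>I. S I" using P by (intro exI[of _ I0]) (simp add: S_def)
  qed (rule step)
  then obtain c :: "nat \<Rightarrow> 'a set" where c': "\<forall>n. S (c n) \<and> c (Suc n) \<subset> c n" ..
  have c: "S (c n)" "c (Suc n) \<subset> c n" for n using c' by blast+
  have "\<forall>n. ideal (c n) R \<and> c (Suc n) \<subseteq> c n" using c unfolding S_def by (simp add: psubset_eq)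
  from art[unfolded artinian_ring_def, THEN spec, THEN mp, OF this] obtain k where "\<forall>n\<ge>k. c n = c k" ..
  then have "k \<le> Suc k \<longrightarrow> c (Suc k) = c k" by (rule spec)
  then have "c (Suc k) = c k" by simp
  then show False using c(2)[of k] by simp
qed

lemma (in left_module) smult_pow_surj:
  assumes "r \<in> carrier A" "I \<subseteq> carrier M" "(\<lambda>x. r \<odot>[M] x) ` I = I" "x \<in> I"
  shows "\<exists>y\<in>I. x = (r [^] (k::nat)) \<odot>[M] y"
  using assms(4)
proof (induction k arbitrary: x)
  case 0
  then show ?case using assms(2) by (intro bexI[of _ x]) (auto simp: smult_one)
next
  case (Suc k)
  obtain y where y: "y \<in> I" "x = (r [^] k) \<odot>[M] y" using Suc by blast
  obtain z where z: "z \<in> I" "y = r \<odot>[M] z" using y(1) assms(3) by blast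
  have "x = (r [^] Suc k) \<odot>[M] z" using y z assms(1,2) by (auto simp: smult_assoc)
  then show ?case using z(1) by blast
qed

text \<open>A minimal ideal \<open>I\<close> of infinite length has the property that each ring element acts on it as zero
  or surjectively, so it is a vector space over a field; a hyperplane in it has finite length.\<close>

lemma (in cring) artinian_finite_length:
  assumes art: "artinian_ring R"
  shows "mlen R (regular_module R) < \<infinity>"
proof (rule ccontr)
  assume inf: "\<not> ?thesis"
  interpret L: left_module R "regular_module R" by (rule left_module_regular)
  let ?M = "regular_module R"
  have "ideal (carrier R) R" using L.sub_carrier sub_regular_iff by simp
  then obtain I where I: "ideal I R" "\<not> il R ?M {\<zero>} I < \<infinity>" "\<forall>K. ideal K R \<longrightarrow> K \<subset> I \<longrightarrow> \<not> \<not> il R ?M {\<zero>} K < \<infinity>"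
    using artinian_minimal[OF art, of "\<lambda>I. \<not> il R ?M {\<zero>} I < \<infinity>" "carrier R"] inf by auto
  have sI: "submodule I R ?M" using I(1) sub_regular_iff by simp
  have IR: "I \<subseteq> carrier R" using L.sub_subset[OF sI] by simp
  have small: "il R ?M {\<zero>} K < \<infinity>" if "submodule K R ?M" "K \<subset> I" for K
    using I(3) that sub_regular_iff by simp
  \<comment> \<open>If r does not annihilate I, its kernel in I is a smaller ideal and has finite
    length. So r I has infinite length and must be I.\<close>
  have act: "(\<lambda>x. r \<otimes> x) ` I = {\<zero>} \<or> (\<lambda>x. r \<otimes> x) ` I = I" if r: "r \<in> carrier R" for r
  proof -
    have "(\<lambda>x. r \<otimes> x) \<in> module_homs R ?M ?M"
      using r by (simp add: module_homs_def r_distr m_lcomm)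
    then interpret g: lhom R ?M ?M "\<lambda>x. r \<otimes> x" by (rule L.hom_lhom[OF left_module_regular])
    have k: "submodule (g.ker \<inter> I) R ?M" by (rule L.sub_Int[OF g.sub_ker sI])
    have eq: "il R ?M {\<zero>} I = il R ?M {\<zero>} (g.ker \<inter> I) + il R ?M {\<zero>} ((\<lambda>x. r \<otimes> x) ` I)"
      using g.il_ker_image[OF sI] by simp
    have sub: "(\<lambda>x. r \<otimes> x) ` I \<subseteq> I" using L.sub_smult[OF sI r] by auto
    show ?thesis
    proof (cases "g.ker \<inter> I = I")
      case True
      then have "r \<otimes> x = \<zero>" if "x \<in> I" for x using that by (auto simp: g.ker_iff)
      moreover have "\<zero> \<in> I" using L.sub_zero[OF sI] by simp
      ultimately have "(\<lambda>x. r \<otimes> x) ` I = {\<zero>}" by auto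
      then show ?thesis ..
    next
      case False
      then have "il R ?M {\<zero>} (g.ker \<inter> I) < \<infinity>" using small[OF k] by blast
      then have "\<not> il R ?M {\<zero>} ((\<lambda>x. r \<otimes> x) ` I) < \<infinity>" using eq I(2)
        by (cases "il R ?M {\<zero>} (g.ker \<inter> I)"; cases "il R ?M {\<zero>} ((\<lambda>x. r \<otimes> x) ` I)") simp_all
      then have "\<not> (\<lambda>x. r \<otimes> x) ` I \<subset> I" using small[OF g.sub_image[OF sI]] by blast
      then show ?thesis using sub by blast
    qed
  qed
  \<comment> \<open>The ideals generated by the powers of r become stationary, say r^k = s r^(k+1).
    Since r I = I, each x in I is r^k z with z in I, and so s r x = x.\<close>
  have inv: "\<exists>s\<in>carrier R. \<forall>x\<in>I. s \<otimes> (r \<otimes> x) = x" if r: "r \<in> carrier R" and y: "y \<in> I" "r \<otimes> y \<noteq> \<zero>" for r y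
  proof -
    have rI: "(\<lambda>x. r \<otimes> x) ` I = I" using act[OF r] y by auto
    define c where "c k = cyc R ?M (r [^] (k::nat))" for k
    have "ideal (c k) R" for k unfolding c_def using sub_regular_iff sub_cyc_reg r by simp
    moreover have "c (Suc k) \<subseteq> c k" for k
    proof -
      have "r [^] Suc k = r \<otimes> r [^] k" using r by (simp add: m_comm)
      then have "r [^] Suc k \<in> c k" using r unfolding c_def by (simp add: cyc_regular del: nat_pow_Suc)
      then show ?thesis unfolding c_def using L.cyc_least[OF sub_cyc_reg] r by simp
    qed
    ultimately have "\<forall>n. ideal (c n) R \<and> c (Suc n) \<subseteq> c n" by simp
    from art[unfolded artinian_ring_def, THEN spec, THEN mp, OF this] obtain k where k: "\<forall>n\<ge>k. c n = c k" ..
    from k have "k \<le> Suc k \<longrightarrow> c (Suc k) = c k" by (rule spec)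
    then have ck: "c (Suc k) = c k" by simp
    have "r [^] k \<in> c k" using L.cyc_self[of "r [^] k"] r unfolding c_def by simp
    then have "r [^] k \<in> c (Suc k)" using ck by simp
    then obtain s where s: "s \<in> carrier R" "r [^] k = s \<otimes> r [^] Suc k" unfolding c_def cyc_regular by blast
    have "s \<otimes> (r \<otimes> x) = x" if x: "x \<in> I" for x
    proof -
      obtain z where z: "z \<in> I" "x = r [^] k \<otimes> z" using L.smult_pow_surj[OF r, of I x k] IR rI x by auto
      have zR: "z \<in> carrier R" using z IR by blast
      have "s \<otimes> (r \<otimes> x) = (s \<otimes> r [^] Suc k) \<otimes> z" using z(2) zR s(1) r by (simp add: m_assoc m_lcomm m_comm)
      then show ?thesis using s(2) z(2) by (simp only:)
    qed
    then show ?thesis using s(1) by blast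
  qed
  have "I \<noteq> {\<zero>}" using I(2) L.il_refl by auto
  then obtain x where x: "x \<in> I" "x \<noteq> \<zero>" using L.sub_zero[OF sI] by auto
  have xR: "x \<in> carrier R" using x IR by blast
  have cov: "covers R ?M {\<zero>} (cyc R ?M x)"
  proof -
    have sc: "submodule (cyc R ?M x) R ?M" by (rule sub_cyc_reg[OF xR])
    have xc: "x \<in> cyc R ?M x" using L.cyc_self[of x] xR by simp
    have "K = {\<zero>} \<or> K = cyc R ?M x" if K: "submodule K R ?M" "K \<subseteq> cyc R ?M x" for K
    proof (rule disjCI)
      assume ne: "K \<noteq> cyc R ?M x"
      show "K = {\<zero>}"
      proof (rule ccontr)
        assume "K \<noteq> {\<zero>}"
        then obtain y where y: "y \<in> K" "y \<noteq> \<zero>" using L.sub_zero[OF K(1)] by auto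
        obtain a where a: "a \<in> carrier R" "y = a \<otimes> x" using y K(2) unfolding cyc_regular by blast
        obtain s where s: "s \<in> carrier R" "\<forall>x\<in>I. s \<otimes> (a \<otimes> x) = x" using inv[OF a(1) x(1)] a(2) y(2) by blast
        have "s \<otimes> y \<in> K" using L.sub_smult[OF K(1) s(1) y(1)] by simp
        then have "x \<in> K" using s(2) x(1) a(2) by simp
        then have "cyc R ?M x \<subseteq> K" by (rule L.cyc_least[OF K(1)])
        then show False using K(2) ne by blast
      qed
    qed
    moreover have "{\<zero>} \<subset> cyc R ?M x" using L.sub_zero[OF sc] xc x(2) by auto
    ultimately show ?thesis unfolding covers_def using sc L.sub_0 by simp
  qed
  \<comment> \<open>A maximal element of this family is the hyperplane. Zorn's lemma is used because
    I has infinite length.\<close>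
  define \<A> where "\<A> = {C. submodule C R ?M \<and> C \<subseteq> I \<and> x \<notin> C}"
  have "\<exists>C\<in>\<A>. \<forall>X\<in>\<A>. C \<subseteq> X \<longrightarrow> X = C"
  proof (rule subset_Zorn_nonempty)
    have "{\<zero>} \<in> \<A>" unfolding \<A>_def using L.sub_0 L.sub_zero[OF sI] x by simp
    then show "\<A> \<noteq> {}" by blast
    fix \<C> assume C: "\<C> \<noteq> {}" "subset.chain \<A> \<C>"
    have CA: "\<C> \<subseteq> \<A>" and ch: "\<And>X Y. X \<in> \<C> \<Longrightarrow> Y \<in> \<C> \<Longrightarrow> X \<subseteq> Y \<or> Y \<subseteq> X"
      using C(2) unfolding subset_chain_def by blast+
    have sub: "submodule X R ?M" if "X \<in> \<C>" for X using CA that unfolding \<A>_def by blast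
    have "submodule (\<Union>\<C>) R ?M"
      unfolding L.sub_iff
    proof (intro conjI ballI)
      show "\<Union>\<C> \<subseteq> carrier ?M" using L.sub_subset[OF sub] by blast
      show "\<zero>[?M] \<in> \<Union>\<C>" using C(1) L.sub_zero[OF sub] by blast
      show "a \<odot>[?M] y \<in> \<Union>\<C>" if "a \<in> carrier R" "y \<in> \<Union>\<C>" for a y using that L.sub_smult[OF sub] by blast
      fix y z assume "y \<in> \<Union>\<C>" "z \<in> \<Union>\<C>"
      then obtain Y Z where YZ: "Y \<in> \<C>" "Z \<in> \<C>" "y \<in> Y" "z \<in> Z" by blast
      then obtain W where "W \<in> \<C>" "y \<in> W" "z \<in> W" using ch[OF YZ(1,2)] by blast
      then show "y \<oplus>[?M] z \<in> \<Union>\<C>" using L.sub_add[OF sub] by blast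
    qed
    then show "\<Union>\<C> \<in> \<A>" using CA unfolding \<A>_def by blast
  qed
  then obtain C where C: "submodule C R ?M" "C \<subseteq> I" "x \<notin> C" "\<forall>X\<in>\<A>. C \<subseteq> X \<longrightarrow> X = C" unfolding \<A>_def by blast
  have sc: "submodule (cyc R ?M x) R ?M" by (rule sub_cyc_reg[OF xR])
  have "I \<subseteq> C <+>[?M] cyc R ?M x"
  proof
    fix y assume y: "y \<in> I"
    have yR: "y \<in> carrier R" using y IR by blast
    have sy: "submodule (cyc R ?M y) R ?M" by (rule sub_cyc_reg[OF yR])
    let ?S = "C <+>[?M] cyc R ?M x"
    have S: "submodule ?S R ?M" by (rule L.sub_sum[OF C(1) sc])
    have CS: "C \<subseteq> ?S" by (rule L.sum_upper(1)[OF C(1) sc])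
    show "y \<in> ?S"
    proof (cases "y \<in> C")
      case False
      let ?D = "C <+>[?M] cyc R ?M y"
      have D: "submodule ?D R ?M" "C \<subseteq> ?D" "?D \<subseteq> I" "y \<in> ?D"
        using L.sub_sum[OF C(1) sy] L.sum_upper[OF C(1) sy] L.sum_least[OF sI C(2) L.cyc_least[OF sI y]] L.cyc_self[of y] yR by auto
      \<comment> \<open>By maximality of C the element x enters as soon as y is added, so x = c + a
        y. Inverting a on I then recovers y from x - c.\<close>
      have "x \<in> ?D"
      proof (rule ccontr)
        assume "x \<notin> ?D"
        then have "?D \<in> \<A>" using D unfolding \<A>_def by blast
        then have "?D = C" using C(4) D(2) by blast
        then show False using D(4) False by simp
      qed
      then obtain c a where ca: "c \<in> C" "a \<in> carrier R" "x = c \<oplus> a \<otimes> y" using L.mem_sum_cyc by auto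
      have cR: "c \<in> carrier R" using ca(1) C(2) IR by blast
      have "a \<otimes> y \<noteq> \<zero>" using ca C(3) cR by auto
      then obtain s where s: "s \<in> carrier R" "\<forall>x\<in>I. s \<otimes> (a \<otimes> x) = x" using inv[OF ca(2) y] by blast
      have "x \<ominus>[?M] c = a \<otimes> y" using L.minus_add_cancel(4)[of "a \<otimes> y" c] ca cR yR by simp
      moreover have "x \<ominus>[?M] c \<in> ?S"
        using L.sub_minus[OF S, of x c] L.sum_upper[OF C(1) sc] L.cyc_self[of x] xR ca(1) by auto
      ultimately have "s \<otimes> (a \<otimes> y) \<in> ?S" using L.sub_smult[OF S s(1)] by simp
      then show ?thesis using s(2) y by simp
    qed (use CS in blast)
  qed
  then have "il R ?M {\<zero>} I \<le> il R ?M {\<zero>} (C <+>[?M] cyc R ?M x)" by (intro L.il_mono subset_refl)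
  also have "\<dots> \<le> il R ?M {\<zero>} C + il R ?M {\<zero>} (cyc R ?M x)" using L.il_sum_le[OF C(1) sc] by simp
  also have "\<dots> < \<infinity>"
  proof -
    have "C \<subset> I" using C(2,3) x(1) by blast
    then have "il R ?M {\<zero>} C < \<infinity>" by (rule small[OF C(1)])
    then show ?thesis using L.il_covers[OF cov] by (cases "il R ?M {\<zero>} C") (simp_all add: one_enat_def)
  qed
  finally show False using I(2) by simp
qed

section \<open>Perpendicular submodules\<close>

text \<open>The elements annihilated by m form a vector space over R/m; the condition says that its
  dimension is at most 1. So each simple module occurs at most once in the socle.\<close>

definition mult_free :: "('r, 'z) ring_scheme \<Rightarrow> ('r, 'm, 'x) module_scheme \<Rightarrow> bool" where
  "mult_free R E \<longleftrightarrow> (\<forall>m x y. maximal_submodule R (regular_module R) m \<longrightarrow> x \<in> carrier E \<longrightarrow> y \<in> carrier E \<longrightarrow>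
     x \<noteq> \<zero>[E] \<longrightarrow> y \<noteq> \<zero>[E] \<longrightarrow> (\<forall>r\<in>m. r \<odot>[E] x = \<zero>[E] \<and> r \<odot>[E] y = \<zero>[E]) \<longrightarrow> y \<in> cyc R E x)"

lemma mult_freeD:
  assumes "mult_free R E" "maximal_submodule R (regular_module R) m" "x \<in> carrier E" "y \<in> carrier E"
    "x \<noteq> \<zero>[E]" "y \<noteq> \<zero>[E]" "\<And>r. r \<in> m \<Longrightarrow> r \<odot>[E] x = \<zero>[E]" "\<And>r. r \<in> m \<Longrightarrow> r \<odot>[E] y = \<zero>[E]"
  obtains r where "r \<in> carrier R" "y = r \<odot>[E] x"
proof -
  have "y \<in> cyc R E x" using assms unfolding mult_free_def by simp
  then show thesis using that by (auto simp: cyc_def)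
qed

text \<open>For multiplicity-free E, orthogonal complements cannot increase lengths
  (\<open>il_perp\<close>). This is applied to the evaluation of functionals, from both sides, and
  to the action of R on a module.\<close>

locale pairing = cring R + X: left_module R X + Y: left_module R Y + E: left_module R E
  for R :: "('r, 'z) ring_scheme" (structure) and X :: "('r, 'm, 'x) module_scheme" and Y :: "('r, 'n, 'y) module_scheme"
    and E :: "('r, 'e, 'w) module_scheme" +
  fixes B :: "'m \<Rightarrow> 'n \<Rightarrow> 'e"
  assumes B_closed: "x \<in> carrier X \<Longrightarrow> y \<in> carrier Y \<Longrightarrow> B x y \<in> carrier E"
    and B_add_l: "x \<in> carrier X \<Longrightarrow> x' \<in> carrier X \<Longrightarrow> y \<in> carrier Y \<Longrightarrow> B (x \<oplus>[X] x') y = B x y \<oplus>[E] B x' y"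
    and B_add_r: "x \<in> carrier X \<Longrightarrow> y \<in> carrier Y \<Longrightarrow> y' \<in> carrier Y \<Longrightarrow> B x (y \<oplus>[Y] y') = B x y \<oplus>[E] B x y'"
    and B_smult_l: "r \<in> carrier R \<Longrightarrow> x \<in> carrier X \<Longrightarrow> y \<in> carrier Y \<Longrightarrow> B (r \<odot>[X] x) y = r \<odot>[E] B x y"
    and B_smult_r: "r \<in> carrier R \<Longrightarrow> x \<in> carrier X \<Longrightarrow> y \<in> carrier Y \<Longrightarrow> B x (r \<odot>[Y] y) = r \<odot>[E] B x y"
begin

lemma flip: "pairing R Y X E (\<lambda>y x. B x y)"
  by (intro pairing.intro pairing_axioms.intro is_cring X.left_module_axioms Y.left_module_axioms E.left_module_axioms)
    (simp_all add: B_closed B_add_l B_add_r B_smult_l B_smult_r)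

definition perp where "perp U = {y \<in> carrier Y. \<forall>u\<in>U. B u y = \<zero>[E]}"

lemma perp_iff: "y \<in> perp U \<longleftrightarrow> y \<in> carrier Y \<and> (\<forall>u\<in>U. B u y = \<zero>[E])"
  by (simp add: perp_def)

lemma B_zero_r: "x \<in> carrier X \<Longrightarrow> B x \<zero>[Y] = \<zero>[E]"
  using B_smult_r[of \<zero> x "\<zero>[Y]"] by (simp add: Y.smult_r_null E.smult_l_null B_closed)

lemma B_zero_l: "y \<in> carrier Y \<Longrightarrow> B \<zero>[X] y = \<zero>[E]"
  using B_smult_l[of \<zero> "\<zero>[X]" y] by (simp add: X.smult_r_null E.smult_l_null B_closed)

lemma sub_perp: "U \<subseteq> carrier X \<Longrightarrow> submodule (perp U) R Y"
  unfolding Y.sub_iff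
  by (auto simp: perp_iff B_zero_r B_add_r B_smult_r Y.smult_closed E.smult_r_null subset_iff)

lemma perp_anti: "U \<subseteq> V \<Longrightarrow> perp V \<subseteq> perp U"
  unfolding perp_def by blast

lemma perp_zero: "perp {\<zero>[X]} = carrier Y"
  by (auto simp: perp_iff B_zero_l)

lemma B_minus_r: "x \<in> carrier X \<Longrightarrow> y \<in> carrier Y \<Longrightarrow> y' \<in> carrier Y \<Longrightarrow> B x (y \<ominus>[Y] y') = B x y \<ominus>[E] B x y'"
  using B_add_r[of x "y \<ominus>[Y] y'" y'] E.minus_add_cancel(3)[of "B x (y \<ominus>[Y] y')" "B x y'"]
  by (simp add: Y.minus_add_cancel B_closed)

text \<open>For v in V outside U, mapping y to B v y embeds the quotient of U^perp by V^perp into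
  the elements of E annihilated by the maximal ideal m. Those form a module of length at most 1, as
  E is multiplicity free.\<close>

lemma il_perp_covers:
  assumes mf: "mult_free R E" and c: "covers R X U V"
  shows "il R Y (perp V) (perp U) \<le> 1"
proof -
  have U: "submodule U R X" "submodule V R X" "U \<subseteq> V" using c by (auto simp: covers_def)
  have UX: "U \<subseteq> carrier X" "V \<subseteq> carrier X" using X.sub_subset U by blast+
  obtain v where v: "v \<in> V" "v \<notin> U" using c unfolding covers_def by blast
  have vX: "v \<in> carrier X" using v UX by blast
  define m where "m = {r \<in> carrier R. r \<odot>[X] v \<in> U}"
  have m: "maximal_submodule R (regular_module R) m" unfolding m_def by (rule X.covers_maximal[OF c v])
  have mR: "r \<in> carrier R" if "r \<in> m" for r using that by (simp add: m_def)
  have inV: "y \<in> perp V" if y: "y \<in> perp U" "B v y = \<zero>[E]" for y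
  proof -
    have yY: "y \<in> carrier Y" using y by (simp add: perp_iff)
    have "B z y = \<zero>[E]" if z: "z \<in> V" for z
    proof -
      obtain u r where ur: "u \<in> U" "r \<in> carrier R" "z = u \<oplus>[X] r \<odot>[X] v" by (rule X.covers_gen[OF c v z])
      have "u \<in> carrier X" using ur UX by blast
      then have "B z y = B u y \<oplus>[E] r \<odot>[E] B v y" using ur vX yY by (simp add: B_add_l B_smult_l X.smult_closed)
      then show ?thesis using y ur by (simp add: perp_iff E.smult_r_null)
    qed
    then show ?thesis using yY by (simp add: perp_iff)
  qed
  have killed: "r \<odot>[E] B v y = \<zero>[E]" if "y \<in> perp U" "r \<in> m" for y r
    using that B_smult_l[of r v y] vX by (simp add: perp_iff m_def)
  show ?thesis
    unfolding il_def
  proof (rule height_le_one)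
    fix W1 W2 W3 assume W: "W1 \<in> subs R Y (perp V) (perp U)" "W2 \<in> subs R Y (perp V) (perp U)" "W3 \<in> subs R Y (perp V) (perp U)"
      "W1 \<subset> W2" "W2 \<subseteq> W3"
    have sW2: "submodule W2 R Y" "perp V \<subseteq> W2" "W2 \<subseteq> perp U" using W(2) by (simp_all add: Y.subs_mem)
    obtain y1 where y1: "y1 \<in> W2" "y1 \<notin> perp V" using W(1,4) by (auto simp: Y.subs_mem)
    have y1U: "y1 \<in> perp U" using y1 sW2 by blast
    have y1Y: "y1 \<in> carrier Y" using y1U by (simp add: perp_iff)
    have ne1: "B v y1 \<noteq> \<zero>[E]" using inV[OF y1U] y1(2) by blast
    have "perp U \<subseteq> W2"
    proof
      fix y assume y: "y \<in> perp U"
      have yY: "y \<in> carrier Y" using y by (simp add: perp_iff)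
      show "y \<in> W2"
      proof (cases "B v y = \<zero>[E]")
        case True
        then show ?thesis using inV[OF y] sW2 by blast
      next
        case False
        obtain r where r: "r \<in> carrier R" "B v y = r \<odot>[E] B v y1"
          using mult_freeD[OF mf m B_closed[OF vX y1Y] B_closed[OF vX yY] ne1 False killed[OF y1U] killed[OF y]] by blast
        have rY: "r \<odot>[Y] y1 \<in> W2" by (rule Y.sub_smult[OF sW2(1) r(1) y1(1)])
        have rY': "r \<odot>[Y] y1 \<in> carrier Y" using r y1Y by (simp add: Y.smult_closed)
        have sU: "submodule (perp U) R Y" by (rule sub_perp[OF UX(1)])
        have "y \<ominus>[Y] r \<odot>[Y] y1 \<in> perp U" by (rule Y.sub_minus[OF sU y]) (use rY sW2(3) in blast)
        moreover have "B v (y \<ominus>[Y] r \<odot>[Y] y1) = \<zero>[E]"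
          using B_minus_r[OF vX yY rY'] r B_smult_r[OF r(1) vX y1Y] E.minus_eq_0 B_closed[OF vX yY] B_closed[OF vX rY'] by simp
        ultimately have "y \<ominus>[Y] r \<odot>[Y] y1 \<in> W2" using inV sW2(2) by blast
        then have "(y \<ominus>[Y] r \<odot>[Y] y1) \<oplus>[Y] r \<odot>[Y] y1 \<in> W2" by (rule Y.sub_add[OF sW2(1) _ rY])
        then show ?thesis using Y.minus_add_cancel(1)[OF yY rY'] by simp
      qed
    qed
    then show "W2 = W3" using W(3,5) by (auto simp: Y.subs_mem)
  qed
qed

lemma il_perp:
  assumes mf: "mult_free R E" and "submodule U R X" "submodule V R X" "U \<subseteq> V" "il R X U V < \<infinity>"
  shows "il R Y (perp V) (perp U) \<le> il R X U V"
  using assms(2,4,5)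
proof (induction "the_enat (il R X U V)" arbitrary: U rule: less_induct)
  case less
  show ?case
  proof (cases "U = V")
    case True
    then show ?thesis by (simp add: Y.il_refl)
  next
    case False
    then have "U \<subset> V" using less.prems by blast
    then obtain W where W: "covers R X U W" "W \<subseteq> V" using X.exists_cover[OF less.prems(1) assms(3)] less.prems by blast
    then have sW: "submodule W R X" "U \<subseteq> W" by (auto simp: covers_def)
    have eq: "il R X U V = 1 + il R X W V"
      using X.il_add[OF less.prems(1) sW(1) assms(3) sW(2) W(2)] X.il_covers[OF W(1)] by simp
    have l: "the_enat (il R X W V) < the_enat (il R X U V)" "il R X W V < \<infinity>"
      using eq less.prems(3) by (cases "il R X W V"; simp add: one_enat_def)+
    have IH: "il R Y (perp V) (perp W) \<le> il R X W V" by (rule less.hyps[OF l(1) sW(1) W(2) l(2)])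
    have s: "submodule (perp U) R Y" "submodule (perp V) R Y" "submodule (perp W) R Y"
      by (intro sub_perp X.sub_subset less.prems(1) assms(3) sW(1))+
    have "il R Y (perp V) (perp U) = il R Y (perp V) (perp W) + il R Y (perp W) (perp U)"
      by (rule Y.il_add[OF s(2,3,1) perp_anti[OF W(2)] perp_anti[OF sW(2)]])
    also have "\<dots> \<le> il R X W V + 1" by (rule add_mono[OF IH il_perp_covers[OF mf W(1)]])
    finally show ?thesis using eq by (simp add: add.commute)
  qed
qed

end

text \<open>Pair R with Z through the action, with values in Z itself: the complement of 0 is Z and
  the complement of R is 0. The bound is what makes a multiplicity-free module of greatest length
  exist.\<close>

lemma (in cring) mult_free_bound:
  assumes "left_module R Z" "mult_free R Z" "mlen R (regular_module R) < \<infinity>"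
  shows "mlen R Z \<le> mlen R (regular_module R)"
proof -
  interpret Z: left_module R Z by fact
  interpret L: left_module R "regular_module R" by (rule left_module_regular)
  interpret P: pairing R "regular_module R" Z Z "\<lambda>r z. r \<odot>[Z] z"
  proof (intro pairing.intro pairing_axioms.intro is_cring L.left_module_axioms Z.left_module_axioms)
    fix r x y assume rxy: "r \<in> carrier R" "x \<in> carrier (regular_module R)" "y \<in> carrier Z"
    have "x \<odot>[Z] (r \<odot>[Z] y) = (r \<otimes> x) \<odot>[Z] y" using rxy Z.smult_assoc[of x r y] by (simp add: m_comm)
    then show "x \<odot>[Z] (r \<odot>[Z] y) = r \<odot>[Z] (x \<odot>[Z] y)" using rxy Z.smult_assoc[of r x y] by simp
  qed (simp_all add: Z.smult_closed Z.smult_l_distr Z.smult_r_distr Z.smult_assoc)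
  have "P.perp (carrier R) = {\<zero>[Z]}"
  proof
    show "P.perp (carrier R) \<subseteq> {\<zero>[Z]}"
    proof
      fix z assume "z \<in> P.perp (carrier R)"
      then have "z \<in> carrier Z" "\<one> \<odot>[Z] z = \<zero>[Z]" by (simp_all add: P.perp_iff)
      then show "z \<in> {\<zero>[Z]}" by (simp add: Z.smult_one)
    qed
  qed (simp add: P.perp_iff Z.smult_r_null)
  then show ?thesis
    using P.il_perp[OF assms(2) L.sub_0 L.sub_carrier] assms(3) P.perp_zero by simp
qed

lemma (in liso) mult_free_transfer:
  assumes "mult_free A M" shows "mult_free A N"
  unfolding mult_free_def
proof (intro allI impI)
  interpret g: liso A N M "inv_into (carrier M) f" by (rule liso_inv)
  let ?g = "inv_into (carrier M) f"
  fix m x y assume *: "maximal_submodule A (regular_module A) m" "x \<in> carrier N" "y \<in> carrier N" "x \<noteq> \<zero>[N]" "y \<noteq> \<zero>[N]"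
    "\<forall>r\<in>m. r \<odot>[N] x = \<zero>[N] \<and> r \<odot>[N] y = \<zero>[N]"
  have mA: "r \<in> carrier A" if "r \<in> m" for r
    using * that left_module.sub_mem[OF dom.reg] by (auto simp: maximal_submodule_def)
  have fg: "f (?g z) = z" if "z \<in> carrier N" for z using that surj by (simp add: f_inv_into_f)
  have nz: "?g z \<noteq> \<zero>[M]" if "z \<in> carrier N" "z \<noteq> \<zero>[N]" for z using fg[OF that(1)] that(2) zero by auto
  have k: "r \<odot>[M] ?g z = \<zero>[M]" if "r \<in> m" "z \<in> carrier N" "r \<odot>[N] z = \<zero>[N]" for r z
    using g.smult[OF mA[OF that(1)] that(2)] that(3) g.zero by simp
  obtain r where r: "r \<in> carrier A" "?g y = r \<odot>[M] ?g x"
    by (rule mult_freeD[OF assms *(1) g.closed[OF *(2)] g.closed[OF *(3)] nz[OF *(2,4)] nz[OF *(3,5)]]) (use * k in auto)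
  have "y = f (?g y)" using fg[OF *(3)] by simp
  also have "\<dots> = r \<odot>[N] f (?g x)" unfolding r(2) by (rule smult[OF r(1) g.closed[OF *(2)]])
  finally have "y = r \<odot>[N] x" using fg[OF *(2)] by simp
  then show "y \<in> cyc A N x" using cod.cyc_mem[OF r(1)] by simp
qed

section \<open>A minimal injective cogenerator\<close>

text \<open>Over a commutative artinian ring, a module of maximal length among the modules in whose socle
  every simple module occurs at most once is an injective envelope of \<open>R / rad R\<close>.\<close>

locale cogenerator = cring R + E: left_module R E
  for R :: "('r, 'z) ring_scheme" (structure) and E :: "'r fg_module" +
  assumes fin_R: "mlen R (regular_module R) < \<infinity>" and mf: "mult_free R E" and fin_E: "mlen R E < \<infinity>"
    and maxE: "\<And>Z :: 'r fg_module. left_module R Z \<Longrightarrow> mult_free R Z \<Longrightarrow> mlen R Z < \<infinity> \<Longrightarrow> mlen R Z \<le> mlen R E"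

lemma (in cring) exists_cogenerator:
  assumes fin: "mlen R (regular_module R) < \<infinity>"
  shows "\<exists>E :: 'a fg_module. cogenerator R E"
proof -
  interpret L: left_module R "regular_module R" by (rule left_module_regular)
  define P where "P Z \<longleftrightarrow> left_module R Z \<and> mult_free R Z \<and> mlen R Z < \<infinity>" for Z :: "'a fg_module"
  \<comment> \<open>The zero module is multiplicity free, so there is a module to start the
    maximisation from.\<close>
  interpret Z: left_module R "sub_module (regular_module R) {\<zero>[regular_module R]}" by (rule L.left_module_sub[OF L.sub_0])
  have "mlen R (sub_module (regular_module R) {\<zero>[regular_module R]}) < \<infinity>"
    using Z.il_refl by simp
  then obtain Z0 :: "'a fg_module" and f where Z0: "liso R (sub_module (regular_module R) {\<zero>[regular_module R]}) Z0 f"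
    using Z.fg_copy by blast
  interpret f: liso R "sub_module (regular_module R) {\<zero>[regular_module R]}" Z0 f by (rule Z0)
  have "mult_free R (sub_module (regular_module R) {\<zero>[regular_module R]})" by (simp add: mult_free_def)
  then have "mult_free R Z0" by (rule f.mult_free_transfer)
  moreover have "mlen R Z0 < \<infinity>" using f.mlen_eq Z.il_refl by simp
  ultimately have P0: "P Z0" unfolding P_def using f.cod.left_module_axioms by simp
  have le: "mlen R Z \<le> mlen R (regular_module R)" if "P Z" for Z
    by (rule mult_free_bound[OF _ _ fin]) (use that in \<open>simp_all add: P_def\<close>)
  have "the_enat (mlen R Z) \<le> the_enat (mlen R (regular_module R))" if "P Z" for Z
    using le[OF that] fin by (cases "mlen R Z"; cases "mlen R (regular_module R)") simp_all
  then have "\<exists>E. P E \<and> (\<forall>Z. P Z \<longrightarrow> the_enat (mlen R Z) \<le> the_enat (mlen R E))"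
    by (intro ex_has_greatest_nat[of P Z0 "\<lambda>Z. the_enat (mlen R Z)" "Suc (the_enat (mlen R (regular_module R)))"])
      (use P0 in \<open>simp_all add: less_Suc_eq_le\<close>)
  then obtain E where E: "P E \<and> (\<forall>Z. P Z \<longrightarrow> the_enat (mlen R Z) \<le> the_enat (mlen R E))" ..
  then have PE: "left_module R E" "mult_free R E" "mlen R E < \<infinity>" by (simp_all add: P_def)
  have "mlen R Z \<le> mlen R E" if "left_module R Z" "mult_free R Z" "mlen R Z < \<infinity>" for Z :: "'a fg_module"
  proof -
    have "P Z" using that by (simp add: P_def)
    then have "the_enat (mlen R Z) \<le> the_enat (mlen R E)" using E by blast
    then show ?thesis using that PE by (cases "mlen R Z"; cases "mlen R E") simp_all
  qed
  then have "cogenerator R E" by (intro cogenerator.intro cogenerator_axioms.intro is_cring PE fin)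
  then show ?thesis by blast
qed

context cogenerator begin

lemma max_any:
  assumes "left_module R Z" "mult_free R Z" "mlen R Z < \<infinity>" shows "mlen R Z \<le> mlen R E"
proof -
  interpret Z: left_module R Z by fact
  obtain N :: "'r fg_module" and f where "liso R Z N f" by (rule Z.fg_copy[OF assms(3)])
  then interpret f: liso R Z N f .
  show ?thesis using maxE[OF f.cod.left_module_axioms f.mult_free_transfer[OF assms(2)]] f.mlen_eq assms(3) by simp
qed

lemma maximal_one:
  assumes m: "maximal_submodule R (regular_module R) m" and r: "r \<in> carrier R" "r \<notin> m"
  obtains n s where "n \<in> m" "n \<in> carrier R" "s \<in> carrier R" "\<one> = n \<oplus> s \<otimes> r"
proof -
  interpret L: left_module R "regular_module R" by (rule left_module_regular)
  have c: "covers R (regular_module R) m (carrier (regular_module R))" using m L.maximal_iff_covers by simp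
  have sm: "submodule m R (regular_module R)" using m by (simp add: maximal_submodule_def)
  obtain n s where "n \<in> m" "s \<in> carrier R" "\<one> = n \<oplus>[regular_module R] s \<odot>[regular_module R] r"
    by (rule L.covers_gen[OF c, of r \<one>]) (use r in auto)
  then show thesis using that L.sub_mem[OF sm] by simp
qed

section \<open>Extension of partial homomorphisms into E\<close>

context
  fixes X :: "('r, 'm, 'x) module_scheme" and F
  assumes X: "left_module R X" and fin_X: "mlen R X < \<infinity>" and F_def: "F = prod_module X E"
begin

lemma lmF: "left_module R F" unfolding F_def by (rule left_module_prod[OF X E.left_module_axioms])

lemma fin_F: "mlen R F < \<infinity>"
  unfolding F_def using mlen_prod[OF X E.left_module_axioms] fin_X fin_E by (cases "mlen R X"; cases "mlen R E") simp_all

lemma incl_hom: "(\<lambda>y. (\<zero>[X], y)) \<in> module_homs R E F"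
proof -
  interpret X: left_module R X by (rule X)
  show ?thesis by (simp add: module_homs_def F_def X.smult_r_null)
qed

lemma quotient_incl:
  assumes C: "submodule C R F" and C0: "\<And>y. (\<zero>[X], y) \<in> C \<Longrightarrow> y = \<zero>[E]"
  shows "lhom R E (quotient_module F C) (\<lambda>y. C +>[F] (\<zero>[X], y))"
    and "\<And>y. y \<in> carrier E \<Longrightarrow> C +>[F] (\<zero>[X], y) = \<zero>[quotient_module F C] \<Longrightarrow> y = \<zero>[E]"
proof -
  interpret F: left_module R F by (rule lmF)
  interpret X: left_module R X by (rule X)
  interpret p: lhom R F "quotient_module F C" "\<lambda>z. C +>[F] z" by (rule F.lhom_quotient[OF C])
  show "lhom R E (quotient_module F C) (\<lambda>y. C +>[F] (\<zero>[X], y))"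
    by (rule E.hom_lhom[OF p.cod.left_module_axioms comp_hom[OF incl_hom p.hom]])
  fix y assume y: "y \<in> carrier E" "C +>[F] (\<zero>[X], y) = \<zero>[quotient_module F C]"
  have "(\<zero>[X], y) \<in> carrier F" using y(1) by (simp add: F_def)
  then have "(\<zero>[X], y) \<in> p.ker" using y(2) by (simp add: p.ker_iff)
  then have "(\<zero>[X], y) \<in> C" using F.ker_quotient[OF C] by blast
  then show "y = \<zero>[E]" by (rule C0)
qed

text \<open>E embeds into F/C, and F/C is not longer than E by the choice of E. So E fills F/C, and
  (x, 0) is congruent modulo C to some (0, y); their difference lies in C and has first component
  x.\<close>

lemma extend_aux:
  assumes C: "submodule C R F" and C0: "\<And>y. (\<zero>[X], y) \<in> C \<Longrightarrow> y = \<zero>[E]"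
    and mfq: "mult_free R (quotient_module F C)" and x: "x \<in> carrier X"
  shows "\<exists>y\<in>carrier E. (x, y) \<in> C"
proof -
  interpret F: left_module R F by (rule lmF)
  interpret X: left_module R X by (rule X)
  let ?Z = "quotient_module F C"
  interpret p: lhom R F ?Z "\<lambda>z. C +>[F] z" by (rule F.lhom_quotient[OF C])
  interpret i: lhom R E ?Z "\<lambda>y. C +>[F] (\<zero>[X], y)" by (rule quotient_incl(1)[OF C C0])
  have surj: "(\<lambda>z. C +>[F] z) ` carrier F = carrier ?Z" using F.quotient(3)[OF C] by simp
  have "mlen R ?Z \<le> mlen R F" using p.il_image_le[OF F.sub_carrier] surj by simp
  then have finZ: "mlen R ?Z < \<infinity>" using fin_F by (rule le_less_trans)
  have le: "mlen R ?Z \<le> mlen R E" by (rule max_any[OF p.cod.left_module_axioms mfq finZ])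
  have "y = \<zero>[E]" if "y \<in> i.ker" for y using that quotient_incl(2)[OF C C0] by (simp add: i.ker_iff)
  then have "i.ker = {\<zero>[E]}" using E.sub_zero[OF i.sub_ker] by blast
  then have inj: "inj_on (\<lambda>y. C +>[F] (\<zero>[X], y)) (carrier E)" using i.inj_iff by simp
  let ?I = "(\<lambda>y. C +>[F] (\<zero>[X], y)) ` carrier E"
  have sI: "submodule ?I R ?Z" by (rule i.sub_image[OF E.sub_carrier])
  have ilI: "il R ?Z {\<zero>[?Z]} ?I = mlen R E" by (rule i.il_inj[OF E.sub_carrier inj])
  have IZ: "?I = carrier ?Z"
  proof (rule ccontr)
    assume "?I \<noteq> carrier ?Z"
    then have "?I \<subset> carrier ?Z" using p.cod.sub_subset[OF sI] by blast
    then have "il R ?Z {\<zero>[?Z]} ?I + 1 \<le> mlen R ?Z"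
      using p.cod.sub_zero[OF sI] by (intro p.cod.il_strict[OF p.cod.sub_0 sI p.cod.sub_carrier]) auto
    then show False using ilI le fin_E by (cases "mlen R ?Z"; cases "mlen R E") (simp_all add: one_enat_def)
  qed
  have xF: "(x, \<zero>[E]) \<in> carrier F" using x by (simp add: F_def)
  then have "C +>[F] (x, \<zero>[E]) \<in> ?I" using p.closed IZ by simp
  then obtain y where y: "y \<in> carrier E" "C +>[F] (x, \<zero>[E]) = C +>[F] (\<zero>[X], y)" by blast
  have yF: "(\<zero>[X], y) \<in> carrier F" using y by (simp add: F_def)
  define c where "c = (x, \<zero>[E]) \<ominus>[F] (\<zero>[X], y)"
  have c: "c \<in> C" using F.coset_eq[OF C xF yF] y(2) by (simp add: c_def)
  have cF: "c \<in> carrier F" by (rule F.sub_mem[OF C c])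
  have "c \<oplus>[F] (\<zero>[X], y) = (x, \<zero>[E])" unfolding c_def by (rule F.minus_add_cancel(1)[OF xF yF])
  then have "fst c = x" using cF by (simp add: F_def mem_Times_iff)
  then have "(x, snd c) \<in> C" "snd c \<in> carrier E" using c cF by (auto simp: F_def)
  then show ?thesis by blast
qed

text \<open>Enlarge the graph to a maximal submodule C that meets the factor E in 0. Then every
  nonzero submodule of F/C meets the image of E, so F/C is multiplicity free like E. By
  \<open>extend_aux\<close> C is the graph of a homomorphism on all of X.\<close>

lemma extend:
  assumes C0: "submodule C0 R F" "\<And>y. (\<zero>[X], y) \<in> C0 \<Longrightarrow> y = \<zero>[E]"
  shows "\<exists>h\<in>module_homs R X E. \<forall>x y. (x, y) \<in> C0 \<longrightarrow> h x = y"
proof -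
  interpret F: left_module R F by (rule lmF)
  interpret X: left_module R X by (rule X)
  define P where "P C \<longleftrightarrow> (\<forall>y. (\<zero>[X], y) \<in> C \<longrightarrow> y = \<zero>[E])" for C
  have P0: "P C0" using C0(2) by (simp add: P_def)
  have "il R F C0 (carrier F) \<le> mlen R F" using F.sub_zero[OF C0(1)] by (intro F.il_mono) auto
  then have "il R F C0 (carrier F) < \<infinity>" using fin_F by (rule le_less_trans)
  from F.exists_max_submodule[of P, OF P0 C0(1) this] obtain C where
    C': "submodule C R F \<and> C0 \<subseteq> C \<and> P C \<and> (\<forall>D. submodule D R F \<longrightarrow> C \<subseteq> D \<longrightarrow> P D \<longrightarrow> D = C)" ..
  then have C: "submodule C R F" "C0 \<subseteq> C" "P C" and Cmax: "\<And>D. submodule D R F \<Longrightarrow> C \<subseteq> D \<Longrightarrow> P D \<Longrightarrow> D = C" by simp_all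
  have CP: "y = \<zero>[E]" if "(\<zero>[X], y) \<in> C" for y using C(3) that by (simp add: P_def)
  let ?Z = "quotient_module F C"
  interpret p: lhom R F ?Z "\<lambda>z. C +>[F] z" by (rule F.lhom_quotient[OF C(1)])
  let ?i = "\<lambda>y. C +>[F] (\<zero>[X], y)"
  interpret i: lhom R E ?Z ?i by (rule quotient_incl(1)[OF C(1) CP])
  have i0: "y = \<zero>[E]" if "y \<in> carrier E" "?i y = \<zero>[?Z]" for y using quotient_incl(2)[OF C(1) CP that] by simp
  have pC: "C +>[F] c = \<zero>[?Z]" if "c \<in> C" for c
  proof -
    have "c \<in> p.ker" using F.ker_quotient[OF C(1)] that by simp
    then show ?thesis by (simp add: p.ker_iff)
  qed
  \<comment> \<open>By maximality, C + R a contains (0, y) for some nonzero y, whose image in F/C is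
    r z for some r. This r is not in m, hence invertible modulo m, so z is a multiple of the image
    of y.\<close>
  have key: "\<exists>y\<in>carrier E. y \<noteq> \<zero>[E] \<and> z = ?i y \<and> (\<forall>r\<in>m. r \<odot>[E] y = \<zero>[E])"
    if m: "maximal_submodule R (regular_module R) m" and z: "z \<in> carrier ?Z" "z \<noteq> \<zero>[?Z]" and k: "\<And>r. r \<in> m \<Longrightarrow> r \<odot>[?Z] z = \<zero>[?Z]"
    for m z
  proof -
    have mR: "r \<in> carrier R" if "r \<in> m" for r
      using m that left_module.sub_mem[OF left_module_regular] by (auto simp: maximal_submodule_def)
    obtain a where a: "a \<in> carrier F" "z = C +>[F] a" using z(1) F.quotient(3)[OF C(1)] by auto
    have aC: "a \<notin> C" using pC a(2) z(2) by blast
    have sa: "submodule (cyc R F a) R F" by (rule F.sub_cyc[OF a(1)])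
    let ?D = "C <+>[F] cyc R F a"
    have sD: "submodule ?D R F" by (rule F.sub_sum[OF C(1) sa])
    have "?D \<noteq> C" using F.sum_upper(2)[OF C(1) sa] F.cyc_self[OF a(1)] aC by blast
    then have "\<not> P ?D" using Cmax[OF sD F.sum_upper(1)[OF C(1) sa]] by blast
    then obtain y where y: "(\<zero>[X], y) \<in> ?D" "y \<noteq> \<zero>[E]" unfolding P_def by blast
    have yE: "y \<in> carrier E" using F.sub_mem[OF sD y(1)] by (simp add: F_def)
    obtain c r where cr: "c \<in> C" "r \<in> carrier R" "(\<zero>[X], y) = c \<oplus>[F] r \<odot>[F] a" using y(1) unfolding F.mem_sum_cyc by blast
    have cF: "c \<in> carrier F" by (rule F.sub_mem[OF C(1) cr(1)])
    have iy: "?i y = r \<odot>[?Z] z"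
      using p.add[OF cF F.smult_closed[OF cr(2) a(1)]] p.smult[OF cr(2) a(1)] pC[OF cr(1)] p.cod.smult_closed[OF cr(2) z(1)]
      unfolding cr(3) a(2) by (simp add: a(2)[symmetric])
    have "r \<notin> m" using k iy i0[OF yE] y(2) by auto
    then obtain n s where ns: "n \<in> m" "n \<in> carrier R" "s \<in> carrier R" "\<one> = n \<oplus> s \<otimes> r" using maximal_one[OF m cr(2)] by blast
    have "\<one> \<odot>[?Z] z = n \<odot>[?Z] z \<oplus>[?Z] s \<odot>[?Z] (r \<odot>[?Z] z)"
      unfolding ns(4) using ns(2,3) cr(2) z(1) by (simp add: p.cod.smult_l_distr p.cod.smult_assoc)
    then have "z = s \<odot>[?Z] ?i y" using k[OF ns(1)] iy z(1) ns(3) i.closed[OF yE] by (simp add: p.cod.smult_one p.cod.smult_closed)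
    then have zi: "z = ?i (s \<odot>[E] y)" using i.smult[OF ns(3) yE] by simp
    have syE: "s \<odot>[E] y \<in> carrier E" using ns yE by (simp add: E.smult_closed)
    have "s \<odot>[E] y \<noteq> \<zero>[E]"
    proof
      assume "s \<odot>[E] y = \<zero>[E]"
      then show False using zi i.zero z(2) by simp
    qed
    moreover have "t \<odot>[E] (s \<odot>[E] y) = \<zero>[E]" if t: "t \<in> m" for t
    proof (rule i0[OF E.smult_closed[OF mR[OF t] syE]])
      show "?i (t \<odot>[E] (s \<odot>[E] y)) = \<zero>[?Z]" using i.smult[OF mR[OF t] syE] zi k[OF t] by simp
    qed
    ultimately show ?thesis using zi syE by blast
  qed
  have mfq: "mult_free R ?Z"
    unfolding mult_free_def
  proof (intro allI impI)
    fix m z1 z2 assume m: "maximal_submodule R (regular_module R) m" and z: "z1 \<in> carrier ?Z" "z2 \<in> carrier ?Z" "z1 \<noteq> \<zero>[?Z]" "z2 \<noteq> \<zero>[?Z]"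
      and k: "\<forall>r\<in>m. r \<odot>[?Z] z1 = \<zero>[?Z] \<and> r \<odot>[?Z] z2 = \<zero>[?Z]"
    obtain y1 where y1: "y1 \<in> carrier E" "y1 \<noteq> \<zero>[E]" "z1 = ?i y1" "\<forall>r\<in>m. r \<odot>[E] y1 = \<zero>[E]" using key[OF m z(1,3)] k by blast
    obtain y2 where y2: "y2 \<in> carrier E" "y2 \<noteq> \<zero>[E]" "z2 = ?i y2" "\<forall>r\<in>m. r \<odot>[E] y2 = \<zero>[E]" using key[OF m z(2,4)] k by blast
    obtain r where r: "r \<in> carrier R" "y2 = r \<odot>[E] y1"
      by (rule mult_freeD[OF mf m y1(1) y2(1) y1(2) y2(2)]) (use y1 y2 in auto)
    have "z2 = r \<odot>[?Z] z1" using y1(3) y2(3) r i.smult[OF r(1) y1(1)] by simp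
    then show "z2 \<in> cyc R ?Z z1" using p.cod.cyc_mem[OF r(1)] by simp
  qed
  have ex: "\<exists>y\<in>carrier E. (x, y) \<in> C" if "x \<in> carrier X" for x by (rule extend_aux[OF C(1) CP mfq that])
  have uniq: "y = y'" if "(x, y) \<in> C" "(x, y') \<in> C" for x y y'
  proof -
    have c: "x \<in> carrier X" "y \<in> carrier E" "y' \<in> carrier E" using F.sub_mem[OF C(1) that(1)] F.sub_mem[OF C(1) that(2)] by (simp_all add: F_def)
    have "(x, y) \<oplus>[F] (\<ominus> \<one>) \<odot>[F] (x, y') \<in> C"
      by (intro F.sub_add[OF C(1) that(1)] F.sub_smult[OF C(1) _ that(2)]) simp
    then have "(\<zero>[X], y \<oplus>[E] \<ominus>[E] y') \<in> C" using c by (simp add: F_def X.smult_minus_one E.smult_minus_one X.r_neg)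
    then have "y \<ominus>[E] y' = \<zero>[E]" using CP by (simp add: a_minus_def)
    then show ?thesis using c E.minus_eq_0 by simp
  qed
  define h where "h x = (SOME y. (x, y) \<in> C)" for x
  have hC: "(x, h x) \<in> C" if "x \<in> carrier X" for x
    unfolding h_def using someI_ex[of "\<lambda>y. (x, y) \<in> C"] ex[OF that] by blast
  have hu: "h x = y" if "(x, y) \<in> C" for x y
  proof -
    have "x \<in> carrier X" using F.sub_mem[OF C(1) that] by (simp add: F_def)
    then show ?thesis using uniq[OF hC that] by simp
  qed
  have "h \<in> module_homs R X E"
    unfolding module_homs_def
  proof (intro CollectI conjI ballI)
    show "h \<in> carrier X \<rightarrow> carrier E" using F.sub_mem[OF C(1) hC] by (simp add: F_def)
    fix x y assume "x \<in> carrier X" "y \<in> carrier X"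
    then show "h (x \<oplus>[X] y) = h x \<oplus>[E] h y" using F.sub_add[OF C(1) hC hC, of x y] by (intro hu) (simp add: F_def)
  next
    fix a x assume "a \<in> carrier R" "x \<in> carrier X"
    then show "h (a \<odot>[X] x) = a \<odot>[E] h x" using F.sub_smult[OF C(1) _ hC, of a x] by (intro hu) (simp add: F_def)
  qed
  moreover have "\<forall>x y. (x, y) \<in> C0 \<longrightarrow> h x = y" using hu C(2) by blast
  ultimately show ?thesis by blast
qed

end

text \<open>Otherwise the direct sum of R/m and E would still be multiplicity free. Then
  \<open>extend_aux\<close>, applied to m x 0 and the element 1, would put 1 into m.\<close>

lemma exists_killed:
  assumes m: "maximal_submodule R (regular_module R) m"
  shows "\<exists>y\<in>carrier E. y \<noteq> \<zero>[E] \<and> (\<forall>r\<in>m. r \<odot>[E] y = \<zero>[E])"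
proof (rule ccontr)
  assume *: "\<not> ?thesis"
  interpret L: left_module R "regular_module R" by (rule left_module_regular)
  define F where "F = prod_module (regular_module R) E"
  interpret F: left_module R F unfolding F_def by (rule left_module_prod[OF left_module_regular E.left_module_axioms])
  have sm: "submodule m R (regular_module R)" "m \<noteq> carrier R" using m by (simp_all add: maximal_submodule_def)
  have mI: "r \<otimes> a \<in> m" if "r \<in> carrier R" "a \<in> m" for r a using L.sub_smult[OF sm(1) that] by simp
  define C where "C = m \<times> {\<zero>[E]}"
  have C: "submodule C R F" unfolding C_def F_def by (rule sub_Times[OF left_module_regular E.left_module_axioms sm(1) E.sub_0])
  let ?Z = "quotient_module F C"
  interpret p: lhom R F ?Z "\<lambda>z. C +>[F] z" by (rule F.lhom_quotient[OF C])
  have pC: "C +>[F] c = \<zero>[?Z] \<longleftrightarrow> c \<in> C" if "c \<in> carrier F" for c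
  proof -
    have "c \<in> p.ker \<longleftrightarrow> c \<in> C" using F.ker_quotient[OF C] by simp
    then show ?thesis using that by (simp add: p.ker_iff)
  qed
  have F_mem: "(a, y) \<in> carrier F \<longleftrightarrow> a \<in> carrier R \<and> y \<in> carrier E" for a y by (simp add: F_def)
  have F_add: "(a, y) \<oplus>[F] (b, z) = (a \<oplus> b, y \<oplus>[E] z)" and F_smult: "r \<odot>[F] (a, y) = (r \<otimes> a, r \<odot>[E] y)" for a b y z r by (simp_all add: F_def)
  have split: "C +>[F] (a \<oplus> b, y) = C +>[F] (b, y)" if "a \<in> m" "b \<in> carrier R" "y \<in> carrier E" for a b y
  proof -
    have aR: "a \<in> carrier R" using L.sub_mem[OF sm(1) that(1)] by simp
    have c: "(a, \<zero>[E]) \<in> carrier F" "(b, y) \<in> carrier F" using aR that by (simp_all add: F_mem)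
    have "C +>[F] ((a, \<zero>[E]) \<oplus>[F] (b, y)) = C +>[F] (b, y)"
    proof -
      have "(a, \<zero>[E]) \<in> C" using that(1) by (simp add: C_def)
      then show ?thesis using p.add[OF c] pC[OF c(1)] p.closed[OF c(2)] by simp
    qed
    then show ?thesis using that by (simp add: F_add)
  qed
  have "mult_free R ?Z"
    unfolding mult_free_def
  proof (intro allI impI)
    fix m' z1 z2 assume m': "maximal_submodule R (regular_module R) m'" and z: "z1 \<in> carrier ?Z" "z2 \<in> carrier ?Z" "z1 \<noteq> \<zero>[?Z]" "z2 \<noteq> \<zero>[?Z]"
      and k: "\<forall>r\<in>m'. r \<odot>[?Z] z1 = \<zero>[?Z] \<and> r \<odot>[?Z] z2 = \<zero>[?Z]"
    have m'R: "r \<in> carrier R" if "r \<in> m'" for r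
      using m' that L.sub_mem by (auto simp: maximal_submodule_def)
    have lift: "\<exists>a y. a \<in> carrier R \<and> y \<in> carrier E \<and> z = C +>[F] (a, y) \<and> (a, y) \<notin> C \<and> (\<forall>r\<in>m'. r \<otimes> a \<in> m \<and> r \<odot>[E] y = \<zero>[E])"
      if zz: "z \<in> carrier ?Z" "z \<noteq> \<zero>[?Z]" "\<forall>r\<in>m'. r \<odot>[?Z] z = \<zero>[?Z]" for z
    proof -
      obtain c where c: "c \<in> carrier F" "z = C +>[F] c" using zz(1) F.quotient(3)[OF C] by auto
      obtain a y where ay: "c = (a, y)" by (cases c)
      have "r \<otimes> a \<in> m \<and> r \<odot>[E] y = \<zero>[E]" if r: "r \<in> m'" for r
      proof -
        have "C +>[F] (r \<odot>[F] c) = \<zero>[?Z]" using p.smult[OF m'R[OF r] c(1)] c(2) zz(3) r by simp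
        then have "r \<odot>[F] c \<in> C" using pC[OF F.smult_closed[OF m'R[OF r] c(1)]] by simp
        then show ?thesis by (simp add: ay F_smult C_def)
      qed
      moreover have "(a, y) \<notin> C" using pC[OF c(1)] c(2) zz(2) ay by simp
      ultimately show ?thesis using c ay F_mem by blast
    qed
    obtain a1 y1 where 1: "a1 \<in> carrier R" "y1 \<in> carrier E" "z1 = C +>[F] (a1, y1)" "(a1, y1) \<notin> C" "\<forall>r\<in>m'. r \<otimes> a1 \<in> m \<and> r \<odot>[E] y1 = \<zero>[E]"
      using lift[OF z(1,3)] k by blast
    obtain a2 y2 where 2: "a2 \<in> carrier R" "y2 \<in> carrier E" "z2 = C +>[F] (a2, y2)" "(a2, y2) \<notin> C" "\<forall>r\<in>m'. r \<otimes> a2 \<in> m \<and> r \<odot>[E] y2 = \<zero>[E]"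
      using lift[OF z(2,4)] k by blast
    \<comment> \<open>For m' = m both elements come from R/m, since E has nothing annihilated by m.
      For m' different from m both come from E, since m' has an element that is invertible modulo
      m.\<close>
    show "z2 \<in> cyc R ?Z z1"
    proof (cases "m' = m")
      case True
      have y0: "y1 = \<zero>[E]" "y2 = \<zero>[E]" using * 1(2,5) 2(2,5) True by blast+
      have "a1 \<notin> m" using 1(4) y0 by (simp add: C_def)
      then obtain n s where ns: "n \<in> m" "n \<in> carrier R" "s \<in> carrier R" "\<one> = n \<oplus> s \<otimes> a1" using maximal_one[OF m 1(1)] by blast
      have "a2 = a2 \<otimes> \<one>" using 2(1) by simp
      also have "\<dots> = a2 \<otimes> n \<oplus> (a2 \<otimes> s) \<otimes> a1" unfolding ns(4) using ns(2,3) 1(1) 2(1) by (simp add: r_distr m_assoc)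
      finally have a2: "a2 = a2 \<otimes> n \<oplus> (a2 \<otimes> s) \<otimes> a1" .
      have "(a2 \<otimes> s) \<otimes> a1 \<in> carrier R" using 1(1) 2(1) ns(3) by simp
      then have "C +>[F] (a2 \<otimes> n \<oplus> (a2 \<otimes> s) \<otimes> a1, \<zero>[E]) = C +>[F] ((a2 \<otimes> s) \<otimes> a1, \<zero>[E])"
        by (intro split[OF mI[OF 2(1) ns(1)]]) simp_all
      then have "z2 = C +>[F] ((a2 \<otimes> s) \<otimes> a1, \<zero>[E])"
        using 2(3) y0(2) unfolding a2[symmetric] by (simp only:)
      also have "\<dots> = C +>[F] ((a2 \<otimes> s) \<odot>[F] (a1, y1))" using y0 2 ns by (simp add: F_smult E.smult_r_null)
      also have "\<dots> = (a2 \<otimes> s) \<odot>[?Z] z1" using p.smult[of "a2 \<otimes> s" "(a1, y1)"] 1 2 ns F_mem by simp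
      finally show ?thesis using p.cod.cyc_mem[of "a2 \<otimes> s" z1] 2 ns by simp
    next
      case False
      have "\<not> m' \<subseteq> m" using m m' False unfolding maximal_submodule_def by blast
      then obtain r where r: "r \<in> m'" "r \<notin> m" by blast
      obtain n s where ns: "n \<in> m" "n \<in> carrier R" "s \<in> carrier R" "\<one> = n \<oplus> s \<otimes> r" using maximal_one[OF m m'R[OF r(1)] r(2)] by blast
      have am: "a \<in> m" if "a \<in> carrier R" "r \<otimes> a \<in> m" for a
      proof -
        have "a = \<one> \<otimes> a" using that by simp
        also have "\<dots> = n \<otimes> a \<oplus> s \<otimes> (r \<otimes> a)" unfolding ns(4) using ns(2,3) m'R[OF r(1)] that by (simp add: l_distr m_assoc)
        also have "n \<otimes> a = a \<otimes> n" by (rule m_comm[OF ns(2) that(1)])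
        finally have "a = a \<otimes> n \<oplus> s \<otimes> (r \<otimes> a)" .
        moreover have "a \<otimes> n \<oplus> s \<otimes> (r \<otimes> a) \<in> m" using L.sub_add[OF sm(1) mI[OF that(1) ns(1)] mI[OF ns(3) that(2)]] by simp
        ultimately show ?thesis using that by simp
      qed
      have a: "a1 \<in> m" "a2 \<in> m" using am 1 2 r by blast+
      have zz: "z1 = C +>[F] (\<zero>, y1)" "z2 = C +>[F] (\<zero>, y2)"
        using split[OF a(1), of \<zero> y1] split[OF a(2), of \<zero> y2] 1 2 by simp_all
      have ne: "y1 \<noteq> \<zero>[E]" "y2 \<noteq> \<zero>[E]" using 1(4) 2(4) a by (auto simp: C_def)
      obtain t where t: "t \<in> carrier R" "y2 = t \<odot>[E] y1"
        by (rule mult_freeD[OF mf m' 1(2) 2(2) ne]) (use 1 2 in auto)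
      have "z2 = t \<odot>[?Z] z1" using zz t 1 p.smult[of t "(\<zero>, y1)"] F_mem by (simp add: F_smult)
      then show ?thesis using p.cod.cyc_mem[OF t(1)] by simp
    qed
  qed
  then have "\<exists>y\<in>carrier E. (\<one>, y) \<in> C"
    by (intro extend_aux[OF left_module_regular fin_R F_def C]) (simp_all add: C_def)
  then have "\<one> \<in> m" by (simp add: C_def)
  then have rm: "r \<in> m" if "r \<in> carrier R" for r using mI[OF that, of \<one>] that by simp
  have "m \<subseteq> carrier R" using L.sub_subset[OF sm(1)] by simp
  then show False using sm(2) rm by blast
qed

text \<open>Choose C containing N and covered by N + R x. Some nonzero y in E is annihilated by the
  maximal ideal that takes x into C. So sending C to 0 and x to y is well defined, and it extends to
  X.\<close>

lemma separate:
  assumes X: "left_module R X" "mlen R X < \<infinity>" and N: "submodule N R X" and x: "x \<in> carrier X" "x \<notin> N"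
  shows "\<exists>h\<in>module_homs R X E. (\<forall>n\<in>N. h n = \<zero>[E]) \<and> h x \<noteq> \<zero>[E]"
proof -
  interpret X: left_module R X by fact
  interpret F: left_module R "prod_module X E" by (rule left_module_prod[OF X(1) E.left_module_axioms])
  let ?V = "N <+>[X] cyc R X x"
  have sx: "submodule (cyc R X x) R X" by (rule X.sub_cyc[OF x(1)])
  have V: "submodule ?V R X" "N \<subseteq> ?V" "x \<in> ?V"
    using X.sub_sum[OF N sx] X.sum_upper[OF N sx] X.cyc_self[OF x(1)] by blast+
  then have "N \<subset> ?V" using x by blast
  then obtain C where C: "N \<subseteq> C" "covers R X C ?V" by (rule X.exists_cocover[OF N V(1) _ X(2)])
  have sC: "submodule C R X" using C by (simp add: covers_def)
  have xC: "x \<notin> C"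
  proof
    assume "x \<in> C"
    then have "?V \<subseteq> C" by (intro X.sum_least[OF sC C(1)] X.cyc_least[OF sC])
    then show False using C by (auto simp: covers_def)
  qed
  obtain y where y: "y \<in> carrier E" "y \<noteq> \<zero>[E]" "\<forall>r\<in>{r \<in> carrier R. r \<odot>[X] x \<in> C}. r \<odot>[E] y = \<zero>[E]"
    using exists_killed[OF X.covers_maximal[OF C(2) V(3) xC]] by blast
  let ?F = "prod_module X E"
  let ?C0 = "(C \<times> {\<zero>[E]}) <+>[?F] cyc R ?F (x, y)"
  have xy: "(x, y) \<in> carrier ?F" using x y by simp
  have s1: "submodule (C \<times> {\<zero>[E]}) R ?F" by (rule sub_Times[OF X(1) E.left_module_axioms sC E.sub_0])
  have s2: "submodule (cyc R ?F (x, y)) R ?F" by (rule F.sub_cyc[OF xy])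
  have "\<exists>h\<in>module_homs R X E. \<forall>x y. (x, y) \<in> ?C0 \<longrightarrow> h x = y"
  proof (rule extend[OF X refl F.sub_sum[OF s1 s2]])
    fix z assume "(\<zero>[X], z) \<in> ?C0"
    then obtain c r where cr: "c \<in> C \<times> {\<zero>[E]}" "r \<in> carrier R" "(\<zero>[X], z) = c \<oplus>[?F] r \<odot>[?F] (x, y)"
      unfolding F.mem_sum_cyc by blast
    obtain c' where c': "c' \<in> C" "c = (c', \<zero>[E])" using cr(1) by auto
    have c'X: "c' \<in> carrier X" by (rule X.sub_mem[OF sC c'(1)])
    have rx: "r \<odot>[X] x \<in> carrier X" using cr x by (simp add: X.smult_closed)
    have e: "\<zero>[X] = c' \<oplus>[X] r \<odot>[X] x" "z = r \<odot>[E] y" using cr c' y by (simp_all add: E.smult_closed)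
    have "c' \<oplus>[X] r \<odot>[X] x \<in> C" using e(1) X.sub_zero[OF sC] by simp
    then have "r \<odot>[X] x \<in> C" using X.sub_add_cancel(2)[OF sC c'(1) rx] by simp
    then show "z = \<zero>[E]" using y(3) cr(2) e(2) by simp
  qed
  then obtain h where h: "h \<in> module_homs R X E" "\<forall>x y. (x, y) \<in> ?C0 \<longrightarrow> h x = y" by blast
  have "(x, y) \<in> ?C0" using F.sum_upper(2)[OF s1 s2] F.cyc_self[OF xy] by blast
  then have "h x = y" using h(2) by blast
  moreover have "h n = \<zero>[E]" if "n \<in> N" for n
  proof -
    have "(n, \<zero>[E]) \<in> ?C0" using F.sum_upper(1)[OF s1 s2] that C(1) by blast
    then show ?thesis using h(2) by blast
  qed
  ultimately show ?thesis using h(1) y(2) by blast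
qed

end

section \<open>Artin algebras\<close>

definition restrict_scalars :: "('r, 'z) ring_scheme \<Rightarrow> ('r, 'a, 'x) module_scheme \<Rightarrow> ('a, 'm, 'y) module_scheme \<Rightarrow> ('r, 'm) module" where
  "restrict_scalars R A M = \<lparr>carrier = carrier M, mult = undefined, one = undefined, zero = \<zero>[M], add = add M,
     smult = (\<lambda>r x. (r \<odot>[A] \<one>[A]) \<odot>[M] x)\<rparr>"

lemma restrict_scalars_simps [simp]: "carrier (restrict_scalars R A M) = carrier M"
  "\<zero>[restrict_scalars R A M] = \<zero>[M]" "x \<oplus>[restrict_scalars R A M] y = x \<oplus>[M] y"
  "r \<odot>[restrict_scalars R A M] x = (r \<odot>[A] \<one>[A]) \<odot>[M] x"
  by (simp_all add: restrict_scalars_def)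

lemma smult_opposite [simp]: "r \<odot>[opposite A] x = r \<odot>[A] x"
  by (simp add: opposite_def)

context artin_algebra begin

lemma left_module_RA: "left_module R A"
  by (intro left_module.intro left_module_axioms.intro R.ring_axioms M.abelian_group_axioms)
    (auto simp: smult_l_distr smult_r_distr smult_assoc1)

lemma sc:
  assumes "r \<in> carrier R"
  shows "r \<odot>[A] \<one>[A] \<in> carrier A"
    and "a \<in> carrier A \<Longrightarrow> (r \<odot>[A] \<one>[A]) \<otimes>[A] a = r \<odot>[A] a"
    and "a \<in> carrier A \<Longrightarrow> a \<otimes>[A] (r \<odot>[A] \<one>[A]) = r \<odot>[A] a"
  using assms by (simp_all add: smult_mult_left smult_mult_right)

lemma artin_algebra_opposite: "artin_algebra R (opposite A)"
proof -
  have ring: "ring (opposite A)" by (rule ring_opposite)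
  have m: "Module.module R (opposite A)"
    using ring.is_abelian_group[OF ring]
    by (intro moduleI R.is_cring) (auto simp: smult_l_distr smult_r_distr smult_assoc1)
  interpret A: left_module R A by (rule left_module_RA)
  interpret m: Module.module R "opposite A" by (rule m)
  have "left_module R (opposite A)"
    by (intro left_module.intro left_module_axioms.intro R.ring_axioms m.M.abelian_group_axioms)
      (auto simp: smult_l_distr smult_r_distr smult_assoc1)
  then interpret O: left_module R "opposite A" .
  have sub: "submodule N R (opposite A) \<longleftrightarrow> submodule N R A" for N
    unfolding A.sub_iff O.sub_iff by simp
  show ?thesis
  proof (intro artin_algebra.intro artin_algebra_axioms.intro m ring artinian_base)
    show "finitely_generated R (opposite A)"
      using finitely_generated_algebra unfolding finitely_generated_def sub by simp
  qed (simp_all add: smult_mult_left smult_mult_right)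
qed

lemma left_module_rs:
  assumes "left_module A M" shows "left_module R (restrict_scalars R A M)"
proof -
  interpret M: left_module A M by fact
  have "abelian_group (restrict_scalars R A M)"
  proof (rule abelian_groupI)
    fix x assume "x \<in> carrier (restrict_scalars R A M)"
    then show "\<exists>y\<in>carrier (restrict_scalars R A M). y \<oplus>[restrict_scalars R A M] x = \<zero>[restrict_scalars R A M]"
      by (intro bexI[of _ "\<ominus>[M] x"]) (auto simp: M.l_neg)
  qed (auto simp: M.a_ac)
  moreover have "((r \<otimes> s) \<odot>[A] \<one>[A]) \<odot>[M] x = (r \<odot>[A] \<one>[A]) \<odot>[M] ((s \<odot>[A] \<one>[A]) \<odot>[M] x)"
    if "r \<in> carrier R" "s \<in> carrier R" "x \<in> carrier M" for r s x
    using that sc(1,2) by (simp add: M.smult_assoc[symmetric] smult_assoc1)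
  ultimately show ?thesis
    by (intro left_module.intro left_module_axioms.intro R.ring_axioms)
      (auto simp: M.smult_closed M.smult_l_distr M.smult_r_distr M.smult_one smult_l_distr sc)
qed

lemma sub_rs:
  assumes "left_module A M" "submodule N A M" shows "submodule N R (restrict_scalars R A M)"
proof -
  interpret M: left_module A M by fact
  interpret X: left_module R "restrict_scalars R A M" by (rule left_module_rs[OF assms(1)])
  show ?thesis using assms(2) sc(1) unfolding X.sub_iff M.sub_iff by simp
qed

lemma il_rs_le: "left_module A M \<Longrightarrow> il A M U V \<le> il R (restrict_scalars R A M) U V"
  unfolding il_def by (rule height_mono) (auto simp: subs_def sub_rs)

lemma fin_R: "mlen R (regular_module R) < \<infinity>"
  by (rule R.artinian_finite_length[OF artinian_base])

lemma fin_rs_regular: "mlen R (restrict_scalars R A (regular_module A)) < \<infinity>"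
proof -
  interpret A: left_module R A by (rule left_module_RA)
  have l: "left_module R (restrict_scalars R A (regular_module A))" by (rule left_module_rs[OF left_module_regular])
  have "liso R A (restrict_scalars R A (regular_module A)) (\<lambda>x. x)"
    by (intro liso.intro liso_axioms.intro A.hom_lhom l) (simp_all add: module_homs_def sc)
  then interpret i: liso R A "restrict_scalars R A (regular_module A)" "\<lambda>x. x" .
  show ?thesis using i.mlen_eq A.fg_imp_finite_length[OF finitely_generated_algebra fin_R] by simp
qed

lemma fin_A: "mlen A (regular_module A) < \<infinity>"
proof (rule le_less_trans[OF _ fin_rs_regular])
  show "mlen A (regular_module A) \<le> mlen R (restrict_scalars R A (regular_module A))"
    using il_rs_le[OF left_module_regular] by simp
qed

lemma fl_ring: "fl_ring A"
  by (intro fl_ring.intro fl_ring_axioms.intro ring_axioms fin_A artin_algebra.fin_A[OF artin_algebra_opposite])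

text \<open>A has finite length over R, so each A x has finite length over R. A maximal A-submodule
  of finite R-length can absorb any A x and is therefore everything.\<close>

lemma fin_rs:
  assumes "left_module A M" "mlen A M < \<infinity>" shows "mlen R (restrict_scalars R A M) < \<infinity>"
proof -
  interpret M: left_module A M by fact
  let ?X = "restrict_scalars R A M"
  interpret X: left_module R ?X by (rule left_module_rs[OF assms(1)])
  define P where "P C \<longleftrightarrow> il R ?X {\<zero>[M]} C < \<infinity>" for C
  have "P {\<zero>[M]}" unfolding P_def by (simp add: X.il_refl)
  from M.exists_max_submodule[of P, OF this M.sub_0 assms(2)] obtain C where
    C': "submodule C A M \<and> {\<zero>[M]} \<subseteq> C \<and> P C \<and> (\<forall>D. submodule D A M \<longrightarrow> C \<subseteq> D \<longrightarrow> P D \<longrightarrow> D = C)" ..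
  then have C: "submodule C A M" "P C" and Cmax: "\<And>D. submodule D A M \<Longrightarrow> C \<subseteq> D \<Longrightarrow> P D \<Longrightarrow> D = C" by simp_all
  have "x \<in> C" if x: "x \<in> carrier M" for x
  proof -
    have sx: "submodule (cyc A M x) A M" by (rule M.sub_cyc[OF x])
    have l: "left_module R (restrict_scalars R A (regular_module A))" by (rule left_module_rs[OF left_module_regular])
    have "(\<lambda>a. a \<odot>[M] x) \<in> module_homs R (restrict_scalars R A (regular_module A)) ?X"
      using x sc(1,2) by (simp add: module_homs_def M.smult_closed M.smult_l_distr M.smult_assoc[symmetric])
    then have "lhom R (restrict_scalars R A (regular_module A)) ?X (\<lambda>a. a \<odot>[M] x)"
      by (rule left_module.hom_lhom[OF l X.left_module_axioms])
    then interpret f: lhom R "restrict_scalars R A (regular_module A)" ?X "\<lambda>a. a \<odot>[M] x" .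
    have "il R ?X {\<zero>[M]} (cyc A M x) \<le> mlen R (restrict_scalars R A (regular_module A))"
      using f.il_image_le[OF f.dom.sub_carrier] by (simp add: cyc_def)
    then have c: "il R ?X {\<zero>[M]} (cyc A M x) < \<infinity>" using fin_rs_regular by (rule le_less_trans)
    have sum: "C <+>[?X] cyc A M x = C <+>[M] cyc A M x" by (simp add: set_add_def')
    have "il R ?X {\<zero>[M]} (C <+>[M] cyc A M x) \<le> il R ?X {\<zero>[M]} C + il R ?X {\<zero>[M]} (cyc A M x)"
      using X.il_sum_le[OF sub_rs[OF assms(1) C(1)] sub_rs[OF assms(1) sx]] sum by simp
    also have "\<dots> < \<infinity>" using c C(2) unfolding P_def
      by (cases "il R ?X {\<zero>[M]} C"; cases "il R ?X {\<zero>[M]} (cyc A M x)") simp_all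
    finally have "P (C <+>[M] cyc A M x)" by (simp add: P_def)
    then have "C <+>[M] cyc A M x = C" by (rule Cmax[OF M.sub_sum[OF C(1) sx] M.sum_upper(1)[OF C(1) sx]])
    then show ?thesis using M.sum_upper(2)[OF C(1) sx] M.cyc_self[OF x] by blast
  qed
  then have "C = carrier M" using M.sub_subset[OF C(1)] by blast
  then show ?thesis using C(2) by (simp add: P_def)
qed

end

section \<open>Duality\<close>

text \<open>Homomorphisms over R from M to E; since a acts by (a f)(x) = f (a x), the result is a
  module over \<open>opposite A\<close>. Functionals are extensional, so that they are determined by
  their values on the carrier.\<close>

definition dual :: "('r, 'z) ring_scheme \<Rightarrow> ('r, 'a, 'x) module_scheme \<Rightarrow> ('a, 'm, 'y) module_scheme \<Rightarrow>
    ('r, 'e, 'w) module_scheme \<Rightarrow> ('a, 'm \<Rightarrow> 'e) module" where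
  "dual R A M E = \<lparr>carrier = module_homs R (restrict_scalars R A M) E \<inter> extensional (carrier M),
     mult = undefined, one = undefined, zero = (\<lambda>x\<in>carrier M. \<zero>[E]),
     add = (\<lambda>f g. \<lambda>x\<in>carrier M. f x \<oplus>[E] g x), smult = (\<lambda>a f. \<lambda>x\<in>carrier M. f (a \<odot>[M] x))\<rparr>"

lemma dual_simps: "\<zero>[dual R A M E] = (\<lambda>x\<in>carrier M. \<zero>[E])"
  "f \<oplus>[dual R A M E] g = (\<lambda>x\<in>carrier M. f x \<oplus>[E] g x)"
  "a \<odot>[dual R A M E] f = (\<lambda>x\<in>carrier M. f (a \<odot>[M] x))"
  by (simp_all add: dual_def)

lemma dual_carrier: "f \<in> carrier (dual R A M E) \<longleftrightarrow> f \<in> extensional (carrier M) \<and> f \<in> module_homs R (restrict_scalars R A M) E"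
  by (auto simp: dual_def)

locale artin_dual = artin_algebra R A + cogen: cogenerator R E
  for R :: "('r, 'z) ring_scheme" (structure) and A :: "('r, 'a, 'x) module_scheme" (structure) and E :: "'r fg_module"
begin

lemma artin_dual_opposite: "artin_dual R (opposite A) E"
  by (intro artin_dual.intro artin_algebra_opposite cogen.cogenerator_axioms)

context
  fixes M :: "('a, 'm, 'y) module_scheme"
  assumes M: "left_module A M" and fin_M: "mlen A M < \<infinity>"
begin

interpretation M: left_module A M by (rule M)
interpretation X: left_module R "restrict_scalars R A M" by (rule left_module_rs[OF M])

abbreviation "D \<equiv> dual R A M E"

lemma D_iff: "f \<in> carrier D \<longleftrightarrow> f \<in> extensional (carrier M) \<and> (\<forall>x\<in>carrier M. f x \<in> carrier E) \<and>
   (\<forall>x\<in>carrier M. \<forall>y\<in>carrier M. f (x \<oplus>[M] y) = f x \<oplus>[E] f y) \<and>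
   (\<forall>r\<in>carrier R. \<forall>x\<in>carrier M. f ((r \<odot>[A] \<one>[A]) \<odot>[M] x) = r \<odot>[E] f x)"
  by (auto simp: dual_carrier module_homs_def)

lemma DD:
  assumes "f \<in> carrier D"
  shows "f \<in> extensional (carrier M)" "x \<in> carrier M \<Longrightarrow> f x \<in> carrier E"
    "x \<in> carrier M \<Longrightarrow> y \<in> carrier M \<Longrightarrow> f (x \<oplus>[M] y) = f x \<oplus>[E] f y"
    "r \<in> carrier R \<Longrightarrow> x \<in> carrier M \<Longrightarrow> f ((r \<odot>[A] \<one>[A]) \<odot>[M] x) = r \<odot>[E] f x"
  using assms by (simp_all add: D_iff)

lemma D_eqI: "f \<in> extensional (carrier M) \<Longrightarrow> g \<in> extensional (carrier M) \<Longrightarrow> (\<And>x. x \<in> carrier M \<Longrightarrow> f x = g x) \<Longrightarrow> f = g"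
  by (rule extensionalityI)

lemma D_smult_closed: "a \<in> carrier A \<Longrightarrow> f \<in> carrier D \<Longrightarrow> a \<odot>[D] f \<in> carrier D"
proof -
  assume a: "a \<in> carrier A" and f: "f \<in> carrier D"
  have "a \<odot>[M] ((r \<odot>[A] \<one>[A]) \<odot>[M] x) = (r \<odot>[A] \<one>[A]) \<odot>[M] (a \<odot>[M] x)" if "r \<in> carrier R" "x \<in> carrier M" for r x
    using that a sc by (simp add: M.smult_assoc[symmetric])
  then show ?thesis
    unfolding D_iff using a DD[OF f] sc(1) by (simp add: dual_simps M.smult_closed M.smult_r_distr)
qed

lemma D_add_closed: "f \<in> carrier D \<Longrightarrow> g \<in> carrier D \<Longrightarrow> f \<oplus>[D] g \<in> carrier D"
  unfolding D_iff[of "f \<oplus>[D] g"] using DD[of f] DD[of g] sc(1)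
  by (simp add: dual_simps M.smult_closed cogen.E.a_ac cogen.E.smult_r_distr)

lemma left_module_dual: "left_module (opposite A) D"
proof -
  have "abelian_group D"
  proof (rule abelian_groupI)
    show "\<zero>[D] \<in> carrier D" unfolding D_iff using sc(1) by (simp add: dual_simps M.smult_closed cogen.E.smult_r_null)
    fix f assume f: "f \<in> carrier D"
    show "\<zero>[D] \<oplus>[D] f = f" by (rule D_eqI) (use DD[OF f] in \<open>simp_all add: dual_simps\<close>)
    show "\<exists>g\<in>carrier D. g \<oplus>[D] f = \<zero>[D]"
    proof (rule bexI)
      show "(\<ominus>[A] \<one>[A]) \<odot>[D] f \<in> carrier D" using f by (simp add: D_smult_closed)
      show "(\<ominus>[A] \<one>[A]) \<odot>[D] f \<oplus>[D] f = \<zero>[D]"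
      proof (rule D_eqI)
        fix x assume x: "x \<in> carrier M"
        have "f (\<ominus>[M] x) \<oplus>[E] f x = f (\<ominus>[M] x \<oplus>[M] x)" using x DD(3)[OF f] by simp
        also have "\<dots> = f ((\<zero> \<odot>[A] \<one>[A]) \<odot>[M] x)" using x by (simp add: M.l_neg M.smult_l_null)
        also have "\<dots> = \<zero> \<odot>[E] f x" by (rule DD(4)[OF f R.zero_closed x])
        also have "\<dots> = \<zero>[E]" by (rule cogen.E.smult_l_null[OF DD(2)[OF f x]])
        finally show "((\<ominus>[A] \<one>[A]) \<odot>[D] f \<oplus>[D] f) x = \<zero>[D] x" using x by (simp add: dual_simps M.smult_minus_one)
      qed (simp_all add: dual_simps)
    qed
    fix g assume g: "g \<in> carrier D"
    show "f \<oplus>[D] g \<in> carrier D" by (rule D_add_closed[OF f g])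
    show "f \<oplus>[D] g = g \<oplus>[D] f" by (rule D_eqI) (use DD[OF f] DD[OF g] in \<open>simp_all add: dual_simps cogen.E.a_comm\<close>)
    fix h assume h: "h \<in> carrier D"
    show "(f \<oplus>[D] g) \<oplus>[D] h = f \<oplus>[D] (g \<oplus>[D] h)"
      by (rule D_eqI) (use DD[OF f] DD[OF g] DD[OF h] in \<open>simp_all add: dual_simps cogen.E.a_assoc\<close>)
  qed
  then show ?thesis
  proof (intro left_module.intro left_module_axioms.intro ring_opposite)
    fix a b f assume a: "a \<in> carrier (opposite A)" and b: "b \<in> carrier (opposite A)" and f: "f \<in> carrier D"
    have ab: "a \<in> carrier A" "b \<in> carrier A" using a b by simp_all
    show "(a \<oplus>[opposite A] b) \<odot>[D] f = a \<odot>[D] f \<oplus>[D] b \<odot>[D] f"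
      by (rule D_eqI) (use DD[OF f] ab in \<open>simp_all add: dual_simps M.smult_closed M.smult_l_distr\<close>)
    show "(a \<otimes>[opposite A] b) \<odot>[D] f = a \<odot>[D] (b \<odot>[D] f)"
      by (rule D_eqI) (use DD[OF f] ab in \<open>simp_all add: dual_simps M.smult_closed M.smult_assoc\<close>)
  next
    fix a f assume a: "a \<in> carrier (opposite A)" and f: "f \<in> carrier D"
    show "a \<odot>[D] f \<in> carrier D" using a f by (simp add: D_smult_closed)
    fix g assume g: "g \<in> carrier D"
    show "a \<odot>[D] (f \<oplus>[D] g) = a \<odot>[D] f \<oplus>[D] a \<odot>[D] g"
      by (rule D_eqI) (use a in \<open>simp_all add: dual_simps M.smult_closed\<close>)
  next
    fix f assume f: "f \<in> carrier D"
    show "\<one>[opposite A] \<odot>[D] f = f"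
      by (rule D_eqI) (use DD[OF f] in \<open>simp_all add: dual_simps M.smult_one\<close>)
  qed
qed

interpretation D: left_module "opposite A" D by (rule left_module_dual)
interpretation Y: left_module R "restrict_scalars R (opposite A) D"
  by (rule artin_algebra.left_module_rs[OF artin_algebra_opposite left_module_dual])

lemma dual_pairing: "pairing R (restrict_scalars R A M) (restrict_scalars R (opposite A) D) E (\<lambda>x f. f x)"
  by (intro pairing.intro pairing_axioms.intro R.is_cring X.left_module_axioms Y.left_module_axioms cogen.E.left_module_axioms)
    (simp_all add: DD dual_simps)

interpretation P: pairing R "restrict_scalars R A M" "restrict_scalars R (opposite A) D" E "\<lambda>x f. f x" by (rule dual_pairing)
interpretation Pf: pairing R "restrict_scalars R (opposite A) D" "restrict_scalars R A M" E "\<lambda>f x. f x" by (rule P.flip)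

section \<open>The annihilator correspondence between M and its dual\<close>

abbreviation "annD N \<equiv> {f \<in> carrier D. \<forall>x\<in>N. f x = \<zero>[E]}"
abbreviation "annM F \<equiv> {x \<in> carrier M. \<forall>f\<in>F. f x = \<zero>[E]}"

lemma perp_eq: "P.perp N = annD N" "Pf.perp F = annM F"
  by (simp_all add: P.perp_def Pf.perp_def)

lemma sub_annD: "submodule N A M \<Longrightarrow> submodule (annD N) (opposite A) D"
proof -
  assume N: "submodule N A M"
  have c: "\<And>x. x \<in> N \<Longrightarrow> x \<in> carrier M" by (rule M.sub_mem[OF N])
  show ?thesis
    unfolding D.sub_iff
  proof (intro conjI ballI)
    show "\<zero>[D] \<in> annD N" using c by (simp add: dual_simps D.M.zero_closed[unfolded dual_simps])
    fix f assume f: "f \<in> annD N"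
    show "f \<oplus>[D] g \<in> annD N" if "g \<in> annD N" for g
      using f that D_add_closed[of f g] c by (simp add: dual_simps)
    show "a \<odot>[D] f \<in> annD N" if "a \<in> carrier (opposite A)" for a
      using f that D_smult_closed[of a f] c M.sub_smult[OF N] by (simp add: dual_simps)
  qed auto
qed

lemma sub_annM: "submodule F (opposite A) D \<Longrightarrow> submodule (annM F) A M"
proof -
  assume F: "submodule F (opposite A) D"
  have c: "f \<in> carrier D" if "f \<in> F" for f by (rule D.sub_mem[OF F that])
  show ?thesis
    unfolding M.sub_iff
  proof (intro conjI ballI)
    show "\<zero>[M] \<in> annM F" using P.B_zero_l c by simp
    fix x assume x: "x \<in> annM F"
    show "x \<oplus>[M] y \<in> annM F" if "y \<in> annM F" for y using x that DD(3)[OF c] by simp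
    show "a \<odot>[M] x \<in> annM F" if a: "a \<in> carrier A" for a
    proof -
      have "f (a \<odot>[M] x) = \<zero>[E]" if f: "f \<in> F" for f
      proof -
        have "a \<odot>[D] f \<in> F" using D.sub_smult[OF F _ f] a by simp
        then have "(a \<odot>[D] f) x = \<zero>[E]" using x by blast
        then show ?thesis using x by (simp add: dual_simps)
      qed
      then show ?thesis using x a by (simp add: M.smult_closed)
    qed
  qed auto
qed

lemma fin_X: "mlen R (restrict_scalars R A M) < \<infinity>" by (rule fin_rs[OF M fin_M])

lemma functional:
  assumes N: "submodule N A M" and x: "x \<in> carrier M" "x \<notin> N"
  shows "\<exists>f\<in>annD N. f x \<noteq> \<zero>[E]"
proof -
  obtain h where h: "h \<in> module_homs R (restrict_scalars R A M) E" "\<forall>n\<in>N. h n = \<zero>[E]" "h x \<noteq> \<zero>[E]"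
    using cogen.separate[OF left_module_rs[OF M] fin_X sub_rs[OF M N]] x by auto
  have c: "\<And>x. x \<in> N \<Longrightarrow> x \<in> carrier M" by (rule M.sub_mem[OF N])
  have "restrict h (carrier M) \<in> carrier D"
    unfolding D_iff using h(1) sc(1) by (simp add: module_homs_def M.smult_closed Pi_iff)
  then have "restrict h (carrier M) \<in> annD N" using h(2) c by simp
  moreover have "restrict h (carrier M) x \<noteq> \<zero>[E]" using h(3) x by simp
  ultimately show ?thesis by blast
qed

lemma annM_annD: "submodule N A M \<Longrightarrow> annM (annD N) = N"
  using functional[of N] M.sub_mem[of N] by blast

lemma annD_carrier: "annD (carrier M) = {\<zero>[D]}"
proof -
  have "f = \<zero>[D]" if "f \<in> annD (carrier M)" for f
    by (rule D_eqI) (use that DD(1)[of f] in \<open>simp_all add: dual_simps\<close>)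
  moreover have "\<zero>[D] \<in> annD (carrier M)" using D.sub_zero[OF sub_annD[OF M.sub_carrier]] .
  ultimately show ?thesis by blast
qed

lemma annD_zero: "annD {\<zero>[M]} = carrier D" using P.perp_zero perp_eq by simp
lemma annM_zero: "annM {\<zero>[D]} = carrier M" using Pf.perp_zero perp_eq by simp

text \<open>F lies in its double annihilator. Taking complements twice cannot increase lengths over
  R, so the double annihilator is not longer than F.\<close>

lemma annD_annM:
  assumes F: "submodule F (opposite A) D" shows "annD (annM F) = F"
proof (rule ccontr)
  let ?X = "restrict_scalars R A M" and ?Y = "restrict_scalars R (opposite A) D"
  assume ne: "annD (annM F) \<noteq> F"
  have sub: "F \<subseteq> annD (annM F)" using D.sub_mem[OF F] by blast
  have FY: "submodule F R ?Y" by (rule artin_algebra.sub_rs[OF artin_algebra_opposite left_module_dual F])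
  have aY: "submodule (annD (annM F)) R ?Y"
    by (rule artin_algebra.sub_rs[OF artin_algebra_opposite left_module_dual sub_annD[OF sub_annM[OF F]]])
  have aX: "submodule (annM F) R ?X" by (rule sub_rs[OF M sub_annM[OF F]])
  have finX: "il R ?X U V < \<infinity>" if "submodule U R ?X" "V \<subseteq> carrier M" for U V
    by (rule le_less_trans[OF X.il_mono fin_X]) (use that X.sub_zero[OF that(1)] in simp_all)
  have 1: "il R ?Y {\<zero>[D]} (annD (annM F)) \<le> il R ?X (annM F) (carrier M)"
    using P.il_perp[OF cogen.mf aX X.sub_carrier X.sub_subset[OF aX]] finX[OF aX, of "carrier M"]
    by (simp add: perp_eq annD_carrier)
  have "il R ?Y {\<zero>[D]} (carrier D) \<le> il R ?X {\<zero>[M]} (carrier M)"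
    using P.il_perp[OF cogen.mf X.sub_0 X.sub_carrier] finX[OF X.sub_0, of "carrier M"]
    using P.perp_zero perp_eq(1)[of "carrier M"] by (simp add: annD_carrier)
  then have finY: "il R ?Y {\<zero>[D]} (carrier D) < \<infinity>" by (rule le_less_trans) (use fin_X in simp)
  have fF: "il R ?Y {\<zero>[D]} V < \<infinity>" if "V \<subseteq> carrier D" for V
    by (rule le_less_trans[OF Y.il_mono finY]) (use that in simp_all)
  have 2: "il R ?X (annM F) (carrier M) \<le> il R ?Y {\<zero>[D]} F"
    using Pf.il_perp[OF cogen.mf Y.sub_0 FY] fF[of F] D.sub_subset[OF F] D.sub_zero[OF F]
    using Pf.perp_zero perp_eq(2)[of F] by simp
  have ps: "F \<subset> annD (annM F)" using sub ne by blast
  have s0: "submodule {\<zero>[D]} R ?Y" using Y.sub_0 by simp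
  have z: "{\<zero>[D]} \<subseteq> F" using D.sub_zero[OF F] by simp
  have "il R ?Y {\<zero>[D]} F + 1 \<le> il R ?Y {\<zero>[D]} (annD (annM F))"
    by (rule Y.il_strict[OF s0 FY aY z ps])
  then have "il R ?Y {\<zero>[D]} F + 1 \<le> il R ?Y {\<zero>[D]} F" by (rule order_trans[OF _ order_trans[OF 1 2]])
  moreover have "il R ?Y {\<zero>[D]} F < \<infinity>" by (rule fF[OF D.sub_subset[OF F]])
  ultimately show False by (cases "il R ?Y {\<zero>[D]} F") (simp_all add: one_enat_def)
qed

text \<open>Taking annihilators is an inclusion-reversing bijection between the A-submodules of M
  and the submodules of its dual over the opposite ring.\<close>

lemma mlen_dual: "mlen (opposite A) D = mlen A M"
proof (rule antisym)
  show "mlen (opposite A) D \<le> mlen A M"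
    unfolding il_def
  proof (rule height_anti_map[where f = "\<lambda>F. annM F"])
    show "inj_on annM (subs (opposite A) D {\<zero>[D]} (carrier D))"
      by (rule inj_on_inverseI[where g = "\<lambda>N. annD N"]) (rule annD_annM, simp only: D.subs_mem)
    fix F assume "F \<in> subs (opposite A) D {\<zero>[D]} (carrier D)"
    then have s: "submodule (annM F) A M" by (simp add: D.subs_mem sub_annM)
    show "annM F \<in> subs A M {\<zero>[M]} (carrier M)" unfolding M.subs_mem using s M.sub_zero[OF s] by blast
  qed blast
  show "mlen A M \<le> mlen (opposite A) D"
    unfolding il_def
  proof (rule height_anti_map[where f = "\<lambda>N. annD N"])
    show "inj_on annD (subs A M {\<zero>[M]} (carrier M))"
      by (rule inj_on_inverseI[where g = "\<lambda>F. annM F"]) (rule annM_annD, simp only: M.subs_mem)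
    fix N assume "N \<in> subs A M {\<zero>[M]} (carrier M)"
    then have s: "submodule (annD N) (opposite A) D" by (simp add: M.subs_mem sub_annD)
    show "annD N \<in> subs (opposite A) D {\<zero>[D]} (carrier D)" unfolding D.subs_mem using s D.sub_zero[OF s] by blast
  qed blast
qed

lemma uniserial_dual: "uniserial (opposite A) D \<longleftrightarrow> uniserial A M"
proof
  assume u: "uniserial A M"
  show "uniserial (opposite A) D"
    unfolding uniserial_def
  proof (intro allI impI)
    fix F G assume FG: "submodule F (opposite A) D \<and> submodule G (opposite A) D"
    have "annM F \<subseteq> annM G \<or> annM G \<subseteq> annM F"
      using u sub_annM[OF FG[THEN conjunct1]] sub_annM[OF FG[THEN conjunct2]] by (simp only: uniserial_def)
    then have "annD (annM G) \<subseteq> annD (annM F) \<or> annD (annM F) \<subseteq> annD (annM G)" by blast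
    then show "F \<subseteq> G \<or> G \<subseteq> F"
      unfolding annD_annM[OF FG[THEN conjunct1]] annD_annM[OF FG[THEN conjunct2]] by (rule disj_commute[THEN iffD1])
  qed
next
  assume u: "uniserial (opposite A) D"
  show "uniserial A M"
    unfolding uniserial_def
  proof (intro allI impI)
    fix F G assume FG: "submodule F A M \<and> submodule G A M"
    have "annD F \<subseteq> annD G \<or> annD G \<subseteq> annD F"
      using u sub_annD[OF FG[THEN conjunct1]] sub_annD[OF FG[THEN conjunct2]] by (simp only: uniserial_def)
    then have "annM (annD G) \<subseteq> annM (annD F) \<or> annM (annD F) \<subseteq> annM (annD G)" by blast
    then show "F \<subseteq> G \<or> G \<subseteq> F"
      unfolding annM_annD[OF FG[THEN conjunct1]] annM_annD[OF FG[THEN conjunct2]] by (rule disj_commute[THEN iffD1])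
  qed
qed

text \<open>The annihilators of two complementary submodules of the dual are complementary
  submodules of M.\<close>

lemma indecomposable_dual:
  assumes ind: "indecomposable A M" shows "indecomposable (opposite A) D"
  unfolding indecomposable_alt
proof (intro conjI allI impI)
  show "carrier D \<noteq> {\<zero>[D]}"
  proof
    assume "carrier D = {\<zero>[D]}"
    then have "annM (annD {\<zero>[M]}) = annM {\<zero>[D]}" using annD_zero by simp
    then show False using annM_annD[OF M.sub_0] annM_zero ind by (simp add: indecomposable_alt)
  qed
  fix F G assume F: "submodule F (opposite A) D" and G: "submodule G (opposite A) D"
    and s: "F <+>[D] G = carrier D" and i: "F \<inter> G = {\<zero>[D]}"
  let ?N = "annM F <+>[M] annM G"
  have sF: "submodule (annM F) A M" and sG: "submodule (annM G) A M" by (rule sub_annM[OF F], rule sub_annM[OF G])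
  have int: "annM F \<inter> annM G = {\<zero>[M]}"
  proof -
    have "x = \<zero>[M]" if x: "x \<in> annM F \<inter> annM G" for x
    proof -
      have "f x = \<zero>[E]" if f: "f \<in> carrier D" for f
      proof -
        obtain a b where ab: "a \<in> F" "b \<in> G" "f = a \<oplus>[D] b" using f s D.mem_set_add by blast
        then show ?thesis using x by (simp add: dual_simps)
      qed
      then have "x \<in> annM (annD {\<zero>[M]})" using x by simp
      then show ?thesis using annM_annD[OF M.sub_0] by blast
    qed
    then show ?thesis using M.sub_zero[OF sF] M.sub_zero[OF sG] by blast
  qed
  have sN: "submodule ?N A M" by (rule M.sub_sum[OF sF sG])
  have "annD ?N \<subseteq> annD (annM F) \<inter> annD (annM G)" using M.sum_upper[OF sF sG] by blast
  then have "annD ?N \<subseteq> {\<zero>[D]}" unfolding annD_annM[OF F] annD_annM[OF G] i .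
  then have "annM {\<zero>[D]} \<subseteq> annM (annD ?N)" by blast
  then have "carrier M \<subseteq> ?N" unfolding annM_annD[OF sN] annM_zero .
  then have "?N = carrier M" using M.sub_subset[OF sN] by blast
  then have "annM F = {\<zero>[M]} \<or> annM G = {\<zero>[M]}" using indecomposableD[OF ind sF sG _ int] by blast
  then show "F = {\<zero>[D]} \<or> G = {\<zero>[D]}"
  proof
    assume eq: "annM F = {\<zero>[M]}"
    have "F = carrier D" using annD_annM[OF F] unfolding eq annD_zero by (rule sym)
    then show ?thesis using i D.sub_subset[OF G] by blast
  next
    assume eq: "annM G = {\<zero>[M]}"
    have "G = carrier D" using annD_annM[OF G] unfolding eq annD_zero by (rule sym)
    then show ?thesis using i D.sub_subset[OF F] by blast
  qed
qed

text \<open>The annihilator of a largest proper submodule is the smallest nonzero submodule of the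
  dual. Applied to the local right module f A, it yields the simple socle of
  \<open>env f\<close>.\<close>

lemma smallest_dual:
  assumes L: "submodule L A M" "L \<noteq> carrier M" "\<And>N. submodule N A M \<Longrightarrow> N \<noteq> carrier M \<Longrightarrow> N \<subseteq> L"
  shows "\<exists>S. submodule S (opposite A) D \<and> S \<noteq> {\<zero>[D]} \<and> (\<forall>F. submodule F (opposite A) D \<longrightarrow> F \<noteq> {\<zero>[D]} \<longrightarrow> S \<subseteq> F)"
proof (intro exI[of _ "annD L"] conjI allI impI)
  show "submodule (annD L) (opposite A) D" by (rule sub_annD[OF L(1)])
  show "annD L \<noteq> {\<zero>[D]}"
  proof
    assume eq: "annD L = {\<zero>[D]}"
    show False using annM_annD[OF L(1)] L(2) unfolding eq annM_zero by simp
  qed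
  fix F assume F: "submodule F (opposite A) D" "F \<noteq> {\<zero>[D]}"
  have "annM F \<noteq> carrier M"
  proof
    assume eq: "annM F = carrier M"
    show False using annD_annM[OF F(1)] F(2) unfolding eq annD_carrier by simp
  qed
  then have "annM F \<subseteq> L" by (rule L(3)[OF sub_annM[OF F(1)]])
  then have "annD L \<subseteq> annD (annM F)" by blast
  then show "annD L \<subseteq> F" unfolding annD_annM[OF F(1)] .
qed

end

end

lemma (in fl_ring) fl_module_pim: "prim A e \<Longrightarrow> fl_module A (pim A e)"
  using left_module_pim[of e] le_less_trans[OF mlen_pim_le fin_l] primD(1)[of A e]
  by (intro fl_module.intro fl_module_axioms.intro fl_ring_axioms) blast+

lemma (in fl_ring) fl_moduleI: "left_module A M \<Longrightarrow> mlen A M < \<infinity> \<Longrightarrow> fl_module A M"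
  by (intro fl_module.intro fl_module_axioms.intro fl_ring_axioms)

lemma (in fl_ring) pim_local:
  assumes e: "prim A e" and N: "submodule N A (pim A e)" "N \<noteq> carrier (pim A e)"
  shows "N \<subseteq> jmul A (pim A e) (carrier (pim A e))"
proof -
  interpret P: fl_module A "pim A e" by (rule fl_module_pim[OF e])
  have eP: "e \<in> carrier (pim A e)" using primD[OF e] by (simp add: cyc_idem)
  have c: "cyc A (pim A e) e = carrier (pim A e)" by (simp add: cyc_def)
  show ?thesis using P.sub_local[OF e eP, of N] N P.sub_subset[OF N(1)] primD(3)[OF e] c by simp
qed

context artin_dual begin

sublocale fl_ring A by (rule fl_ring)

section \<open>Indecomposable injective modules\<close>

text \<open>The dual of the right module \<open>f A\<close> is the injective envelope of the simple left module \<open>A f / J f\<close>.\<close>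

definition env :: "'a \<Rightarrow> ('a, 'a \<Rightarrow> nat \<Rightarrow> 'r) module" where
  "env f = dual R (opposite A) (pim (opposite A) f) E"

lemma pimO:
  assumes "prim A f"
  shows "left_module (opposite A) (pim (opposite A) f)" "mlen (opposite A) (pim (opposite A) f) < \<infinity>"
    "p \<in> carrier (pim (opposite A) f) \<longleftrightarrow> p \<in> carrier A \<and> f \<otimes>[A] p = p"
proof -
  interpret O: fl_ring "opposite A" by (rule fl_ring_opposite)
  interpret P: fl_module "opposite A" "pim (opposite A) f" by (rule O.fl_module_pim) (simp add: assms)
  show "left_module (opposite A) (pim (opposite A) f)" "mlen (opposite A) (pim (opposite A) f) < \<infinity>"
    by (rule P.left_module_axioms, rule P.fin_M)
  show "p \<in> carrier (pim (opposite A) f) \<longleftrightarrow> p \<in> carrier A \<and> f \<otimes>[A] p = p"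
    using O.cyc_idem[of f p] primD[OF assms] by simp
qed

lemma env_facts:
  assumes f: "prim A f"
  shows "left_module A (env f)" "mlen A (env f) = mlen (opposite A) (pim (opposite A) f)" "mlen A (env f) < \<infinity>"
    "uniserial A (env f) \<longleftrightarrow> uniserial (opposite A) (pim (opposite A) f)" "indecomposable A (env f)"
proof -
  interpret O: artin_dual R "opposite A" E by (rule artin_dual_opposite)
  note P = pimO(1,2)[OF f]
  show "left_module A (env f)" using O.left_module_dual[OF P] by (simp add: env_def)
  show m: "mlen A (env f) = mlen (opposite A) (pim (opposite A) f)" using O.mlen_dual[OF P] by (simp add: env_def)
  show "mlen A (env f) < \<infinity>" unfolding m by (rule P(2))
  show "uniserial A (env f) \<longleftrightarrow> uniserial (opposite A) (pim (opposite A) f)" using O.uniserial_dual[OF P] by (simp add: env_def)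
  have "indecomposable (opposite A) (pim (opposite A) f)" by (rule O.prim_indecomposable) (simp add: f)
  then show "indecomposable A (env f)" using O.indecomposable_dual[OF P] by (simp add: env_def)
qed

lemma env_smallest:
  assumes f: "prim A f"
  shows "\<exists>S. submodule S A (env f) \<and> S \<noteq> {\<zero>[env f]} \<and> (\<forall>F. submodule F A (env f) \<longrightarrow> F \<noteq> {\<zero>[env f]} \<longrightarrow> S \<subseteq> F)"
proof -
  interpret O: artin_dual R "opposite A" E by (rule artin_dual_opposite)
  have f': "prim (opposite A) f" by (simp add: f)
  let ?P = "pim (opposite A) f"
  have c: "covers (opposite A) ?P (jmul (opposite A) ?P (carrier ?P)) (carrier ?P)" by (rule O.jmul_pim(1)[OF f'])
  have "\<exists>S. submodule S (opposite (opposite A)) (dual R (opposite A) ?P E) \<and> S \<noteq> {\<zero>[dual R (opposite A) ?P E]} \<and>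
      (\<forall>F. submodule F (opposite (opposite A)) (dual R (opposite A) ?P E) \<longrightarrow> F \<noteq> {\<zero>[dual R (opposite A) ?P E]} \<longrightarrow> S \<subseteq> F)"
  proof (rule O.smallest_dual[OF pimO(1,2)[OF f]])
    show "submodule (jmul (opposite A) ?P (carrier ?P)) (opposite A) ?P" "jmul (opposite A) ?P (carrier ?P) \<noteq> carrier ?P"
      using c by (auto simp: covers_def)
  qed (rule O.pim_local[OF f'])
  then show ?thesis unfolding env_def opposite_opposite .
qed

text \<open>One direction of the adjunction between A-homomorphisms from Y to the dual of f A and
  R-functionals on f Y. Only the values of t on f Y enter, since p = f p for p in f A.\<close>

lemma hom_of_functional:
  assumes f: "prim A f" and Y: "left_module A Y" and t: "t \<in> module_homs R (restrict_scalars R A Y) E"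
  shows "(\<lambda>y. \<lambda>p\<in>carrier (pim (opposite A) f). t (p \<odot>[Y] y)) \<in> module_homs A Y (env f)"
proof -
  interpret Y: left_module A Y by (rule Y)
  interpret O: artin_dual R "opposite A" E by (rule artin_dual_opposite)
  let ?P = "pim (opposite A) f"
  note P = pimO(3)[OF f]
  have fA: "f \<in> carrier A" by (rule primD(1)[OF f])
  have tt: "\<And>y. y \<in> carrier Y \<Longrightarrow> t y \<in> carrier E" "\<And>y z. y \<in> carrier Y \<Longrightarrow> z \<in> carrier Y \<Longrightarrow> t (y \<oplus>[Y] z) = t y \<oplus>[E] t z"
    "\<And>r y. r \<in> carrier R \<Longrightarrow> y \<in> carrier Y \<Longrightarrow> t ((r \<odot>[A] \<one>[A]) \<odot>[Y] y) = r \<odot>[E] t y"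
    using t by (auto simp: module_homs_def)
  have Pc: "p \<in> carrier A" if "p \<in> carrier ?P" for p using that P[of p] by simp
  have Pa: "p \<otimes>[A] a \<in> carrier ?P" if "p \<in> carrier ?P" "a \<in> carrier A" for p a
    using that P[of p] P[of "p \<otimes>[A] a"] m_assoc[OF fA, of p a, symmetric] by simp
  have Padd: "p \<oplus>[A] q \<in> carrier ?P" if "p \<in> carrier ?P" "q \<in> carrier ?P" for p q
    using that P[of p] P[of q] P[of "p \<oplus>[A] q"] fA by (simp add: r_distr)
  have mem: "(\<lambda>p\<in>carrier ?P. t (p \<odot>[Y] y)) \<in> carrier (env f)" if y: "y \<in> carrier Y" for y
  proof -
    have sc': "t ((p \<otimes>[A] (r \<odot>[A] \<one>[A])) \<odot>[Y] y) = r \<odot>[E] t (p \<odot>[Y] y)" if r: "r \<in> carrier R" and p: "p \<in> carrier ?P" for r p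
    proof -
      have "p \<otimes>[A] (r \<odot>[A] \<one>[A]) = (r \<odot>[A] \<one>[A]) \<otimes>[A] p" using sc(2,3)[OF r Pc[OF p]] by simp
      then have "(p \<otimes>[A] (r \<odot>[A] \<one>[A])) \<odot>[Y] y = (r \<odot>[A] \<one>[A]) \<odot>[Y] (p \<odot>[Y] y)"
        using Y.smult_assoc[OF sc(1)[OF r] Pc[OF p] y] by simp
      then show ?thesis using tt(3)[OF r Y.smult_closed[OF Pc[OF p] y]] by simp
    qed
    have cl: "\<And>p. p \<in> carrier ?P \<Longrightarrow> p \<odot>[Y] y \<in> carrier Y" using Y.smult_closed[OF Pc y] .
    show ?thesis
      unfolding env_def O.D_iff[OF pimO(1,2)[OF f]]
    proof (intro conjI ballI)
      fix p q assume p: "p \<in> carrier ?P" and q: "q \<in> carrier ?P"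
      show "(\<lambda>p\<in>carrier ?P. t (p \<odot>[Y] y)) (p \<oplus>[?P] q) = (\<lambda>p\<in>carrier ?P. t (p \<odot>[Y] y)) p \<oplus>[E] (\<lambda>p\<in>carrier ?P. t (p \<odot>[Y] y)) q"
        using Padd[OF p q] p q Y.smult_l_distr[OF Pc[OF p] Pc[OF q] y] tt(2)[OF cl[OF p] cl[OF q]]
        by (simp only: restrict_apply' sub_module_simps(3) regular_module_simps(3) opposite_simps(4))
    next
      fix r p assume r: "r \<in> carrier R" and p: "p \<in> carrier ?P"
      show "(\<lambda>p\<in>carrier ?P. t (p \<odot>[Y] y)) ((r \<odot>[opposite A] \<one>[opposite A]) \<odot>[?P] p) = r \<odot>[E] (\<lambda>p\<in>carrier ?P. t (p \<odot>[Y] y)) p"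
        using Pa[OF p sc(1)[OF r]] p sc'[OF r p]
        by (simp only: restrict_apply' sub_module_simps(4) regular_module_simps(4) opposite_simps(5) smult_opposite opposite_simps(3))
    next
      fix p assume p: "p \<in> carrier ?P"
      show "(\<lambda>p\<in>carrier ?P. t (p \<odot>[Y] y)) p \<in> carrier E" using p tt(1)[OF cl[OF p]] by (simp only: restrict_apply')
    qed (rule restrict_extensional)
  qed
  have eq: "g = h" if "g \<in> extensional (carrier ?P)" "h \<in> extensional (carrier ?P)" "\<And>p. p \<in> carrier ?P \<Longrightarrow> g p = h p" for g h :: "'a \<Rightarrow> nat \<Rightarrow> 'r"
    using that by (rule extensionalityI)
  show ?thesis
    unfolding module_homs_def
  proof (intro CollectI conjI ballI Pi_I)
    show "(\<lambda>p\<in>carrier ?P. t (p \<odot>[Y] y)) \<in> carrier (env f)" if "y \<in> carrier Y" for y by (rule mem[OF that])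
    fix y assume y: "y \<in> carrier Y"
    show "(\<lambda>p\<in>carrier ?P. t (p \<odot>[Y] (y \<oplus>[Y] z))) = (\<lambda>p\<in>carrier ?P. t (p \<odot>[Y] y)) \<oplus>[env f] (\<lambda>p\<in>carrier ?P. t (p \<odot>[Y] z))" if z: "z \<in> carrier Y" for z
    proof (rule eq)
      fix p assume p: "p \<in> carrier ?P"
      show "(\<lambda>p\<in>carrier ?P. t (p \<odot>[Y] (y \<oplus>[Y] z))) p = ((\<lambda>p\<in>carrier ?P. t (p \<odot>[Y] y)) \<oplus>[env f] (\<lambda>p\<in>carrier ?P. t (p \<odot>[Y] z))) p"
        using p Y.smult_r_distr[OF Pc[OF p] y z] tt(2)[OF Y.smult_closed[OF Pc[OF p] y] Y.smult_closed[OF Pc[OF p] z]]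
        by (simp only: restrict_apply' env_def dual_simps(2))
    qed (simp_all only: restrict_extensional env_def dual_simps(2))
    show "(\<lambda>p\<in>carrier ?P. t (p \<odot>[Y] (a \<odot>[Y] y))) = a \<odot>[env f] (\<lambda>p\<in>carrier ?P. t (p \<odot>[Y] y))" if a: "a \<in> carrier A" for a
    proof (rule eq)
      fix p assume p: "p \<in> carrier ?P"
      show "(\<lambda>p\<in>carrier ?P. t (p \<odot>[Y] (a \<odot>[Y] y))) p = (a \<odot>[env f] (\<lambda>p\<in>carrier ?P. t (p \<odot>[Y] y))) p"
        using p Pa[OF p a] Y.smult_assoc[OF Pc[OF p] a y]
        by (simp only: restrict_apply' env_def dual_simps(3) sub_module_simps(4) regular_module_simps(4) opposite_simps(5))
    qed (simp_all only: restrict_extensional env_def dual_simps(3))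
  qed
qed

lemma env_zero: "\<zero>[env f] = (\<lambda>p\<in>carrier (pim (opposite A) f). \<zero>[E])"
  by (simp only: env_def dual_simps(1))

text \<open>Take a functional t with t s nonzero. Under the associated homomorphism s goes to a
  functional on f A whose value at f is t (f s) = t s.\<close>

lemma env_hom:
  assumes f: "prim A f" and M: "left_module A M" "mlen A M < \<infinity>" and s: "s \<in> carrier M" "f \<odot>[M] s = s" "s \<noteq> \<zero>[M]"
  shows "\<exists>h\<in>module_homs A M (env f). h s \<noteq> \<zero>[env f]"
proof -
  interpret M: left_module A M by fact
  obtain t where t: "t \<in> carrier (dual R A M E)" "t s \<noteq> \<zero>[E]" using functional[OF M M.sub_0 s(1)] s(3) by blast
  have th: "t \<in> module_homs R (restrict_scalars R A M) E" using t(1) by (simp add: dual_carrier)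
  let ?h = "\<lambda>y. \<lambda>p\<in>carrier (pim (opposite A) f). t (p \<odot>[M] y)"
  have fP: "f \<in> carrier (pim (opposite A) f)" using pimO(3)[OF f, of f] primD[OF f] by simp
  have "?h s f = t s" using fP s(2) by (simp only: restrict_apply')
  moreover have "\<zero>[env f] f = \<zero>[E]" using fP by (simp only: env_zero restrict_apply')
  ultimately have "?h s \<noteq> \<zero>[env f]" using t(2) by metis
  then show ?thesis by (rule bexI[OF _ hom_of_functional[OF f M(1) th]])
qed

text \<open>By the adjunction, g corresponds to the functional sending x to the value of g x at f.
  Along the injection j this is a partial functional on Y with graph \<open>C0\<close>, and it
  extends by the injectivity of E expressed in \<open>cogen.extend\<close>.\<close>

lemma env_injective:
  assumes f: "prim A f" shows "injective_in_mod A (env f)"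
  unfolding injective_in_mod_def
proof (intro conjI allI ballI impI)
  show "in_mod A (env f)" using env_facts[OF f] by (simp only: in_mod_iff simp_thms)
  fix X Y :: "'a fg_module" and j g
  assume XY: "in_mod A X \<and> in_mod A Y" and j: "j \<in> module_homs A X Y" and g: "g \<in> module_homs A X (env f)" and inj: "inj_on j (carrier X)"
  have X: "left_module A X" "mlen A X < \<infinity>" and Y: "left_module A Y" "mlen A Y < \<infinity>" using XY by (simp_all only: in_mod_iff simp_thms)
  interpret j: lhom A X Y j by (rule left_module.hom_lhom[OF X(1) Y(1) j])
  interpret g: lhom A X "env f" g by (rule left_module.hom_lhom[OF X(1) env_facts(1)[OF f] g])
  interpret O: artin_dual R "opposite A" E by (rule artin_dual_opposite)
  let ?P = "pim (opposite A) f"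
  let ?Y = "restrict_scalars R A Y"
  interpret Yr: left_module R ?Y by (rule left_module_rs[OF Y(1)])
  interpret F: left_module R "prod_module ?Y E" by (rule left_module_prod[OF Yr.left_module_axioms cogen.E.left_module_axioms])
  have fP: "f \<in> carrier ?P" using pimO(3)[OF f, of f] primD[OF f] by simp
  have gD: "g x \<in> carrier (dual R (opposite A) ?P E)" if "x \<in> carrier X" for x using g.closed[OF that] by (simp only: env_def)
  note DD' = O.DD[OF pimO(1,2)[OF f]]
  have g0: "g \<zero>[X] f = \<zero>[E]" using g.zero fP by (simp only: env_zero restrict_apply')
  have gadd: "g (x \<oplus>[X] y) f = g x f \<oplus>[E] g y f" if "x \<in> carrier X" "y \<in> carrier X" for x y
    using g.add[OF that] fP by (simp only: env_def dual_simps(2) restrict_apply')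
  have gsm: "g (a \<odot>[X] x) f = g x (f \<otimes>[A] a)" if "a \<in> carrier A" "x \<in> carrier X" for a x
    using g.smult[OF that] fP by (simp only: env_def dual_simps(3) restrict_apply' sub_module_simps(4) regular_module_simps(4) opposite_simps(5))
  have gsc: "g ((r \<odot>[A] \<one>[A]) \<odot>[X] x) f = r \<odot>[E] g x f" if r: "r \<in> carrier R" and x: "x \<in> carrier X" for r x
    using gsm[OF sc(1)[OF r] x] DD'(4)[OF gD[OF x] r fP] by simp
  define C0 where "C0 = (\<lambda>x. (j x, g x f)) ` carrier X"
  have "submodule C0 R (prod_module ?Y E)"
    unfolding F.sub_iff
  proof (intro conjI ballI)
    show "C0 \<subseteq> carrier (prod_module ?Y E)" using j.closed DD'(2)[OF gD fP] by (auto simp: C0_def)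
    show "\<zero>[prod_module ?Y E] \<in> C0" unfolding C0_def by (rule image_eqI[of _ _ "\<zero>[X]"]) (simp_all add: j.zero g0)
    fix c assume "c \<in> C0"
    then obtain x where x: "x \<in> carrier X" "c = (j x, g x f)" by (auto simp: C0_def)
    show "c \<oplus>[prod_module ?Y E] d \<in> C0" if d: "d \<in> C0" for d
    proof -
      obtain y where y: "y \<in> carrier X" "d = (j y, g y f)" using d by (auto simp: C0_def)
      show ?thesis unfolding C0_def by (rule image_eqI[of _ _ "x \<oplus>[X] y"]) (use x y in \<open>simp_all add: j.add gadd\<close>)
    qed
    show "r \<odot>[prod_module ?Y E] c \<in> C0" if r: "r \<in> carrier R" for r
      unfolding C0_def by (rule image_eqI[of _ _ "(r \<odot>[A] \<one>[A]) \<odot>[X] x"]) (use x r sc(1) in \<open>simp_all add: j.smult gsc j.dom.smult_closed\<close>)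
  qed
  moreover have "y = \<zero>[E]" if y: "(\<zero>[?Y], y) \<in> C0" for y
  proof -
    obtain x where x: "x \<in> carrier X" "j x = \<zero>[Y]" "y = g x f" using y by (auto simp: C0_def)
    then have "x \<in> j.ker" by (simp add: j.ker_iff)
    then have "x = \<zero>[X]" using j.inj_iff inj by blast
    then show ?thesis using x(3) g0 by simp
  qed
  ultimately have "\<exists>t\<in>module_homs R ?Y E. \<forall>x y. (x, y) \<in> C0 \<longrightarrow> t x = y"
    by (rule cogen.extend[OF Yr.left_module_axioms fin_rs[OF Y] refl])
  then obtain t where t: "t \<in> module_homs R ?Y E" "\<forall>x y. (x, y) \<in> C0 \<longrightarrow> t x = y" ..
  have tj: "t (j x) = g x f" if "x \<in> carrier X" for x using t(2) that unfolding C0_def by blast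
  let ?h = "\<lambda>y. \<lambda>p\<in>carrier ?P. t (p \<odot>[Y] y)"
  show "\<exists>h\<in>module_homs A Y (env f). \<forall>x\<in>carrier X. h (j x) = g x"
  proof (rule bexI[of _ ?h], rule ballI)
    show "?h \<in> module_homs A Y (env f)" by (rule hom_of_functional[OF f Y(1) t(1)])
    fix x assume x: "x \<in> carrier X"
    show "?h (j x) = g x"
    proof (rule extensionalityI[of _ "carrier ?P"])
      show "g x \<in> extensional (carrier ?P)" by (rule DD'(1)[OF gD[OF x]])
      fix p assume p: "p \<in> carrier ?P"
      have p': "p \<in> carrier A" "f \<otimes>[A] p = p" using p pimO(3)[OF f, of p] by simp_all
      have "t (p \<odot>[Y] j x) = t (j (p \<odot>[X] x))" using j.smult[OF p'(1) x] by simp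
      also have "\<dots> = g x p" using tj[OF j.dom.smult_closed[OF p'(1) x]] gsm[OF p'(1) x] p'(2) by simp
      finally show "?h (j x) p = g x p" using p by (simp only: restrict_apply')
    qed (rule restrict_extensional)
  qed
qed

section \<open>Splitting off submodules\<close>

text \<open>A homomorphism h from M to the uniserial module \<open>env f\<close> with h s nonzero is
  injective on L, as s lies in every nonzero submodule of L. The image of M has length at most k by
  \<open>uniserial_length\<close>, while the image of L has length at least k. So both images agree,
  and M is the direct sum of L and the kernel of h.\<close>

lemma splits_off:
  assumes M: "left_module A M" "mlen A M < \<infinity>" "indecomposable A M" and f: "prim A f" "uniserial (opposite A) (pim (opposite A) f)"
    and L: "submodule L A M" "s \<in> L" "f \<odot>[M] s = s" "s \<noteq> \<zero>[M]"
    and min: "\<And>Z. submodule Z A M \<Longrightarrow> Z \<subseteq> L \<Longrightarrow> Z \<noteq> {\<zero>[M]} \<Longrightarrow> s \<in> Z"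
    and k: "jpow A M k (carrier M) = {\<zero>[M]}" "enat k \<le> il A M {\<zero>[M]} L"
  shows "L = carrier M"
proof -
  interpret M: left_module A M by fact
  have sM: "s \<in> carrier M" by (rule M.sub_mem[OF L(1,2)])
  obtain h where h: "h \<in> module_homs A M (env f)" "h s \<noteq> \<zero>[env f]" using env_hom[OF f(1) M(1,2) sM L(3,4)] by blast
  interpret h: lhom A M "env f" h by (rule M.hom_lhom[OF env_facts(1)[OF f(1)] h(1)])
  interpret I: fl_module A "env f" by (rule fl_moduleI[OF env_facts(1,3)[OF f(1)]])
  have hM: "submodule (h ` carrier M) A (env f)" by (rule h.sub_image[OF M.sub_carrier])
  have hL: "submodule (h ` L) A (env f)" by (rule h.sub_image[OF L(1)])
  have "jpow A (env f) k (h ` carrier M) = h ` {\<zero>[M]}" using h.image_jpow[OF M.sub_carrier, of k] k(1) by simp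
  then have "jpow A (env f) k (h ` carrier M) = {\<zero>[env f]}" using h.image_0 by simp
  then have le: "il A (env f) {\<zero>[env f]} (h ` carrier M) \<le> enat k"
    using I.uniserial_length[OF _ hM] env_facts(4)[OF f(1)] f(2) by blast
  have kL: "submodule (h.ker \<inter> L) A M" by (rule M.sub_Int[OF h.sub_ker L(1)])
  have k0: "h.ker \<inter> L = {\<zero>[M]}"
  proof (rule ccontr)
    assume "h.ker \<inter> L \<noteq> {\<zero>[M]}"
    then have "s \<in> h.ker \<inter> L" by (intro min[OF kL]) blast
    then show False using h(2) by (simp add: h.ker_iff)
  qed
  have "il A M {\<zero>[M]} L = il A (env f) {\<zero>[env f]} (h ` L)"
    using h.il_ker_image[OF L(1)] k0 by (simp add: M.il_refl)
  then have ge: "enat k \<le> il A (env f) {\<zero>[env f]} (h ` L)" using k(2) by simp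
  have eq: "h ` L = h ` carrier M"
  proof (rule ccontr)
    assume ne: "h ` L \<noteq> h ` carrier M"
    have "h ` L \<subseteq> h ` carrier M" using M.sub_subset[OF L(1)] by blast
    then have ps: "h ` L \<subset> h ` carrier M" using ne by blast
    have z: "{\<zero>[env f]} \<subseteq> h ` L" using h.cod.sub_zero[OF hL] by simp
    have "il A (env f) {\<zero>[env f]} (h ` L) + 1 \<le> il A (env f) {\<zero>[env f]} (h ` carrier M)"
      by (rule h.cod.il_strict[OF h.cod.sub_0 hL hM z ps])
    then have "enat k + 1 \<le> enat k" using ge le by (meson add_right_mono order_trans)
    then show False by (simp add: one_enat_def)
  qed
  have sum: "L <+>[M] h.ker = carrier M"
  proof
    show "L <+>[M] h.ker \<subseteq> carrier M" by (rule M.sub_subset[OF M.sub_sum[OF L(1) h.sub_ker]])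
    show "carrier M \<subseteq> L <+>[M] h.ker"
    proof
      fix m assume m: "m \<in> carrier M"
      then have "h m \<in> h ` L" using eq by simp
      then obtain l where l: "l \<in> L" "h m = h l" by blast
      have lM: "l \<in> carrier M" by (rule M.sub_mem[OF L(1) l(1)])
      have "h (m \<ominus>[M] l) = \<zero>[env f]" using m lM l(2) h.minus[OF m lM] h.cod.minus_eq_0 h.closed by simp
      then have "m \<ominus>[M] l \<in> h.ker" using m lM by (simp add: h.ker_iff)
      moreover have "m = l \<oplus>[M] (m \<ominus>[M] l)" using m lM by (simp add: M.minus_add_cancel)
      ultimately show "m \<in> L <+>[M] h.ker" unfolding M.mem_set_add using l(1) by blast
    qed
  qed
  have "L \<inter> h.ker = {\<zero>[M]}" using k0 by (simp add: Int_commute)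
  then have "L = {\<zero>[M]} \<or> h.ker = {\<zero>[M]}" by (rule indecomposableD[OF M(3) L(1) h.sub_ker sum])
  then have "h.ker = {\<zero>[M]}" using L(2,4) by blast
  then have "L <+>[M] h.ker \<subseteq> L" using M.sub_zero[OF L(1)] by (intro M.sum_least[OF L(1)]) simp_all
  then show ?thesis using sum M.sub_subset[OF L(1)] by blast
qed

end

section \<open>Cyclic submodules as images of A e\<close>

lemma (in left_module) cyc_pim_hom:
  assumes e: "prim A e" and x: "x \<in> carrier M" "e \<odot>[M] x = x"
  shows "lhom A (pim A e) M (\<lambda>a. a \<odot>[M] x)" "(\<lambda>a. a \<odot>[M] x) ` carrier (pim A e) = cyc A M x"
proof -
  note e' = primD[OF e]
  interpret r: lhom A "regular_module A" M "\<lambda>a. a \<odot>[M] x" by (rule lhom_cyc[OF x(1)])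
  interpret i: lhom A "pim A e" "regular_module A" "\<lambda>a. a" by (rule r.dom.lhom_incl[OF sub_cyc_reg[OF e'(1)]])
  show "lhom A (pim A e) M (\<lambda>a. a \<odot>[M] x)"
    by (rule left_module.hom_lhom[OF left_module_pim[OF e'(1)] left_module_axioms comp_hom[OF i.hom r.hom]])
  have "(a \<otimes> e) \<odot>[M] x = a \<odot>[M] x" if "a \<in> carrier A" for a using smult_assoc[OF that e'(1) x(1)] x(2) by simp
  then show "(\<lambda>a. a \<odot>[M] x) ` carrier (pim A e) = cyc A M x"
    unfolding sub_module_simps cyc_regular image_image by (simp add: cyc_def)
qed

text \<open>The second bound is the case in which the epimorphism from A e to A x has a nonzero
  element a in its kernel, which costs at least 1.\<close>

lemma (in left_module) il_cyc_pim:
  assumes e: "prim A e" and x: "x \<in> carrier M" "e \<odot>[M] x = x"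
  shows "il A M {\<zero>[M]} (cyc A M x) \<le> mlen A (pim A e)"
    and "a \<in> carrier A \<Longrightarrow> a \<otimes> e = a \<Longrightarrow> a \<odot>[M] x = \<zero>[M] \<Longrightarrow> a \<noteq> \<zero> \<Longrightarrow> il A M {\<zero>[M]} (cyc A M x) + 1 \<le> mlen A (pim A e)"
proof -
  interpret h: lhom A "pim A e" M "\<lambda>a. a \<odot>[M] x" by (rule cyc_pim_hom(1)[OF assms])
  show "il A M {\<zero>[M]} (cyc A M x) \<le> mlen A (pim A e)"
    using h.il_image_le[OF h.dom.sub_carrier] by (simp only: cyc_pim_hom(2)[OF assms])
  assume a: "a \<in> carrier A" "a \<otimes> e = a" "a \<odot>[M] x = \<zero>[M]" "a \<noteq> \<zero>"
  let ?K = "h.ker \<inter> carrier (pim A e)"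
  have K: "submodule ?K A (pim A e)" by (rule h.dom.sub_Int[OF h.sub_ker h.dom.sub_carrier])
  have aP: "a \<in> carrier (pim A e)" using a(1,2) cyc_idem[OF primD(1)[OF e] primD(3)[OF e]] by simp
  have "a \<in> ?K" using aP a(3) by (simp only: h.ker_iff Int_iff simp_thms)
  then have "{\<zero>[pim A e]} \<subset> ?K" using h.dom.sub_zero[OF K] a(4) by auto
  then have "1 \<le> il A (pim A e) {\<zero>[pim A e]} ?K" by (rule h.dom.il_pos[OF h.dom.sub_0 K])
  moreover have "mlen A (pim A e) = il A (pim A e) {\<zero>[pim A e]} ?K + il A M {\<zero>[M]} (cyc A M x)"
    using h.il_ker_image[OF h.dom.sub_carrier] by (simp only: cyc_pim_hom(2)[OF assms])
  ultimately show "il A M {\<zero>[M]} (cyc A M x) + 1 \<le> mlen A (pim A e)"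
    by (metis add.commute add_right_mono)
qed

context fl_module begin

lemma obtain_prim_vec:
  assumes Z: "submodule Z A M" "Z \<noteq> {\<zero>[M]}"
  obtains f s where "prim A f" "s \<in> Z" "f \<odot>[M] s = s" "s \<noteq> \<zero>[M]"
proof -
  obtain x where x: "x \<in> Z" "x \<noteq> \<zero>[M]" using Z sub_zero[OF Z(1)] by blast
  have xM: "x \<in> carrier M" by (rule sub_mem[OF Z(1) x(1)])
  obtain f where f: "prim A f" "f \<odot>[M] x \<notin> {\<zero>[M]}" using exists_prim_sub[OF sub_0 xM] x(2) by blast
  note f' = primD[OF f(1)]
  have "f \<odot>[M] (f \<odot>[M] x) = f \<odot>[M] x" using smult_assoc[OF f'(1) f'(1) xM] f'(3) by simp
  moreover have "f \<odot>[M] x \<in> Z" by (rule sub_smult[OF Z(1) f'(1) x(1)])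
  ultimately show thesis using f(2) by (intro that[OF f(1), of "f \<odot>[M] x"]) simp_all
qed

text \<open>A y is local with radical J y, and J y is nonzero because of j. When A y has length 2, J
  y is simple and contains all proper submodules, so it is the smallest nonzero submodule.\<close>

lemma cyc_len_two:
  assumes e: "prim A e" and y: "y \<in> carrier M" "e \<odot>[M] y = y" and j: "j \<in> jac A" "j \<odot>[M] y \<noteq> \<zero>[M]"
  shows "2 \<le> il A M {\<zero>[M]} (cyc A M y)"
    and "il A M {\<zero>[M]} (cyc A M y) \<le> 2 \<Longrightarrow> submodule Z A M \<Longrightarrow> Z \<subseteq> cyc A M y \<Longrightarrow> Z \<noteq> {\<zero>[M]} \<Longrightarrow> jmul A M (cyc A M y) \<subseteq> Z"
proof -
  let ?N = "jmul A M (cyc A M y)"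
  have cy: "submodule (cyc A M y) A M" by (rule sub_cyc[OF y(1)])
  have N: "submodule ?N A M" by (rule sub_jmul'[OF cy])
  have y0: "y \<noteq> \<zero>[M]" using j smult_r_null[OF J_carrier[OF j(1)]] by auto
  have cov: "covers A M ?N (cyc A M y)" by (rule covers_local[OF e y y0])
  have jy: "j \<odot>[M] y \<in> ?N" by (rule jmul.elem[where M = M, OF j(1) cyc_self[OF y(1)]])
  have "{\<zero>[M]} \<subset> ?N" using jy j(2) sub_zero[OF N] by blast
  then have one: "1 \<le> il A M {\<zero>[M]} ?N" by (rule il_pos[OF sub_0 N])
  have z: "{\<zero>[M]} \<subseteq> ?N" using sub_zero[OF N] by simp
  have eq: "il A M {\<zero>[M]} (cyc A M y) = il A M {\<zero>[M]} ?N + 1"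
    using il_add[OF sub_0 N cy z jmul_subset[OF cy]] il_covers[OF cov] by simp
  have two: "(2::enat) = 1 + 1" by simp
  show "2 \<le> il A M {\<zero>[M]} (cyc A M y)" unfolding eq two by (rule add_right_mono[OF one])
  assume le: "il A M {\<zero>[M]} (cyc A M y) \<le> 2" and Z: "submodule Z A M" "Z \<subseteq> cyc A M y" "Z \<noteq> {\<zero>[M]}"
  have N1: "il A M {\<zero>[M]} ?N \<le> 1" using le unfolding eq
    by (cases "il A M {\<zero>[M]} ?N") (simp_all add: one_enat_def numeral_eq_enat)
  have zZ: "{\<zero>[M]} \<subset> Z" using sub_zero[OF Z(1)] Z(3) by blast
  from sub_local[OF e y Z(1,2)] show "?N \<subseteq> Z"
  proof
    assume "Z = cyc A M y" then show ?thesis using jmul_subset[OF cy] by simp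
  next
    assume ZN: "Z \<subseteq> ?N"
    show ?thesis
    proof (rule ccontr)
      assume "\<not> ?N \<subseteq> Z"
      then have ps: "Z \<subset> ?N" using ZN by blast
      have "il A M {\<zero>[M]} Z + 1 \<le> il A M {\<zero>[M]} ?N" by (rule il_strict[OF sub_0 Z(1) N psubset_imp_subset[OF zZ] ps])
      moreover have "1 \<le> il A M {\<zero>[M]} Z" by (rule il_pos[OF sub_0 Z(1) zZ])
      ultimately have "(1::enat) + 1 \<le> 1" using N1 by (meson add_right_mono order_trans)
      then show False by (simp add: one_enat_def)
    qed
  qed
qed

end

section \<open>Modules over a non-uniserial A e\<close>

context artin_dual begin

text \<open>A y has length 2, which J^2 M = 0 makes enough to reach the Loewy length of M. Its socle
  J y contains some f j y that is nonzero, and \<open>RU\<close> makes f A uniserial, so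
  \<open>splits_off\<close> applies with k = 2.\<close>

lemma tall_cyc:
  assumes M: "left_module A M" "mlen A M < \<infinity>" "indecomposable A M" and J2M: "jmul A M (jmul A M (carrier M)) = {\<zero>[M]}"
    and e: "prim A e" and le2: "il A M {\<zero>[M]} (cyc A M y) \<le> 2"
    and RU: "\<And>g j. prim A g \<Longrightarrow> j \<in> jac A \<Longrightarrow> g \<otimes>[A] (j \<otimes>[A] e) \<noteq> \<zero>[A] \<Longrightarrow> uniserial (opposite A) (pim (opposite A) g)"
    and y: "y \<in> carrier M" "e \<odot>[M] y = y" and j: "j \<in> jac A" "j \<odot>[M] y \<noteq> \<zero>[M]"
  shows "cyc A M y = carrier M"
proof -
  interpret M: left_module A M by fact
  interpret M: fl_module A M by (rule fl_moduleI[OF M(1,2)])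
  note e' = primD[OF e] and jc = J_carrier[OF j(1)]
  let ?N = "jmul A M (cyc A M y)"
  have cy: "submodule (cyc A M y) A M" by (rule M.sub_cyc[OF y(1)])
  have N: "submodule ?N A M" by (rule M.sub_jmul'[OF cy])
  have jyM: "j \<odot>[M] y \<in> carrier M" by (rule M.smult_closed[OF jc y(1)])
  obtain f where f: "prim A f" "f \<odot>[M] (j \<odot>[M] y) \<notin> {\<zero>[M]}" using M.exists_prim_sub[OF M.sub_0 jyM] j(2) by blast
  note f' = primD[OF f(1)]
  let ?s = "f \<odot>[M] (j \<odot>[M] y)"
  have fs: "f \<odot>[M] ?s = ?s" using M.smult_assoc[OF f'(1) f'(1) jyM] f'(3) by simp
  have sN: "?s \<in> ?N" by (rule M.sub_smult[OF N f'(1) jmul.elem[where M = M, OF j(1) M.cyc_self[OF y(1)]]])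
  have s0: "?s \<noteq> \<zero>[M]" using f(2) by simp
  have "(f \<otimes>[A] (j \<otimes>[A] e)) \<odot>[M] y = ?s"
    using M.smult_assoc[OF f'(1) _ y(1)] M.smult_assoc[OF jc e'(1) y(1)] y(2) jc e'(1) by simp
  then have "f \<otimes>[A] (j \<otimes>[A] e) \<noteq> \<zero>[A]" using s0 M.smult_l_null[OF y(1)] by metis
  then have u: "uniserial (opposite A) (pim (opposite A) f)" by (rule RU[OF f(1) j(1)])
  have min: "?s \<in> Z" if Z: "submodule Z A M" "Z \<subseteq> cyc A M y" "Z \<noteq> {\<zero>[M]}" for Z
    using M.cyc_len_two(2)[OF e y j le2 Z] sN by blast
  have two: "enat 2 \<le> il A M {\<zero>[M]} (cyc A M y)" using M.cyc_len_two(1)[OF e y j] by (simp only: numeral_eq_enat)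
  have jp: "jpow A M 2 (carrier M) = {\<zero>[M]}" using J2M by (simp add: numeral_2_eq_2 M.jpow_Suc M.jpow_0)
  have sc: "?s \<in> cyc A M y" using sN M.jmul_subset[OF cy] by blast
  show ?thesis by (rule splits_off[OF M f(1) u cy sc fs s0 min jp two])
qed

text \<open>The bound \<open>le3\<close> is exploited through the fact \<open>free\<close>: if M is
  longer than 3, then for y = e y either J y = 0 or A e maps isomorphically onto A y. Indeed, a
  proper image of A e with nonzero radical has length 2 and would be all of M by
  \<open>tall_cyc\<close>.\<close>

lemma wide_top_bound:
  assumes M: "left_module A M" "mlen A M < \<infinity>" "indecomposable A M" and J2M: "jmul A M (jmul A M (carrier M)) = {\<zero>[M]}"
    and e: "prim A e" and le3: "mlen A (pim A e) \<le> 3"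
    and J2: "\<And>i j. i \<in> jac A \<Longrightarrow> j \<in> jac A \<Longrightarrow> i \<otimes>[A] (j \<otimes>[A] e) = \<zero>[A]"
    and RU: "\<And>g j. prim A g \<Longrightarrow> j \<in> jac A \<Longrightarrow> g \<otimes>[A] (j \<otimes>[A] e) \<noteq> \<zero>[A] \<Longrightarrow> uniserial (opposite A) (pim (opposite A) g)"
    and x: "x \<in> carrier M" "e \<odot>[M] x = x" and j0: "j0 \<in> jac A" "j0 \<odot>[M] x \<noteq> \<zero>[M]"
  shows "mlen A M \<le> 3"
proof (rule ccontr)
  assume big: "\<not> mlen A M \<le> 3"
  interpret M: left_module A M by fact
  interpret M: fl_module A M by (rule fl_moduleI[OF M(1,2)])
  note e' = primD[OF e]
  let ?c = "carrier M"
  have free: "j \<odot>[M] y = \<zero>[M]" if y: "y \<in> ?c" "e \<odot>[M] y = y" and j: "j \<in> jac A"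
    and a: "a \<in> carrier A" "a \<otimes>[A] e = a" "a \<odot>[M] y = \<zero>[M]" "a \<noteq> \<zero>[A]" for y j a
  proof (rule ccontr)
    assume ne: "j \<odot>[M] y \<noteq> \<zero>[M]"
    have "il A M {\<zero>[M]} (cyc A M y) + 1 \<le> 3" by (rule order_trans[OF M.il_cyc_pim(2)[OF e y a] le3])
    then have le2: "il A M {\<zero>[M]} (cyc A M y) \<le> 2"
      by (cases "il A M {\<zero>[M]} (cyc A M y)") (simp_all add: one_enat_def numeral_eq_enat)
    have "cyc A M y = ?c" by (rule tall_cyc[OF M J2M e le2 RU y j ne])
    then have "mlen A M \<le> 2" using le2 by simp
    moreover have "(2::enat) \<le> 3" by (simp add: numeral_eq_enat)
    ultimately have "mlen A M \<le> 3" by (rule order_trans)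
    then show False using big by simp
  qed
  have jc: "submodule (jmul A M ?c) A M" by (rule M.sub_jmul'[OF M.sub_carrier])
  have x0: "x \<noteq> \<zero>[M]" using j0 M.smult_r_null[OF J_carrier[OF j0(1)]] by auto
  have xn: "x \<notin> jmul A M ?c"
  proof
    assume "x \<in> jmul A M ?c"
    then have "j0 \<odot>[M] x \<in> jmul A M (jmul A M ?c)" by (rule jmul.elem[where M = M, OF j0(1)])
    then show False using J2M j0(2) by blast
  qed
  let ?X = "cyc A M x"
  have cx: "submodule ?X A M" by (rule M.sub_cyc[OF x(1)])
  obtain C0 where C0: "submodule C0 A M" "jmul A M ?c \<subseteq> C0" "x \<notin> C0" "C0 <+>[M] ?X = ?c" using M.exists_complement[OF x(1) xn] by blast
  have fin0: "il A M {\<zero>[M]} C0 < \<infinity>" by (rule le_less_trans[OF M.il_mono M(2)]) (use M.sub_subset[OF C0(1)] in simp_all)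
  \<comment> \<open>Minimality of C forces every simple submodule Z of C that lies in A x into J C:
    otherwise Z would be a direct summand of C and could be dropped without changing C + A
    x.\<close>
  from M.exists_min_submodule[of "\<lambda>C. C <+>[M] ?X = ?c", OF C0(4,1) fin0]
  obtain C where C': "submodule C A M \<and> C \<subseteq> C0 \<and> C <+>[M] ?X = ?c \<and> (\<forall>D. submodule D A M \<longrightarrow> D \<subseteq> C \<longrightarrow> D <+>[M] ?X = ?c \<longrightarrow> D = C)" ..
  then have C: "submodule C A M" "C \<subseteq> C0" "C <+>[M] ?X = ?c" by simp_all
  have Cmin: "D = C" if "submodule D A M" "D \<subseteq> C" "D <+>[M] ?X = ?c" for D using C' that by blast
  have xC: "x \<notin> C" using C(2) C0(3) by blast
  have int: "C \<inter> ?X = {\<zero>[M]}"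
  proof (rule ccontr)
    assume ne: "C \<inter> ?X \<noteq> {\<zero>[M]}"
    obtain Z where Z: "covers A M {\<zero>[M]} Z" "Z \<subseteq> C \<inter> ?X" using M.exists_simple[OF M.sub_Int[OF C(1) cx] ne] by blast
    have Zs: "submodule Z A M" and Z0: "Z \<noteq> {\<zero>[M]}" using Z(1) unfolding covers_def by blast+
    have ZC: "Z \<subseteq> C" and ZX: "Z \<subseteq> ?X" using Z(2) by blast+
    have ZJC: "Z \<subseteq> jmul A M C"
    proof (rule ccontr)
      assume nl: "\<not> Z \<subseteq> jmul A M C"
      interpret i: lhom A "sub_module M C" M "\<lambda>x. x" by (rule M.lhom_incl[OF C(1)])
      have finC: "mlen A (sub_module M C) < \<infinity>"
        by (rule le_less_trans[OF _ fin0]) (simp only: sub_module_simps M.il_sub[OF C(1) order_refl] M.il_mono[OF order_refl C(2)])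
      interpret S: fl_module A "sub_module M C" by (rule fl_moduleI[OF M.left_module_sub[OF C(1)] finC])
      have "jmul A (sub_module M C) C = jmul A M C" using i.image_jmul[of C] by simp
      then have nl': "\<not> Z \<subseteq> jmul A (sub_module M C) (carrier (sub_module M C))" using nl by simp
      have cv: "covers A (sub_module M C) {\<zero>[sub_module M C]} Z" using Z(1) M.covers_sub[OF C(1) ZC] by simp
      obtain D where D: "submodule D A (sub_module M C)" "D \<inter> Z = {\<zero>[sub_module M C]}" "D <+>[sub_module M C] Z = carrier (sub_module M C)"
        using S.simple_summand[OF cv nl'] by blast
      have D': "submodule D A M" "D \<subseteq> C" using D(1) M.sub_sub_iff[OF C(1)] by blast+
      have sum: "C \<subseteq> D <+>[M] ?X"
      proof
        fix c assume "c \<in> C"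
        then have "c \<in> D <+>[sub_module M C] Z" using D(3) by simp
        then obtain d z where dz: "d \<in> D" "z \<in> Z" "c = d \<oplus>[M] z" unfolding i.dom.mem_set_add by auto
        show "c \<in> D <+>[M] ?X" unfolding M.mem_set_add using dz ZX by blast
      qed
      have DX: "submodule (D <+>[M] ?X) A M" by (rule M.sub_sum[OF D'(1) cx])
      have "?c \<subseteq> D <+>[M] ?X" using M.sum_least[OF DX sum M.sum_upper(2)[OF D'(1) cx]] C(3) by simp
      then have "D <+>[M] ?X = ?c" using M.sub_subset[OF DX] by blast
      then have "D = C" by (rule Cmin[OF D'])
      then have "D \<inter> Z = Z" using ZC by blast
      then show False using D(2) Z0 by simp
    qed
    have ZJX: "Z \<subseteq> jmul A M ?X" using M.sub_local[OF e x Zs ZX]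
    proof
      assume "Z = ?X" then have "x \<in> C" using ZC M.cyc_self[OF x(1)] by blast
      then show ?thesis using xC by simp
    qed
    obtain f z where f: "prim A f" and z: "z \<in> Z" "f \<odot>[M] z = z" "z \<noteq> \<zero>[M]" using M.obtain_prim_vec[OF Zs Z0] by blast
    note f' = primD[OF f]
    obtain j where j: "j \<in> jac A" "z = j \<odot>[M] x" using ZJX z(1) M.jmul_cyc[OF x(1)] by blast
    note jc' = J_carrier[OF j(1)]
    define v where "v = f \<otimes>[A] (j \<otimes>[A] e)"
    have v: "v \<in> jac A" "f \<otimes>[A] v = v" "v \<otimes>[A] e = v"
      unfolding v_def using M.J_mult_l[OF f'(1) M.J_mult_r[OF j(1) e'(1)]] f' e' jc' by (simp_all add: m_assoc[symmetric]) (simp add: m_assoc)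
    have vc: "v \<in> carrier A" by (rule J_carrier[OF v(1)])
    have vx: "v \<odot>[M] x = z"
      unfolding v_def using M.smult_assoc[OF f'(1) _ x(1)] M.smult_assoc[OF jc' e'(1) x(1)] x(2) j(2) z(2) jc' e'(1) by simp
    have v0: "v \<noteq> \<zero>[A]" using vx z(3) M.smult_l_null[OF x(1)] by metis
    have uf: "uniserial (opposite A) (pim (opposite A) f)" by (rule RU[OF f j(1)]) (use v0 v_def in simp)
    \<comment> \<open>W = v C is only an additive group, yet it contains f J C. For i in J, f i is a
      sum of elements f i g with g primitive, and each of them has the form v a by
      \<open>uniserial_generates\<close>.\<close>
    define W where "W = (\<lambda>c. v \<odot>[M] c) ` C"
    have W0: "\<zero>[M] \<in> W" unfolding W_def by (rule image_eqI[of _ _ "\<zero>[M]"]) (simp_all add: M.smult_r_null[OF vc] M.sub_zero[OF C(1)])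
    have Wadd: "p \<oplus>[M] q \<in> W" if p: "p \<in> W" and q: "q \<in> W" for p q
    proof -
      obtain c where c: "c \<in> C" "p = v \<odot>[M] c" using p by (auto simp: W_def)
      obtain d where d: "d \<in> C" "q = v \<odot>[M] d" using q by (auto simp: W_def)
      show ?thesis unfolding W_def
        by (rule image_eqI[of _ _ "c \<oplus>[M] d"])
          (use c d M.sub_add[OF C(1) c(1) d(1)] M.smult_r_distr[OF vc M.sub_mem[OF C(1) c(1)] M.sub_mem[OF C(1) d(1)]] in simp_all)
    qed
    have fJ: "f \<odot>[M] (i \<odot>[M] c) \<in> W" if i: "i \<in> jac A" and c: "c \<in> C" for i c
    proof -
      note ic = J_carrier[OF i] and cM = M.sub_mem[OF C(1) c]
      let ?H = "{a \<in> carrier A. (f \<otimes>[A] (i \<otimes>[A] a)) \<odot>[M] c \<in> W}"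
      have "\<one>[A] \<in> ?H"
      proof (rule prim_induct[OF fin_l])
        show "\<zero>[A] \<in> ?H" using W0 f'(1) ic M.smult_l_null[OF cM] by simp
        show "a \<oplus>[A] b \<in> ?H" if "a \<in> ?H" "b \<in> ?H" for a b
          using that Wadd f'(1) ic cM by (simp add: r_distr M.smult_l_distr)
        fix g assume g: "prim A g"
        note g' = primD[OF g]
        let ?w = "f \<otimes>[A] (i \<otimes>[A] g)"
        have w: "?w \<in> jac A" "f \<otimes>[A] ?w = ?w" "?w \<otimes>[A] g = ?w"
          using M.J_mult_l[OF f'(1) M.J_mult_r[OF i g'(1)]] f' g' ic by (simp_all add: m_assoc[symmetric]) (simp add: m_assoc)
        obtain a where a: "a \<in> carrier A" "?w = v \<otimes>[A] a" using uniserial_generates[OF e g f'(1,3) uf v v0 w J2] by blast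
        have "?w \<odot>[M] c = v \<odot>[M] (a \<odot>[M] c)" unfolding a(2) by (rule M.smult_assoc[OF vc a(1) cM])
        then have "?w \<odot>[M] c \<in> W" unfolding W_def by (rule image_eqI[OF _ M.sub_smult[OF C(1) a(1) c]])
        then show "g \<in> ?H" using g'(1) by simp
      qed
      then show ?thesis using f'(1) ic cM by (simp add: M.smult_assoc)
    qed
    have fC: "f \<odot>[M] y \<in> W \<and> y \<in> carrier M" if "y \<in> jmul A M C" for y
      using that
    proof (induct rule: jmul.induct)
      case zero show ?case using W0 M.smult_r_null[OF f'(1)] by simp
    next
      case (elem i c) then show ?case using fJ M.smult_closed[OF J_carrier M.sub_mem[OF C(1)]] by blast
    next
      case (add p q) then show ?case using Wadd M.smult_r_distr[OF f'(1), of p q] by simp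
    qed
    have "z \<in> W" using fC[of z] ZJC z(1,2) by auto
    then obtain c where c: "c \<in> C" "z = v \<odot>[M] c" by (auto simp: W_def)
    \<comment> \<open>Since z = v x = v c = v d, the element y = x - d is annihilated by v, a
      nonzero element of A e. By \<open>free\<close>, J y = 0, so A y is simple. As M is longer than
      3, A y lies in JM and hence in C0, and x = d + y would lie in C0.\<close>
    define d where "d = e \<odot>[M] c"
    have cM: "c \<in> ?c" by (rule M.sub_mem[OF C(1) c(1)])
    have dC: "d \<in> C" unfolding d_def by (rule M.sub_smult[OF C(1) e'(1) c(1)])
    have dM: "d \<in> ?c" by (rule M.sub_mem[OF C(1) dC])
    have ed: "e \<odot>[M] d = d" unfolding d_def using M.smult_assoc[OF e'(1) e'(1) cM] e'(3) by simp
    have vd: "v \<odot>[M] d = z" unfolding d_def using M.smult_assoc[OF vc e'(1) cM] v(3) c(2) by simp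
    define y where "y = x \<ominus>[M] d"
    have yM: "y \<in> ?c" unfolding y_def using x(1) dM by simp
    have ey: "e \<odot>[M] y = y" unfolding y_def using M.smult_minus_r[OF e'(1) dM x(1)] x(2) ed by simp
    have vy: "v \<odot>[M] y = \<zero>[M]" unfolding y_def using M.smult_minus_r[OF vc dM x(1)] vx vd M.minus_eq_0 M.sub_mem[OF Zs z(1)] by simp
    have xy: "x = d \<oplus>[M] y" unfolding y_def using M.minus_add_cancel(2)[OF x(1) dM] by simp
    have y0: "y \<noteq> \<zero>[M]" using xy dC xC dM by auto
    have Jy: "k \<odot>[M] y = \<zero>[M]" if "k \<in> jac A" for k by (rule free[OF yM ey that vc v(3) vy v0])
    have "jmul A M (cyc A M y) = {\<zero>[M]}" unfolding M.jmul_cyc[OF yM] using Jy M.J_zero by auto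
    then have cv: "covers A M {\<zero>[M]} (cyc A M y)" using M.covers_local[OF e yM ey y0] by simp
    from M.simple_in_rad[OF M(3) cv] show False
    proof
      assume "cyc A M y = ?c"
      then have "mlen A M = 1" using M.il_covers[OF cv] by simp
      then show False using big by (simp add: one_enat_def numeral_eq_enat)
    next
      assume "cyc A M y \<subseteq> jmul A M ?c"
      then have "y \<in> C0" using M.cyc_self[OF yM] C0(2) by blast
      then have "d \<oplus>[M] y \<in> C0" using M.sub_add[OF C0(1)] dC C(2) by blast
      then show False using xy C0(3) by simp
    qed
  qed
  have "C = {\<zero>[M]} \<or> ?X = {\<zero>[M]}" by (rule indecomposableD[OF M(3) C(1) cx C(3) int])
  then have "C = {\<zero>[M]}" using x0 M.cyc_self[OF x(1)] by blast
  then have "C <+>[M] ?X \<subseteq> ?X" using M.sub_zero[OF cx] by (intro M.sum_least[OF cx]) simp_all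
  then have "?X = ?c" using C(3) M.sub_subset[OF cx] by blast
  then show False using order_trans[OF M.il_cyc_pim(1)[OF e x] le3] big by simp
qed

end

section \<open>Iterated radicals and modules of small Loewy length\<close>

context left_module begin

lemma jmul_smult_in:
  assumes N: "N \<subseteq> carrier M" and L: "submodule L A M" and a: "a \<in> carrier A"
    and step: "\<And>j x. j \<in> jac A \<Longrightarrow> x \<in> N \<Longrightarrow> a \<odot>[M] (j \<odot>[M] x) \<in> L" and y: "y \<in> jmul A M N"
  shows "a \<odot>[M] y \<in> L"
proof -
  have "a \<odot>[M] y \<in> L \<and> y \<in> carrier M"
    using y
  proof (induct rule: jmul.induct)
    case zero show ?case using sub_zero[OF L] smult_r_null[OF a] by simp
  next
    case (elem j x) then show ?case using step[OF elem] smult_closed[OF J_carrier, of j x] N by blast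
  next
    case (add p q) then show ?case using sub_add[OF L] smult_r_distr[OF a, of p q] by simp
  qed
  then show ?thesis ..
qed

lemma jmul_jmul_least:
  assumes N: "N \<subseteq> carrier M" and L: "submodule L A M"
    and step: "\<And>i j x. i \<in> jac A \<Longrightarrow> j \<in> jac A \<Longrightarrow> x \<in> N \<Longrightarrow> i \<odot>[M] (j \<odot>[M] x) \<in> L"
  shows "jmul A M (jmul A M N) \<subseteq> L"
  by (rule jmul_least[OF L], rule jmul_smult_in[OF N L J_carrier]) (auto intro: step)

lemma jpow_3_zero:
  assumes J3: "\<And>i j k. i \<in> jac A \<Longrightarrow> j \<in> jac A \<Longrightarrow> k \<in> jac A \<Longrightarrow> i \<otimes> (j \<otimes> k) = \<zero>"
  shows "jmul A M (jmul A M (jmul A M (carrier M))) = {\<zero>[M]}" "jpow A M 3 (carrier M) = {\<zero>[M]}"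
proof -
  let ?N = "jmul A M (carrier M)"
  have N: "submodule ?N A M" by (rule sub_jmul'[OF sub_carrier])
  have "jmul A M (jmul A M ?N) \<subseteq> {\<zero>[M]}"
  proof (rule jmul_jmul_least[OF sub_subset[OF N] sub_0])
    fix i j y assume i: "i \<in> jac A" and j: "j \<in> jac A" and y: "y \<in> ?N"
    note c = J_carrier[OF i] J_carrier[OF j]
    have "(i \<otimes> j) \<odot>[M] y \<in> {\<zero>[M]}"
    proof (rule jmul_smult_in[OF order_refl sub_0 _ _ y])
      show "i \<otimes> j \<in> carrier A" using c by simp
      fix k x assume k: "k \<in> jac A" and x: "x \<in> carrier M"
      have "(i \<otimes> j) \<odot>[M] (k \<odot>[M] x) = (i \<otimes> (j \<otimes> k)) \<odot>[M] x"
        using c J_carrier[OF k] x smult_assoc[of "i \<otimes> j" k x] by (simp add: A.m_assoc)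
      then show "(i \<otimes> j) \<odot>[M] (k \<odot>[M] x) \<in> {\<zero>[M]}" using J3[OF i j k] smult_l_null[OF x] by simp
    qed
    then show "i \<odot>[M] (j \<odot>[M] y) \<in> {\<zero>[M]}" using smult_assoc[OF c sub_mem[OF N y]] by simp
  qed
  then show e: "jmul A M (jmul A M ?N) = {\<zero>[M]}"
    using sub_zero[OF sub_jmul'[OF sub_jmul'[OF N]]] by blast
  show "jpow A M 3 (carrier M) = {\<zero>[M]}" using e by (simp add: numeral_3_eq_3 jpow_Suc jpow_0)
qed

lemma sub_jpow: "submodule N A M \<Longrightarrow> submodule (jpow A M k N) A M"
  by (induct k) (simp_all add: jpow_0 jpow_Suc sub_jmul')

lemma jpow_mono: "submodule N A M \<Longrightarrow> jpow A M k N \<subseteq> jpow A M k (carrier M)"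
proof (induct k)
  case 0 then show ?case using sub_subset by (simp add: jpow_0)
next
  case (Suc k)
  show ?case unfolding jpow_Suc
    by (rule jmul_mono[OF Suc(1)[OF Suc(2)] sub_subset[OF sub_jpow[OF sub_carrier]]])
qed

end

lemma enat_chain3: "(1::enat) \<le> a \<Longrightarrow> a + 1 \<le> b \<Longrightarrow> b + 1 \<le> c \<Longrightarrow> 3 \<le> c"
  by (cases a; cases b; cases c) (simp_all add: one_enat_def numeral_eq_enat)

lemma enat_chain4: "(1::enat) \<le> a \<Longrightarrow> a + 1 \<le> b \<Longrightarrow> b + 1 \<le> c \<Longrightarrow> c + 1 \<le> d \<Longrightarrow> \<not> d \<le> 3"
  by (cases a; cases b; cases c; cases d) (simp_all add: one_enat_def numeral_eq_enat)

context fl_module begin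

lemma uniserial_cyc:
  assumes e: "prim A e" "uniserial A (pim A e)" and x: "x \<in> carrier M" "e \<odot>[M] x = x"
  shows "uniserial A (sub_module M (cyc A M x))"
    and "jpow A M k (carrier M) = {\<zero>[M]} \<Longrightarrow> il A M {\<zero>[M]} (cyc A M x) \<le> enat k"
proof -
  let ?L = "cyc A M x"
  have L: "submodule ?L A M" by (rule sub_cyc[OF x(1)])
  show u: "uniserial A (sub_module M ?L)"
    using lhom.uniserial_image[OF cyc_pim_hom(1)[OF e(1) x] e(2)] by (simp only: cyc_pim_hom(2)[OF e(1) x])
  assume k: "jpow A M k (carrier M) = {\<zero>[M]}"
  interpret i: lhom A "sub_module M ?L" M "\<lambda>x. x" by (rule lhom_incl[OF L])
  have fin: "mlen A (sub_module M ?L) < \<infinity>"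
    by (rule le_less_trans[OF _ fin_M]) (simp only: sub_module_simps il_sub[OF L order_refl] il_mono[OF order_refl sub_subset[OF L]])
  interpret S: fl_module A "sub_module M ?L" by (rule fl_moduleI[OF left_module_sub[OF L] fin])
  have "jpow A (sub_module M ?L) k ?L = jpow A M k ?L" using i.image_jpow[OF i.dom.sub_carrier, of k] by simp
  also have "\<dots> = {\<zero>[M]}" using jpow_mono[OF L, of k] sub_zero[OF sub_jpow[OF L], of k] k by blast
  finally have "il A (sub_module M ?L) {\<zero>[sub_module M ?L]} ?L \<le> enat k"
    using S.uniserial_length[OF u i.dom.sub_carrier, of k] by simp
  then show "il A M {\<zero>[M]} ?L \<le> enat k" by (simp only: sub_module_simps il_sub[OF L order_refl])
qed

text \<open>If JM = 0, then A x is simple for x = e x nonzero, and a simple submodule that is not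
  inside JM is a direct summand.\<close>

lemma semisimple_bound:
  assumes "indecomposable A M" "jmul A M (carrier M) = {\<zero>[M]}"
  shows "mlen A M = 1"
proof -
  have ne: "carrier M \<noteq> {\<zero>[M]}" using assms(1) by (simp add: indecomposable_alt)
  obtain e x where e: "prim A e" and x: "x \<in> carrier M" "e \<odot>[M] x = x" "x \<noteq> \<zero>[M]"
    using obtain_prim_vec[OF sub_carrier ne] by blast
  have cx: "submodule (cyc A M x) A M" by (rule sub_cyc[OF x(1)])
  have "jmul A M (cyc A M x) = {\<zero>[M]}"
    using jmul_mono[OF sub_subset[OF cx] order_refl] sub_zero[OF sub_jmul'[OF cx]] assms(2) by blast
  then have cv: "covers A M {\<zero>[M]} (cyc A M x)" using covers_local[OF e x] by simp
  have "cyc A M x = carrier M" using simple_in_rad[OF assms(1) cv] assms(2) cyc_self[OF x(1)] x(3) by blast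
  then show ?thesis using il_covers[OF cv] by simp
qed

lemma obtain_prim_pair:
  assumes "jmul A M (carrier M) \<noteq> {\<zero>[M]}"
  obtains e f j x where "prim A e" "prim A f" "j \<in> jac A" "x \<in> carrier M" "e \<odot>[M] x = x" "f \<odot>[M] (j \<odot>[M] x) \<noteq> \<zero>[M]"
proof -
  have "\<not> jmul A M (carrier M) \<subseteq> {\<zero>[M]}" using assms sub_zero[OF sub_jmul'[OF sub_carrier]] by blast
  then obtain j x where j: "j \<in> jac A" and x: "x \<in> carrier M" "j \<odot>[M] x \<noteq> \<zero>[M]"
    using jmul_least[OF sub_0, of "carrier M"] by blast
  note jc = J_carrier[OF j]
  \<comment> \<open>This is an additive subgroup but not a submodule in general, which is why
    \<open>exists_prim\<close> is used in its additive form.\<close>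
  let ?N = "{y \<in> carrier M. j \<odot>[M] y = \<zero>[M]}"
  have N: "\<zero>[M] \<in> ?N" "\<And>y z. y \<in> ?N \<Longrightarrow> z \<in> ?N \<Longrightarrow> y \<oplus>[M] z \<in> ?N" using smult_r_null[OF jc] by (auto simp: smult_r_distr[OF jc])
  obtain e where e: "prim A e" "e \<odot>[M] x \<notin> ?N" using exists_prim[OF N x(1)] x(2) by blast
  note e' = primD[OF e(1)]
  let ?x = "e \<odot>[M] x"
  have xM: "?x \<in> carrier M" by (rule smult_closed[OF e'(1) x(1)])
  have jx: "j \<odot>[M] ?x \<notin> {\<zero>[M]}" using e(2) xM by blast
  have ex: "e \<odot>[M] ?x = ?x" using smult_assoc[OF e'(1) e'(1) x(1)] e'(3) by simp
  obtain f where f: "prim A f" "f \<odot>[M] (j \<odot>[M] ?x) \<notin> {\<zero>[M]}" using exists_prim_sub[OF sub_0 smult_closed[OF jc xM] jx] by blast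
  then have "f \<odot>[M] (j \<odot>[M] ?x) \<noteq> \<zero>[M]" by blast
  then show thesis by (rule that[OF e(1) f(1) j xM ex])
qed

end

text \<open>A one-sided consequence of being a wedged-string algebra with radical cubed zero, stated in terms of
  primitive idempotents: \<open>opposite A\<close>-uniseriality of \<open>g A\<close> is uniseriality of the injective envelope of the top of \<open>A g\<close>.\<close>

definition wedge :: "('a, 'z) ring_scheme \<Rightarrow> bool" where
  "wedge A \<longleftrightarrow> (\<forall>e. prim A e \<longrightarrow> uniserial A (pim A e) \<or>
    (mlen A (pim A e) \<le> 3 \<and>
     (\<forall>i\<in>jac A. \<forall>j\<in>jac A. i \<otimes>[A] (j \<otimes>[A] e) = \<zero>[A]) \<and>
     (\<forall>g. prim A g \<longrightarrow> (\<exists>j\<in>jac A. g \<otimes>[A] (j \<otimes>[A] e) \<noteq> \<zero>[A]) \<longrightarrow> uniserial (opposite A) (pim (opposite A) g))))"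

lemma wedgeD:
  assumes "wedge A" "prim A e" "\<not> uniserial A (pim A e)"
  shows "mlen A (pim A e) \<le> 3"
    and "\<And>i j. i \<in> jac A \<Longrightarrow> j \<in> jac A \<Longrightarrow> i \<otimes>[A] (j \<otimes>[A] e) = \<zero>[A]"
    and "\<And>g j. prim A g \<Longrightarrow> j \<in> jac A \<Longrightarrow> g \<otimes>[A] (j \<otimes>[A] e) \<noteq> \<zero>[A] \<Longrightarrow> uniserial (opposite A) (pim (opposite A) g)"
  using assms unfolding wedge_def by blast+

section \<open>Bounding the lengths under the wedge condition\<close>

context artin_dual begin

text \<open>A x is an image of the uniserial A e and J^2 M = 0, so its length is exactly 2. Its
  socle contains f j x with f A uniserial, so \<open>splits_off\<close> with k = 2 gives A x =
  M.\<close>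

lemma uniserial_pair_bound:
  assumes M: "left_module A M" "mlen A M < \<infinity>" "indecomposable A M" and J2M: "jmul A M (jmul A M (carrier M)) = {\<zero>[M]}"
    and e: "prim A e" "uniserial A (pim A e)" and f: "prim A f" "uniserial (opposite A) (pim (opposite A) f)"
    and j: "j \<in> jac A" and x: "x \<in> carrier M" "e \<odot>[M] x = x" and ne: "f \<odot>[M] (j \<odot>[M] x) \<noteq> \<zero>[M]"
  shows "mlen A M \<le> 2"
proof -
  interpret M: left_module A M by fact
  interpret M: fl_module A M by (rule fl_moduleI[OF M(1,2)])
  note f' = primD[OF f(1)] and jc = J_carrier[OF j]
  let ?L = "cyc A M x" and ?s = "f \<odot>[M] (j \<odot>[M] x)"
  have jp: "jpow A M 2 (carrier M) = {\<zero>[M]}" using J2M by (simp add: numeral_2_eq_2 M.jpow_Suc M.jpow_0)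
  have L: "submodule ?L A M" by (rule M.sub_cyc[OF x(1)])
  have jx: "j \<odot>[M] x \<noteq> \<zero>[M]" using ne M.smult_r_null[OF f'(1)] by auto
  have le: "il A M {\<zero>[M]} ?L \<le> 2" using M.uniserial_cyc(2)[OF e x jp] by (simp only: numeral_eq_enat)
  have ge: "enat 2 \<le> il A M {\<zero>[M]} ?L" using M.cyc_len_two(1)[OF e(1) x j jx] by (simp only: numeral_eq_enat)
  have sN: "?s \<in> jmul A M ?L" by (rule M.sub_smult[OF M.sub_jmul'[OF L] f'(1) jmul.elem[where M = M, OF j M.cyc_self[OF x(1)]]])
  have sL: "?s \<in> ?L" using sN M.jmul_subset[OF L] by blast
  have fs: "f \<odot>[M] ?s = ?s" using M.smult_assoc[OF f'(1) f'(1) M.smult_closed[OF jc x(1)]] f'(3) by simp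
  have min: "?s \<in> Z" if Z: "submodule Z A M" "Z \<subseteq> ?L" "Z \<noteq> {\<zero>[M]}" for Z
    using M.cyc_len_two(2)[OF e(1) x j jx le Z] sN by blast
  have "?L = carrier M" by (rule splits_off[OF M f L sL fs ne min jp ge])
  then show ?thesis using le by simp
qed

text \<open>A nonzero product i j x with x = e x shows that J^2 e is nonzero, and a nonzero s = f s
  in J^2 x shows that f J^2 is nonzero. By the wedge conditions on both sides A e and f A are then
  uniserial. So A x has length 3, which is the Loewy length of M, and splits off.\<close>

lemma tall_bound:
  assumes M: "left_module A M" "mlen A M < \<infinity>" "indecomposable A M" and w: "wedge A" "wedge (opposite A)"
    and J3: "\<And>i j k. i \<in> jac A \<Longrightarrow> j \<in> jac A \<Longrightarrow> k \<in> jac A \<Longrightarrow> i \<otimes>[A] (j \<otimes>[A] k) = \<zero>[A]"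
    and ne: "jmul A M (jmul A M (carrier M)) \<noteq> {\<zero>[M]}"
  shows "mlen A M \<le> 3"
proof -
  interpret M: left_module A M by fact
  interpret M: fl_module A M by (rule fl_moduleI[OF M(1,2)])
  have sub: "submodule (jmul A M (jmul A M (carrier M))) A M" by (intro M.sub_jmul' M.sub_carrier)
  have "\<not> jmul A M (jmul A M (carrier M)) \<subseteq> {\<zero>[M]}" using ne M.sub_zero[OF sub] by blast
  then obtain i j x0 where ij: "i \<in> jac A" "j \<in> jac A" and x0: "x0 \<in> carrier M" "i \<odot>[M] (j \<odot>[M] x0) \<noteq> \<zero>[M]"
    using M.jmul_jmul_least[OF order_refl M.sub_0] by blast
  note ic = J_carrier[OF ij(1)] and jc = J_carrier[OF ij(2)]
  let ?N = "{y \<in> carrier M. i \<odot>[M] (j \<odot>[M] y) = \<zero>[M]}"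
  have N: "\<zero>[M] \<in> ?N" "\<And>y z. y \<in> ?N \<Longrightarrow> z \<in> ?N \<Longrightarrow> y \<oplus>[M] z \<in> ?N"
    using M.smult_r_null[OF jc] M.smult_r_null[OF ic] M.smult_closed[OF jc] by (auto simp: M.smult_r_distr[OF jc] M.smult_r_distr[OF ic])
  obtain e where e: "prim A e" "e \<odot>[M] x0 \<notin> ?N" using M.exists_prim[OF N x0(1)] x0(2) by blast
  note e' = primD[OF e(1)]
  define x where "x = e \<odot>[M] x0"
  have x: "x \<in> carrier M" unfolding x_def by (rule M.smult_closed[OF e'(1) x0(1)])
  have ex: "e \<odot>[M] x = x" unfolding x_def using M.smult_assoc[OF e'(1) e'(1) x0(1)] e'(3) by simp
  have ijx: "i \<odot>[M] (j \<odot>[M] x) \<noteq> \<zero>[M]" using e(2) x unfolding x_def by blast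
  have "(i \<otimes>[A] (j \<otimes>[A] e)) \<odot>[M] x = i \<odot>[M] (j \<odot>[M] x)"
    using M.smult_assoc[OF ic _ x] M.smult_assoc[OF jc e'(1) x] ex jc e'(1) by simp
  then have "i \<otimes>[A] (j \<otimes>[A] e) \<noteq> \<zero>[A]" using ijx M.smult_l_null[OF x] by metis
  then have ue: "uniserial A (pim A e)" using wedgeD(2)[OF w(1) e(1) _ ij] by blast
  note jp = M.jpow_3_zero(2)[OF J3]
  let ?L = "cyc A M x"
  let ?L1 = "jmul A M ?L" let ?L2 = "jmul A M ?L1"
  have L: "submodule ?L A M" by (rule M.sub_cyc[OF x])
  have L1: "submodule ?L1 A M" by (rule M.sub_jmul'[OF L])
  have L2: "submodule ?L2 A M" by (rule M.sub_jmul'[OF L1])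
  have le: "il A M {\<zero>[M]} ?L \<le> 3" using M.uniserial_cyc(2)[OF e(1) ue x ex jp] by (simp only: numeral_eq_enat)
  have "i \<odot>[M] (j \<odot>[M] x) \<in> ?L2" by (intro jmul.elem[where M = M] ij M.cyc_self x)
  then have n2: "?L2 \<noteq> {\<zero>[M]}" using ijx by blast
  have n1: "?L1 \<noteq> {\<zero>[M]}" using n2 M.jmul_0 by metis
  have n0: "?L \<noteq> {\<zero>[M]}" using n1 M.jmul_0 by metis
  have p1: "?L1 \<subset> ?L" by (rule M.jmul_proper[OF L M(2) n0])
  have p2: "?L2 \<subset> ?L1" by (rule M.jmul_proper[OF L1 M(2) n1])
  have z: "{\<zero>[M]} \<subseteq> Z" if "submodule Z A M" for Z using M.sub_zero[OF that] by simp
  have s1: "il A M {\<zero>[M]} ?L1 + 1 \<le> il A M {\<zero>[M]} ?L" by (rule M.il_strict[OF M.sub_0 L1 L z[OF L1] p1])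
  have s2: "il A M {\<zero>[M]} ?L2 + 1 \<le> il A M {\<zero>[M]} ?L1" by (rule M.il_strict[OF M.sub_0 L2 L1 z[OF L2] p2])
  have s3: "1 \<le> il A M {\<zero>[M]} ?L2" by (rule M.il_pos[OF M.sub_0 L2]) (use z[OF L2] n2 in blast)
  have ge: "enat 3 \<le> il A M {\<zero>[M]} ?L" using enat_chain3[OF s3 s2 s1] by (simp only: numeral_eq_enat)
  obtain f s where f: "prim A f" and s: "s \<in> ?L2" "f \<odot>[M] s = s" "s \<noteq> \<zero>[M]" using M.obtain_prim_vec[OF L2 n2] by blast
  note f' = primD[OF f]
  have uf: "uniserial (opposite A) (pim (opposite A) f)"
  proof (rule ccontr)
    assume nu: "\<not> uniserial (opposite A) (pim (opposite A) f)"
    have fo: "prim (opposite A) f" using f by simp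
    have z2: "(f \<otimes>[A] k) \<otimes>[A] l = \<zero>[A]" if "k \<in> jac A" "l \<in> jac A" for k l
      using wedgeD(2)[OF w(2) fo nu, of l k] that J_opposite by (simp add: opposite_def)
    have "f \<odot>[M] s \<in> {\<zero>[M]}"
    proof (rule M.jmul_smult_in[OF M.sub_subset[OF L1] M.sub_0 f'(1) _ s(1)])
      fix k y assume k: "k \<in> jac A" and y: "y \<in> ?L1"
      note kc = J_carrier[OF k]
      have "(f \<otimes>[A] k) \<odot>[M] y \<in> {\<zero>[M]}"
      proof (rule M.jmul_smult_in[OF M.sub_subset[OF L] M.sub_0 m_closed[OF f'(1) kc] _ y])
        fix l u assume l: "l \<in> jac A" and u: "u \<in> ?L"
        have uM: "u \<in> carrier M" by (rule M.sub_mem[OF L u])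
        show "(f \<otimes>[A] k) \<odot>[M] (l \<odot>[M] u) \<in> {\<zero>[M]}"
          using M.smult_assoc[OF m_closed[OF f'(1) kc] J_carrier[OF l] uM] z2[OF k l] M.smult_l_null[OF uM] by simp
      qed
      then show "f \<odot>[M] (k \<odot>[M] y) \<in> {\<zero>[M]}" using M.smult_assoc[OF f'(1) kc M.sub_mem[OF L1 y]] by simp
    qed
    then show False using s(2,3) by simp
  qed
  have uL: "uniserial A (sub_module M ?L)" by (rule M.uniserial_cyc(1)[OF e(1) ue x ex])
  have L2L: "?L2 \<subseteq> ?L" using p1 p2 by blast
  have min: "s \<in> Z" if Z: "submodule Z A M" "Z \<subseteq> ?L" "Z \<noteq> {\<zero>[M]}" for Z
  proof -
    have "Z \<subseteq> ?L2 \<or> ?L2 \<subseteq> Z" using uL Z(1,2) L2 L2L unfolding uniserial_def M.sub_sub_iff[OF L] by blast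
    then show ?thesis
    proof
      assume ZL: "Z \<subseteq> ?L2"
      have "Z = ?L2"
      proof (rule ccontr)
        assume "Z \<noteq> ?L2"
        then have ps: "Z \<subset> ?L2" using ZL by blast
        have a: "1 \<le> il A M {\<zero>[M]} Z" by (rule M.il_pos[OF M.sub_0 Z(1)]) (use z[OF Z(1)] Z(3) in blast)
        have b: "il A M {\<zero>[M]} Z + 1 \<le> il A M {\<zero>[M]} ?L2" by (rule M.il_strict[OF M.sub_0 Z(1) L2 z[OF Z(1)] ps])
        show False using enat_chain4[OF a b s2 s1] le by simp
      qed
      then show ?thesis using s(1) by simp
    qed (use s(1) in blast)
  qed
  have sL: "s \<in> ?L" using s(1) L2L by blast
  have "?L = carrier M" by (rule splits_off[OF M f uf L sL s(2,3) min jp ge])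
  then show ?thesis using le by simp
qed

text \<open>The essential case is J^2 M = 0 with JM nonzero, where some f j x with x = e x is
  nonzero. If A e is not uniserial, \<open>wide_top_bound\<close> applies; if A e and f A are
  uniserial, the length is at most 2. The remaining case, with f A not uniserial, becomes the first
  one for the dual of M over \<open>opposite A\<close>.\<close>

lemma wedge_bound:
  assumes M: "left_module A M" "mlen A M < \<infinity>" "indecomposable A M" and w: "wedge A" "wedge (opposite A)"
    and J3: "\<And>i j k. i \<in> jac A \<Longrightarrow> j \<in> jac A \<Longrightarrow> k \<in> jac A \<Longrightarrow> i \<otimes>[A] (j \<otimes>[A] k) = \<zero>[A]"
  shows "mlen A M \<le> 3"
proof (cases "jmul A M (jmul A M (carrier M)) = {\<zero>[M]}")
  case False then show ?thesis using tall_bound[OF M w J3] by blast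
next
  case J2M: True
  interpret M: left_module A M by fact
  interpret M: fl_module A M by (rule fl_moduleI[OF M(1,2)])
  show ?thesis
  proof (cases "jmul A M (carrier M) = {\<zero>[M]}")
    case True then show ?thesis using M.semisimple_bound[OF M(3)] by (simp add: one_enat_def numeral_eq_enat)
  next
    case False
    then obtain e f j x where e: "prim A e" and f: "prim A f" and j: "j \<in> jac A"
      and x: "x \<in> carrier M" "e \<odot>[M] x = x" and ne: "f \<odot>[M] (j \<odot>[M] x) \<noteq> \<zero>[M]" using M.obtain_prim_pair by blast
    note f' = primD[OF f] and jc = J_carrier[OF j]
    have jx: "j \<odot>[M] x \<noteq> \<zero>[M]" using ne M.smult_r_null[OF f'(1)] by auto
    show ?thesis
    proof (cases "uniserial A (pim A e)")
      case False
      show ?thesis by (rule wide_top_bound[OF M J2M e wedgeD[OF w(1) e False] x j jx])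
    next
      case ue: True
      show ?thesis
      proof (cases "uniserial (opposite A) (pim (opposite A) f)")
        case uf: True
        have "mlen A M \<le> 2" by (rule uniserial_pair_bound[OF M J2M e ue f uf j x ne])
        moreover have "(2::enat) \<le> 3" by (simp add: numeral_eq_enat)
        ultimately show ?thesis by (rule order_trans)
      next
        case nu: False
        interpret O: artin_dual R "opposite A" E by (rule artin_dual_opposite)
        let ?D = "dual R A M E"
        interpret D: left_module "opposite A" ?D by (rule left_module_dual[OF M(1,2)])
        have fo: "prim (opposite A) f" using f by simp
        have jo: "j \<in> jac (opposite A)" using j J_opposite by simp
        have fin: "mlen (opposite A) ?D < \<infinity>" unfolding mlen_dual[OF M(1,2)] by (rule M(2))
        have ind: "indecomposable (opposite A) ?D" by (rule indecomposable_dual[OF M])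
        obtain t where t: "t \<in> carrier ?D" "t (f \<odot>[M] (j \<odot>[M] x)) \<noteq> \<zero>[E]"
          using functional[OF M(1,2) M.sub_0 M.smult_closed[OF f'(1) M.smult_closed[OF jc x(1)]]] ne by blast
        have fc: "f \<in> carrier (opposite A)" and jco: "j \<in> carrier (opposite A)" using f'(1) jc by simp_all
        let ?t = "f \<odot>[?D] t"
        have tD: "?t \<in> carrier ?D" by (rule D.smult_closed[OF fc t(1)])
        have ft: "f \<odot>[?D] ?t = ?t" using D.smult_assoc[OF fc fc t(1)] f'(3) by (simp add: opposite_def)
        have jxM: "j \<odot>[M] x \<in> carrier M" by (rule M.smult_closed[OF jc x(1)])
        \<comment> \<open>The roles of e and f are exchanged by duality: the functional f t is fixed
          by f, and j does not annihilate it because its product with j takes x to t (f j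
          x).\<close>
        have "(j \<odot>[?D] ?t) x = t (f \<odot>[M] (j \<odot>[M] x))" using x(1) jxM by (simp only: dual_simps restrict_apply')
        moreover have "\<zero>[?D] x = \<zero>[E]" using x(1) by (simp only: dual_simps restrict_apply')
        ultimately have jt: "j \<odot>[?D] ?t \<noteq> \<zero>[?D]" using t(2) by metis
        have "jmul (opposite A) ?D (jmul (opposite A) ?D (carrier ?D)) \<subseteq> {\<zero>[?D]}"
        proof (rule D.jmul_jmul_least[OF order_refl D.sub_0])
          fix i k g assume i: "i \<in> jac (opposite A)" and k: "k \<in> jac (opposite A)" and g: "g \<in> carrier ?D"
          have i': "i \<in> jac A" and k': "k \<in> jac A" using i k J_opposite by simp_all
          have ko: "k \<in> carrier (opposite A)" and io: "i \<in> carrier (opposite A)" using J_carrier[OF k] J_carrier[OF i] .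
          have kg: "k \<odot>[?D] g \<in> carrier ?D" by (rule D.smult_closed[OF ko g])
          have gz: "g \<zero>[M] = \<zero>[E]"
          proof -
            interpret g: lhom R "restrict_scalars R A M" E g
              using g by (intro left_module.hom_lhom[OF left_module_rs[OF M(1)] cogen.E.left_module_axioms]) (simp add: dual_carrier)
            show ?thesis using g.zero by (simp add: restrict_scalars_def)
          qed
          have "i \<odot>[?D] (k \<odot>[?D] g) = \<zero>[?D]"
          proof (rule extensionalityI[of _ "carrier M"])
            fix m assume m: "m \<in> carrier M"
            have im: "i \<odot>[M] m \<in> carrier M" by (rule M.smult_closed[OF J_carrier[OF i'] m])
            have "k \<odot>[M] (i \<odot>[M] m) \<in> jmul A M (jmul A M (carrier M))" by (intro jmul.elem[where M = M] i' k' m)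
            then have "k \<odot>[M] (i \<odot>[M] m) = \<zero>[M]" using J2M by blast
            then show "(i \<odot>[?D] (k \<odot>[?D] g)) m = \<zero>[?D] m" using m im gz by (simp only: dual_simps restrict_apply')
          qed (simp_all only: dual_simps restrict_extensional)
          then show "i \<odot>[?D] (k \<odot>[?D] g) \<in> {\<zero>[?D]}" by simp
        qed
        then have J2D: "jmul (opposite A) ?D (jmul (opposite A) ?D (carrier ?D)) = {\<zero>[?D]}"
          using D.sub_zero[OF D.sub_jmul'[OF D.sub_jmul'[OF D.sub_carrier]]] by blast
        have "mlen (opposite A) ?D \<le> 3"
          by (rule O.wide_top_bound[OF D.left_module_axioms fin ind J2D fo wedgeD[OF w(2) fo nu] tD ft jo jt])
        then show ?thesis unfolding mlen_dual[OF M(1,2)] .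
      qed
    qed
  qed
qed

end

lemma (in lhom) uniserial_inj:
  assumes "inj_on f (carrier M)" "uniserial A N" shows "uniserial A M"
  unfolding uniserial_def
proof (intro allI impI)
  fix X Y assume XY: "submodule X A M \<and> submodule Y A M"
  then have X: "submodule X A M" and Y: "submodule Y A M" by simp_all
  have le: "U \<subseteq> V" if "f ` U \<subseteq> f ` V" "submodule U A M" "submodule V A M" for U V
  proof
    fix u assume u: "u \<in> U"
    then obtain v where "v \<in> V" "f u = f v" using \<open>f ` U \<subseteq> f ` V\<close> by blast
    then show "u \<in> V" using inj_onD[OF assms(1), of u v] dom.sub_mem[OF that(2) u] dom.sub_mem[OF that(3)] by simp
  qed
  have "f ` X \<subseteq> f ` Y \<or> f ` Y \<subseteq> f ` X"
    using assms(2)[unfolded uniserial_def, rule_format, of "f ` X" "f ` Y"] sub_image[OF X] sub_image[OF Y] by simp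
  then show "X \<subseteq> Y \<or> Y \<subseteq> X" using le[OF _ X Y] le[OF _ Y X] by blast
qed

lemma (in liso) uniserial_reflect: "uniserial A N \<Longrightarrow> uniserial A M"
  by (rule uniserial_inj[OF inj])

lemma (in lhom) simple_inj:
  assumes "covers A M {\<zero>[M]} (carrier M)" "s \<in> carrier M" "f s \<noteq> \<zero>[N]"
  shows "inj_on f (carrier M)"
proof -
  have "ker = {\<zero>[M]} \<or> ker = carrier M"
    using assms(1) sub_ker dom.sub_subset[OF sub_ker] dom.sub_zero[OF sub_ker] unfolding covers_def by blast
  moreover have "s \<notin> ker" using assms(3) by (simp add: ker_iff)
  ultimately show ?thesis using assms(2) unfolding inj_iff by blast
qed

section \<open>Modules of length at most three\<close>

context left_module begin

lemma incomparable_chain: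
  assumes X: "submodule X A M" "\<not> X \<subseteq> Y" and Y: "submodule Y A M" "\<not> Y \<subseteq> X"
  shows "1 \<le> il A M {\<zero>[M]} X" "il A M {\<zero>[M]} X + 1 \<le> il A M {\<zero>[M]} (X <+>[M] Y)"
    "X \<inter> Y \<noteq> {\<zero>[M]} \<Longrightarrow> 1 \<le> il A M {\<zero>[M]} (X \<inter> Y)" "il A M {\<zero>[M]} (X \<inter> Y) + 1 \<le> il A M {\<zero>[M]} X"
proof -
  have z: "{\<zero>[M]} \<subseteq> Z" if "submodule Z A M" for Z using sub_zero[OF that] by simp
  have I: "submodule (X \<inter> Y) A M" by (rule sub_Int[OF X(1) Y(1)])
  have S: "submodule (X <+>[M] Y) A M" by (rule sub_sum[OF X(1) Y(1)])
  have "{\<zero>[M]} \<subset> X" using z[OF X(1)] z[OF Y(1)] X(2) by blast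
  then show "1 \<le> il A M {\<zero>[M]} X" by (rule il_pos[OF sub_0 X(1)])
  have "X \<subset> X <+>[M] Y" using sum_upper[OF X(1) Y(1)] Y(2) by blast
  then show "il A M {\<zero>[M]} X + 1 \<le> il A M {\<zero>[M]} (X <+>[M] Y)" by (rule il_strict[OF sub_0 X(1) S z[OF X(1)]])
  have "X \<inter> Y \<subset> X" using X(2) by blast
  then show "il A M {\<zero>[M]} (X \<inter> Y) + 1 \<le> il A M {\<zero>[M]} X" by (rule il_strict[OF sub_0 I X(1) z[OF I]])
  assume "X \<inter> Y \<noteq> {\<zero>[M]}"
  then have "{\<zero>[M]} \<subset> X \<inter> Y" using z[OF I] by blast
  then show "1 \<le> il A M {\<zero>[M]} (X \<inter> Y)" by (rule il_pos[OF sub_0 I])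
qed

text \<open>For incomparable X and Y, use the chain 0 < X < X + Y < M if X + Y is proper. Otherwise
  the intersection of X and Y is nonzero by indecomposability, and it can be inserted below
  X.\<close>

lemma nonuniserial_length:
  assumes "indecomposable A M" "\<not> uniserial A M"
  shows "3 \<le> mlen A M"
proof -
  obtain X Y where X: "submodule X A M" "\<not> X \<subseteq> Y" and Y: "submodule Y A M" "\<not> Y \<subseteq> X"
    using assms(2) unfolding uniserial_def by blast
  note ch = incomparable_chain[OF X Y]
  have S: "submodule (X <+>[M] Y) A M" by (rule sub_sum[OF X(1) Y(1)])
  have Sc: "X <+>[M] Y \<subseteq> carrier M" by (rule sub_subset[OF S])
  show ?thesis
  proof (cases "X <+>[M] Y = carrier M")
    case True
    have "X \<inter> Y \<noteq> {\<zero>[M]}"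
    proof
      assume "X \<inter> Y = {\<zero>[M]}"
      then have "X = {\<zero>[M]} \<or> Y = {\<zero>[M]}" by (rule indecomposableD[OF assms(1) X(1) Y(1) True])
      then show False using X Y sub_zero[OF X(1)] sub_zero[OF Y(1)] by blast
    qed
    from enat_chain3[OF ch(3)[OF this] ch(4,2)] show ?thesis unfolding True .
  next
    case False
    then have ps: "X <+>[M] Y \<subset> carrier M" using Sc by blast
    have z: "{\<zero>[M]} \<subseteq> X <+>[M] Y" using sub_zero[OF S] by simp
    show ?thesis by (rule enat_chain3[OF ch(1,2) il_strict[OF sub_0 S sub_carrier z ps]])
  qed
qed

end

context fl_module begin

lemma generated_local:
  assumes e: "prim A e" and x: "x \<in> carrier M" "e \<odot>[M] x = x" "x \<noteq> \<zero>[M]" "cyc A M x = carrier M"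
  shows "covers A M (jmul A M (carrier M)) (carrier M)"
    and "\<And>L. submodule L A M \<Longrightarrow> L \<noteq> carrier M \<Longrightarrow> L \<subseteq> jmul A M (carrier M)"
    and "module_rad A M = jmul A M (carrier M)"
    and "largest_proper_submodule A M (jmul A M (carrier M))"
proof -
  let ?N = "jmul A M (carrier M)"
  show cov: "covers A M ?N (carrier M)" using covers_local[OF e x(1-3)] x(4) by simp
  have N: "submodule ?N A M" "?N \<noteq> carrier M" using cov by (auto simp: covers_def)
  show lp: "L \<subseteq> ?N" if "submodule L A M" "L \<noteq> carrier M" for L
    using sub_local[OF e x(1,2) that(1)] sub_subset[OF that(1)] that(2) x(4) by simp
  show "largest_proper_submodule A M ?N" unfolding largest_proper_submodule_def using N lp by blast
  have "maximal_submodule A M L \<longleftrightarrow> L = ?N" for L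
  proof
    assume L: "maximal_submodule A M L"
    then have "L \<subseteq> ?N" using lp unfolding maximal_submodule_def by blast
    then show "L = ?N" using L N unfolding maximal_submodule_def by blast
  qed (simp add: maximal_iff_covers cov)
  then have "{L. maximal_submodule A M L} = {?N}" by simp
  then show "module_rad A M = ?N" unfolding module_rad_def using sub_subset[OF N(1)] by auto
qed

text \<open>Incomparable submodules X and Y lie in the radical of a local module, so 0 < X < X + Y <
  M already uses up the length 3. A fourth strict step would come from a nonzero intersection, from
  a submodule strictly inside X or Y, or from a gap between X + Y and the radical.\<close>

lemma nonuniserial_local_three:
  assumes e: "prim A e" and x: "x \<in> carrier M" "e \<odot>[M] x = x" "x \<noteq> \<zero>[M]" "cyc A M x = carrier M"
    and le: "mlen A M \<le> 3" and nu: "\<not> uniserial A M"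
  obtains X Y where "covers A M {\<zero>[M]} X" "covers A M {\<zero>[M]} Y" "\<not> X \<subseteq> Y" "\<not> Y \<subseteq> X"
    "X \<inter> Y = {\<zero>[M]}" "X <+>[M] Y = jmul A M (carrier M)" "3 \<le> mlen A M"
proof -
  let ?N = "jmul A M (carrier M)"
  note loc = generated_local[OF e x]
  have N: "submodule ?N A M" "?N \<subset> carrier M" using loc(1) by (auto simp: covers_def)
  have z: "{\<zero>[M]} \<subseteq> Z" if "submodule Z A M" for Z using sub_zero[OF that] by simp
  have Nlt: "il A M {\<zero>[M]} ?N + 1 \<le> mlen A M" by (rule il_strict[OF sub_0 N(1) sub_carrier z[OF N(1)] N(2)])
  obtain X Y where X: "submodule X A M" "\<not> X \<subseteq> Y" and Y: "submodule Y A M" "\<not> Y \<subseteq> X"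
    using nu unfolding uniserial_def by blast
  have XN: "X \<subseteq> ?N" using loc(2)[OF X(1)] sub_subset[OF Y(1)] Y(2) by blast
  have YN: "Y \<subseteq> ?N" using loc(2)[OF Y(1)] sub_subset[OF X(1)] X(2) by blast
  have S: "submodule (X <+>[M] Y) A M" by (rule sub_sum[OF X(1) Y(1)])
  have SN: "X <+>[M] Y \<subseteq> ?N" by (rule sum_least[OF N(1) XN YN])
  note ch = incomparable_chain[OF X Y] and ch' = incomparable_chain[OF Y X]
  have Slt: "il A M {\<zero>[M]} (X <+>[M] Y) + 1 \<le> mlen A M"
    by (rule il_strict[OF sub_0 S sub_carrier z[OF S]]) (use SN N(2) in blast)
  have SeN: "X <+>[M] Y = ?N"
  proof (rule ccontr)
    assume "X <+>[M] Y \<noteq> ?N"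
    then have "X <+>[M] Y \<subset> ?N" using SN by blast
    from il_strict[OF sub_0 S N(1) z[OF S] this] enat_chain4[OF ch(1,2) _ Nlt] le show False by blast
  qed
  have int: "X \<inter> Y = {\<zero>[M]}"
  proof (rule ccontr)
    assume "X \<inter> Y \<noteq> {\<zero>[M]}"
    from enat_chain4[OF ch(3)[OF this] ch(4,2) Slt] le show False by blast
  qed
  have simple: "covers A M {\<zero>[M]} V"
    if V: "submodule V A M" "1 \<le> il A M {\<zero>[M]} V" "il A M {\<zero>[M]} V + 1 \<le> il A M {\<zero>[M]} (X <+>[M] Y)" for V
    unfolding covers_def
  proof (intro conjI allI impI sub_0 V(1))
    have "V \<noteq> {\<zero>[M]}" using V(2) il_refl[of "{\<zero>[M]}"] by (auto simp: one_enat_def zero_enat_def)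
    then show "{\<zero>[M]} \<subset> V" using z[OF V(1)] by blast
    fix Z assume Z: "submodule Z A M" "{\<zero>[M]} \<subseteq> Z" "Z \<subseteq> V"
    show "Z = {\<zero>[M]} \<or> Z = V"
    proof (rule ccontr)
      assume "\<not> (Z = {\<zero>[M]} \<or> Z = V)"
      then have p: "{\<zero>[M]} \<subset> Z" "Z \<subset> V" using Z by blast+
      from enat_chain4[OF il_pos[OF sub_0 Z(1) p(1)] il_strict[OF sub_0 Z(1) V(1) Z(2) p(2)] V(3) Slt] le show False by blast
    qed
  qed
  have comm: "Y <+>[M] X = X <+>[M] Y" by (rule sum_comm[OF Y(1) X(1)])
  show thesis
    by (rule that[OF simple[OF X(1) ch(1,2)] simple[OF Y(1) ch'(1) ch'(2)[unfolded comm]] X(2) Y(2) int SeN enat_chain3[OF ch(1,2) Slt]])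
qed

lemma jmul_sum_simple:
  assumes X: "covers A M {\<zero>[M]} X" and Y: "covers A M {\<zero>[M]} Y" and s: "X <+>[M] Y = N"
  shows "jmul A M N = {\<zero>[M]}"
proof -
  have XY: "submodule X A M" "submodule Y A M" using X Y by (auto simp: covers_def)
  have "jmul A M N \<subseteq> {\<zero>[M]}"
  proof (rule jmul_least[OF sub_0])
    fix j n assume j: "j \<in> jac A" and n: "n \<in> N"
    obtain a b where ab: "a \<in> X" "b \<in> Y" "n = a \<oplus>[M] b" using n unfolding s[symmetric] mem_set_add by blast
    have "j \<odot>[M] a = \<zero>[M]" "j \<odot>[M] b = \<zero>[M]" using J_covers[OF X ab(1) j] J_covers[OF Y ab(2) j] by simp_all
    then show "j \<odot>[M] n \<in> {\<zero>[M]}"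
      using smult_r_distr[OF J_carrier[OF j] sub_mem[OF XY(1) ab(1)] sub_mem[OF XY(2) ab(2)]] ab(3) by simp
  qed
  moreover have "submodule N A M" unfolding s[symmetric] by (rule sub_sum[OF XY])
  ultimately show ?thesis using sub_zero[OF sub_jmul'] by blast
qed

end

section \<open>Projective modules\<close>

text \<open>A homomorphism on A e is determined by the image of e. To lift it, choose a preimage x
  of that image and replace it by e x, which is fixed by e.\<close>

lemma (in fl_ring) pim_projective:
  assumes e: "prim A e" shows "projective_in_mod A (pim A e)"
  unfolding projective_in_mod_def
proof (intro conjI allI ballI impI)
  interpret P: fl_module A "pim A e" by (rule fl_module_pim[OF e])
  note e' = primD[OF e]
  show "in_mod A (pim A e)" using P.left_module_axioms P.fin_M by (simp only: in_mod_iff simp_thms)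
  fix X Y :: "'a fg_module" and p g
  assume XY: "in_mod A X \<and> in_mod A Y" and p: "p \<in> module_homs A X Y" and g: "g \<in> module_homs A (pim A e) Y" and s: "p ` carrier X = carrier Y"
  have X: "left_module A X" and Y: "left_module A Y" using XY by (simp_all add: in_mod_iff)
  interpret p: lhom A X Y p by (rule left_module.hom_lhom[OF X Y p])
  interpret g: lhom A "pim A e" Y g by (rule left_module.hom_lhom[OF P.left_module_axioms Y g])
  have eP: "e \<in> carrier (pim A e)" using e' by (simp add: cyc_idem)
  have "g e \<in> p ` carrier X" using s g.closed[OF eP] by simp
  then obtain x where x: "x \<in> carrier X" "p x = g e" by auto
  let ?x = "e \<odot>[X] x"
  have xX: "?x \<in> carrier X" by (rule p.dom.smult_closed[OF e'(1) x(1)])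
  have ex: "e \<odot>[X] ?x = ?x" using p.dom.smult_assoc[OF e'(1) e'(1) x(1)] e'(3) by simp
  interpret h: lhom A "pim A e" X "\<lambda>a. a \<odot>[X] ?x" by (rule p.dom.cyc_pim_hom(1)[OF e xX ex])
  show "\<exists>h\<in>module_homs A (pim A e) X. \<forall>a\<in>carrier (pim A e). p (h a) = g a"
  proof (rule bexI[OF _ h.hom], rule ballI)
    fix a assume "a \<in> carrier (pim A e)"
    then have a: "a \<in> carrier A" "a \<otimes> e = a" using e' by (simp_all add: cyc_idem)
    have "a \<odot>[X] ?x = a \<odot>[X] x" using p.dom.smult_assoc[OF a(1) e'(1) x(1)] a(2) by simp
    moreover have "p (a \<odot>[X] x) = a \<odot>[Y] g e" using p.smult[OF a(1) x(1)] x(2) by simp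
    moreover have "g a = a \<odot>[Y] g e" using g.smult[OF a(1) eP] a(2) by simp
    ultimately show "p (a \<odot>[X] ?x) = g a" by simp
  qed
qed

text \<open>P and A e both map onto P/C, where C is a complement of A x modulo JP. Lifting the
  projection of P along the map from A e gives a homomorphism from P to A e, which is onto because x
  does not go into J e. A preimage p = e p of e splits it, and indecomposability leaves P = A p,
  with A e mapping faithfully.\<close>

lemma (in fl_ring) projective_indecomposable:
  fixes P :: "'a fg_module"
  assumes P: "projective_in_mod A P" "indecomposable A P"
  obtains e x where "prim A e" "x \<in> carrier P" "e \<odot>[P] x = x" "x \<noteq> \<zero>[P]" "cyc A P x = carrier P"
    "\<forall>a\<in>carrier A. a \<otimes> e = a \<longrightarrow> a \<odot>[P] x = \<zero>[P] \<longrightarrow> a = \<zero>"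
proof -
  have mP: "left_module A P" "mlen A P < \<infinity>" using P(1) unfolding projective_in_mod_def by (simp_all add: in_mod_iff)
  interpret P: left_module A P by fact
  interpret P: fl_module A P by (rule fl_moduleI[OF mP])
  let ?J = "jmul A P (carrier P)"
  have ne: "carrier P \<noteq> {\<zero>[P]}" using P(2) by (simp add: indecomposable_alt)
  have Jp: "?J \<subset> carrier P" by (rule P.jmul_proper[OF P.sub_carrier mP(2) ne])
  have J: "submodule ?J A P" by (rule P.sub_jmul'[OF P.sub_carrier])
  obtain y where y: "y \<in> carrier P" "y \<notin> ?J" using Jp by blast
  obtain e where e: "prim A e" "e \<odot>[P] y \<notin> ?J" using P.exists_prim_sub[OF J y] by blast
  note e' = primD[OF e(1)]
  define x where "x = e \<odot>[P] y"
  have x: "x \<in> carrier P" unfolding x_def by (rule P.smult_closed[OF e'(1) y(1)])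
  have ex: "e \<odot>[P] x = x" unfolding x_def using P.smult_assoc[OF e'(1) e'(1) y(1)] e'(3) by simp
  have xJ: "x \<notin> ?J" using e(2) unfolding x_def .
  obtain C where C: "submodule C A P" "?J \<subseteq> C" "x \<notin> C" "C <+>[P] cyc A P x = carrier P" using P.exists_complement[OF x xJ] by blast
  let ?Q = "quotient_module P C"
  interpret q: lhom A P ?Q "\<lambda>m. C +>[P] m" by (rule P.lhom_quotient[OF C(1)])
  have kq: "C +>[P] m = \<zero>[?Q] \<longleftrightarrow> m \<in> C" if "m \<in> carrier P" for m
    using P.ker_quotient[OF C(1)] q.ker_iff[of m] that by simp
  have sq: "(\<lambda>m. C +>[P] m) ` carrier P = carrier ?Q" using P.quotient(3)[OF C(1)] by simp
  have finQ: "mlen A ?Q < \<infinity>" by (rule le_less_trans[OF _ mP(2)]) (use q.il_image_le[OF P.sub_carrier] sq in simp)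
  interpret S: fl_module A "pim A e" by (rule fl_module_pim[OF e(1)])
  have Pe: "a \<in> carrier (pim A e) \<longleftrightarrow> a \<in> carrier A \<and> a \<otimes> e = a" for a using e' by (simp add: cyc_idem)
  interpret c: lhom A "pim A e" P "\<lambda>a. a \<odot>[P] x" by (rule P.cyc_pim_hom(1)[OF e(1) x ex])
  have ci: "(\<lambda>a. a \<odot>[P] x) ` carrier (pim A e) = cyc A P x" by (rule P.cyc_pim_hom(2)[OF e(1) x ex])
  \<comment> \<open>Copies on \<open>nat \<Rightarrow> 'a\<close> are taken because the lifting
    property of P is stated for modules of that type.\<close>
  obtain X :: "'a fg_module" and i where i: "liso A (pim A e) X i" using S.fg_copy[OF S.fin_M] by blast
  obtain Y :: "'a fg_module" and t where t: "liso A ?Q Y t" using q.cod.fg_copy[OF finQ] by blast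
  interpret i: liso A "pim A e" X i by (rule i)
  interpret t: liso A ?Q Y t by (rule t)
  let ?k = "inv_into (carrier (pim A e)) i"
  interpret k: liso A X "pim A e" ?k by (rule i.liso_inv)
  have surj: "(\<lambda>u. t (C +>[P] (?k u \<odot>[P] x))) ` carrier X = carrier Y"
  proof -
    have "carrier ?Q \<subseteq> (\<lambda>a. C +>[P] (a \<odot>[P] x)) ` carrier (pim A e)"
    proof
      fix Z assume "Z \<in> carrier ?Q"
      then obtain m where m: "m \<in> carrier P" "Z = C +>[P] m" using sq by blast
      have "m \<in> C <+>[P] cyc A P x" using m(1) C(4) by simp
      then obtain d u where du: "d \<in> C" "u \<in> cyc A P x" "m = d \<oplus>[P] u" unfolding P.mem_set_add by blast
      obtain a where a: "a \<in> carrier (pim A e)" "u = a \<odot>[P] x" using du(2) ci by blast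
      have dP: "d \<in> carrier P" and uP: "u \<in> carrier P" using P.sub_mem[OF C(1) du(1)] c.closed[OF a(1)] a(2) by simp_all
      have "m \<ominus>[P] u \<in> C" using du P.minus_add_cancel(3)[OF dP uP] by simp
      then have "Z = C +>[P] (a \<odot>[P] x)" using P.coset_eq[OF C(1) m(1) uP] m(2) a(2) by simp
      then show "Z \<in> (\<lambda>a. C +>[P] (a \<odot>[P] x)) ` carrier (pim A e)" using a(1) by blast
    qed
    moreover have "(\<lambda>a. C +>[P] (a \<odot>[P] x)) ` carrier (pim A e) \<subseteq> carrier ?Q" using q.closed c.closed by blast
    ultimately have eq: "(\<lambda>a. C +>[P] (a \<odot>[P] x)) ` carrier (pim A e) = carrier ?Q" by blast
    have "(\<lambda>u. t (C +>[P] (?k u \<odot>[P] x))) ` carrier X = t ` ((\<lambda>a. C +>[P] (a \<odot>[P] x)) ` (?k ` carrier X))"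
      by (simp only: image_image)
    then show ?thesis using k.surj eq t.surj by simp
  qed
  have eh: "(\<lambda>u. t (C +>[P] (?k u \<odot>[P] x))) \<in> module_homs A X Y"
    by (rule comp_hom[OF comp_hom[OF comp_hom[OF k.hom c.hom] q.hom] t.hom])
  have gh: "(\<lambda>m. t (C +>[P] m)) \<in> module_homs A P Y" by (rule comp_hom[OF q.hom t.hom])
  have inX: "in_mod A X" "in_mod A Y"
    using i.cod.left_module_axioms i.mlen_eq S.fin_M t.cod.left_module_axioms t.mlen_eq finQ by (simp_all only: in_mod_iff simp_thms)
  have "\<exists>h\<in>module_homs A P X. \<forall>m\<in>carrier P. t (C +>[P] (?k (h m) \<odot>[P] x)) = t (C +>[P] m)"
    by (rule P(1)[unfolded projective_in_mod_def, THEN conjunct2, rule_format, OF conjI[OF inX] eh gh surj])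
  then obtain h where h: "h \<in> module_homs A P X" "\<forall>m\<in>carrier P. t (C +>[P] (?k (h m) \<odot>[P] x)) = t (C +>[P] m)"
    by (rule bexE)
  interpret h: lhom A P X h by (rule P.hom_lhom[OF i.cod.left_module_axioms h(1)])
  interpret hk: lhom A P "pim A e" "\<lambda>m. ?k (h m)" by (rule P.hom_lhom[OF S.left_module_axioms comp_hom[OF h.hom k.hom]])
  let ?a = "?k (h x)"
  have aP: "?a \<in> carrier (pim A e)" by (rule hk.closed[OF x])
  \<comment> \<open>If ?a were in J, then ?a x would lie in JP and so in C. But the lifting equation
    makes ?a x congruent to x modulo C, and x is not in C.\<close>
  have anJ: "?a \<notin> jmul A (pim A e) (carrier (pim A e))"
  proof
    assume "?a \<in> jmul A (pim A e) (carrier (pim A e))"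
    then have aJ: "?a \<in> jac A" using jmul_pim(2)[OF e(1), of ?a] by simp
    have "?a \<odot>[P] x \<in> C" by (rule subsetD[OF C(2) jmul.elem[where M = P, OF aJ x]])
    then have "C +>[P] (?a \<odot>[P] x) = \<zero>[?Q]" using kq[OF c.closed[OF aP]] by simp
    then have "t (C +>[P] (?a \<odot>[P] x)) = \<zero>[Y]" using t.zero by simp
    then have "t (C +>[P] x) = \<zero>[Y]" using bspec[OF h(2) x] by simp
    then have "C +>[P] x \<in> t.ker" using q.closed[OF x] by (simp add: t.ker_iff)
    then have "C +>[P] x = \<zero>[?Q]" using t.ker_0 by blast
    then show False using kq[OF x] C(3) by simp
  qed
  have him: "(\<lambda>m. ?k (h m)) ` carrier P = carrier (pim A e)"
  proof (rule ccontr)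
    assume "(\<lambda>m. ?k (h m)) ` carrier P \<noteq> carrier (pim A e)"
    then have "(\<lambda>m. ?k (h m)) ` carrier P \<subseteq> jmul A (pim A e) (carrier (pim A e))"
      by (rule pim_local[OF e(1) hk.sub_image[OF P.sub_carrier]])
    then show False using anJ x by blast
  qed
  have eP: "e \<in> carrier (pim A e)" unfolding Pe using e' by blast
  then have "e \<in> (\<lambda>m. ?k (h m)) ` carrier P" using him by simp
  then obtain p0 where p0: "p0 \<in> carrier P" "e = ?k (h p0)" by auto
  define p where "p = e \<odot>[P] p0"
  have pP: "p \<in> carrier P" unfolding p_def by (rule P.smult_closed[OF e'(1) p0(1)])
  have ep: "e \<odot>[P] p = p" unfolding p_def using P.smult_assoc[OF e'(1) e'(1) p0(1)] e'(3) by simp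
  have hp: "?k (h p) = e" unfolding p_def using hk.smult[OF e'(1) p0(1)] p0(2) e'(3) by simp
  have hap: "?k (h (a \<odot>[P] p)) = a" if "a \<in> carrier A" "a \<otimes> e = a" for a using hk.smult[OF that(1) pP] hp that(2) by simp
  have faith: "\<forall>a\<in>carrier A. a \<otimes> e = a \<longrightarrow> a \<odot>[P] p = \<zero>[P] \<longrightarrow> a = \<zero>"
  proof (intro ballI impI)
    fix a assume a: "a \<in> carrier A" "a \<otimes> e = a" "a \<odot>[P] p = \<zero>[P]"
    show "a = \<zero>" using hap[OF a(1,2)] a(3) hk.zero by simp
  qed
  have pn: "p \<noteq> \<zero>[P]" using hp hk.zero e'(2) by auto
  have cp: "submodule (cyc A P p) A P" by (rule P.sub_cyc[OF pP])
  have cpi: "(\<lambda>a. a \<odot>[P] p) ` carrier (pim A e) = cyc A P p" by (rule P.cyc_pim_hom(2)[OF e(1) pP ep])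
  have int: "cyc A P p \<inter> hk.ker = {\<zero>[P]}"
  proof -
    have "u = \<zero>[P]" if u: "u \<in> cyc A P p" "u \<in> hk.ker" for u
    proof -
      obtain a where a: "a \<in> carrier (pim A e)" "u = a \<odot>[P] p" using u(1) cpi by blast
      have a': "a \<in> carrier A" "a \<otimes> e = a" using a(1) unfolding Pe by blast+
      have "a = \<zero>" using hap[OF a'] hk.ker_iff[THEN iffD1, OF u(2)] a(2) by simp
      then show ?thesis using a(2) P.smult_l_null[OF pP] by simp
    qed
    then show ?thesis using P.sub_zero[OF cp] P.sub_zero[OF hk.sub_ker] by blast
  qed
  have sum: "cyc A P p <+>[P] hk.ker = carrier P"
  proof
    show "cyc A P p <+>[P] hk.ker \<subseteq> carrier P" by (rule P.sub_subset[OF P.sub_sum[OF cp hk.sub_ker]])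
    show "carrier P \<subseteq> cyc A P p <+>[P] hk.ker"
    proof
      fix m assume m: "m \<in> carrier P"
      let ?b = "?k (h m)"
      have b: "?b \<in> carrier A" "?b \<otimes> e = ?b" using hk.closed[OF m] unfolding Pe by blast+
      let ?u = "?b \<odot>[P] p"
      have uP: "?u \<in> carrier P" by (rule P.smult_closed[OF b(1) pP])
      have "?k (h (m \<ominus>[P] ?u)) = \<zero>[pim A e]"
        using hk.minus[OF m uP] hap[OF b] S.minus_eq_0[OF hk.closed[OF m] hk.closed[OF m]] by simp
      then have mk: "m \<ominus>[P] ?u \<in> hk.ker" by (rule hk.ker_iff[THEN iffD2, OF conjI[OF P.M.minus_closed[OF m uP]]])
      show "m \<in> cyc A P p <+>[P] hk.ker"
        unfolding P.mem_set_add by (rule bexI[OF bexI[OF _ mk] P.cyc_mem[OF b(1)]]) (rule P.minus_add_cancel(2)[OF m uP, symmetric])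
    qed
  qed
  have "cyc A P p = {\<zero>[P]} \<or> hk.ker = {\<zero>[P]}" by (rule indecomposableD[OF P(2) cp hk.sub_ker sum int])
  then have "hk.ker = {\<zero>[P]}" using P.cyc_self[OF pP] pn by blast
  then have "cyc A P p <+>[P] hk.ker \<subseteq> cyc A P p" using P.sub_zero[OF cp] by (intro P.sum_least[OF cp]) simp_all
  then have full: "cyc A P p = carrier P" using sum P.sub_subset[OF cp] by blast
  show thesis by (rule that[OF e(1) pP ep pn full faith])
qed

section \<open>The representation bound\<close>

context fl_ring begin

text \<open>Modules on arbitrary element types are covered through \<open>fg_copy\<close>; this is
  what lets the bound be applied to A e, to quotients and to duals.\<close>

lemma representation_bound_upper:
  assumes M: "left_module A M" "mlen A M < \<infinity>" "indecomposable A M"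
  shows "mlen A M \<le> representation_bound A"
proof -
  interpret M: left_module A M by fact
  obtain N :: "'a fg_module" and f where "liso A M N f" using M.fg_copy[OF M(2)] by blast
  then interpret f: liso A M N f .
  have fin: "finite_length A N" using M(2) f.mlen_eq by (simp only: f.cod.finite_length_iff)
  have "enat (composition_length A N) \<le> representation_bound A"
    unfolding representation_bound_def
    by (rule SUP_upper) (use fin f.cod.left_module_axioms f.indecomposable_transfer[OF M(3)] in simp)
  then show ?thesis by (simp only: f.cod.composition_length_eq[OF fin] f.mlen_eq)
qed

lemma representation_bound_least:
  assumes "\<And>M :: 'a fg_module. left_module A M \<Longrightarrow> mlen A M < \<infinity> \<Longrightarrow> indecomposable A M \<Longrightarrow> mlen A M \<le> n"
  shows "representation_bound A \<le> n"
  unfolding representation_bound_def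
proof (rule SUP_least)
  fix M :: "'a fg_module" assume M: "M \<in> {M. left_module A M \<and> indecomposable A M \<and> finite_length A M}"
  then interpret M: left_module A M by simp
  have fin: "finite_length A M" using M by simp
  have "mlen A M \<le> n" by (rule assms) (use M in \<open>simp_all only: M.finite_length_iff[symmetric] mem_Collect_eq simp_thms\<close>)
  then show "enat (composition_length A M) \<le> n" by (simp only: M.composition_length_eq[OF fin])
qed

section \<open>Vanishing of the square and the cube of the radical\<close>

lemma radical_squared_zero_iff:
  "radical_squared_zero A \<longleftrightarrow> (\<forall>i\<in>jac A. \<forall>j\<in>jac A. i \<otimes> j = \<zero>)"
proof
  assume z: "radical_squared_zero A"
  show "\<forall>i\<in>jac A. \<forall>j\<in>jac A. i \<otimes> j = \<zero>"
    using ideal_prod.prod[of _ "jac A" _ "jac A" A] z unfolding radical_squared_zero_def by auto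
next
  interpret L: left_module A "regular_module A" by (rule left_module_regular)
  assume z: "\<forall>i\<in>jac A. \<forall>j\<in>jac A. i \<otimes> j = \<zero>"
  have "s = \<zero>" if "s \<in> ideal_prod A (jac A) (jac A)" for s
    using that by induct (use z in auto)
  moreover have "\<zero> \<in> ideal_prod A (jac A) (jac A)"
    using ideal_prod.prod[where R = A, OF L.J_zero L.J_zero] by simp
  ultimately show "radical_squared_zero A" unfolding radical_squared_zero_def by blast
qed

lemma radical_cubed_zero_iff:
  "radical_cubed_zero A \<longleftrightarrow> (\<forall>i\<in>jac A. \<forall>j\<in>jac A. \<forall>k\<in>jac A. i \<otimes> (j \<otimes> k) = \<zero>)"
proof
  assume z: "radical_cubed_zero A"
  show "\<forall>i\<in>jac A. \<forall>j\<in>jac A. \<forall>k\<in>jac A. i \<otimes> (j \<otimes> k) = \<zero>"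
  proof (intro ballI)
    fix i j k assume i: "i \<in> jac A" and j: "j \<in> jac A" and k: "k \<in> jac A"
    have "(i \<otimes> j) \<otimes> k = \<zero>"
      using ideal_prod.prod[OF ideal_prod.prod[OF i j] k] z unfolding radical_cubed_zero_def by auto
    then show "i \<otimes> (j \<otimes> k) = \<zero>" by (simp only: m_assoc[OF J_carrier[OF i] J_carrier[OF j] J_carrier[OF k]])
  qed
next
  interpret L: left_module A "regular_module A" by (rule left_module_regular)
  let ?J = "jac A"
  assume z: "\<forall>i\<in>?J. \<forall>j\<in>?J. \<forall>k\<in>?J. i \<otimes> (j \<otimes> k) = \<zero>"
  have s: "s \<in> carrier A \<and> s \<otimes> k = \<zero>" if "s \<in> ideal_prod A ?J ?J" and k: "k \<in> ?J" for s k
    using that(1)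
  proof induct
    case (prod i j) then show ?case using z k m_assoc[OF J_carrier[OF prod(1)] J_carrier[OF prod(2)] J_carrier[OF k]] m_closed[OF J_carrier[OF prod(1)] J_carrier[OF prod(2)]] by simp
  next
    case (sum s t) then show ?case using J_carrier[OF k] by (simp add: l_distr)
  qed
  have "t = \<zero>" if "t \<in> ideal_prod A (ideal_prod A ?J ?J) ?J" for t
    using that by induct (use s in auto)
  moreover have "\<zero> \<in> ideal_prod A (ideal_prod A ?J ?J) ?J"
    using ideal_prod.prod[where R = A, OF ideal_prod.prod[where R = A, OF L.J_zero L.J_zero] L.J_zero] by simp
  ultimately show "radical_cubed_zero A" unfolding radical_cubed_zero_def by blast
qed

text \<open>1 is a sum of primitive idempotents, so i j e is nonzero for one of them. Then A e, J e
  and J^2 e are nonzero and strictly decreasing.\<close>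

lemma exists_pim_tall:
  assumes i: "i \<in> jac A" and j: "j \<in> jac A" and ne: "i \<otimes> j \<noteq> \<zero>"
  obtains e where "prim A e" "3 \<le> mlen A (pim A e)"
proof -
  note ic = J_carrier[OF i] and jc = J_carrier[OF j]
  let ?H = "{a \<in> carrier A. i \<otimes> (j \<otimes> a) = \<zero>}"
  have "\<exists>e. prim A e \<and> i \<otimes> (j \<otimes> e) \<noteq> \<zero>"
  proof (rule ccontr)
    assume n: "\<nexists>e. prim A e \<and> i \<otimes> (j \<otimes> e) \<noteq> \<zero>"
    have "\<one> \<in> ?H" by (rule prim_induct[OF fin_l]) (use n ic jc primD(1)[of A] in \<open>auto simp: r_distr\<close>)
    then show False using ne ic jc by simp
  qed
  then obtain e where e: "prim A e" "i \<otimes> (j \<otimes> e) \<noteq> \<zero>" by blast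
  note e' = primD[OF e(1)]
  interpret P: fl_module A "pim A e" by (rule fl_module_pim[OF e(1)])
  let ?c = "carrier (pim A e)" let ?L1 = "jmul A (pim A e) ?c" let ?L2 = "jmul A (pim A e) ?L1"
  have L: "submodule ?c A (pim A e)" by (rule P.sub_carrier)
  have L1: "submodule ?L1 A (pim A e)" by (rule P.sub_jmul'[OF L])
  have L2: "submodule ?L2 A (pim A e)" by (rule P.sub_jmul'[OF L1])
  have eP: "e \<in> ?c" using e' by (simp add: cyc_idem)
  have "i \<odot>[pim A e] (j \<odot>[pim A e] e) \<in> ?L2" by (intro jmul.elem[where M = "pim A e"] i j eP)
  then have n2: "?L2 \<noteq> {\<zero>[pim A e]}" using e(2) by auto
  have n1: "?L1 \<noteq> {\<zero>[pim A e]}" using n2 P.jmul_0 by metis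
  have n0: "?c \<noteq> {\<zero>[pim A e]}" using n1 P.jmul_0 by metis
  have p1: "?L1 \<subset> ?c" by (rule P.jmul_proper[OF L P.fin_M n0])
  have p2: "?L2 \<subset> ?L1" by (rule P.jmul_proper[OF L1 P.fin_M n1])
  have z: "{\<zero>[pim A e]} \<subseteq> Z" if "submodule Z A (pim A e)" for Z using P.sub_zero[OF that] by simp
  have s3: "1 \<le> il A (pim A e) {\<zero>[pim A e]} ?L2" by (rule P.il_pos[OF P.sub_0 L2]) (use z[OF L2] n2 in blast)
  have "3 \<le> mlen A (pim A e)"
    by (rule enat_chain3[OF s3 P.il_strict[OF P.sub_0 L2 L1 z[OF L2] p2] P.il_strict[OF P.sub_0 L1 L z[OF L1] p1]])
  then show thesis by (rule that[OF e(1)])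
qed

text \<open>Each A e is indecomposable of length at most 3, so J^3 e = 0; additivity over primitive
  idempotents carries this to J^3.\<close>

lemma radical_cubed_zero_of_bound:
  assumes "representation_bound A \<le> 3" shows "radical_cubed_zero A"
  unfolding radical_cubed_zero_iff
proof (intro ballI)
  fix i j k assume i: "i \<in> jac A" and j: "j \<in> jac A" and k: "k \<in> jac A"
  note c = J_carrier[OF i] J_carrier[OF j] J_carrier[OF k]
  let ?H = "{a \<in> carrier A. i \<otimes> (j \<otimes> (k \<otimes> a)) = \<zero>}"
  have "\<one> \<in> ?H"
  proof (rule prim_induct[OF fin_l])
    show "\<zero> \<in> ?H" using c by simp
    show "a \<oplus> b \<in> ?H" if "a \<in> ?H" "b \<in> ?H" for a b using that c by (simp add: r_distr)
    fix e assume e: "prim A e"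
    note e' = primD[OF e]
    interpret P: fl_module A "pim A e" by (rule fl_module_pim[OF e])
    have le: "mlen A (pim A e) \<le> enat 3"
      using order_trans[OF representation_bound_upper[OF P.left_module_axioms P.fin_M prim_indecomposable[OF e]] assms] by (simp only: numeral_eq_enat)
    have "jpow A (pim A e) 3 (carrier (pim A e)) = {\<zero>[pim A e]}" by (rule P.jpow_zero_of_length[OF P.fin_M P.sub_carrier le])
    then have z: "jmul A (pim A e) (jmul A (pim A e) (jmul A (pim A e) (carrier (pim A e)))) = {\<zero>[pim A e]}"
      by (simp only: numeral_3_eq_3 P.jpow_Suc P.jpow_0)
    have eP: "e \<in> carrier (pim A e)" using e' by (simp add: cyc_idem)
    have "i \<odot>[pim A e] (j \<odot>[pim A e] (k \<odot>[pim A e] e)) \<in> jmul A (pim A e) (jmul A (pim A e) (jmul A (pim A e) (carrier (pim A e))))"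
      by (intro jmul.elem[where M = "pim A e"] i j k eP)
    then have "i \<odot>[pim A e] (j \<odot>[pim A e] (k \<odot>[pim A e] e)) = \<zero>[pim A e]" unfolding z by simp
    then show "e \<in> ?H" using e'(1) by simp
  qed
  then show "i \<otimes> (j \<otimes> k) = \<zero>" using c by simp
qed

end

section \<open>Injective envelopes of simple modules\<close>

lemma (in liso) smallest_transfer:
  assumes S: "submodule S A M" "S \<noteq> {\<zero>[M]}" "\<forall>F. submodule F A M \<longrightarrow> F \<noteq> {\<zero>[M]} \<longrightarrow> S \<subseteq> F"
  shows "submodule (f ` S) A N" "f ` S \<noteq> {\<zero>[N]}" "\<And>F. submodule F A N \<Longrightarrow> F \<noteq> {\<zero>[N]} \<Longrightarrow> f ` S \<subseteq> F"
proof -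
  show "submodule (f ` S) A N" by (rule sub_image[OF S(1)])
  show "f ` S \<noteq> {\<zero>[N]}"
  proof
    assume z: "f ` S = {\<zero>[N]}"
    have "S \<subseteq> ker"
    proof
      fix s assume s: "s \<in> S"
      then have "f s \<in> {\<zero>[N]}" using z by blast
      then show "s \<in> ker" using dom.sub_mem[OF S(1) s] by (simp add: ker_iff)
    qed
    then show False using S(2) dom.sub_zero[OF S(1)] ker_0 by blast
  qed
  fix F assume F: "submodule F A N" "F \<noteq> {\<zero>[N]}"
  have fp: "f ` pre F = F" by (rule image_pre) (simp only: surj cod.sub_subset[OF F(1)])
  have "pre F \<noteq> {\<zero>[M]}" using fp F(2) image_0 by metis
  then have "S \<subseteq> pre F" using S(3) sub_pre[OF F(1)] by blast
  then show "f ` S \<subseteq> F" using fp by blast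
qed

context artin_dual begin

lemma simple_into_env:
  assumes S: "left_module A S" "covers A S {\<zero>[S]} (carrier S)" and f: "prim A f" and s: "s \<in> carrier S" "f \<odot>[S] s = s" "s \<noteq> \<zero>[S]"
  obtains h where "lhom A S (env f) h" "inj_on h (carrier S)" "h s \<noteq> \<zero>[env f]"
proof -
  interpret S: left_module A S by fact
  have fin: "mlen A S < \<infinity>" using S.il_covers[OF S(2)] by (simp add: one_enat_def)
  obtain h where h: "h \<in> module_homs A S (env f)" "h s \<noteq> \<zero>[env f]" using env_hom[OF f S(1) fin s] by blast
  interpret h: lhom A S "env f" h by (rule S.hom_lhom[OF env_facts(1)[OF f] h(1)])
  show thesis by (rule that[OF h.lhom_axioms h.simple_inj[OF S(2) s(1) h(2)] h(2)])
qed

text \<open>As I is injective, the embedding of S into I extends along the embedding of S into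
  \<open>env g\<close>. The extension is injective: a nonzero kernel would contain the smallest
  nonzero submodule of \<open>env g\<close>, which lies in the image of S. So \<open>env g\<close>
  inherits uniseriality from I.\<close>

lemma env_uniserial:
  fixes S :: "'a fg_module"
  assumes S: "left_module A S" "covers A S {\<zero>[S]} (carrier S)" and g: "prim A g" and s: "s \<in> carrier S" "g \<odot>[S] s = s" "s \<noteq> \<zero>[S]"
    and u: "has_uniserial_envelope A S"
  shows "uniserial (opposite A) (pim (opposite A) g)"
proof -
  obtain I :: "'a fg_module" and i where I: "injective_in_mod A I" "uniserial A I" and i: "i \<in> module_homs A S I" "inj_on i (carrier S)"
    using u unfolding has_uniserial_envelope_def injective_envelope_def by blast
  have lI: "left_module A I" using I(1) unfolding injective_in_mod_def by (simp add: in_mod_iff)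
  interpret i: lhom A S I i by (rule left_module.hom_lhom[OF S(1) lI i(1)])
  obtain h where h: "lhom A S (env g) h" "inj_on h (carrier S)" "h s \<noteq> \<zero>[env g]" by (rule simple_into_env[OF S g s])
  interpret h: lhom A S "env g" h by (rule h(1))
  obtain Y :: "'a fg_module" and p where "liso A (env g) Y p" using h.cod.fg_copy[OF env_facts(3)[OF g]] by blast
  then interpret p: liso A "env g" Y p .
  have fin: "mlen A S < \<infinity>" using i.dom.il_covers[OF S(2)] by (simp add: one_enat_def)
  have in1: "in_mod A S" using S(1) fin by (simp only: in_mod_iff simp_thms)
  have in2: "in_mod A Y" using p.cod.left_module_axioms p.mlen_eq env_facts(3)[OF g] by (simp only: in_mod_iff simp_thms)
  have inj: "inj_on (\<lambda>x. p (h x)) (carrier S)"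
    using inj_onD[OF h(2)] inj_onD[OF p.inj] h.closed by (intro inj_onI) simp
  have "\<exists>k\<in>module_homs A Y I. \<forall>x\<in>carrier S. k (p (h x)) = i x"
    by (rule I(1)[unfolded injective_in_mod_def, THEN conjunct2, rule_format, OF conjI[OF in1 in2] comp_hom[OF h.hom p.hom] i(1) inj])
  then obtain k where k: "k \<in> module_homs A Y I" "\<forall>x\<in>carrier S. k (p (h x)) = i x" by (rule bexE)
  interpret k: lhom A Y I k by (rule left_module.hom_lhom[OF p.cod.left_module_axioms lI k(1)])
  interpret kp: lhom A "env g" I "\<lambda>y. k (p y)" by (rule left_module.hom_lhom[OF h.cod.left_module_axioms lI comp_hom[OF p.hom k.hom]])
  obtain T where T: "submodule T A (env g)" "T \<noteq> {\<zero>[env g]}" "\<forall>F. submodule F A (env g) \<longrightarrow> F \<noteq> {\<zero>[env g]} \<longrightarrow> T \<subseteq> F"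
    using env_smallest[OF g] by blast
  have "kp.ker = {\<zero>[env g]}"
  proof (rule ccontr)
    assume "kp.ker \<noteq> {\<zero>[env g]}"
    then have Tk: "T \<subseteq> kp.ker" using T(3) kp.sub_ker by blast
    have "h ` carrier S \<noteq> {\<zero>[env g]}" using h(3) s(1) by blast
    then have Th: "T \<subseteq> h ` carrier S" using T(3) h.sub_image[OF i.dom.sub_carrier] by blast
    obtain t where t: "t \<in> T" "t \<noteq> \<zero>[env g]" using T(2) h.cod.sub_zero[OF T(1)] by blast
    obtain y where y: "y \<in> carrier S" "t = h y" using Th t(1) by blast
    have "i y = \<zero>[I]" using Tk t(1) y k(2) by (auto simp: kp.ker_iff)
    then have "y = \<zero>[S]" using inj_onD[OF i(2), of y "\<zero>[S]"] y(1) i.zero by simp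
    then show False using t(2) y(2) h.zero by simp
  qed
  then have "inj_on (\<lambda>y. k (p y)) (carrier (env g))" using kp.inj_iff by blast
  then have "uniserial A (env g)" by (rule kp.uniserial_inj[OF _ I(2)])
  then show ?thesis using env_facts(4)[OF g] by blast
qed

text \<open>\<open>env f\<close> has a smallest nonzero submodule, so the image of S is essential in
  it, like every nonzero submodule.\<close>

lemma has_uniserial_envelopeI:
  assumes S: "left_module A S" "covers A S {\<zero>[S]} (carrier S)" and f: "prim A f" and s: "s \<in> carrier S" "f \<odot>[S] s = s" "s \<noteq> \<zero>[S]"
    and u: "uniserial (opposite A) (pim (opposite A) f)"
  shows "has_uniserial_envelope A S"
proof -
  obtain h where h: "lhom A S (env f) h" "inj_on h (carrier S)" "h s \<noteq> \<zero>[env f]" by (rule simple_into_env[OF S f s])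
  interpret h: lhom A S "env f" h by (rule h(1))
  obtain Y :: "'a fg_module" and p where "liso A (env f) Y p" using h.cod.fg_copy[OF env_facts(3)[OF f]] by blast
  then interpret p: liso A "env f" Y p .
  obtain T0 where T0: "submodule T0 A (env f)" "T0 \<noteq> {\<zero>[env f]}" "\<forall>F. submodule F A (env f) \<longrightarrow> F \<noteq> {\<zero>[env f]} \<longrightarrow> T0 \<subseteq> F"
    using env_smallest[OF f] by blast
  note T = p.smallest_transfer[OF T0]
  let ?g = "\<lambda>x. p (h x)"
  interpret g: lhom A S Y ?g by (rule h.dom.hom_lhom[OF p.cod.left_module_axioms comp_hom[OF h.hom p.hom]])
  have inj: "inj_on ?g (carrier S)" using inj_onD[OF h(2)] inj_onD[OF p.inj] h.closed by (intro inj_onI) simp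
  have im: "submodule (?g ` carrier S) A Y" by (rule g.sub_image[OF h.dom.sub_carrier])
  have imn: "?g ` carrier S \<noteq> {\<zero>[Y]}"
  proof
    assume "?g ` carrier S = {\<zero>[Y]}"
    then have "?g s = \<zero>[Y]" using s(1) by blast
    then have "h s \<in> p.ker" using h.closed[OF s(1)] by (simp add: p.ker_iff)
    then show False using p.ker_0 h(3) by blast
  qed
  have ess: "L = {\<zero>[Y]}" if L: "submodule L A Y" "L \<inter> ?g ` carrier S = {\<zero>[Y]}" for L
  proof (rule ccontr)
    assume n: "L \<noteq> {\<zero>[Y]}"
    have "p ` T0 \<subseteq> {\<zero>[Y]}" using T(3)[OF L(1) n] T(3)[OF im imn] L(2) by blast
    then show False using T(2) p.cod.sub_zero[OF T(1)] by blast
  qed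
  have "injective_in_mod A Y" by (rule p.injective_transfer[OF fl_ring_axioms env_injective[OF f]])
  then have "injective_envelope A S Y"
    unfolding injective_envelope_def essential_submodule_def using g.hom inj im ess by blast
  moreover have "uniserial A Y" using p.uniserial_transfer env_facts(4)[OF f] u by blast
  ultimately show ?thesis unfolding has_uniserial_envelope_def by blast
qed

text \<open>For A e not uniserial, the radical is a sum of two simple modules, so the length is at
  most 1 + 1 + 1 and J^2 e = 0. If g j e is nonzero, write j x = a + b along the two simple modules;
  then g a or g b is nonzero, and \<open>env_uniserial\<close> turns the uniserial envelope of that
  simple module into uniseriality of g A.\<close>

lemma wedge_of_wedged_string:
  assumes ws: "wedged_string_left A" shows "wedge A"
  unfolding wedge_def
proof (intro allI impI)
  fix e assume e: "prim A e"
  note e' = primD[OF e]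
  interpret S: fl_module A "pim A e" by (rule fl_module_pim[OF e])
  show "uniserial A (pim A e) \<or> (mlen A (pim A e) \<le> 3 \<and>
     (\<forall>i\<in>jac A. \<forall>j\<in>jac A. i \<otimes>[A] (j \<otimes>[A] e) = \<zero>[A]) \<and>
     (\<forall>g. prim A g \<longrightarrow> (\<exists>j\<in>jac A. g \<otimes>[A] (j \<otimes>[A] e) \<noteq> \<zero>[A]) \<longrightarrow> uniserial (opposite A) (pim (opposite A) g)))"
  proof (rule disjCI)
    assume nn: "\<not> (mlen A (pim A e) \<le> 3 \<and>
     (\<forall>i\<in>jac A. \<forall>j\<in>jac A. i \<otimes>[A] (j \<otimes>[A] e) = \<zero>[A]) \<and>
     (\<forall>g. prim A g \<longrightarrow> (\<exists>j\<in>jac A. g \<otimes>[A] (j \<otimes>[A] e) \<noteq> \<zero>[A]) \<longrightarrow> uniserial (opposite A) (pim (opposite A) g)))"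
    show "uniserial A (pim A e)"
    proof (rule ccontr)
      assume nu: "\<not> uniserial A (pim A e)"
      obtain P :: "'a fg_module" and p where "liso A (pim A e) P p" using S.fg_copy[OF S.fin_M] by blast
      then interpret p: liso A "pim A e" P p .
      have finP: "mlen A P < \<infinity>" unfolding p.mlen_eq by (rule S.fin_M)
      interpret P: fl_module A P by (rule fl_moduleI[OF p.cod.left_module_axioms finP])
      have "projective_in_mod A P" by (rule p.projective_transfer[OF fl_ring_axioms pim_projective[OF e]])
      moreover have "indecomposable A P" by (rule p.indecomposable_transfer[OF prim_indecomposable[OF e]])
      moreover have "\<not> uniserial A P" using nu p.uniserial_reflect by blast
      ultimately obtain S1 S2 where SS: "simple_submodule A P S1" "simple_submodule A P S2" "is_direct_sum P (module_rad A P) S1 S2"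
        and env12: "has_uniserial_envelope A (sub_module P S1)" "has_uniserial_envelope A (sub_module P S2)"
        using ws unfolding wedged_string_left_def by blast
      have cov: "covers A P {\<zero>[P]} S1" "covers A P {\<zero>[P]} S2" using SS(1,2) by (simp_all only: p.cod.simple_submodule_iff)
      have sub: "submodule S1 A P" "submodule S2 A P" using cov by (auto simp: covers_def)
      define x where "x = p e"
      have eS: "e \<in> carrier (pim A e)" using e' by (simp add: cyc_idem)
      have x: "x \<in> carrier P" unfolding x_def by (rule p.closed[OF eS])
      have pa: "p a = a \<odot>[P] x" if "a \<in> carrier A" "a \<otimes>[A] e = a" for a
        unfolding x_def using p.smult[OF that(1) eS] that(2) by simp
      have ex: "e \<odot>[P] x = x" using pa[OF e'(1,3)] unfolding x_def by simp
      have faith: "a = \<zero>[A]" if a: "a \<in> carrier A" "a \<otimes>[A] e = a" "a \<odot>[P] x = \<zero>[P]" for a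
      proof -
        have aS: "a \<in> carrier (pim A e)" using a(1,2) e' by (simp add: cyc_idem)
        have "p a = \<zero>[P]" using pa[OF a(1,2)] a(3) by simp
        then have "a \<in> p.ker" by (rule p.ker_iff[THEN iffD2, OF conjI[OF aS]])
        then show ?thesis using p.ker_0 by simp
      qed
      have x0: "x \<noteq> \<zero>[P]" using faith[OF e'(1,3)] ex e'(2) by auto
      have full: "cyc A P x = carrier P"
      proof
        show "cyc A P x \<subseteq> carrier P" by (rule p.cod.sub_subset[OF p.cod.sub_cyc[OF x]])
        show "carrier P \<subseteq> cyc A P x"
        proof
          fix y assume "y \<in> carrier P"
          then have "y \<in> p ` carrier (pim A e)" using p.surj by simp
          then obtain a where a: "a \<in> carrier (pim A e)" "y = p a" by blast
          have "a \<in> carrier A" "a \<otimes>[A] e = a" using a(1) e' by (simp_all add: cyc_idem)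
          then show "y \<in> cyc A P x" using pa p.cod.cyc_mem a(2) by simp
        qed
      qed
      note loc = P.generated_local[OF e x ex x0 full]
      let ?N = "jmul A P (carrier P)"
      have sumN: "S1 <+>[P] S2 = ?N" using SS(3) loc(3) unfolding is_direct_sum_def by simp
      have N: "submodule ?N A P" by (rule p.cod.sub_jmul'[OF p.cod.sub_carrier])
      have "mlen A P = il A P {\<zero>[P]} ?N + il A P ?N (carrier P)"
        by (rule p.cod.il_add[OF p.cod.sub_0 N p.cod.sub_carrier]) (use p.cod.sub_zero[OF N] p.cod.sub_subset[OF N] in simp_all)
      then have mP: "mlen A P = il A P {\<zero>[P]} ?N + 1" using p.cod.il_covers[OF loc(1)] by simp
      have "il A P {\<zero>[P]} ?N \<le> 1 + 1"
        using p.cod.il_sum_le[OF sub] sumN p.cod.il_covers[OF cov(1)] p.cod.il_covers[OF cov(2)] by simp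
      then have "mlen A P \<le> 1 + 1 + 1" unfolding mP by (rule add_right_mono)
      then have le3: "mlen A (pim A e) \<le> 3" unfolding p.mlen_eq by simp
      have JN: "jmul A P ?N = {\<zero>[P]}" by (rule P.jmul_sum_simple[OF cov sumN])
      have J2: "i \<otimes>[A] (j \<otimes>[A] e) = \<zero>[A]" if i: "i \<in> jac A" and j: "j \<in> jac A" for i j
      proof (rule faith)
        note ic = J_carrier[OF i] and jc = J_carrier[OF j]
        show "i \<otimes>[A] (j \<otimes>[A] e) \<in> carrier A" using ic jc e'(1) by simp
        show "i \<otimes>[A] (j \<otimes>[A] e) \<otimes>[A] e = i \<otimes>[A] (j \<otimes>[A] e)" using ic jc e' by (simp add: m_assoc)
        have "(i \<otimes>[A] (j \<otimes>[A] e)) \<odot>[P] x = i \<odot>[P] (j \<odot>[P] x)"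
          using p.cod.smult_assoc[OF ic _ x] p.cod.smult_assoc[OF jc e'(1) x] ex jc e'(1) by simp
        also have "\<dots> \<in> jmul A P ?N" by (intro jmul.elem[where M = P] i j x)
        finally show "(i \<otimes>[A] (j \<otimes>[A] e)) \<odot>[P] x = \<zero>[P]" unfolding JN by simp
      qed
      have piece: "uniserial (opposite A) (pim (opposite A) g)"
        if g: "prim A g" and c: "covers A P {\<zero>[P]} V" and ev: "has_uniserial_envelope A (sub_module P V)" and s: "s \<in> V" "g \<odot>[P] s \<noteq> \<zero>[P]" for g V s
      proof -
        note g' = primD[OF g]
        have V: "submodule V A P" using c by (auto simp: covers_def)
        have sP: "s \<in> carrier P" by (rule p.cod.sub_mem[OF V s(1)])
        have gs: "g \<odot>[P] (g \<odot>[P] s) = g \<odot>[P] s" using p.cod.smult_assoc[OF g'(1) g'(1) sP] g'(3) by simp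
        have gV: "g \<odot>[P] s \<in> V" by (rule p.cod.sub_smult[OF V g'(1) s(1)])
        have c': "covers A (sub_module P V) {\<zero>[sub_module P V]} (carrier (sub_module P V))"
          using c p.cod.covers_sub[OF V order_refl] by simp
        show ?thesis
          by (rule env_uniserial[OF p.cod.left_module_sub[OF V] c' g _ _ _ ev, of "g \<odot>[P] s"]) (use gV gs s(2) in simp_all)
      qed
      have RU: "uniserial (opposite A) (pim (opposite A) g)" if g: "prim A g" and j: "j \<in> jac A" and ne: "g \<otimes>[A] (j \<otimes>[A] e) \<noteq> \<zero>[A]" for g j
      proof -
        note g' = primD[OF g] and jc = J_carrier[OF j]
        have "(g \<otimes>[A] (j \<otimes>[A] e)) \<odot>[P] x = g \<odot>[P] (j \<odot>[P] x)"
          using p.cod.smult_assoc[OF g'(1) _ x] p.cod.smult_assoc[OF jc e'(1) x] ex jc e'(1) by simp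
        moreover have "(g \<otimes>[A] (j \<otimes>[A] e)) \<odot>[P] x \<noteq> \<zero>[P]"
        proof
          assume z: "(g \<otimes>[A] (j \<otimes>[A] e)) \<odot>[P] x = \<zero>[P]"
          have "g \<otimes>[A] (j \<otimes>[A] e) = \<zero>[A]" by (rule faith[OF _ _ z]) (use g'(1) jc e' in \<open>simp_all add: m_assoc\<close>)
          then show False using ne by simp
        qed
        ultimately have gn: "g \<odot>[P] (j \<odot>[P] x) \<noteq> \<zero>[P]" by simp
        have "j \<odot>[P] x \<in> S1 <+>[P] S2" unfolding sumN by (rule jmul.elem[where M = P, OF j x])
        then obtain a b where ab: "a \<in> S1" "b \<in> S2" "j \<odot>[P] x = a \<oplus>[P] b" unfolding p.cod.mem_set_add by blast
        have "g \<odot>[P] (j \<odot>[P] x) = g \<odot>[P] a \<oplus>[P] g \<odot>[P] b"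
          unfolding ab(3) by (rule p.cod.smult_r_distr[OF g'(1) p.cod.sub_mem[OF sub(1) ab(1)] p.cod.sub_mem[OF sub(2) ab(2)]])
        then have "g \<odot>[P] a \<noteq> \<zero>[P] \<or> g \<odot>[P] b \<noteq> \<zero>[P]" using gn by auto
        then show ?thesis using piece[OF g cov(1) env12(1) ab(1)] piece[OF g cov(2) env12(2) ab(2)] by blast
      qed
      show False using nn le3 J2 RU by blast
    qed
  qed
qed

end

lemma (in left_module) simple_uniserial: "covers A M {\<zero>[M]} V \<Longrightarrow> uniserial A (sub_module M V)"
proof -
  assume c: "covers A M {\<zero>[M]} V"
  have V: "submodule V A M" using c by (simp add: covers_def)
  have V0: "N = {\<zero>[M]} \<or> N = V" if "submodule N A M" "N \<subseteq> V" for N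
    using c that sub_zero[OF that(1)] unfolding covers_def by blast
  show ?thesis
    unfolding uniserial_def sub_sub_iff[OF V]
  proof (intro allI impI)
    fix N L assume NL: "(submodule N A M \<and> N \<subseteq> V) \<and> submodule L A M \<and> L \<subseteq> V"
    have "\<zero>[M] \<in> N" "\<zero>[M] \<in> L" using NL sub_zero[of N] sub_zero[of L] by simp_all
    then show "N \<subseteq> L \<or> L \<subseteq> N" using NL V0[of N] V0[of L] by auto
  qed
qed

section \<open>From the bound three back to wedged-string and Nakayama conditions\<close>

context artin_dual begin

text \<open>Duality preserves length and indecomposability, so the bound for A also bounds the right
  modules.\<close>

lemma opposite_bound:
  assumes "left_module (opposite A) M" "mlen (opposite A) M < \<infinity>" "indecomposable (opposite A) M"
  shows "mlen (opposite A) M \<le> representation_bound A"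
proof -
  interpret O: artin_dual R "opposite A" E by (rule artin_dual_opposite)
  have l: "left_module A (dual R (opposite A) M E)" using O.left_module_dual[OF assms(1,2)] by simp
  have m: "mlen A (dual R (opposite A) M E) = mlen (opposite A) M" using O.mlen_dual[OF assms(1,2)] by simp
  have i: "indecomposable A (dual R (opposite A) M E)" using O.indecomposable_dual[OF assms] by simp
  show ?thesis using representation_bound_upper[OF l _ i] assms(2) unfolding m by blast
qed

text \<open>If f A is not uniserial, the bound for right modules makes f J a sum of two simple
  modules, so f J^2 = 0 and v A is a proper submodule of f J. An element of f J outside v A,
  multiplied by a suitable primitive g, provides the second generator w of an amalgam, whose
  quotient has length at least 4.\<close>

lemma pimO_uniserial_of_bound:
  assumes b: "representation_bound A \<le> 3" and e: "prim A e" and f: "prim A f"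
    and J2: "\<And>i j. i \<in> jac A \<Longrightarrow> j \<in> jac A \<Longrightarrow> i \<otimes>[A] (j \<otimes>[A] e) = \<zero>[A]"
    and three: "3 \<le> mlen A (pim A e)"
    and v: "v \<in> jac A" "f \<otimes>[A] v = v" "v \<otimes>[A] e = v" "v \<noteq> \<zero>[A]"
  shows "uniserial (opposite A) (pim (opposite A) f)"
proof (rule ccontr)
  assume nu: "\<not> uniserial (opposite A) (pim (opposite A) f)"
  interpret O: artin_dual R "opposite A" E by (rule artin_dual_opposite)
  note e' = primD[OF e] and f' = primD[OF f]
  have fo: "prim (opposite A) f" using f by simp
  let ?F = "pim (opposite A) f"
  interpret F: fl_module "opposite A" ?F by (rule O.fl_module_pim[OF fo])
  have le: "mlen (opposite A) ?F \<le> 3"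
    by (rule order_trans[OF opposite_bound[OF F.left_module_axioms F.fin_M O.prim_indecomposable[OF fo]] b])
  have fF: "f \<in> carrier ?F" using pimO(3)[OF f, of f] f' by simp
  have ff: "f \<odot>[?F] f = f" using f'(3) by simp
  have f0: "f \<noteq> \<zero>[?F]" using f'(2) by simp
  have cf: "cyc (opposite A) ?F f = carrier ?F" by (simp add: cyc_def)
  let ?N = "jmul (opposite A) ?F (carrier ?F)"
  obtain X Y where XY: "covers (opposite A) ?F {\<zero>[?F]} X" "covers (opposite A) ?F {\<zero>[?F]} Y" "\<not> X \<subseteq> Y" "\<not> Y \<subseteq> X"
      "X \<inter> Y = {\<zero>[?F]}" "X <+>[?F] Y = ?N" "3 \<le> mlen (opposite A) ?F"
    by (rule F.nonuniserial_local_three[OF fo fF ff f0 cf le nu])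
  have X: "submodule X (opposite A) ?F" and Y: "submodule Y (opposite A) ?F" using XY(1,2) by (auto simp: covers_def)
  have JN: "jmul (opposite A) ?F ?N = {\<zero>[?F]}" by (rule F.jmul_sum_simple[OF XY(1,2,6)])
  have N: "submodule ?N (opposite A) ?F" by (rule F.sub_jmul'[OF F.sub_carrier])
  have Nm: "y \<in> ?N \<longleftrightarrow> y \<in> jac A \<and> f \<otimes>[A] y = y" for y
    using O.jmul_pim(2)[OF fo, of y] J_opposite by (simp only: opposite_simps)
  have simple: "covers (opposite A) ?F {\<zero>[?F]} (cyc (opposite A) ?F u)"
    if u: "u \<in> ?N" "u \<otimes>[A] g = u" "u \<noteq> \<zero>[A]" and g: "prim A g" for u g
  proof -
    have uF: "u \<in> carrier ?F" by (rule F.sub_mem[OF N u(1)])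
    have "cyc (opposite A) ?F u \<subseteq> ?N" by (rule F.cyc_least[OF N u(1)])
    then have "jmul (opposite A) ?F (cyc (opposite A) ?F u) \<subseteq> {\<zero>[?F]}"
      using F.jmul_mono[OF _ F.sub_subset[OF N]] JN by blast
    then have z: "jmul (opposite A) ?F (cyc (opposite A) ?F u) = {\<zero>[?F]}"
      using F.sub_zero[OF F.sub_jmul'[OF F.sub_cyc[OF uF]]] by blast
    have go: "prim (opposite A) g" and gu: "g \<odot>[?F] u = u" and u0: "u \<noteq> \<zero>[?F]" using g u(2,3) by simp_all
    show ?thesis using F.covers_local[OF go uF gu u0] unfolding z .
  qed
  have vN: "v \<in> ?N" using v(1,2) Nm by simp
  let ?V = "cyc (opposite A) ?F v"
  have cv: "covers (opposite A) ?F {\<zero>[?F]} ?V" by (rule simple[OF vN v(3,4) e])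
  have V: "submodule ?V (opposite A) ?F" using cv by (simp add: covers_def)
  have VN: "?V \<subseteq> ?N" by (rule F.cyc_least[OF N vN])
  have XN: "X \<subseteq> ?N" "Y \<subseteq> ?N" using F.sum_upper[OF X Y] XY(6) by simp_all
  have "?V \<noteq> ?N"
  proof
    assume "?V = ?N"
    then have c: "covers (opposite A) ?F {\<zero>[?F]} ?N" using cv by simp
    have z: "{\<zero>[?F]} \<subseteq> X" "{\<zero>[?F]} \<subseteq> Y" using F.sub_zero[OF X] F.sub_zero[OF Y] by simp_all
    have "X = {\<zero>[?F]} \<or> X = ?N" using c X z(1) XN(1) unfolding covers_def by blast
    then show False using z(2) XN(2) XY(3,4) by blast
  qed
  then obtain w0 where w0: "w0 \<in> ?N" "w0 \<notin> ?V" using VN by blast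
  have w0F: "w0 \<in> carrier ?F" by (rule F.sub_mem[OF N w0(1)])
  obtain g where g: "prim (opposite A) g" "g \<odot>[?F] w0 \<notin> ?V" using F.exists_prim_sub[OF V w0F w0(2)] by blast
  have gA: "prim A g" using g(1) by simp
  note g' = primD[OF gA]
  define w where "w = w0 \<otimes>[A] g"
  have w0A: "w0 \<in> carrier A" using w0(1) Nm[of w0] J_carrier[of w0 A] by simp
  have wV: "w \<notin> ?V" using g(2) unfolding w_def by simp
  have go: "g \<in> carrier (opposite A)" using g'(1) by simp
  have wN: "w \<in> ?N" using F.sub_smult[OF N go w0(1)] unfolding w_def by simp
  have wg: "w \<otimes>[A] g = w" unfolding w_def using w0A g' by (simp add: m_assoc)
  have z0: "\<zero>[A] \<in> ?V" using F.sub_zero[OF V] by simp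
  then have wn: "w \<noteq> \<zero>[A]" using wV by blast
  let ?W = "cyc (opposite A) ?F w"
  have cw: "covers (opposite A) ?F {\<zero>[?F]} ?W" by (rule simple[OF wN wg wn gA])
  have wF: "w \<in> carrier ?F" and vF: "v \<in> carrier ?F" by (rule F.sub_mem[OF N wN], rule F.sub_mem[OF N vN])
  have W: "submodule ?W (opposite A) ?F" by (rule F.sub_cyc[OF wF])
  \<comment> \<open>Independence is a statement about two simple right modules: w is outside v A,
    and v in w A would force v A = w A by simplicity of w A.\<close>
  have indep2: "w \<noteq> v \<otimes>[A] a" if a: "a \<in> carrier A" for a
  proof
    assume eq: "w = v \<otimes>[A] a"
    have ao: "a \<in> carrier (opposite A)" using a by simp
    have "a \<odot>[?F] v \<in> ?V" by (rule F.cyc_mem[OF ao])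
    then show False using wV eq by simp
  qed
  have indep1: "v \<noteq> w \<otimes>[A] a" if a: "a \<in> carrier A" for a
  proof
    assume eq: "v = w \<otimes>[A] a"
    have ao: "a \<in> carrier (opposite A)" using a by simp
    have "a \<odot>[?F] w \<in> ?W" by (rule F.cyc_mem[OF ao])
    then have vW: "v \<in> ?W" using eq by simp
    have "?V \<subseteq> ?W" by (rule F.cyc_least[OF W vW])
    moreover have "{\<zero>[?F]} \<subseteq> ?V" using z0 by simp
    ultimately have "?V = {\<zero>[?F]} \<or> ?V = ?W" using cw V unfolding covers_def by blast
    moreover have "?V \<noteq> {\<zero>[?F]}" using cv by (auto simp: covers_def)
    ultimately show False using wV F.cyc_self[OF wF] by blast
  qed
  have fJ2: "f \<otimes>[A] (i \<otimes>[A] j) = \<zero>[A]" if i: "i \<in> jac A" and j: "j \<in> jac A" for i j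
  proof -
    have io: "i \<in> jac (opposite A)" and jo: "j \<in> jac (opposite A)" using i j J_opposite by simp_all
    have "j \<odot>[?F] (i \<odot>[?F] f) \<in> jmul (opposite A) ?F ?N" by (intro jmul.elem[where M = ?F] io jo fF)
    then have "(f \<otimes>[A] i) \<otimes>[A] j = \<zero>[A]" unfolding JN by simp
    then show ?thesis using m_assoc[OF f'(1) J_carrier[OF i] J_carrier[OF j]] by simp
  qed
  have wJ: "w \<in> jac A" "f \<otimes>[A] w = w" using wN Nm by simp_all
  interpret S: fl_module A "pim A e" by (rule fl_module_pim[OF e])
  interpret Q: amalgam A e g f v w
    by (intro amalgam.intro amalgam_axioms.intro fl_ring_axioms e gA f v(1-3) wJ wg indep1 indep2 fJ2)
  have "jmul A (pim A e) (jmul A (pim A e) (carrier (pim A e))) \<subseteq> {\<zero>[pim A e]}"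
  proof (rule S.jmul_jmul_least[OF order_refl S.sub_0])
    fix i j a assume i: "i \<in> jac A" and j: "j \<in> jac A" and "a \<in> carrier (pim A e)"
    then have a: "a \<in> carrier A" "a \<otimes>[A] e = a" using e' by (simp_all add: cyc_idem)
    have "i \<otimes>[A] ((j \<otimes>[A] a) \<otimes>[A] e) = \<zero>[A]" by (rule J2[OF i S.J_mult_r[OF j a(1)]])
    then have "i \<otimes>[A] (j \<otimes>[A] a) = \<zero>[A]" using m_assoc[OF J_carrier[OF j] a(1) e'(1)] a(2) by simp
    then show "i \<odot>[pim A e] (j \<odot>[pim A e] a) \<in> {\<zero>[pim A e]}" by simp
  qed
  then have JJ: "jmul A (pim A e) (jmul A (pim A e) (carrier (pim A e))) = {\<zero>[pim A e]}"
    using S.sub_zero[OF S.sub_jmul'[OF S.sub_jmul'[OF S.sub_carrier]]] by blast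
  have "3 \<le> il A (pim A e) (jmul A (pim A e) (jmul A (pim A e) (carrier (pim A e)))) (carrier (pim A e))"
    unfolding JJ by (rule three)
  note mQ = Q.mlen_Q[OF this]
  have "(4::enat) \<le> 3" by (rule order_trans[OF mQ(1) order_trans[OF representation_bound_upper[OF mQ(3,2) Q.Q_indecomposable] b]])
  then show False by simp
qed

text \<open>A non-uniserial P has length 3 and is generated by some x = e x on which A e acts
  faithfully, so relations in P such as J^2 x = 0 hold for e in A. A simple submodule of the radical
  contains some s = f s = v x with v in f J e, and this v is the input of
  \<open>pimO_uniserial_of_bound\<close>.\<close>

lemma wedged_string_left_of_bound:
  assumes b: "representation_bound A \<le> 3" shows "wedged_string_left A"
  unfolding wedged_string_left_def
proof (intro allI impI)
  fix P :: "'a fg_module" assume P: "projective_in_mod A P \<and> indecomposable A P"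
  show "uniserial A P \<or> astride_biserial A P \<and> (\<exists>S\<^sub>1 S\<^sub>2. simple_submodule A P S\<^sub>1 \<and> simple_submodule A P S\<^sub>2 \<and>
         is_direct_sum P (module_rad A P) S\<^sub>1 S\<^sub>2 \<and> has_uniserial_envelope A (sub_module P S\<^sub>1) \<and> has_uniserial_envelope A (sub_module P S\<^sub>2))"
  proof (cases "uniserial A P")
    case nu: False
    have mP: "left_module A P" "mlen A P < \<infinity>" using P unfolding projective_in_mod_def by (simp_all add: in_mod_iff)
    interpret P: left_module A P by fact
    interpret P: fl_module A P by (rule fl_moduleI[OF mP])
    have ind: "indecomposable A P" using P by simp
    obtain e x where e: "prim A e" and x: "x \<in> carrier P" "e \<odot>[P] x = x" "x \<noteq> \<zero>[P]" "cyc A P x = carrier P"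
      and faithful: "\<forall>a\<in>carrier A. a \<otimes>[A] e = a \<longrightarrow> a \<odot>[P] x = \<zero>[P] \<longrightarrow> a = \<zero>[A]"
      by (rule projective_indecomposable[OF conjunct1[OF P] ind])
    note e' = primD[OF e] and loc = P.generated_local[OF e x]
    have le: "mlen A P \<le> 3" by (rule order_trans[OF representation_bound_upper[OF mP ind] b])
    let ?N = "jmul A P (carrier P)"
    obtain X Y where XY: "covers A P {\<zero>[P]} X" "covers A P {\<zero>[P]} Y" "\<not> X \<subseteq> Y" "\<not> Y \<subseteq> X"
      "X \<inter> Y = {\<zero>[P]}" "X <+>[P] Y = ?N" "3 \<le> mlen A P"
      by (rule P.nonuniserial_local_three[OF e x le nu])
    have X: "submodule X A P" and Y: "submodule Y A P" using XY(1,2) by (auto simp: covers_def)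
    have JN: "jmul A P ?N = {\<zero>[P]}" by (rule P.jmul_sum_simple[OF XY(1,2,6)])
    have J2: "i \<otimes>[A] (j \<otimes>[A] e) = \<zero>[A]" if i: "i \<in> jac A" and j: "j \<in> jac A" for i j
    proof (rule faithful[rule_format])
      note ic = J_carrier[OF i] and jc = J_carrier[OF j]
      show "i \<otimes>[A] (j \<otimes>[A] e) \<in> carrier A" using ic jc e'(1) by simp
      show "i \<otimes>[A] (j \<otimes>[A] e) \<otimes>[A] e = i \<otimes>[A] (j \<otimes>[A] e)" using ic jc e' by (simp add: m_assoc)
      have "(i \<otimes>[A] (j \<otimes>[A] e)) \<odot>[P] x = i \<odot>[P] (j \<odot>[P] x)"
        using P.smult_assoc[OF ic _ x(1)] P.smult_assoc[OF jc e'(1) x(1)] x(2) jc e'(1) by simp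
      also have "\<dots> \<in> jmul A P ?N" by (intro jmul.elem[where M = P] i j x(1))
      finally show "(i \<otimes>[A] (j \<otimes>[A] e)) \<odot>[P] x = \<zero>[P]" unfolding JN by simp
    qed
    have "mlen A P \<le> mlen A (pim A e)" using P.il_cyc_pim(1)[OF e x(1,2)] x(4) by simp
    then have three: "3 \<le> mlen A (pim A e)" by (rule order_trans[OF XY(7)])
    have env: "has_uniserial_envelope A (sub_module P V)" if c: "covers A P {\<zero>[P]} V" and VN: "V \<subseteq> ?N" for V
    proof -
      have V: "submodule V A P" "V \<noteq> {\<zero>[P]}" using c by (auto simp: covers_def)
      obtain f s where f: "prim A f" and s: "s \<in> V" "f \<odot>[P] s = s" "s \<noteq> \<zero>[P]" by (rule P.obtain_prim_vec[OF V])
      note f' = primD[OF f]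
      have "s \<in> jmul A P (cyc A P x)" using VN s(1) x(4) by auto
      then obtain j where j: "j \<in> jac A" "s = j \<odot>[P] x" unfolding P.jmul_cyc[OF x(1)] by blast
      note jc = J_carrier[OF j(1)]
      let ?v = "f \<otimes>[A] (j \<otimes>[A] e)"
      have v: "?v \<in> jac A" "f \<otimes>[A] ?v = ?v" "?v \<otimes>[A] e = ?v"
        using P.J_mult_l[OF f'(1) P.J_mult_r[OF j(1) e'(1)]] f' e' jc by (simp_all add: m_assoc[symmetric]) (simp add: m_assoc)
      have "?v \<odot>[P] x = s"
        using P.smult_assoc[OF f'(1) _ x(1)] P.smult_assoc[OF jc e'(1) x(1)] x(2) j(2) s(2) jc e'(1) by simp
      then have v0: "?v \<noteq> \<zero>[A]" using s(3) P.smult_l_null[OF x(1)] by metis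
      have u: "uniserial (opposite A) (pim (opposite A) f)" by (rule pimO_uniserial_of_bound[OF b e f J2 three v v0])
      have c': "covers A (sub_module P V) {\<zero>[sub_module P V]} (carrier (sub_module P V))"
        using c P.covers_sub[OF V(1) order_refl] by simp
      show ?thesis by (rule has_uniserial_envelopeI[OF P.left_module_sub[OF V(1)] c' f _ _ _ u, of s]) (use s in simp_all)
    qed
    have XN: "X \<subseteq> ?N" "Y \<subseteq> ?N" using P.sum_upper[OF X Y] XY(6) by simp_all
    have N: "submodule ?N A P" using loc(1) by (simp add: covers_def)
    have bis: "biserial A P"
      unfolding biserial_def
      by (rule conjI[OF ind], rule exI[of _ X], rule exI[of _ Y], intro conjI X Y P.simple_uniserial XY(1-4)) (simp_all add: XY(5,6) loc(4))
    have loca: "local_module A P"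
      unfolding local_module_def module_top_def loc(3) P.simple_quotient_iff[OF N] by (rule loc(1))
    have ncol: "\<not> colocal_module A P"
    proof
      assume col: "colocal_module A P"
      let ?S = "module_socle A P"
      have S: "submodule ?S A P"
        unfolding module_socle_def
      proof (rule P.sub_Inter)
        show "submodule N A P" if "N \<in> {N. submodule N A P \<and> (\<forall>S. simple_submodule A P S \<longrightarrow> S \<subseteq> N)}" for N using that by simp
        have "carrier P \<in> {N. submodule N A P \<and> (\<forall>S. simple_submodule A P S \<longrightarrow> S \<subseteq> N)}"
          using P.sub_carrier P.sub_subset by (simp add: simple_submodule_def)
        then show "{N. submodule N A P \<and> (\<forall>S. simple_submodule A P S \<longrightarrow> S \<subseteq> N)} \<noteq> {}" by blast
      qed
      have "simple_submodule A P ?S" using S col unfolding simple_submodule_def colocal_module_def by blast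
      then have cS: "covers A P {\<zero>[P]} ?S" unfolding P.simple_submodule_iff .
      \<comment> \<open>A simple socle equals each simple submodule, but X and Y are two different
        ones.\<close>
      have eq: "V = ?S" if c: "covers A P {\<zero>[P]} V" for V
      proof -
        have "simple_submodule A P V" unfolding P.simple_submodule_iff by (rule c)
        then have "V \<subseteq> ?S" unfolding module_socle_def by blast
        then show ?thesis using c cS unfolding covers_def by blast
      qed
      show False using eq[OF XY(1)] eq[OF XY(2)] XY(3) by simp
    qed
    have "simple_submodule A P X" "simple_submodule A P Y" unfolding P.simple_submodule_iff by (rule XY(1), rule XY(2))
    moreover have "is_direct_sum P (module_rad A P) X Y" unfolding is_direct_sum_def loc(3) using XY(5,6) by simp
    moreover have "astride_biserial A P" unfolding astride_biserial_def using bis loca ncol by simp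
    ultimately show ?thesis using env[OF XY(1) XN(1)] env[OF XY(2) XN(2)] by blast
  qed simp
qed

text \<open>With J^2 = 0 an indecomposable module is simple or contains some nonzero f j x with x =
  e x. In the latter case A e and \<open>env f\<close> are uniserial, so
  \<open>uniserial_pair_bound\<close> applies.\<close>

lemma bound_two_of_nakayama:
  assumes n: "nakayama A" and r: "radical_squared_zero A" shows "representation_bound A \<le> 2"
proof (rule representation_bound_least)
  fix M :: "'a fg_module" assume M: "left_module A M" "mlen A M < \<infinity>" "indecomposable A M"
  interpret M: left_module A M by fact
  interpret M: fl_module A M by (rule fl_moduleI[OF M(1,2)])
  have "jmul A M (jmul A M (carrier M)) \<subseteq> {\<zero>[M]}"
  proof (rule M.jmul_jmul_least[OF order_refl M.sub_0])
    fix i j x assume i: "i \<in> jac A" and j: "j \<in> jac A" and x: "x \<in> carrier M"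
    have "i \<otimes>[A] j = \<zero>[A]" using r i j unfolding radical_squared_zero_iff by blast
    then show "i \<odot>[M] (j \<odot>[M] x) \<in> {\<zero>[M]}"
      using M.smult_assoc[OF J_carrier[OF i] J_carrier[OF j] x] M.smult_l_null[OF x] by simp
  qed
  then have J2M: "jmul A M (jmul A M (carrier M)) = {\<zero>[M]}"
    using M.sub_zero[OF M.sub_jmul'[OF M.sub_jmul'[OF M.sub_carrier]]] by blast
  show "mlen A M \<le> 2"
  proof (cases "jmul A M (carrier M) = {\<zero>[M]}")
    case True then show ?thesis using M.semisimple_bound[OF M(3)] by (simp add: one_enat_def numeral_eq_enat)
  next
    case False
    then obtain e f j x where e: "prim A e" and f: "prim A f" and j: "j \<in> jac A"
      and x: "x \<in> carrier M" "e \<odot>[M] x = x" and ne: "f \<odot>[M] (j \<odot>[M] x) \<noteq> \<zero>[M]" by (rule M.obtain_prim_pair)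
    interpret S: fl_module A "pim A e" by (rule fl_module_pim[OF e])
    obtain P :: "'a fg_module" and p where "liso A (pim A e) P p" using S.fg_copy[OF S.fin_M] by blast
    then interpret p: liso A "pim A e" P p .
    have "projective_in_mod A P" "indecomposable A P"
      by (rule p.projective_transfer[OF fl_ring_axioms pim_projective[OF e]], rule p.indecomposable_transfer[OF prim_indecomposable[OF e]])
    then have ue: "uniserial A (pim A e)" using n p.uniserial_reflect unfolding nakayama_def by blast
    interpret I: left_module A "env f" by (rule env_facts(1)[OF f])
    obtain Y :: "'a fg_module" and q where "liso A (env f) Y q" using I.fg_copy[OF env_facts(3)[OF f]] by blast
    then interpret q: liso A "env f" Y q .
    have "injective_in_mod A Y" "indecomposable A Y"
      by (rule q.injective_transfer[OF fl_ring_axioms env_injective[OF f]], rule q.indecomposable_transfer[OF env_facts(5)[OF f]])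
    then have "uniserial A (env f)" using n q.uniserial_reflect unfolding nakayama_def by blast
    then have uf: "uniserial (opposite A) (pim (opposite A) f)" using env_facts(4)[OF f] by blast
    show ?thesis by (rule uniserial_pair_bound[OF M J2M e ue f uf j x ne])
  qed
qed

lemma exists_tall:
  assumes "\<not> (nakayama A \<and> radical_squared_zero A)" shows "3 \<le> representation_bound A"
proof (cases "radical_squared_zero A")
  case False
  then obtain i j where "i \<in> jac A" "j \<in> jac A" "i \<otimes>[A] j \<noteq> \<zero>[A]"
    unfolding radical_squared_zero_iff by blast
  then obtain e where e: "prim A e" "3 \<le> mlen A (pim A e)" by (rule exists_pim_tall)
  interpret S: fl_module A "pim A e" by (rule fl_module_pim[OF e(1)])
  show ?thesis by (rule order_trans[OF e(2) representation_bound_upper[OF S.left_module_axioms S.fin_M prim_indecomposable[OF e(1)]]])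
next
  case True
  then obtain M :: "'a fg_module" where M: "indecomposable A M" "projective_in_mod A M \<or> injective_in_mod A M" "\<not> uniserial A M"
    using assms unfolding nakayama_def by blast
  have lM: "left_module A M" "mlen A M < \<infinity>" using M(2) unfolding projective_in_mod_def injective_in_mod_def by (auto simp: in_mod_iff)
  show ?thesis by (rule order_trans[OF left_module.nonuniserial_length[OF lM(1) M(1,3)] representation_bound_upper[OF lM M(1)]])
qed

end

theorem theorem5p3p4:
  fixes R :: "('r, 'z) ring_scheme" and A :: "('r, 'a, 'x) module_scheme"
  assumes "artin_algebra R A"
  shows "representation_bound A = 3 \<longleftrightarrow>
    wedged_string A \<and> radical_cubed_zero A \<and> \<not> (nakayama A \<and> radical_squared_zero A)"
proof -
  interpret A0: artin_algebra R A by fact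
  obtain E :: "'r fg_module" where E: "cogenerator R E" using A0.R.exists_cogenerator[OF A0.fin_R] by blast
  interpret A: artin_dual R A E by (intro artin_dual.intro assms E)
  interpret O: artin_dual R "opposite A" E by (rule A.artin_dual_opposite)
  show ?thesis
  proof
    assume b: "representation_bound A = 3"
    then have le: "representation_bound A \<le> 3" by simp
    \<comment> \<open>Duality carries the bound to right modules, which yields the half of
      \<open>wedged_string\<close> that concerns \<open>opposite A\<close>.\<close>
    have leO: "representation_bound (opposite A) \<le> 3"
      by (rule O.representation_bound_least, rule order_trans[OF A.opposite_bound le])
    have "\<not> (nakayama A \<and> radical_squared_zero A)"
    proof
      assume "nakayama A \<and> radical_squared_zero A"
      then have "(3::enat) \<le> 2" using A.bound_two_of_nakayama b by simp
      then show False by simp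
    qed
    then show "wedged_string A \<and> radical_cubed_zero A \<and> \<not> (nakayama A \<and> radical_squared_zero A)"
      unfolding wedged_string_def
      using A.wedged_string_left_of_bound[OF le] O.wedged_string_left_of_bound[OF leO] A.radical_cubed_zero_of_bound[OF le] by blast
  next
    assume r: "wedged_string A \<and> radical_cubed_zero A \<and> \<not> (nakayama A \<and> radical_squared_zero A)"
    have w: "wedge A" "wedge (opposite A)"
      using r A.wedge_of_wedged_string O.wedge_of_wedged_string unfolding wedged_string_def by blast+
    have J3: "i \<otimes>[A] (j \<otimes>[A] k) = \<zero>[A]"
      if "i \<in> jac A" "j \<in> jac A" "k \<in> jac A" for i j k
      using r that unfolding A.radical_cubed_zero_iff by blast
    have "representation_bound A \<le> 3" by (rule A.representation_bound_least) (rule A.wedge_bound[OF _ _ _ w J3])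
    moreover have "3 \<le> representation_bound A" using r by (intro A.exists_tall) blast
    ultimately show "representation_bound A = 3" by (rule antisym)
  qed
qed

end
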